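(* Let $V:\mathsf Z\to[e,\infty)$ be measurable and let $Q$ be a Markov kernel on $(\mathsf Z,\mathcal Z)$ satisfying the $V$-uniform geometric ergodicity assumption (VGE) with invariant distribution $\pi$ and constants $\tau,\varkappa$. Let $\beta\ge0$, $C_1=60e$, $C_2=60$, and $$D_1=\tfrac83\left(\tfrac{16}{3}\right)^{1/2}C_1^2\left(C_2^{1/2}+1\right),\qquad D_2=\tfrac{8e}{3}\left(\sqrt2\,C_1^2C_2^{1/2}+C_2\right),$$ $$D_1^{(\beta)}=4D_1(2\beta/e)^\beta,\qquad D_2^{(\beta)}=4D_2(2\beta/e)^\beta .$$ Then for every measurable $f:\mathsf Z\to\mathbb R$ with $\|f\|_{\log^\beta V}<\infty$, every $p\ge2$ and every integer $n\ge3$, $$\mathrm E_\pi^{1/p}\left[|S_n|^p\right]\le C_1\sqrt2\,p^{1/2}n^{1/2}\sigma_\pi(f)+D_1^{(\beta)}\{\varkappa\pi(V)\}^{2/p}p^{2+\beta}\log_2(2p)\,n^{1/4}\tau^{3/4}\|f\|_{\log^\beta V}$$ $$\qquad+D_2^{(\beta)}\{\varkappa\pi(V)\}^{1/p}p^{2+\beta}\log_2(2p)\,(\log n)^{\beta+1}\,\tau\,\|f\|_{\log^\beta V}.$$ Moreover, for every initial probability measure $\xi$ on $(\mathsf Z,\mathcal Z)$, $$\mathrm E_\xi^{1/p}\left[|S_n|^p\right]\le\mathrm E_\pi^{1/p}\left[|S_n|^p\right]+\tfrac{32}{15}(\beta/e)^\beta\varkappa^{1/p}\left(\xi(V)+\pi(V)\right)^{1/p}p^{\beta+1}\tau\,\|f\|_{\log^\beta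 V}.$$
   Context: $(Z_k)_{k\ge0}$ is the (canonical) Markov chain with kernel $Q$; $\mathrm E_\xi$ is expectation when $Z_0\sim\xi$, and $\mathrm E_\xi^{1/p}[\cdot]=(\mathrm E_\xi[\cdot])^{1/p}$. For a measurable weight $W\ge1$: $\|f\|_W=\sup_z|f(z)|/W(z)$ for functions, and $\|\mu\|_W=\int W\,d|\mu|$ for signed measures. Assumption (VGE): $Q$ has a unique invariant distribution $\pi$, $\pi(V)<\infty$, and there are an integer $\tau\ge1$ and $\varkappa\ge1$ such that for every integer $n\ge0$, $$\sup_{z,z'\in\mathsf Z}\frac{\|\delta_zQ^n-\delta_{z'}Q^n\|_V}{V(z)+V(z')}\le\varkappa(1/4)^{\lfloor n/\tau\rfloor}.$$ $\bar f=f-\pi(f)$, $S_n=\sum_{\ell=0}^{n-1}\{f(Z_\ell)-\pi(f)\}$, $\sigma_\pi^2(f)=\pi(\bar f^2)+2\sum_{\ell=1}^\infty\pi(\bar f\,Q^\ell\bar f)$. $\log$ is the natural logarithm; $0^0=1$. *)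

theory Defs
  imports "HOL-Probability.Probability"
begin

definition invariant_distribution ::
  "'a measure \<Rightarrow> ('a \<Rightarrow> 'a measure) \<Rightarrow> 'a measure \<Rightarrow> bool" where
  "invariant_distribution M Q \<pi> \<longleftrightarrow> \<pi> \<in> space (prob_algebra M) \<and> \<pi> \<bind> Q = \<pi>"

primrec kernel_power ::
  "'a measure \<Rightarrow> ('a \<Rightarrow> 'a measure) \<Rightarrow> nat \<Rightarrow> 'a \<Rightarrow> 'a measure" where
  "kernel_power M Q 0 z = return M z"
| "kernel_power M Q (Suc n) z = kernel_power M Q n z \<bind> Q"

text \<open>The step kernels of the chain in the format of the Ionescu-Tulcea theorem: the law of the
  next state given the whole past.\<close>

definition markov_step ::
  "('a \<Rightarrow> 'a measure) \<Rightarrow> 'a measure \<Rightarrow> nat \<Rightarrow> (nat \<Rightarrow> 'a) \<Rightarrow> 'a measure" where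
  "markov_step Q \<xi> i \<omega> = (case i of 0 \<Rightarrow> \<xi> | Suc j \<Rightarrow> Q (\<omega> j))"

lemma Ionescu_Tulcea_markov_step:
  assumes Q: "Q \<in> M \<rightarrow>\<^sub>M prob_algebra M" and \<xi>: "\<xi> \<in> space (prob_algebra M)"
  shows "Ionescu_Tulcea (markov_step Q \<xi>) (\<lambda>_. M)"
proof (rule Ionescu_Tulcea.intro)
  fix i
  have Q': "Q \<in> M \<rightarrow>\<^sub>M subprob_algebra M"
    using Q by (rule measurable_prob_algebraD)
  have \<xi>': "\<xi> \<in> space (subprob_algebra M)"
    using \<xi> by (auto simp: space_prob_algebra space_subprob_algebra prob_space_imp_subprob_space)
  show "markov_step Q \<xi> i \<in> (\<Pi>\<^sub>M j\<in>{0..<i}. M) \<rightarrow>\<^sub>M subprob_algebra M"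
  proof (cases i)
    case 0
    then show ?thesis using \<xi>' by (simp add: markov_step_def[abs_def])
  next
    case (Suc j)
    have "(\<lambda>\<omega>. \<omega> j) \<in> (\<Pi>\<^sub>M j\<in>{0..<i}. M) \<rightarrow>\<^sub>M M"
      using Suc by (intro measurable_component_singleton) auto
    from measurable_compose[OF this Q'] show ?thesis
      using Suc by (simp add: markov_step_def[abs_def])
  qed
next
  fix i and \<omega> :: "nat \<Rightarrow> 'a"
  assume \<omega>: "\<omega> \<in> space (\<Pi>\<^sub>M j\<in>{0..<i}. M)"
  show "prob_space (markov_step Q \<xi> i \<omega>)"
  proof (cases i)
    case 0
    then show ?thesis using \<xi> by (simp add: markov_step_def space_prob_algebra)
  next
    case (Suc j)
    then have "\<omega> j \<in> space M" using \<omega> by (auto simp: space_PiM PiE_iff)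
    then have "Q (\<omega> j) \<in> space (prob_algebra M)" by (rule measurable_space[OF Q])
    then show ?thesis using Suc by (simp add: markov_step_def space_prob_algebra)
  qed
qed

text \<open>Law of the canonical chain on the path space; the chain is the coordinate process
  \<open>Z\<^sub>k \<omega> = \<omega> k\<close>.\<close>

definition markov_law ::
  "'a measure \<Rightarrow> ('a \<Rightarrow> 'a measure) \<Rightarrow> 'a measure \<Rightarrow> (nat \<Rightarrow> 'a) measure" where
  "markov_law M Q \<xi> =
     projective_family.lim UNIV (Ionescu_Tulcea.CI (markov_step Q \<xi>) (\<lambda>_. M)) (\<lambda>_. M)"

lemma sets_markov_law: "sets (markov_law M Q \<xi>) = sets (\<Pi>\<^sub>M i\<in>UNIV. M)"
  if "Q \<in> M \<rightarrow>\<^sub>M prob_algebra M" "\<xi> \<in> space (prob_algebra M)"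
proof -
  interpret Ionescu_Tulcea "markov_step Q \<xi>" "\<lambda>_. M"
    using that by (rule Ionescu_Tulcea_markov_step)
  show ?thesis by (simp add: markov_law_def)
qed

lemma emeasure_markov_law_cylinder:
  assumes "Q \<in> M \<rightarrow>\<^sub>M prob_algebra M" "\<xi> \<in> space (prob_algebra M)"
    and "finite J" "X \<in> sets (\<Pi>\<^sub>M i\<in>J. M)"
  shows "emeasure (markov_law M Q \<xi>) (prod_emb UNIV (\<lambda>_. M) J X) =
         emeasure (Ionescu_Tulcea.CI (markov_step Q \<xi>) (\<lambda>_. M) J) X"
proof -
  interpret Ionescu_Tulcea "markov_step Q \<xi>" "\<lambda>_. M"
    using assms(1,2) by (rule Ionescu_Tulcea_markov_step)
  show ?thesis unfolding markov_law_def by (rule lim[OF assms(3,4)])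
qed

text \<open>Total variation measure \<open>|\<mu> - \<nu>|\<close> of the signed measure \<open>\<mu> - \<nu>\<close>, for finite measures
  \<open>\<mu>\<close>, \<open>\<nu>\<close> on the same \<open>\<sigma>\<close>-algebra, as the supremum over finite measurable partitions.\<close>

definition tv_measure :: "'a measure \<Rightarrow> 'a measure \<Rightarrow> 'a measure" where
  "tv_measure \<mu> \<nu> = measure_of (space \<mu>) (sets \<mu>)
     (\<lambda>A. SUP P\<in>{P. finite P \<and> P \<subseteq> sets \<mu> \<and> disjoint P \<and> \<Union>P = A}.
        \<Sum>B\<in>P. ennreal \<bar>measure \<mu> B - measure \<nu> B\<bar>)"

text \<open>A partition-free form through a Hahn decomposition, which in particular shows that
  the set function in \<^term>\<open>tv_measure\<close> is countably additive.\<close>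

lemma tv_measure_Hahn:
  assumes fin: "finite_measure \<mu>" "finite_measure \<nu>" and sets: "sets \<nu> = sets \<mu>"
  shows "\<exists>Y\<in>sets \<mu>. \<forall>A\<in>sets \<mu>. emeasure (tv_measure \<mu> \<nu>) A =
    ennreal ((measure \<mu> (A \<inter> Y) - measure \<nu> (A \<inter> Y)) + (measure \<nu> (A - Y) - measure \<mu> (A - Y)))
    \<and> measure \<nu> (A \<inter> Y) \<le> measure \<mu> (A \<inter> Y) \<and> measure \<mu> (A - Y) \<le> measure \<nu> (A - Y)"
proof -
  interpret m: finite_measure \<mu> by fact
  interpret n: finite_measure \<nu> by fact
  define d where "d A = measure \<mu> A - measure \<nu> A" for A
  obtain Y where Y: "Y \<in> sets \<mu>"
    and Y1: "\<And>X. X \<in> sets \<mu> \<Longrightarrow> X \<subseteq> Y \<Longrightarrow> emeasure \<nu> X \<le> emeasure \<mu> X"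
    and Y2: "\<And>X. X \<in> sets \<mu> \<Longrightarrow> X \<inter> Y = {} \<Longrightarrow> emeasure \<mu> X \<le> emeasure \<nu> X"
    using finite_unsigned_Hahn_decomposition[OF fin sets] by blast
  have pos: "0 \<le> d (A \<inter> Y)" if "A \<in> sets \<mu>" for A
    using Y1[of "A \<inter> Y"] that Y
    by (auto simp: d_def m.emeasure_eq_measure n.emeasure_eq_measure)
  have neg: "d (A - Y) \<le> 0" if "A \<in> sets \<mu>" for A
    using Y2[of "A - Y"] that Y
    by (auto simp: d_def m.emeasure_eq_measure n.emeasure_eq_measure)
  define g where "g A = d (A \<inter> Y) - d (A - Y)" for A
  have g_nonneg: "0 \<le> g A" if "A \<in> sets \<mu>" for A
    using pos[OF that] neg[OF that] by (simp add: g_def)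
  have d_split: "d A = d (A \<inter> Y) + d (A - Y)" if "A \<in> sets \<mu>" for A
  proof -
    have e: "(A \<inter> Y) \<union> (A - Y) = A" by blast
    have "measure \<mu> ((A \<inter> Y) \<union> (A - Y)) = measure \<mu> (A \<inter> Y) + measure \<mu> (A - Y)"
      using that Y by (intro m.finite_measure_Union) auto
    moreover have "measure \<nu> ((A \<inter> Y) \<union> (A - Y)) = measure \<nu> (A \<inter> Y) + measure \<nu> (A - Y)"
      using that Y sets by (intro n.finite_measure_Union) auto
    ultimately show ?thesis unfolding d_def e by simp
  qed
  have d_le: "\<bar>d A\<bar> \<le> g A" if "A \<in> sets \<mu>" for A
    using d_split[OF that] pos[OF that] neg[OF that] unfolding g_def by linarith
  have d_fin: "d (\<Union>B\<in>P. h B) = (\<Sum>B\<in>P. d (h B))"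
    if "finite P" "h ` P \<subseteq> sets \<mu>" "disjoint_family_on h P" for P :: "'a set set" and h
    unfolding d_def using that sets
    by (simp add: m.finite_measure_finite_Union n.finite_measure_finite_Union sum_subtractf)
  let ?S = "\<lambda>A. SUP P\<in>{P. finite P \<and> P \<subseteq> sets \<mu> \<and> disjoint P \<and> \<Union>P = A}.
        \<Sum>B\<in>P. ennreal \<bar>measure \<mu> B - measure \<nu> B\<bar>"
  have S: "?S A = ennreal (g A)" if A: "A \<in> sets \<mu>" for A
  proof (rule antisym)
    show "?S A \<le> ennreal (g A)"
    proof (rule SUP_least)
      fix P assume "P \<in> {P. finite P \<and> P \<subseteq> sets \<mu> \<and> disjoint P \<and> \<Union>P = A}"
      then have P: "finite P" "P \<subseteq> sets \<mu>" "disjoint P" "\<Union>P = A" by auto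
      have disj: "disjoint_family_on (\<lambda>B. B \<inter> Y) P" "disjoint_family_on (\<lambda>B. B - Y) P"
        using P(3) by (auto simp: disjoint_family_on_def disjoint_def)
      have "d (\<Union>B\<in>P. B \<inter> Y) = (\<Sum>B\<in>P. d (B \<inter> Y))" "d (\<Union>B\<in>P. B - Y) = (\<Sum>B\<in>P. d (B - Y))"
        using P Y disj by (intro d_fin; auto)+
      moreover have "(\<Union>B\<in>P. B \<inter> Y) = A \<inter> Y" "(\<Union>B\<in>P. B - Y) = A - Y" using P(4) by auto
      ultimately have g: "g A = (\<Sum>B\<in>P. g B)" by (simp add: g_def sum_subtractf)
      have "(\<Sum>B\<in>P. ennreal \<bar>measure \<mu> B - measure \<nu> B\<bar>) = ennreal (\<Sum>B\<in>P. \<bar>d B\<bar>)"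
        by (simp add: d_def)
      also have "\<dots> \<le> ennreal (\<Sum>B\<in>P. g B)"
        using P(2) by (intro ennreal_leI sum_mono d_le) auto
      finally show "(\<Sum>B\<in>P. ennreal \<bar>measure \<mu> B - measure \<nu> B\<bar>) \<le> ennreal (g A)"
        by (simp add: g)
    qed
    show "ennreal (g A) \<le> ?S A"
    proof (cases "A = {}")
      case True
      then show ?thesis by (simp add: g_def d_def)
    next
      case False
      then have ne: "A \<inter> Y \<noteq> A - Y" by blast
      have "ennreal (g A) = ennreal (\<bar>d (A \<inter> Y)\<bar> + \<bar>d (A - Y)\<bar>)"
        using pos[OF A] neg[OF A] by (simp add: g_def)
      also have "\<dots> = (\<Sum>B\<in>{A \<inter> Y, A - Y}. ennreal \<bar>measure \<mu> B - measure \<nu> B\<bar>)"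
        using ne by (simp add: d_def)
      also have "\<dots> \<le> ?S A"
        using A Y by (intro SUP_upper) (auto simp: disjoint_def)
      finally show ?thesis .
    qed
  qed
  have tv: "emeasure (tv_measure \<mu> \<nu>) A = ennreal (g A)" if A: "A \<in> sets \<mu>" for A
  proof -
    have "emeasure (tv_measure \<mu> \<nu>) A = ?S A"
    proof (rule emeasure_measure_of[where \<Omega>="space \<mu>" and A="sets \<mu>"])
      show "tv_measure \<mu> \<nu> = measure_of (space \<mu>) (sets \<mu>) ?S" by (simp only: tv_measure_def)
      show "sets \<mu> \<subseteq> Pow (space \<mu>)" by (rule sets.space_closed)
      show "A \<in> sets (tv_measure \<mu> \<nu>)" using A by (simp add: tv_measure_def)
      show "positive (sets (tv_measure \<mu> \<nu>)) ?S"
        unfolding positive_def using S[of "{}"] by (simp add: g_def d_def)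
      show "countably_additive (sets (tv_measure \<mu> \<nu>)) ?S"
      proof (rule countably_additiveI)
        fix A :: "nat \<Rightarrow> 'a set"
        assume "range A \<subseteq> sets (tv_measure \<mu> \<nu>)" and disj: "disjoint_family A"
          and "(\<Union>i. A i) \<in> sets (tv_measure \<mu> \<nu>)"
        then have A: "range A \<subseteq> sets \<mu>" "\<And>i. A i \<in> sets \<mu>" "(\<Union>i. A i) \<in> sets \<mu>"
          by (auto simp: tv_measure_def)
        have d_sums: "(\<lambda>i. d (h i)) sums d (\<Union>i. h i)"
          if "range h \<subseteq> sets \<mu>" "disjoint_family h" for h :: "nat \<Rightarrow> 'a set"
          unfolding d_def using that sets
          by (intro sums_diff m.finite_measure_UNION n.finite_measure_UNION) auto
        have "(\<lambda>i. d (A i \<inter> Y)) sums d (\<Union>i. A i \<inter> Y)" "(\<lambda>i. d (A i - Y)) sums d (\<Union>i. A i - Y)"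
          using A(2) Y disj
          by (intro d_sums; fastforce simp: disjoint_family_on_def)+
        moreover have "(\<Union>i. A i \<inter> Y) = (\<Union>i. A i) \<inter> Y" "(\<Union>i. A i - Y) = (\<Union>i. A i) - Y"
          by auto
        ultimately have "(\<lambda>i. g (A i)) sums g (\<Union>i. A i)"
          unfolding g_def by (metis sums_diff)
        then have "(\<Sum>i. ennreal (g (A i))) = ennreal (g (\<Union>i. A i))"
          using A by (intro suminf_ennreal_eq g_nonneg) auto
        then show "(\<Sum>i. ?S (A i)) = ?S (\<Union>i. A i)"
          by (simp only: S A)
      qed
    qed
    also have "\<dots> = ennreal (g A)" by (rule S[OF A])
    finally show ?thesis .
  qed
  show ?thesis
  proof (intro bexI[OF _ Y] ballI conjI)
    fix A assume A: "A \<in> sets \<mu>"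
    show "measure \<nu> (A \<inter> Y) \<le> measure \<mu> (A \<inter> Y)" "measure \<mu> (A - Y) \<le> measure \<nu> (A - Y)"
      using pos[OF A] neg[OF A] by (simp_all add: d_def)
    show "emeasure (tv_measure \<mu> \<nu>) A =
      ennreal ((measure \<mu> (A \<inter> Y) - measure \<nu> (A \<inter> Y)) + (measure \<nu> (A - Y) - measure \<mu> (A - Y)))"
      unfolding tv[OF A] by (rule arg_cong[of _ _ ennreal]) (simp add: g_def d_def)
  qed
qed

text \<open>\<open>\<parallel>\<mu> - \<nu>\<parallel>\<^sub>W\<close> for finite measures and \<open>\<parallel>f\<parallel>\<^sub>W\<close> for functions.\<close>

definition wnorm_diff :: "('a \<Rightarrow> real) \<Rightarrow> 'a measure \<Rightarrow> 'a measure \<Rightarrow> ennreal" where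
  "wnorm_diff W \<mu> \<nu> = (\<integral>\<^sup>+z. ennreal (W z) \<partial>tv_measure \<mu> \<nu>)"

definition wnorm :: "'a measure \<Rightarrow> ('a \<Rightarrow> real) \<Rightarrow> ('a \<Rightarrow> real) \<Rightarrow> ennreal" where
  "wnorm M W f = (SUP z\<in>space M. ennreal (\<bar>f z\<bar> / W z))"

definition VGE ::
  "'a measure \<Rightarrow> ('a \<Rightarrow> 'a measure) \<Rightarrow> ('a \<Rightarrow> real) \<Rightarrow> 'a measure \<Rightarrow> nat \<Rightarrow> real \<Rightarrow> bool" where
  "VGE M Q V \<pi> \<tau> \<kappa> \<longleftrightarrow>
     invariant_distribution M Q \<pi> \<and>
     (\<forall>\<pi>'. invariant_distribution M Q \<pi>' \<longrightarrow> \<pi>' = \<pi>) \<and>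
     (\<integral>\<^sup>+z. ennreal (V z) \<partial>\<pi>) < \<infinity> \<and> 1 \<le> \<tau> \<and> 1 \<le> \<kappa> \<and>
     (\<forall>n. (SUP (z, z') \<in> space M \<times> space M.
            wnorm_diff V (kernel_power M Q n z) (kernel_power M Q n z') / ennreal (V z + V z'))
          \<le> ennreal (\<kappa> * (1 / 4) ^ (n div \<tau>)))"

definition centered :: "'a measure \<Rightarrow> ('a \<Rightarrow> real) \<Rightarrow> 'a \<Rightarrow> real" where
  "centered \<pi> f z = f z - (\<integral>x. f x \<partial>\<pi>)"

definition centered_sum :: "'a measure \<Rightarrow> ('a \<Rightarrow> real) \<Rightarrow> nat \<Rightarrow> (nat \<Rightarrow> 'a) \<Rightarrow> real" where
  "centered_sum \<pi> f n \<omega> = (\<Sum>l<n. centered \<pi> f (\<omega> l))"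

definition asymp_var ::
  "'a measure \<Rightarrow> ('a \<Rightarrow> 'a measure) \<Rightarrow> 'a measure \<Rightarrow> ('a \<Rightarrow> real) \<Rightarrow> real" where
  "asymp_var M Q \<pi> f =
     (\<integral>z. (centered \<pi> f z)\<^sup>2 \<partial>\<pi>) +
     2 * (\<Sum>l. \<integral>z. centered \<pi> f z * (\<integral>y. centered \<pi> f y \<partial>kernel_power M Q (Suc l) z) \<partial>\<pi>)"

text \<open>Real powers of extended nonnegative numbers, for positive exponents only.\<close>

definition ennpowr :: "ennreal \<Rightarrow> real \<Rightarrow> ennreal" where
  "ennpowr x a = (if x = \<infinity> then \<infinity> else ennreal (enn2real x powr a))"

definition moment_norm ::
  "'a measure \<Rightarrow> ('a \<Rightarrow> 'a measure) \<Rightarrow> 'a measure \<Rightarrow> real \<Rightarrow> ((nat \<Rightarrow> 'a) \<Rightarrow> real) \<Rightarrow> ennreal" where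
  "moment_norm M Q \<xi> p X = ennpowr (\<integral>\<^sup>+\<omega>. ennreal (\<bar>X \<omega>\<bar> powr p) \<partial>markov_law M Q \<xi>) (1 / p)"

text \<open>The library has \<^prop>\<open>(0::real) powr 0 = 0\<close>; here \<open>0\<^sup>0 = 1\<close>.\<close>

definition powr0 :: "real \<Rightarrow> real \<Rightarrow> real" where
  "powr0 x a = (if a = 0 then 1 else x powr a)"

definition C1 :: real where "C1 = 60 * exp 1"

definition C2 :: real where "C2 = 60"

definition D1 :: real where
  "D1 = 8 / 3 * sqrt (16 / 3) * C1\<^sup>2 * (sqrt C2 + 1)"

definition D2 :: real where
  "D2 = 8 * exp 1 / 3 * (sqrt 2 * C1\<^sup>2 * sqrt C2 + C2)"

definition D1_beta :: "real \<Rightarrow> real" where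
  "D1_beta \<beta> = 4 * D1 * powr0 (2 * \<beta> / exp 1) \<beta>"

definition D2_beta :: "real \<Rightarrow> real" where
  "D2_beta \<beta> = 4 * D2 * powr0 (2 * \<beta> / exp 1) \<beta>"

end

theory Submission
  imports Defs
begin

text \<open>Let \<open>g\<close> solve the Poisson equation for the centred function, so that \<open>M\<^sub>l = S\<^sub>l + g (Z\<^sub>l)\<close> is a
  martingale, and let \<open>P\<close> be an even integer in \<open>[p, 2 p]\<close>. The conditional variance of \<open>M\<close> fluctuates, but the
  Poisson equation for \<open>2 g (f - \<pi> f) - (f - \<pi> f)\<^sup>2\<close> provides a corrector \<open>\<psi>\<close> for which
  \<open>M\<^sub>l\<^sup>2 + \<psi> (Z\<^sub>l) - l \<sigma>\<^sup>2\<close> behaves like a martingale. Along \<open>M\<close> sampled in blocks of length \<open>\<tau> P\<close>,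
  on which the increments have the same size as \<open>g\<close>, the Lyapunov function \<open>E[M^P + 3 c \<psi> M^(P - 2)]\<close> with
  \<open>c = P (P - 1) / 2\<close> satisfies a recursion whose solution gives the \<open>\<sigma>\<close> term and the \<open>n^(1/4)\<close> term; the last term
  pays for incomplete blocks.

  For another initial law the two chains are coupled maximally, but one chain at a time: each chain is stopped
  with a state-dependent probability chosen such that the law of (time, state) at stopping is the same for both chains.
  After stopping the two sums therefore have equal moments, and the sums before stopping are
  controlled by the geometric decay of the mass that has not been coupled yet.\<close>

section \<open>Total variation and kernels\<close>

text \<open>The exponent is made even so that powers expand binomially and stay nonnegative, and at
  least 4 because the expansion goes to fourth order. The leading term needs the constant
  \<sigma>^2, not the random conditional variance; exchanging them inside the recursion avoids a
  separate moment bound for the accumulated conditional variance. The power 1/4 arises as follows.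
  With m blocks whose increments have L^P size D, the fourth-order remainders are absorbed once the
  squared bound is of order P^2 D^2 sqrt m, which leaves a term P D m^(1/4). Solving the Poisson
  equation costs a factor \<tau> P, so D is of that order; blocks of this length reduce m without
  enlarging D, and \<tau> (n / \<tau>)^(1/4) = \<tau>^(3/4) n^(1/4). VGE compares kernels started at
  two points only; statements about a single point arise by averaging the other one over \<pi>. The
  change of initial law builds no joint process, so Radon-Nikodym densities suffice and the
  measurable space may be arbitrary.\<close>

lemma tv_measure_sets [simp]: "sets (tv_measure \<mu> \<nu>) = sets \<mu>" "space (tv_measure \<mu> \<nu>) = space \<mu>"
  by (simp_all add: tv_measure_def)

text \<open>The Hahn set splits A into a piece where \<mu> dominates and one where \<nu> does; each
  setwise difference is one of the two nonnegative terms of the total variation. The mass is at most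
  2 because each term is at most a probability.\<close>

lemma tv_measure_le_add:
  assumes fin: "prob_space \<mu>" "prob_space \<nu>" and sets: "sets \<nu> = sets \<mu>"
  shows "A \<in> sets \<mu> \<Longrightarrow> emeasure \<mu> A \<le> emeasure \<nu> A + emeasure (tv_measure \<mu> \<nu>) A"
    and "A \<in> sets \<mu> \<Longrightarrow> emeasure \<nu> A \<le> emeasure \<mu> A + emeasure (tv_measure \<mu> \<nu>) A"
    and "emeasure (tv_measure \<mu> \<nu>) (space \<mu>) \<le> 2"
proof -
  interpret m: prob_space \<mu> by fact
  interpret n: prob_space \<nu> by fact
  obtain Y where Y: "Y \<in> sets \<mu>"
    and tv: "\<And>A. A \<in> sets \<mu> \<Longrightarrow> emeasure (tv_measure \<mu> \<nu>) A =
      ennreal ((measure \<mu> (A \<inter> Y) - measure \<nu> (A \<inter> Y)) + (measure \<nu> (A - Y) - measure \<mu> (A - Y)))"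
    and le: "\<And>A. A \<in> sets \<mu> \<Longrightarrow> measure \<nu> (A \<inter> Y) \<le> measure \<mu> (A \<inter> Y) \<and> measure \<mu> (A - Y) \<le> measure \<nu> (A - Y)"
    using tv_measure_Hahn[OF m.finite_measure_axioms n.finite_measure_axioms sets] by blast
  have split: "measure \<mu> A = measure \<mu> (A \<inter> Y) + measure \<mu> (A - Y)"
    "measure \<nu> A = measure \<nu> (A \<inter> Y) + measure \<nu> (A - Y)" if A: "A \<in> sets \<mu>" for A
  proof -
    have e: "(A \<inter> Y) \<union> (A - Y) = A" by blast
    show "measure \<mu> A = measure \<mu> (A \<inter> Y) + measure \<mu> (A - Y)"
      using m.finite_measure_Union[of "A \<inter> Y" "A - Y"] A Y unfolding e by auto
    show "measure \<nu> A = measure \<nu> (A \<inter> Y) + measure \<nu> (A - Y)"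
      using n.finite_measure_Union[of "A \<inter> Y" "A - Y"] A Y sets unfolding e by auto
  qed
  { fix A assume A: "A \<in> sets \<mu>"
    have "measure \<mu> A \<le> measure \<nu> A + ((measure \<mu> (A \<inter> Y) - measure \<nu> (A \<inter> Y)) + (measure \<nu> (A - Y) - measure \<mu> (A - Y)))"
      using split[OF A] le[OF A] by linarith
    then show "emeasure \<mu> A \<le> emeasure \<nu> A + emeasure (tv_measure \<mu> \<nu>) A"
      using le[OF A] unfolding tv[OF A] m.emeasure_eq_measure n.emeasure_eq_measure
      by (simp flip: ennreal_plus)
    have "measure \<nu> A \<le> measure \<mu> A + ((measure \<mu> (A \<inter> Y) - measure \<nu> (A \<inter> Y)) + (measure \<nu> (A - Y) - measure \<mu> (A - Y)))"
      using split[OF A] le[OF A] by linarith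
    then show "emeasure \<nu> A \<le> emeasure \<mu> A + emeasure (tv_measure \<mu> \<nu>) A"
      using le[OF A] unfolding tv[OF A] m.emeasure_eq_measure n.emeasure_eq_measure
      by (simp flip: ennreal_plus) }
  show "emeasure (tv_measure \<mu> \<nu>) (space \<mu>) \<le> 2"
  proof -
    have "(measure \<mu> (space \<mu> \<inter> Y) - measure \<nu> (space \<mu> \<inter> Y)) + (measure \<nu> (space \<mu> - Y) - measure \<mu> (space \<mu> - Y)) \<le> 1 + 1"
      using m.prob_le_1[of "space \<mu> \<inter> Y"] n.prob_le_1[of "space \<mu> - Y"] measure_nonneg[of \<nu> "space \<mu> \<inter> Y"]
        measure_nonneg[of \<mu> "space \<mu> - Y"] by linarith
    then show ?thesis unfolding tv[OF sets.top]
      by (metis ennreal_leI ennreal_numeral one_add_one zero_le_numeral)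
  qed
qed

text \<open>Domination is kept in additive form because extended nonnegative integrals cannot be
  subtracted freely. It passes from sets to simple functions and then to monotone limits.\<close>

lemma nn_integral_mono_add_measure:
  assumes sets: "sets \<nu> = sets \<mu>" "sets T = sets \<mu>"
    and le: "\<And>A. A \<in> sets \<mu> \<Longrightarrow> emeasure \<mu> A \<le> emeasure \<nu> A + emeasure T A"
    and h: "h \<in> borel_measurable \<mu>"
  shows "(\<integral>\<^sup>+x. h x \<partial>\<mu>) \<le> (\<integral>\<^sup>+x. h x \<partial>\<nu>) + (\<integral>\<^sup>+x. h x \<partial>T)"
  using h
proof (induction rule: borel_measurable_induct)
  case (cong f g)
  have "(\<integral>\<^sup>+x. f x \<partial>N) = (\<integral>\<^sup>+x. g x \<partial>N)" if "sets N = sets \<mu>" for N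
    using sets_eq_imp_space_eq[OF that] cong(3) by (intro nn_integral_cong) auto
  then show ?case using cong sets by simp
next
  case (set A) then show ?case using le[of A] sets by simp
next
  case (mult u c)
  then have "u \<in> borel_measurable \<nu>" "u \<in> borel_measurable T" using sets by (auto cong: measurable_cong_sets)
  then show ?case using mult by (simp add: nn_integral_cmult mult_left_mono flip: distrib_left)
next
  case (add u v)
  then have "u \<in> borel_measurable \<nu>" "u \<in> borel_measurable T" "v \<in> borel_measurable \<nu>" "v \<in> borel_measurable T"
    using sets by (auto cong: measurable_cong_sets)
  moreover have "a + b \<le> (c + d) + (e + f)" if "a \<le> c + e" "b \<le> d + f" for a b c d e f :: ennreal
    using add_mono[OF that] by (simp add: ac_simps)
  ultimately show ?case using add by (simp add: nn_integral_add)
next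
  case (seq U)
  have m: "U i \<in> borel_measurable N" if "sets N = sets \<mu>" for i N
    using seq(1) that by (auto cong: measurable_cong_sets)
  have sup: "(\<integral>\<^sup>+x. (SUP i. U i) x \<partial>N) = (SUP i. \<integral>\<^sup>+x. U i x \<partial>N)" if "sets N = sets \<mu>" for N
    unfolding SUP_apply using seq m[OF that] by (intro nn_integral_monotone_convergence_SUP) auto
  have inc: "(\<integral>\<^sup>+x. U i x \<partial>N) \<le> (SUP i. \<integral>\<^sup>+x. U i x \<partial>N)" for i N by (rule SUP_upper) simp
  show ?case
    unfolding image_comp sup[OF refl] sup[OF sets(1)] sup[OF sets(2)]
    by (intro SUP_least order.trans[OF seq.IH] add_mono inc)
qed

text \<open>Only a finite right-hand side has content: then the positive and the negative part of
  \<phi> each contribute at most their own total variation integral, and these two add up to that of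
  the absolute value.\<close>

lemma integral_diff_le_tv:
  assumes "prob_space \<mu>" "prob_space \<nu>" and sets: "sets \<nu> = sets \<mu>"
    and \<phi>: "\<phi> \<in> borel_measurable \<mu>" and i: "integrable \<mu> \<phi>" "integrable \<nu> \<phi>"
  shows "ennreal \<bar>(\<integral>x. \<phi> x \<partial>\<mu>) - (\<integral>x. \<phi> x \<partial>\<nu>)\<bar> \<le> (\<integral>\<^sup>+x. ennreal \<bar>\<phi> x\<bar> \<partial>tv_measure \<mu> \<nu>)"
proof -
  let ?T = "tv_measure \<mu> \<nu>"
  note le = tv_measure_le_add[OF assms(1-3)]
  have \<phi>T [measurable]: "\<phi> \<in> borel_measurable ?T" "\<phi> \<in> borel_measurable \<mu>" "\<phi> \<in> borel_measurable \<nu>"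
    using \<phi> sets by (auto cong: measurable_cong_sets)
  have A: "(\<integral>\<^sup>+x. h x \<partial>\<mu>) \<le> (\<integral>\<^sup>+x. h x \<partial>\<nu>) + (\<integral>\<^sup>+x. h x \<partial>?T)"
     "(\<integral>\<^sup>+x. h x \<partial>\<nu>) \<le> (\<integral>\<^sup>+x. h x \<partial>\<mu>) + (\<integral>\<^sup>+x. h x \<partial>?T)" if "h \<in> borel_measurable \<mu>" for h
    using that le sets by (auto intro!: nn_integral_mono_add_measure cong: measurable_cong_sets)
  have fin: "(\<integral>\<^sup>+x. ennreal (\<phi> x) \<partial>\<mu>) < \<infinity>" "(\<integral>\<^sup>+x. ennreal (- \<phi> x) \<partial>\<mu>) < \<infinity>"
     "(\<integral>\<^sup>+x. ennreal (\<phi> x) \<partial>\<nu>) < \<infinity>" "(\<integral>\<^sup>+x. ennreal (- \<phi> x) \<partial>\<nu>) < \<infinity>"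
    using i by (auto simp: real_integrable_def less_top)
  have sum: "(\<integral>\<^sup>+x. ennreal (\<phi> x) \<partial>?T) + (\<integral>\<^sup>+x. ennreal (- \<phi> x) \<partial>?T) = (\<integral>\<^sup>+x. ennreal \<bar>\<phi> x\<bar> \<partial>?T)"
    by (subst nn_integral_add[symmetric]) (auto intro!: nn_integral_cong simp: abs_real_def ennreal_neg)
  show ?thesis
  proof (cases "(\<integral>\<^sup>+x. ennreal \<bar>\<phi> x\<bar> \<partial>?T) = \<infinity>")
    case False
    then have finT: "(\<integral>\<^sup>+x. ennreal (\<phi> x) \<partial>?T) < \<infinity>" "(\<integral>\<^sup>+x. ennreal (- \<phi> x) \<partial>?T) < \<infinity>"
      unfolding sum[symmetric] by (auto simp: less_top)
    have ex: "\<exists>r\<ge>0. t = ennreal r" if "t < \<infinity>" for t :: ennreal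
      using that by (cases t) auto
    obtain a b a1 b1 a2 b2 where
      r: "(\<integral>\<^sup>+x. ennreal (\<phi> x) \<partial>?T) = ennreal a" "(\<integral>\<^sup>+x. ennreal (- \<phi> x) \<partial>?T) = ennreal b"
       "(\<integral>\<^sup>+x. ennreal (\<phi> x) \<partial>\<mu>) = ennreal a1" "(\<integral>\<^sup>+x. ennreal (- \<phi> x) \<partial>\<mu>) = ennreal b1"
       "(\<integral>\<^sup>+x. ennreal (\<phi> x) \<partial>\<nu>) = ennreal a2" "(\<integral>\<^sup>+x. ennreal (- \<phi> x) \<partial>\<nu>) = ennreal b2"
      and nn: "a \<ge> 0" "b \<ge> 0" "a1 \<ge> 0" "b1 \<ge> 0" "a2 \<ge> 0" "b2 \<ge> 0"
      using ex[OF finT(1)] ex[OF finT(2)] ex[OF fin(1)] ex[OF fin(2)] ex[OF fin(3)] ex[OF fin(4)] by auto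
    have "a1 \<le> a2 + a" "a2 \<le> a1 + a" "b1 \<le> b2 + b" "b2 \<le> b1 + b"
      using A[of "\<lambda>x. ennreal (\<phi> x)"] A[of "\<lambda>x. ennreal (- \<phi> x)"] nn
      by (auto simp: r ennreal_le_iff simp flip: ennreal_plus)
    then have "\<bar>(\<integral>x. \<phi> x \<partial>\<mu>) - (\<integral>x. \<phi> x \<partial>\<nu>)\<bar> \<le> a + b"
      using i nn by (auto simp: real_lebesgue_integral_def r)
    then show ?thesis unfolding sum[symmetric] r using nn by (simp flip: ennreal_plus)
  qed simp
qed

text \<open>Jensen's inequality for the concave power 1/s under a measure whose mass is only bounded
  by m. For a total variation measure it interpolates between the mass bound 2 and the
  V-norm.\<close>

lemma nn_integral_powr_le:
  fixes V :: "'a \<Rightarrow> real"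
  assumes V: "V \<in> borel_measurable T" "\<And>x. x \<in> space T \<Longrightarrow> 0 < V x"
    and s: "1 \<le> s" and mass: "emeasure T (space T) \<le> ennreal m" "0 < m"
    and v: "(\<integral>\<^sup>+x. ennreal (V x) \<partial>T) \<le> ennreal v" "0 < v"
  shows "(\<integral>\<^sup>+x. ennreal (V x powr (1 / s)) \<partial>T) \<le> ennreal (m powr (1 - 1 / s) * v powr (1 / s))"
proof -
  \<comment> \<open>The tangent of x^(1/s) at v / m lies above the curve, and this base point makes
    the integrated bound exactly m^(1 - 1/s) v^(1/s).\<close>
  define a where "a = v / m"
  have a: "a > 0" using v mass by (simp add: a_def)
  note [measurable] = V(1)
  have V0: "0 \<le> V x" if "x \<in> space T" for x using V(2)[OF that] by simp
  have pt: "V x powr (1 / s) \<le> a powr (1 / s) * (1 / s / a * V x + (1 - 1 / s))" if "x \<in> space T" for x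
  proof -
    have "(V x / a) powr (1 / s) * 1 powr (1 - 1 / s) \<le> 1 / s * (V x / a) + (1 - 1 / s) * 1"
      using s V(2)[OF that] a by (intro Youngs_inequality_0) auto
    moreover have "(V x / a) powr (1 / s) = V x powr (1 / s) / a powr (1 / s)"
      using V0[OF that] a by (simp add: powr_divide)
    ultimately show ?thesis using a by (simp add: field_simps)
  qed
  have "(\<integral>\<^sup>+x. ennreal (V x powr (1 / s)) \<partial>T)
    \<le> (\<integral>\<^sup>+x. ennreal (a powr (1 / s)) * (ennreal (1 / s / a) * ennreal (V x) + ennreal (1 - 1 / s)) \<partial>T)"
    using s a V0 by (intro nn_integral_mono order.trans[OF ennreal_leI[OF pt]])
      (auto simp flip: ennreal_mult ennreal_plus simp: add_nonneg_nonneg)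
  also have "\<dots> = ennreal (a powr (1 / s)) * (ennreal (1 / s / a) * (\<integral>\<^sup>+x. ennreal (V x) \<partial>T) + ennreal (1 - 1 / s) * emeasure T (space T))"
    by (simp add: nn_integral_cmult nn_integral_add)
  also have "\<dots> \<le> ennreal (a powr (1 / s)) * (ennreal (1 / s / a) * ennreal v + ennreal (1 - 1 / s) * ennreal m)"
    by (intro mult_left_mono add_mono v mass) auto
  also have "\<dots> = ennreal (a powr (1 / s) * (1 / s / a * v + (1 - 1 / s) * m))"
  proof -
    have e: "ennreal (1 / s / a) * ennreal v + ennreal (1 - 1 / s) * ennreal m = ennreal (1 / s / a * v + (1 - 1 / s) * m)"
      using s a v mass by (simp flip: ennreal_mult ennreal_plus)
    show ?thesis unfolding e using s a v mass by (intro ennreal_mult[symmetric] add_nonneg_nonneg mult_nonneg_nonneg) auto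
  qed
  also have "1 / s / a * v + (1 - 1 / s) * m = m" using v s mass by (simp add: a_def field_simps)
  also have "a powr (1 / s) * m = m powr (1 - 1 / s) * v powr (1 / s)"
    using v mass by (simp add: a_def powr_divide powr_diff)
  finally show ?thesis .
qed

text \<open>A Bochner integral of a non-integrable function is 0, so the inner integral splits into
  positive and negative parts only where \<phi> is integrable. The pointwise hypothesis
  \<open>fin'\<close> makes the splitting valid at every x.\<close>

lemma integral_bind_kernel:
  fixes \<phi> :: "'b \<Rightarrow> real"
  assumes K: "K \<in> measurable \<mu> (subprob_algebra N)" and ne: "space \<mu> \<noteq> {}"
    and \<phi> [measurable]: "\<phi> \<in> borel_measurable N"
    and fin: "(\<integral>\<^sup>+x. \<integral>\<^sup>+y. ennreal \<bar>\<phi> y\<bar> \<partial>K x \<partial>\<mu>) < \<infinity>"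
    and fin': "\<And>x. x \<in> space \<mu> \<Longrightarrow> (\<integral>\<^sup>+y. ennreal \<bar>\<phi> y\<bar> \<partial>K x) < \<infinity>"
  shows "integrable (\<mu> \<bind> K) \<phi>" "integrable \<mu> (\<lambda>x. \<integral>y. \<phi> y \<partial>K x)"
    "(\<integral>y. \<phi> y \<partial>(\<mu> \<bind> K)) = (\<integral>x. \<integral>y. \<phi> y \<partial>K x \<partial>\<mu>)"
proof -
  have sK: "sets (K x) = sets N" if "x \<in> space \<mu>" for x using sets_kernel[OF K that] .
  have sB: "sets (\<mu> \<bind> K) = sets N" using ne sK by (intro sets_bind) auto
  have Im: "(\<lambda>x. \<integral>y. h y \<partial>K x) \<in> borel_measurable \<mu>" if "h \<in> borel_measurable N" for h :: "'b \<Rightarrow> real"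
    using measurable_compose[OF K integral_measurable_subprob_algebra[OF that]] .
  have *: "integrable (\<mu> \<bind> K) h \<and> integrable \<mu> (\<lambda>x. \<integral>y. h y \<partial>K x) \<and>
      (\<integral>y. h y \<partial>(\<mu> \<bind> K)) = (\<integral>x. \<integral>y. h y \<partial>K x \<partial>\<mu>) \<and> (\<forall>x\<in>space \<mu>. integrable (K x) h)"
    if h [measurable]: "h \<in> borel_measurable N" and nn: "\<And>y. 0 \<le> h y" and le: "\<And>y. h y \<le> \<bar>\<phi> y\<bar>" for h :: "'b \<Rightarrow> real"
  proof -
    have "(\<integral>\<^sup>+y. ennreal (h y) \<partial>K x) < \<infinity>" if "x \<in> space \<mu>" for x
      by (rule le_less_trans[OF nn_integral_mono fin'[OF that]]) (simp add: le ennreal_leI)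
    then have iK: "integrable (K x) h" if "x \<in> space \<mu>" for x
      using that nn sK[OF that] by (intro integrableI_nonneg) (auto cong: measurable_cong_sets)
    have e: "(\<integral>\<^sup>+y. ennreal (h y) \<partial>K x) = ennreal (\<integral>y. h y \<partial>K x)" if "x \<in> space \<mu>" for x
      using iK[OF that] nn by (intro nn_integral_eq_integral) auto
    have B: "(\<integral>\<^sup>+y. ennreal (h y) \<partial>(\<mu> \<bind> K)) = (\<integral>\<^sup>+x. ennreal (\<integral>y. h y \<partial>K x) \<partial>\<mu>)"
      by (subst nn_integral_bind[OF _ K]) (auto intro!: nn_integral_cong e)
    have B': "(\<integral>\<^sup>+x. ennreal (\<integral>y. h y \<partial>K x) \<partial>\<mu>) < \<infinity>"
      by (rule le_less_trans[OF nn_integral_mono fin]) (auto simp flip: e intro!: nn_integral_mono le ennreal_leI)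
    have i1: "integrable (\<mu> \<bind> K) h"
      using B B' nn sB by (intro integrableI_nonneg) (auto cong: measurable_cong_sets)
    have i2: "integrable \<mu> (\<lambda>x. \<integral>y. h y \<partial>K x)"
      using B' nn Im[OF h] by (intro integrableI_nonneg) auto
    have "ennreal (\<integral>y. h y \<partial>(\<mu> \<bind> K)) = ennreal (\<integral>x. \<integral>y. h y \<partial>K x \<partial>\<mu>)"
      using B nn_integral_eq_integral[OF i1] nn_integral_eq_integral[OF i2] nn by (simp add: integral_nonneg)
    then have "(\<integral>y. h y \<partial>(\<mu> \<bind> K)) = (\<integral>x. \<integral>y. h y \<partial>K x \<partial>\<mu>)"
      using nn by (subst (asm) ennreal_inj) (auto intro!: integral_nonneg)
    with i1 i2 iK show ?thesis by blast
  qed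
  have pos: "(\<lambda>y. max 0 (\<phi> y)) \<in> borel_measurable N" and neg: "(\<lambda>y. max 0 (- \<phi> y)) \<in> borel_measurable N"
    by measurable
  note p = *[OF pos] and n = *[OF neg]
  have \<phi>: "\<phi> = (\<lambda>y. max 0 (\<phi> y) - max 0 (- \<phi> y))" by auto
  have p: "integrable (\<mu> \<bind> K) (\<lambda>y. max 0 (\<phi> y))" "integrable \<mu> (\<lambda>x. \<integral>y. max 0 (\<phi> y) \<partial>K x)"
    "(\<integral>y. max 0 (\<phi> y) \<partial>(\<mu> \<bind> K)) = (\<integral>x. \<integral>y. max 0 (\<phi> y) \<partial>K x \<partial>\<mu>)"
    "\<And>x. x \<in> space \<mu> \<Longrightarrow> integrable (K x) (\<lambda>y. max 0 (\<phi> y))"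
   and n: "integrable (\<mu> \<bind> K) (\<lambda>y. max 0 (- \<phi> y))" "integrable \<mu> (\<lambda>x. \<integral>y. max 0 (- \<phi> y) \<partial>K x)"
    "(\<integral>y. max 0 (- \<phi> y) \<partial>(\<mu> \<bind> K)) = (\<integral>x. \<integral>y. max 0 (- \<phi> y) \<partial>K x \<partial>\<mu>)"
    "\<And>x. x \<in> space \<mu> \<Longrightarrow> integrable (K x) (\<lambda>y. max 0 (- \<phi> y))"
    using p n by auto
  have e: "(\<integral>y. \<phi> y \<partial>K x) = (\<integral>y. max 0 (\<phi> y) \<partial>K x) - (\<integral>y. max 0 (- \<phi> y) \<partial>K x)" if "x \<in> space \<mu>" for x
    using p(4)[OF that] n(4)[OF that] by (subst \<phi>) (rule Bochner_Integration.integral_diff)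
  show "integrable (\<mu> \<bind> K) \<phi>" by (subst \<phi>) (intro Bochner_Integration.integrable_diff p n)
  show "integrable \<mu> (\<lambda>x. \<integral>y. \<phi> y \<partial>K x)"
    using Bochner_Integration.integrable_diff[OF p(2) n(2)] by (subst Bochner_Integration.integrable_cong[OF refl e])
  have "(\<integral>y. \<phi> y \<partial>(\<mu> \<bind> K)) = (\<integral>y. max 0 (\<phi> y) \<partial>(\<mu> \<bind> K)) - (\<integral>y. max 0 (- \<phi> y) \<partial>(\<mu> \<bind> K))"
    by (subst \<phi>) (intro Bochner_Integration.integral_diff p n)
  also have "\<dots> = (\<integral>x. (\<integral>y. max 0 (\<phi> y) \<partial>K x) - (\<integral>y. max 0 (- \<phi> y) \<partial>K x) \<partial>\<mu>)"
    using p n by (simp add: Bochner_Integration.integral_diff)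
  also have "\<dots> = (\<integral>x. \<integral>y. \<phi> y \<partial>K x \<partial>\<mu>)" by (intro Bochner_Integration.integral_cong refl e[symmetric])
  finally show "(\<integral>y. \<phi> y \<partial>(\<mu> \<bind> K)) = (\<integral>x. \<integral>y. \<phi> y \<partial>K x \<partial>\<mu>)" .
qed

text \<open>After division by a + b both fractions lie in [0, 1], where x \<le> x^r, and they sum to
  1.\<close>

lemma powr_add_le:
  fixes a b r :: real
  assumes "0 \<le> a" "0 \<le> b" "0 < r" "r \<le> 1"
  shows "(a + b) powr r \<le> a powr r + b powr r"
proof (cases "a + b = 0")
  case False
  then have ab: "a + b > 0" using assms by linarith
  have *: "x / (a + b) \<le> (x / (a + b)) powr r" if "0 \<le> x" "x \<le> a + b" for x
    using powr_mono'[of r 1 "x / (a + b)"] that assms ab by simp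
  have "1 = a / (a + b) + b / (a + b)" using ab by (simp add: add_divide_distrib[symmetric])
  also have "\<dots> \<le> (a / (a + b)) powr r + (b / (a + b)) powr r"
    using assms by (intro add_mono *) auto
  also have "\<dots> = (a powr r + b powr r) / (a + b) powr r"
    using assms by (simp add: powr_divide add_divide_distrib)
  finally show ?thesis using ab by (simp add: field_simps)
qed (use assms in auto)

text \<open>Each exponent k div \<tau> occurs for exactly \<tau> consecutive k, so the series is
  \<tau> copies of a geometric one.\<close>

lemma geometric_block_sum:
  fixes r :: real
  assumes r: "0 \<le> r" "r < 1" and \<tau>: "1 \<le> \<tau>"
  shows "summable (\<lambda>k. r ^ (k div \<tau>))" "(\<Sum>k. r ^ (k div \<tau>)) \<le> real \<tau> / (1 - r)"
proof -
  have le: "(\<Sum>k<n. r ^ (k div \<tau>)) \<le> real \<tau> / (1 - r)" for n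
  proof -
    have "(\<Sum>k<n. r ^ (k div \<tau>)) \<le> (\<Sum>k<n * \<tau>. r ^ (k div \<tau>))"
      using \<tau> r by (intro sum_mono2) (auto intro: less_le_trans)
    also have "\<dots> = (\<Sum>m<n. \<Sum>k\<in>{m * \<tau>..<m * \<tau> + \<tau>}. r ^ (k div \<tau>))"
      by (rule sum.nat_group[symmetric])
    also have "\<dots> = (\<Sum>m<n. \<Sum>k\<in>{m * \<tau>..<m * \<tau> + \<tau>}. r ^ m)"
    proof (intro sum.cong refl)
      fix m k assume "k \<in> {m * \<tau>..<m * \<tau> + \<tau>}"
      then have "k div \<tau> = m" by (auto simp: div_nat_eqI mult.commute)
      then show "r ^ (k div \<tau>) = r ^ m" by simp
    qed
    also have "\<dots> = real \<tau> * (\<Sum>m<n. r ^ m)" by (simp add: sum_distrib_left)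
    also have "\<dots> \<le> real \<tau> * (\<Sum>m. r ^ m)"
      using r by (intro mult_left_mono sum_le_suminf summable_geometric) auto
    also have "\<dots> = real \<tau> / (1 - r)" using r by (simp add: suminf_geometric)
    finally show ?thesis .
  qed
  show s: "summable (\<lambda>k. r ^ (k div \<tau>))"
    using r le by (intro summableI_nonneg_bounded) auto
  show "(\<Sum>k. r ^ (k div \<tau>)) \<le> real \<tau> / (1 - r)"
    using s le by (intro suminf_le_const) auto
qed

lemma quarter_powr_le: "(1 / 4) powr x \<le> 1 - x" if "0 \<le> x" "x \<le> 1 / 2" for x :: real
proof -
  have "1 powr (1 - 2 * x) * (1 / 2) powr (2 * x) \<le> (1 - 2 * x) * 1 + 2 * x * (1 / 2 :: real)"
    using that by (intro Youngs_inequality_0) auto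
  moreover have "(1 / 2) powr (2 * x) = ((1 / 2 :: real) powr 2) powr x" by (rule powr_powr[symmetric])
  moreover have "(1 / 2 :: real) powr 2 = 1 / 4" by (simp add: power2_eq_square)
  ultimately show ?thesis by simp
qed

section \<open>Iterates of a Markov kernel\<close>

locale markov_kernel =
  fixes M :: "'a measure" and Q :: "'a \<Rightarrow> 'a measure"
  assumes Q [measurable]: "Q \<in> M \<rightarrow>\<^sub>M prob_algebra M"
begin

lemma Q_sub [measurable]: "Q \<in> M \<rightarrow>\<^sub>M subprob_algebra M"
  by (rule measurable_prob_algebraD[OF Q])

lemma Q_space: "z \<in> space M \<Longrightarrow> prob_space (Q z)" "z \<in> space M \<Longrightarrow> sets (Q z) = sets M"
  "z \<in> space M \<Longrightarrow> space (Q z) = space M"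
  using measurable_space[OF Q, of z] sets_eq_imp_space_eq[of "Q z" M] by (auto simp: space_prob_algebra)

lemma kernel_measurable [measurable]: "kernel_power M Q n \<in> M \<rightarrow>\<^sub>M prob_algebra M"
proof (induction n)
  case 0 then show ?case by (subst measurable_cong[where g="return M"]) auto
next
  case (Suc n)
  have [measurable]: "kernel_power M Q n \<in> M \<rightarrow>\<^sub>M prob_algebra M" by fact
  have "(\<lambda>z. kernel_power M Q n z \<bind> Q) \<in> M \<rightarrow>\<^sub>M prob_algebra M"
    by (rule measurable_bind_prob_space[OF Suc Q])
  then show ?case by (simp cong: measurable_cong)
qed

lemma kernel_sub [measurable]: "kernel_power M Q n \<in> M \<rightarrow>\<^sub>M subprob_algebra M"
  by (rule measurable_prob_algebraD[OF kernel_measurable])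

lemma kernel_space: "z \<in> space M \<Longrightarrow> prob_space (kernel_power M Q n z)"
  "z \<in> space M \<Longrightarrow> sets (kernel_power M Q n z) = sets M"
  "z \<in> space M \<Longrightarrow> space (kernel_power M Q n z) = space M"
  using measurable_space[OF kernel_measurable, of z n] sets_eq_imp_space_eq[of "kernel_power M Q n z" M]
  by (auto simp: space_prob_algebra)

text \<open>The recursion of \<open>kernel_power\<close> appends a step, while the Poisson equation
  applies Q first; associativity of bind moves the new step to the front.\<close>

lemma kernel_power_Suc': "z \<in> space M \<Longrightarrow> kernel_power M Q (Suc n) z = Q z \<bind> kernel_power M Q n"
proof (induction n)
  case 0
  then show ?case
    using Q_space[of z] by (simp add: bind_return[OF Q_sub] bind_return'')
next
  case (Suc n)
  have "kernel_power M Q (Suc (Suc n)) z = (Q z \<bind> kernel_power M Q n) \<bind> Q"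
    using Suc by simp
  also have "\<dots> = Q z \<bind> (\<lambda>x. kernel_power M Q n x \<bind> Q)"
    using Q_space[OF Suc.prems] by (intro bind_assoc[where N=M and R=M]) (auto cong: measurable_cong_sets)
  finally show ?case by simp
qed

lemma nn_integral_Suc:
  assumes "z \<in> space M" "h \<in> borel_measurable M"
  shows "(\<integral>\<^sup>+y. h y \<partial>kernel_power M Q (Suc n) z) = (\<integral>\<^sup>+x. \<integral>\<^sup>+y. h y \<partial>Q x \<partial>kernel_power M Q n z)"
    "(\<integral>\<^sup>+y. h y \<partial>kernel_power M Q (Suc n) z) = (\<integral>\<^sup>+x. \<integral>\<^sup>+y. h y \<partial>kernel_power M Q n x \<partial>Q z)"
  subgoal
    using assms kernel_space[of z n]
    by (simp, subst nn_integral_bind[where B=M]) (auto cong: measurable_cong_sets)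
  subgoal
    using assms Q_space[of z]
    by (subst kernel_power_Suc'[OF assms(1)], subst nn_integral_bind[where B=M]) (auto cong: measurable_cong_sets)
  done

lemma Q_eq_kernel: "z \<in> space M \<Longrightarrow> Q z = kernel_power M Q 1 z"
  by (simp add: bind_return[OF Q_sub])

end

section \<open>Decay of the iterates and the Poisson equation under VGE\<close>

locale vge_chain = markov_kernel +
  fixes V :: "'a \<Rightarrow> real" and \<pi> :: "'a measure" and \<tau> :: nat and \<kappa> :: real
  assumes V_meas [measurable]: "V \<in> borel_measurable M"
    and V_ge: "\<And>z. z \<in> space M \<Longrightarrow> exp 1 \<le> V z"
    and VGE: "VGE M Q V \<pi> \<tau> \<kappa>"
begin

abbreviation "T n \<phi> z \<equiv> (\<integral>y. \<phi> y \<partial>kernel_power M Q n z)"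

definition "piV = (\<integral>z. V z \<partial>\<pi>)"

lemma pi_inv: "\<pi> \<bind> Q = \<pi>" and pi_space: "prob_space \<pi>" "sets \<pi> = sets M" "space \<pi> = space M"
  using VGE sets_eq_imp_space_eq[of \<pi> M] by (auto simp: VGE_def invariant_distribution_def space_prob_algebra)

lemma V_ge1: "z \<in> space M \<Longrightarrow> 1 \<le> V z"
  by (rule order_trans[OF _ V_ge]) simp

lemma V_pos: "z \<in> space M \<Longrightarrow> 0 < V z"
  using V_ge1[of z] by linarith

lemma tau: "1 \<le> \<tau>" and kappa: "1 \<le> \<kappa>"
  using VGE by (auto simp: VGE_def)

lemma pi_kernel: "\<pi> \<bind> kernel_power M Q n = \<pi>"
proof (induction n)
  case 0
  have "\<pi> \<bind> kernel_power M Q 0 = \<pi> \<bind> return M" by (intro bind_cong) auto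
  then show ?case using pi_space by (simp add: bind_return'')
next
  case (Suc n)
  have "\<pi> \<bind> kernel_power M Q (Suc n) = (\<pi> \<bind> kernel_power M Q n) \<bind> Q"
    unfolding kernel_power.simps(2)[abs_def]
    by (subst bind_assoc[where N=M and R=M]) (auto simp: pi_space cong: measurable_cong_sets)
  then show ?case by (simp only: Suc pi_inv)
qed

lemma pi_sub [measurable_cong]: "sets \<pi> = sets M" by (rule pi_space)

lemma nn_integral_pi:
  assumes "h \<in> borel_measurable M"
  shows "(\<integral>\<^sup>+x. \<integral>\<^sup>+y. h y \<partial>kernel_power M Q n x \<partial>\<pi>) = (\<integral>\<^sup>+y. h y \<partial>\<pi>)"
  using assms by (subst (2) pi_kernel[of n, symmetric], subst nn_integral_bind[where B=M]) (auto cong: measurable_cong_sets)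

lemma V_pi_integrable: "integrable \<pi> V"
  using VGE V_ge1[THEN order_trans[OF zero_le_one]] pi_space
  by (intro integrableI_nonneg) (auto simp: VGE_def)

lemma piV_nn: "(\<integral>\<^sup>+z. ennreal (V z) \<partial>\<pi>) = ennreal piV"
  unfolding piV_def using V_pos pi_space by (intro nn_integral_eq_integral V_pi_integrable AE_I2) (auto intro: less_imp_le)

lemma piV_ge: "exp 1 \<le> piV"
proof -
  interpret prob_space \<pi> by (rule pi_space)
  have "(\<integral>z. exp 1 \<partial>\<pi>) \<le> piV" unfolding piV_def
    using V_pi_integrable V_ge pi_space by (intro integral_mono) auto
  then show ?thesis by (simp add: prob_space)
qed

lemma piV_ge1: "1 \<le> piV"
  using piV_ge one_le_exp_iff[of "1::real"] by linarith

lemma wnorm_diff_le: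
  assumes "z \<in> space M" "z' \<in> space M"
  shows "wnorm_diff V (kernel_power M Q n z) (kernel_power M Q n z') \<le> ennreal (\<kappa> * (1/4)^(n div \<tau>) * (V z + V z'))"
proof -
  let ?w = "wnorm_diff V (kernel_power M Q n z) (kernel_power M Q n z')"
  have v: "0 < V z + V z'" using V_pos assms by (simp add: add_pos_pos)
  have "?w / ennreal (V z + V z') \<le> (SUP (z, z') \<in> space M \<times> space M.
            wnorm_diff V (kernel_power M Q n z) (kernel_power M Q n z') / ennreal (V z + V z'))"
    using assms by (intro SUP_upper2[of "(z, z')"]) auto
  also have "\<dots> \<le> ennreal (\<kappa> * (1 / 4) ^ (n div \<tau>))" using VGE by (auto simp: VGE_def)
  finally have "?w / ennreal (V z + V z') * ennreal (V z + V z') \<le> ennreal (\<kappa> * (1 / 4) ^ (n div \<tau>)) * ennreal (V z + V z')"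
    by (rule mult_right_mono) simp
  moreover have "?w / ennreal (V z + V z') * ennreal (V z + V z') = ?w"
    using v by (simp add: ennreal_divide_times ennreal_divide_self ennreal_times_divide[symmetric])
  ultimately show ?thesis using v kappa by (simp add: ennreal_mult)
qed

lemma tv_V_le:
  assumes "z \<in> space M" "z' \<in> space M"
  shows "(\<integral>\<^sup>+y. ennreal (V y) \<partial>tv_measure (kernel_power M Q n z) (kernel_power M Q n z')) \<le> ennreal (\<kappa> * (1/4)^(n div \<tau>) * (V z + V z'))"
  using wnorm_diff_le[OF assms] by (simp add: wnorm_diff_def)

text \<open>VGE controls differences and contains no drift condition. Averaging the second starting
  point over \<pi>, for which Q^n V has the same integral as V, yields a bound for a single starting
  point; it makes functions of order V integrable under every iterate.\<close>

lemma kernel_V_finite: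
  assumes z: "z \<in> space M"
  shows "(\<integral>\<^sup>+y. ennreal (V y) \<partial>kernel_power M Q n z) \<le> ennreal ((\<kappa> + 1) * piV + \<kappa> * V z)"
proof -
  interpret pi: prob_space \<pi> by (rule pi_space)
  have c: "\<kappa> * (1/4)^(n div \<tau>) \<le> \<kappa>"
    using kappa power_le_one[of "1/4::real" "n div \<tau>"] by (simp add: mult_left_le)
  have *: "(\<integral>\<^sup>+y. ennreal (V y) \<partial>kernel_power M Q n z) \<le>
      (\<integral>\<^sup>+y. ennreal (V y) \<partial>kernel_power M Q n z') + ennreal (\<kappa> * (V z + V z'))" if z': "z' \<in> space M" for z'
  proof -
    have "(\<integral>\<^sup>+y. ennreal (V y) \<partial>kernel_power M Q n z) \<le>
      (\<integral>\<^sup>+y. ennreal (V y) \<partial>kernel_power M Q n z') +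
      (\<integral>\<^sup>+y. ennreal (V y) \<partial>tv_measure (kernel_power M Q n z) (kernel_power M Q n z'))"
      using kernel_space[OF z] kernel_space[OF z']
      by (intro nn_integral_mono_add_measure tv_measure_le_add) (auto cong: measurable_cong_sets)
    also have "\<dots> \<le> (\<integral>\<^sup>+y. ennreal (V y) \<partial>kernel_power M Q n z') + ennreal (\<kappa> * (V z + V z'))"
      using V_pos[OF z] V_pos[OF z'] mult_right_mono[OF c, of "V z + V z'"]
      by (intro add_left_mono order_trans[OF tv_V_le[OF z z']] ennreal_leI) auto
    finally show ?thesis .
  qed
  have "(\<integral>\<^sup>+y. ennreal (V y) \<partial>kernel_power M Q n z) = (\<integral>\<^sup>+z'. (\<integral>\<^sup>+y. ennreal (V y) \<partial>kernel_power M Q n z) \<partial>\<pi>)"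
    by (simp add: pi.emeasure_space_1)
  also have "\<dots> \<le> (\<integral>\<^sup>+z'. (\<integral>\<^sup>+y. ennreal (V y) \<partial>kernel_power M Q n z') + (ennreal (\<kappa> * V z) + ennreal \<kappa> * ennreal (V z')) \<partial>\<pi>)"
  proof (rule nn_integral_mono)
    fix z' assume "z' \<in> space \<pi>"
    then have z': "z' \<in> space M" using pi_space by simp
    have "ennreal (\<kappa> * (V z + V z')) = ennreal (\<kappa> * V z) + ennreal \<kappa> * ennreal (V z')"
      using V_pos[OF z] V_pos[OF z'] kappa
      by (simp add: distrib_left flip: ennreal_mult ennreal_plus)
    with *[OF z'] show "(\<integral>\<^sup>+y. ennreal (V y) \<partial>kernel_power M Q n z) \<le>
      (\<integral>\<^sup>+y. ennreal (V y) \<partial>kernel_power M Q n z') + (ennreal (\<kappa> * V z) + ennreal \<kappa> * ennreal (V z'))"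
      by simp
  qed
  also have "\<dots> = (\<integral>\<^sup>+z'. (\<integral>\<^sup>+y. ennreal (V y) \<partial>kernel_power M Q n z') \<partial>\<pi>) + (ennreal (\<kappa> * V z) + ennreal \<kappa> * (\<integral>\<^sup>+z'. ennreal (V z') \<partial>\<pi>))"
    by (subst nn_integral_add) (auto simp: nn_integral_add nn_integral_cmult pi.emeasure_space_1)
  also have "\<dots> = ennreal piV + (ennreal (\<kappa> * V z) + ennreal \<kappa> * ennreal piV)"
    by (simp add: nn_integral_pi piV_nn)
  also have "\<dots> = ennreal ((\<kappa> + 1) * piV + \<kappa> * V z)"
    using V_pos[OF z] kappa piV_ge1 by (simp add: distrib_right algebra_simps flip: ennreal_mult ennreal_plus)
  finally show ?thesis .
qed

lemma V_kernel_integrable: "z \<in> space M \<Longrightarrow> integrable (kernel_power M Q n z) V"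
  using kernel_V_finite[of z n] V_pos kernel_space[of z n]
  by (intro integrableI_nonneg AE_I2) (auto intro: less_imp_le le_less_trans cong: measurable_cong_sets)

lemma V_bounded_integrable:
  assumes "\<phi> \<in> borel_measurable M" "\<And>z. z \<in> space M \<Longrightarrow> \<bar>\<phi> z\<bar> \<le> A * V z"
  shows "z \<in> space M \<Longrightarrow> integrable (kernel_power M Q n z) \<phi>" "integrable \<pi> \<phi>"
proof -
  assume z: "z \<in> space M"
  have "integrable (kernel_power M Q n z) (\<lambda>z. A * V z)" using V_kernel_integrable[OF z] by simp
  then show "integrable (kernel_power M Q n z) \<phi>"
    by (rule Bochner_Integration.integrable_bound)
      (use assms(1) kernel_space[OF z] in \<open>auto cong: measurable_cong_sets intro!: AE_I2 order_trans[OF assms(2) abs_ge_self]\<close>)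
next
  have "integrable \<pi> (\<lambda>z. A * V z)" using V_pi_integrable by simp
  then show "integrable \<pi> \<phi>"
    by (rule Bochner_Integration.integrable_bound)
      (use assms(1) pi_space in \<open>auto intro!: AE_I2 order_trans[OF assms(2) abs_ge_self]\<close>)
qed

lemma V_bounded_abs_finite:
  assumes "\<phi> \<in> borel_measurable M" "\<And>z. z \<in> space M \<Longrightarrow> \<bar>\<phi> z\<bar> \<le> A * V z" "z \<in> space M"
  shows "(\<integral>\<^sup>+y. ennreal \<bar>\<phi> y\<bar> \<partial>kernel_power M Q n z) < \<infinity>"
  using V_bounded_integrable(1)[OF assms] by (simp add: integrable_iff_bounded)

lemma T_measurable [measurable]: "\<phi> \<in> borel_measurable M \<Longrightarrow> (\<lambda>z. T n \<phi> z) \<in> borel_measurable M" for \<phi> :: "'a \<Rightarrow> real"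
  using measurable_compose[OF kernel_sub integral_measurable_subprob_algebra] .

lemma T_Suc:
  assumes \<phi>: "\<phi> \<in> borel_measurable M" "\<And>z. z \<in> space M \<Longrightarrow> \<bar>\<phi> z\<bar> \<le> A * V z" and z: "z \<in> space M"
  shows "T (Suc n) \<phi> z = (\<integral>y. T n \<phi> y \<partial>Q z)" "integrable (Q z) (\<lambda>y. T n \<phi> y)"
proof -
  have 1: "(\<integral>\<^sup>+x. \<integral>\<^sup>+y. ennreal \<bar>\<phi> y\<bar> \<partial>kernel_power M Q n x \<partial>Q z) < \<infinity>"
    using V_bounded_abs_finite[OF \<phi> z, of "Suc n"] nn_integral_Suc(2)[OF z, of "\<lambda>y. ennreal \<bar>\<phi> y\<bar>" n] \<phi>(1)
    by (simp del: kernel_power.simps)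
  have 2: "kernel_power M Q n \<in> Q z \<rightarrow>\<^sub>M subprob_algebra M" using Q_space[OF z] by (auto cong: measurable_cong_sets)
  have 3: "space (Q z) \<noteq> {}" using Q_space(1)[OF z] prob_space.not_empty by blast
  have 4: "\<And>x. x \<in> space (Q z) \<Longrightarrow> (\<integral>\<^sup>+y. ennreal \<bar>\<phi> y\<bar> \<partial>kernel_power M Q n x) < \<infinity>"
    using V_bounded_abs_finite[OF \<phi>] Q_space[OF z] by auto
  note I = integral_bind_kernel[OF 2 3 \<phi>(1) 1 4]
  show "T (Suc n) \<phi> z = (\<integral>y. T n \<phi> y \<partial>Q z)" unfolding kernel_power_Suc'[OF z] by (rule I)
  show "integrable (Q z) (\<lambda>y. T n \<phi> y)" by (rule I)
qed

lemma T_pi: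
  assumes \<phi>: "\<phi> \<in> borel_measurable M" "\<And>z. z \<in> space M \<Longrightarrow> \<bar>\<phi> z\<bar> \<le> A * V z"
  shows "(\<integral>z. T n \<phi> z \<partial>\<pi>) = (\<integral>z. \<phi> z \<partial>\<pi>)" "integrable \<pi> (\<lambda>z. T n \<phi> z)"
proof -
  have 1: "(\<integral>\<^sup>+x. \<integral>\<^sup>+y. ennreal \<bar>\<phi> y\<bar> \<partial>kernel_power M Q n x \<partial>\<pi>) < \<infinity>"
    using V_bounded_integrable(2)[OF \<phi>] \<phi>(1) by (subst nn_integral_pi) (auto simp: integrable_iff_bounded)
  have 2: "kernel_power M Q n \<in> \<pi> \<rightarrow>\<^sub>M subprob_algebra M" by measurable
  have 3: "space \<pi> \<noteq> {}" using pi_space(1) prob_space.not_empty by blast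
  have 4: "\<And>x. x \<in> space \<pi> \<Longrightarrow> (\<integral>\<^sup>+y. ennreal \<bar>\<phi> y\<bar> \<partial>kernel_power M Q n x) < \<infinity>"
    using V_bounded_abs_finite[OF \<phi>] pi_space by auto
  note I = integral_bind_kernel[OF 2 3 \<phi>(1) 1 4]
  show "(\<integral>z. T n \<phi> z \<partial>\<pi>) = (\<integral>z. \<phi> z \<partial>\<pi>)" using I(3) unfolding pi_kernel by simp
  show "integrable \<pi> (\<lambda>z. T n \<phi> z)" by (rule I)
qed

text \<open>Functions of order V^(1/s) contract at the s-th root of the rate, because total
  variation mass 2 and the decaying V-norm are interpolated by \<open>nn_integral_powr_le\<close>.
  The constant c stays separate from V^(1/s): it is later a power of \<pi>(V), and here it costs
  only the factor 1 + c.\<close>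

lemma contraction:
  assumes \<phi>: "\<phi> \<in> borel_measurable M" "\<And>z. z \<in> space M \<Longrightarrow> \<bar>\<phi> z\<bar> \<le> A * (V z powr (1/s) + c)"
    and s: "1 \<le> s" and c: "0 \<le> c" and A: "0 \<le> A"
    and z: "z \<in> space M" "z' \<in> space M"
  shows "\<bar>T n \<phi> z - T n \<phi> z'\<bar> \<le> 2 * A * (1 + c) * (\<kappa> * (1/4)^(n div \<tau>) * (V z + V z')) powr (1/s)"
proof -
  let ?\<mu> = "kernel_power M Q n z" and ?\<nu> = "kernel_power M Q n z'"
  let ?T = "tv_measure ?\<mu> ?\<nu>"
  let ?v = "\<kappa> * (1/4)^(n div \<tau>) * (V z + V z')"
  have v: "0 < ?v" using kappa V_pos[OF z(1)] V_pos[OF z(2)] by (simp add: add_pos_pos)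
  have sp: "space ?T = space M" "sets ?T = sets M" using kernel_space[OF z(1)] by simp_all
  have p1: "1 \<le> V x powr (1/s)" if "x \<in> space M" for x
    using V_ge1[OF that] s by (simp add: ge_one_powr_ge_zero)
  have pV: "V x powr (1/s) \<le> V x" if "x \<in> space M" for x
    using powr_mono[of "1/s" 1 "V x"] V_ge1[OF that] s by simp
  have b1: "A * (V x powr (1/s) + c) \<le> A * (1 + c) * V x powr (1/s)" if "x \<in> space M" for x
    using mult_left_mono[OF p1[OF that] c] A unfolding mult.assoc by (intro mult_left_mono) (auto simp: algebra_simps)
  have b2: "A * (1 + c) * V x powr (1/s) \<le> A * (1 + c) * V x" if "x \<in> space M" for x
    using pV[OF that] c A by (intro mult_left_mono) auto
  have bV: "\<bar>\<phi> x\<bar> \<le> A * (1 + c) * V x" if "x \<in> space M" for x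
    using \<phi>(2)[OF that] b1[OF that] b2[OF that] by linarith
  have "ennreal \<bar>T n \<phi> z - T n \<phi> z'\<bar> \<le> (\<integral>\<^sup>+x. ennreal \<bar>\<phi> x\<bar> \<partial>?T)"
    using kernel_space[OF z(1)] kernel_space[OF z(2)] V_bounded_integrable(1)[OF \<phi>(1) bV] z \<phi>(1)
    by (intro integral_diff_le_tv) (auto cong: measurable_cong_sets)
  also have "\<dots> \<le> (\<integral>\<^sup>+x. ennreal (A * (1 + c)) * ennreal (V x powr (1/s)) \<partial>?T)"
    using \<phi>(2) b1 sp A c
    by (intro nn_integral_mono) (auto simp flip: ennreal_mult intro!: ennreal_leI intro: order_trans)
  also have "\<dots> = ennreal (A * (1 + c)) * (\<integral>\<^sup>+x. ennreal (V x powr (1/s)) \<partial>?T)"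
    using sp by (intro nn_integral_cmult) (auto cong: measurable_cong_sets)
  also have "\<dots> \<le> ennreal (A * (1 + c)) * ennreal (2 powr (1 - 1/s) * ?v powr (1/s))"
  proof (intro mult_left_mono nn_integral_powr_le)
    show "emeasure ?T (space ?T) \<le> ennreal 2"
      using tv_measure_le_add(3)[of ?\<mu> ?\<nu>] kernel_space[OF z(1)] kernel_space[OF z(2)] by simp
    show "(\<integral>\<^sup>+x. ennreal (V x) \<partial>?T) \<le> ennreal ?v" using tv_V_le[OF z] .
  qed (use sp s v V_pos in \<open>auto cong: measurable_cong_sets\<close>)
  also have "\<dots> = ennreal (A * (1 + c) * (2 powr (1 - 1/s) * ?v powr (1/s)))"
    using A c by (simp add: ennreal_mult)
  finally have "\<bar>T n \<phi> z - T n \<phi> z'\<bar> \<le> A * (1 + c) * (2 powr (1 - 1/s) * ?v powr (1/s))"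
    using A c by (simp add: ennreal_le_iff)
  also have "\<dots> \<le> A * (1 + c) * (2 * ?v powr (1/s))"
    using s A c powr_mono[of "1 - 1/s" 1 "2::real"] by (intro mult_left_mono mult_right_mono) auto
  finally show ?thesis by (simp add: algebra_simps)
qed


lemma V_powr_le: "z \<in> space M \<Longrightarrow> 1 \<le> s \<Longrightarrow> V z powr (1/s) \<le> V z"
  and V_powr_ge1: "z \<in> space M \<Longrightarrow> 1 \<le> s \<Longrightarrow> 1 \<le> V z powr (1/s)"
proof -
  assume "z \<in> space M" "1 \<le> s"
  then show "V z powr (1/s) \<le> V z" "1 \<le> V z powr (1/s)"
    using powr_mono[of "1/s" 1 "V z"] V_ge1[of z] by (simp_all add: ge_one_powr_ge_zero)
qed

lemma V_bound_of_powr_bound: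
  assumes "\<And>z. z \<in> space M \<Longrightarrow> \<bar>\<phi> z\<bar> \<le> A * (V z powr (1/s) + c)"
    and s: "1 \<le> s" and c: "0 \<le> c" and A: "0 \<le> A" and z: "z \<in> space M"
  shows "\<bar>\<phi> z\<bar> \<le> A * (1 + c) * V z"
proof -
  have "V z powr (1/s) + c \<le> (1 + c) * V z"
    using V_powr_le[OF z s] mult_left_mono[OF V_ge1[OF z] c] by (simp add: algebra_simps)
  from mult_left_mono[OF this A] show ?thesis using assms(1)[OF z] by (simp add: mult.assoc)
qed

lemma pi_powr_integrable: "1 \<le> s \<Longrightarrow> integrable \<pi> (\<lambda>z. V z powr (1/s))"
  by (rule V_bounded_integrable(2)[where A=1]) (use V_powr_le in auto)

lemma pi_powr_le:
  assumes s: "1 \<le> s"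
  shows "(\<integral>z. V z powr (1/s) \<partial>\<pi>) \<le> piV powr (1/s)"
proof -
  interpret prob_space \<pi> by (rule pi_space)
  have "ennreal (\<integral>z. V z powr (1/s) \<partial>\<pi>) = (\<integral>\<^sup>+z. ennreal (V z powr (1/s)) \<partial>\<pi>)"
    by (rule nn_integral_eq_integral[OF pi_powr_integrable[OF s], symmetric]) simp
  also have "\<dots> \<le> ennreal (1 powr (1 - 1/s) * piV powr (1/s))"
    using s V_pos pi_space piV_nn piV_ge1 emeasure_space_1 by (intro nn_integral_powr_le) auto
  finally show ?thesis using s by (simp add: ennreal_le_iff)
qed

text \<open>The two-point bound is averaged over z' under \<pi>. Subadditivity of the power
  separates V z from V z', and Jensen's inequality \<open>pi_powr_le\<close> treats the
  latter.\<close>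

lemma contraction_pi:
  assumes \<phi>: "\<phi> \<in> borel_measurable M" "\<And>z. z \<in> space M \<Longrightarrow> \<bar>\<phi> z\<bar> \<le> A * (V z powr (1/s) + c)"
    and s: "1 \<le> s" and c: "0 \<le> c" and A: "0 \<le> A"
    and z: "z \<in> space M"
  shows "\<bar>T n \<phi> z - (\<integral>z. \<phi> z \<partial>\<pi>)\<bar> \<le> 2 * A * (1 + c) * \<kappa> powr (1/s) * ((1/4) powr (1/s)) ^ (n div \<tau>) * (V z powr (1/s) + piV powr (1/s))"
proof -
  interpret prob_space \<pi> by (rule pi_space)
  note bV = V_bound_of_powr_bound[OF \<phi>(2) s c A]
  let ?q = "2 * A * (1 + c) * \<kappa> powr (1/s) * ((1/4) powr (1/s)) ^ (n div \<tau>)"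
  have q0: "0 \<le> ?q" using A c by simp
  have pw: "((1/4) ^ k) powr (1/s) = ((1/4) powr (1/s)) ^ k" for k
  proof -
    have "((1/4::real) ^ k) powr (1/s) = ((1/4) powr real k) powr (1/s)" by (subst powr_realpow) auto
    also have "\<dots> = ((1/4) powr (1/s)) powr real k" by (simp only: powr_powr mult.commute)
    also have "\<dots> = ((1/4) powr (1/s)) ^ k" by (rule powr_realpow) simp
    finally show ?thesis .
  qed
  have le: "\<bar>T n \<phi> z - T n \<phi> z'\<bar> \<le> ?q * (V z powr (1/s) + V z' powr (1/s))" if z': "z' \<in> space M" for z'
  proof -
    have "\<bar>T n \<phi> z - T n \<phi> z'\<bar> \<le> 2 * A * (1 + c) * (\<kappa> * (1/4)^(n div \<tau>) * (V z + V z')) powr (1/s)"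
      by (rule contraction[OF \<phi> s c A z z'])
    also have "\<dots> = ?q * (V z + V z') powr (1/s)"
      using kappa V_pos[OF z] V_pos[OF z'] by (simp add: powr_mult pw)
    also have "\<dots> \<le> ?q * (V z powr (1/s) + V z' powr (1/s))"
      using V_pos[OF z] V_pos[OF z'] s by (intro mult_left_mono q0 powr_add_le) auto
    finally show ?thesis .
  qed
  have iT: "integrable \<pi> (\<lambda>z'. T n \<phi> z')" by (rule T_pi(2)[OF \<phi>(1) bV])
  have "T n \<phi> z - (\<integral>z. \<phi> z \<partial>\<pi>) = (\<integral>z'. T n \<phi> z - T n \<phi> z' \<partial>\<pi>)"
    using T_pi(1)[OF \<phi>(1) bV] iT by (simp add: prob_space)
  also have "\<bar>\<dots>\<bar> \<le> (\<integral>z'. \<bar>T n \<phi> z - T n \<phi> z'\<bar> \<partial>\<pi>)" by (rule integral_abs_bound)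
  also have "\<dots> \<le> (\<integral>z'. ?q * (V z powr (1/s) + V z' powr (1/s)) \<partial>\<pi>)"
    using pi_powr_integrable[OF s] iT le pi_space
    by (intro integral_mono) (auto intro!: Bochner_Integration.integrable_abs Bochner_Integration.integrable_diff)
  also have "\<dots> = ?q * (V z powr (1/s) + (\<integral>z'. V z' powr (1/s) \<partial>\<pi>))"
    using pi_powr_integrable[OF s] by (simp add: prob_space)
  also have "\<dots> \<le> ?q * (V z powr (1/s) + piV powr (1/s))"
    by (intro mult_left_mono q0 add_left_mono pi_powr_le s)
  finally show ?thesis .
qed

text \<open>The Neumann series for the inverse of I - Q on centred functions; the centring is done
  in each term, so \<phi> enters as it is.\<close>

definition poisson :: "('a \<Rightarrow> real) \<Rightarrow> 'a \<Rightarrow> real" where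
  "poisson \<phi> z = (\<Sum>n. T n \<phi> z - (\<integral>z. \<phi> z \<partial>\<pi>))"

lemma poisson_measurable [measurable]: "\<phi> \<in> borel_measurable M \<Longrightarrow> poisson \<phi> \<in> borel_measurable M"
  unfolding poisson_def[abs_def] by (intro borel_measurable_suminf borel_measurable_diff T_measurable) auto

text \<open>The factor \<tau> s is the price of solving a Poisson equation and sets the scale of the
  blocks used later.\<close>

lemma poisson_rate:
  fixes s :: real
  assumes s: "2 \<le> s"
  shows "summable (\<lambda>n. ((1/4) powr (1/s)) ^ (n div \<tau>))"
  "(\<Sum>n. ((1/4) powr (1/s)) ^ (n div \<tau>)) \<le> real \<tau> * s"
proof -
  let ?r = "(1/4::real) powr (1/s)"
  have r: "?r \<le> 1 - 1/s" using quarter_powr_le[of "1/s"] s by (simp add: field_simps)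
  then have r1: "?r < 1" using s by (smt (verit) divide_pos_pos)
  show "summable (\<lambda>n. ?r ^ (n div \<tau>))" using geometric_block_sum(1)[OF _ r1 tau] by simp
  have "(\<Sum>n. ?r ^ (n div \<tau>)) \<le> real \<tau> / (1 - ?r)" using geometric_block_sum(2)[OF _ r1 tau] by simp
  also have "\<dots> \<le> real \<tau> / (1 / s)" using r s r1 by (intro divide_left_mono) (auto intro!: mult_pos_pos)
  finally show "(\<Sum>n. ?r ^ (n div \<tau>)) \<le> real \<tau> * s" by simp
qed

context
  fixes \<phi> :: "'a \<Rightarrow> real" and A s c :: real
  assumes \<phi>: "\<phi> \<in> borel_measurable M" "\<And>z. z \<in> space M \<Longrightarrow> \<bar>\<phi> z\<bar> \<le> A * (V z powr (1/s) + c)"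
    and s: "2 \<le> s" and c: "0 \<le> c" and A: "0 \<le> A"
begin

private abbreviation "cc \<equiv> 2 * A * (1 + c) * \<kappa> powr (1/s)"

lemma poisson_term_le:
  assumes z: "z \<in> space M"
  shows "\<bar>T n \<phi> z - (\<integral>z. \<phi> z \<partial>\<pi>)\<bar> \<le> cc * (V z powr (1/s) + piV powr (1/s)) * ((1/4) powr (1/s)) ^ (n div \<tau>)"
  using contraction_pi[OF \<phi> _ c A z, of n] s by (simp add: mult.assoc mult.left_commute mult.commute)

lemma poisson_summable:
  assumes z: "z \<in> space M"
  shows "summable (\<lambda>n. \<bar>T n \<phi> z - (\<integral>z. \<phi> z \<partial>\<pi>)\<bar>)"
  by (rule summable_comparison_test'[OF summable_mult[OF poisson_rate(1)[OF s]]])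
    (use poisson_term_le[OF z] in simp)

lemma poisson_le:
  assumes z: "z \<in> space M"
  shows "\<bar>poisson \<phi> z\<bar> \<le> cc * real \<tau> * s * (V z powr (1/s) + piV powr (1/s))"
proof -
  have "\<bar>poisson \<phi> z\<bar> \<le> (\<Sum>n. \<bar>T n \<phi> z - (\<integral>z. \<phi> z \<partial>\<pi>)\<bar>)"
    unfolding poisson_def by (rule summable_rabs[OF poisson_summable[OF z]])
  also have "\<dots> \<le> (\<Sum>n. cc * (V z powr (1/s) + piV powr (1/s)) * ((1/4) powr (1/s)) ^ (n div \<tau>))"
    by (intro suminf_le poisson_term_le z poisson_summable summable_mult poisson_rate[OF s])
  also have "\<dots> = cc * (V z powr (1/s) + piV powr (1/s)) * (\<Sum>n. ((1/4) powr (1/s)) ^ (n div \<tau>))"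
    by (rule suminf_mult[OF poisson_rate(1)[OF s]])
  also have "\<dots> \<le> cc * (V z powr (1/s) + piV powr (1/s)) * (real \<tau> * s)"
    using A c by (intro mult_left_mono poisson_rate[OF s]) auto
  finally show ?thesis by (simp add: mult_ac)
qed

lemma poisson_V_bound:
  assumes z: "z \<in> space M"
  shows "\<bar>poisson \<phi> z\<bar> \<le> cc * real \<tau> * s * (1 + piV powr (1/s)) * V z"
  using V_bound_of_powr_bound[OF poisson_le _ _ _ z] s A c by simp

lemma poisson_eq:
  assumes z: "z \<in> space M"
  shows "(\<integral>y. poisson \<phi> y \<partial>Q z) = poisson \<phi> z - (\<phi> z - (\<integral>z. \<phi> z \<partial>\<pi>))"
proof -
  interpret prob_space "Q z" by (rule Q_space[OF z])
  have s1: "1 \<le> s" using s by simp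
  note bV = V_bound_of_powr_bound[OF \<phi>(2) s1 c A]
  let ?m = "\<integral>z. \<phi> z \<partial>\<pi>"
  let ?r = "\<lambda>n. ((1/4) powr (1/s)) ^ (n div \<tau>)"
  have iT: "integrable (Q z) (\<lambda>y. T n \<phi> y - ?m)" for n
    using T_Suc(2)[OF \<phi>(1) bV z, of n] by simp
  have iV: "integrable (Q z) (\<lambda>z. V z powr (1/s))"
    unfolding Q_eq_kernel[OF z] by (rule V_bounded_integrable(1)[where A=1, OF _ _ z]) (use V_powr_le s1 in auto)
  \<comment> \<open>Interchanging Q with the series rests on summable L1 norms under Q z, dominated
    by the geometric rate.\<close>
  have sm: "summable (\<lambda>n. \<integral>y. norm (T n \<phi> y - ?m) \<partial>Q z)"
  proof (rule summable_comparison_test')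
    show "summable (\<lambda>n. cc * ((\<integral>y. V y powr (1/s) \<partial>Q z) + piV powr (1/s)) * ?r n)"
      by (intro summable_mult poisson_rate[OF s])
    fix n
    have "norm (\<integral>y. norm (T n \<phi> y - ?m) \<partial>Q z) = (\<integral>y. \<bar>T n \<phi> y - ?m\<bar> \<partial>Q z)" by simp
    also have "\<dots> \<le> (\<integral>y. cc * (V y powr (1/s) + piV powr (1/s)) * ?r n \<partial>Q z)"
      using iT[of n] iV Q_space[OF z] by (intro integral_mono poisson_term_le) auto
    also have "\<dots> = cc * ((\<integral>y. V y powr (1/s) \<partial>Q z) + piV powr (1/s)) * ?r n"
      using iV by (simp add: prob_space)
    finally show "norm (\<integral>y. norm (T n \<phi> y - ?m) \<partial>Q z) \<le> cc * ((\<integral>y. V y powr (1/s) \<partial>Q z) + piV powr (1/s)) * ?r n" .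
  qed
  have "(\<integral>y. poisson \<phi> y \<partial>Q z) = (\<Sum>n. \<integral>y. T n \<phi> y - ?m \<partial>Q z)"
    unfolding poisson_def
    using iT sm poisson_summable Q_space[OF z]
    by (intro integral_suminf AE_I2) auto
  also have "\<dots> = (\<Sum>n. T (Suc n) \<phi> z - ?m)"
    using T_Suc[OF \<phi>(1) bV z] by (simp add: prob_space del: kernel_power.simps)
  \<comment> \<open>Applying Q shifts the series by one index; the lost term, n = 0, is the centred
    \<phi>.\<close>
  also have "\<dots> = (\<Sum>n. T n \<phi> z - ?m) - (T 0 \<phi> z - ?m)"
    by (rule suminf_split_head) (rule summable_rabs_cancel[OF poisson_summable[OF z]])
  also have "T 0 \<phi> z = \<phi> z" using z \<phi>(1) by (simp add: integral_return)
  finally show ?thesis unfolding poisson_def .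
qed

end

text \<open>Termwise integration against h, which turns \<pi>(h g) into the covariance series of the
  asymptotic variance. The majorant is a product of two functions of order V^(1/s), dominated by V
  because 2/s \<le> 1.\<close>

lemma integral_mult_poisson:
  fixes A s c B c' :: real
  assumes \<phi>: "\<phi> \<in> borel_measurable M" "\<And>z. z \<in> space M \<Longrightarrow> \<bar>\<phi> z\<bar> \<le> A * (V z powr (1/s) + c)"
    and s: "2 \<le> s" and c: "0 \<le> c" and A: "0 \<le> A"
    and h: "h \<in> borel_measurable M" "\<And>z. z \<in> space M \<Longrightarrow> \<bar>h z\<bar> \<le> B * (V z powr (1/s) + c')"
    and B: "0 \<le> B" "0 \<le> c'"
  shows "(\<integral>z. h z * poisson \<phi> z \<partial>\<pi>) = (\<Sum>n. \<integral>z. h z * (T n \<phi> z - (\<integral>z. \<phi> z \<partial>\<pi>)) \<partial>\<pi>)"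
    "summable (\<lambda>n. \<integral>z. h z * (T n \<phi> z - (\<integral>z. \<phi> z \<partial>\<pi>)) \<partial>\<pi>)"
proof -
  let ?m = "\<integral>z. \<phi> z \<partial>\<pi>" and ?cc = "2 * A * (1 + c) * \<kappa> powr (1/s)"
  let ?r = "\<lambda>n. ((1/4) powr (1/s)) ^ (n div \<tau>)" and ?C = "piV powr (1/s)"
  let ?W = "\<lambda>z. (B * (V z powr (1/s) + c')) * (?cc * (V z powr (1/s) + ?C))"
  note [measurable] = \<phi>(1) h(1)
  have s1: "1 \<le> s" using s by simp
  have cc: "0 \<le> ?cc" using A c by simp
  have iW: "integrable \<pi> ?W"
  proof (rule V_bounded_integrable(2))
    fix z assume z: "z \<in> space M"
    let ?v = "V z powr (1/s)"
    have v: "1 \<le> ?v" "?v * ?v \<le> V z"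
    proof -
      show "1 \<le> ?v" by (rule V_powr_ge1[OF z s1])
      have "?v * ?v = V z powr (1/s + 1/s)" by (rule powr_add[symmetric])
      also have "\<dots> \<le> V z powr 1" using s V_ge1[OF z] by (intro powr_mono) (auto simp: field_simps)
      finally show "?v * ?v \<le> V z" using V_pos[OF z] by simp
    qed
    have "(?v + c') * (?v + ?C) \<le> ((1 + c') * ?v) * ((1 + ?C) * ?v)"
      using v(1) B mult_left_mono[OF v(1) B(2)] mult_right_mono[OF v(1), of ?C]
      by (intro mult_mono) (auto simp: algebra_simps)
    also have "\<dots> = (1 + c') * (1 + ?C) * (?v * ?v)" by (simp add: mult_ac)
    also have "\<dots> \<le> (1 + c') * (1 + ?C) * V z" using v(2) B by (intro mult_left_mono) auto
    finally have "?cc * B * ((?v + c') * (?v + ?C)) \<le> ?cc * B * ((1 + c') * (1 + ?C) * V z)"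
      using cc B by (intro mult_left_mono) auto
    moreover have "0 \<le> ?W z" using cc B by simp
    ultimately show "\<bar>?W z\<bar> \<le> (?cc * B * ((1 + c') * (1 + ?C))) * V z" by (simp add: mult_ac)
  qed measurable
  have b: "\<bar>h z * (T n \<phi> z - ?m)\<bar> \<le> ?W z * ?r n" if "z \<in> space M" for z n
  proof -
    have "\<bar>h z\<bar> * \<bar>T n \<phi> z - ?m\<bar> \<le> (B * (V z powr (1/s) + c')) * (?cc * (V z powr (1/s) + ?C) * ?r n)"
      using h(2)[OF that] poisson_term_le[OF \<phi> s c A that, of n] B by (intro mult_mono) auto
    then show ?thesis by (simp add: abs_mult mult_ac)
  qed
  have i: "integrable \<pi> (\<lambda>z. h z * (T n \<phi> z - ?m))" for n
  proof (rule Bochner_Integration.integrable_bound)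
    show "integrable \<pi> (\<lambda>z. ?W z * ?r n)" using iW by (rule integrable_mult_left)
    show "AE z in \<pi>. norm (h z * (T n \<phi> z - ?m)) \<le> norm (?W z * ?r n)"
      using b[of _ n] pi_space by (intro AE_I2) (auto intro: order_trans[OF _ abs_ge_self])
  qed measurable
  have sm: "summable (\<lambda>n. \<integral>z. norm (h z * (T n \<phi> z - ?m)) \<partial>\<pi>)"
  proof (rule summable_comparison_test')
    show "summable (\<lambda>n. (\<integral>z. ?W z \<partial>\<pi>) * ?r n)"
      by (intro summable_mult poisson_rate[OF s])
    fix n
    have "norm (\<integral>z. norm (h z * (T n \<phi> z - ?m)) \<partial>\<pi>) = (\<integral>z. \<bar>h z * (T n \<phi> z - ?m)\<bar> \<partial>\<pi>)" by simp
    also have "\<dots> \<le> (\<integral>z. ?W z * ?r n \<partial>\<pi>)"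
      using i[of n] iW pi_space b by (intro integral_mono) auto
    also have "\<dots> = (\<integral>z. ?W z \<partial>\<pi>) * ?r n" by simp
    finally show "norm (\<integral>z. norm (h z * (T n \<phi> z - ?m)) \<partial>\<pi>) \<le> (\<integral>z. ?W z \<partial>\<pi>) * ?r n" .
  qed
  have as: "summable (\<lambda>n. norm (h z * (T n \<phi> z - ?m)))" if "z \<in> space M" for z
    using summable_mult[OF poisson_summable[OF \<phi> s c A that], of "\<bar>h z\<bar>"] by (simp add: abs_mult)
  have "h z * poisson \<phi> z = (\<Sum>n. h z * (T n \<phi> z - ?m))" if "z \<in> space M" for z
    unfolding poisson_def using summable_rabs_cancel[OF poisson_summable[OF \<phi> s c A that]] by (rule suminf_mult[symmetric])
  then have "(\<integral>z. h z * poisson \<phi> z \<partial>\<pi>) = (\<integral>z. (\<Sum>n. h z * (T n \<phi> z - ?m)) \<partial>\<pi>)"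
    using pi_space by (intro Bochner_Integration.integral_cong) auto
  also have "\<dots> = (\<Sum>n. \<integral>z. h z * (T n \<phi> z - ?m) \<partial>\<pi>)"
    using i sm as pi_space by (intro integral_suminf AE_I2) auto
  finally show "(\<integral>z. h z * poisson \<phi> z \<partial>\<pi>) = (\<Sum>n. \<integral>z. h z * (T n \<phi> z - ?m) \<partial>\<pi>)" .
  show "summable (\<lambda>n. \<integral>z. h z * (T n \<phi> z - ?m) \<partial>\<pi>)"
    by (rule summable_comparison_test'[OF sm]) (rule integral_norm_bound)
qed

end

section \<open>Path measures\<close>

text \<open>The path frozen at time l. The equation
  \<open>F (stop_path l \<omega>) = F \<omega>\<close> says that F depends on the coordinates up to
  l only, which expresses adaptedness without a filtration.\<close>

definition stop_path :: "nat \<Rightarrow> (nat \<Rightarrow> 'a) \<Rightarrow> nat \<Rightarrow> 'a" where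
  "stop_path l \<omega> = (\<lambda>i. \<omega> (min i l))"

lemma stop_path_apply: "stop_path l \<omega> i = \<omega> (min i l)"
  by (simp add: stop_path_def)

lemma stop_path_stop_path [simp]: "stop_path l (stop_path k \<omega>) = stop_path (min l k) \<omega>"
  by (simp add: stop_path_def min.assoc)

lemma stop_path_measurable [measurable]: "stop_path l \<in> (\<Pi>\<^sub>M i\<in>UNIV. M) \<rightarrow>\<^sub>M (\<Pi>\<^sub>M i\<in>UNIV. M)"
  unfolding stop_path_def[abs_def] by (intro measurable_abs_UNIV measurable_component_singleton) auto

lemma stop_path_measurable_restrict [measurable]:
  "l < n \<Longrightarrow> stop_path l \<in> (\<Pi>\<^sub>M i\<in>{0..<n}. M) \<rightarrow>\<^sub>M (\<Pi>\<^sub>M i\<in>UNIV. M)"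
  unfolding stop_path_def[abs_def] by (intro measurable_abs_UNIV measurable_component_singleton) auto

lemma space_path_component: "\<omega> \<in> space (\<Pi>\<^sub>M i\<in>UNIV. M) \<Longrightarrow> \<omega> l \<in> space M"
  by (auto simp: space_PiM PiE_iff)

context markov_kernel
begin

context
  fixes \<xi> :: "'a measure"
  assumes \<xi>: "\<xi> \<in> space (prob_algebra M)"
begin

lemma sets_path [simp]: "sets (markov_law M Q \<xi>) = sets (\<Pi>\<^sub>M i\<in>UNIV. M)"
  by (rule sets_markov_law[OF Q \<xi>])

lemma space_path [simp]: "space (markov_law M Q \<xi>) = space (\<Pi>\<^sub>M i\<in>UNIV. M)"
  by (rule sets_eq_imp_space_eq[OF sets_path])

lemma measurable_path [simp]: "measurable (markov_law M Q \<xi>) N = measurable (\<Pi>\<^sub>M i\<in>UNIV. M) N"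
  by (rule measurable_cong_sets) auto

interpretation IT: Ionescu_Tulcea "markov_step Q \<xi>" "\<lambda>_. M"
  using Q \<xi> by (rule Ionescu_Tulcea_markov_step)

text \<open>The path law is a projective limit; on finitely many coordinates it is an iterated
  kernel, and the Markov property is read off there.\<close>

lemma nn_integral_path_restrict:
  assumes F: "F \<in> borel_measurable (\<Pi>\<^sub>M i\<in>{0..<n}. M)"
  shows "(\<integral>\<^sup>+\<omega>. F (restrict \<omega> {0..<n}) \<partial>markov_law M Q \<xi>) = (\<integral>\<^sup>+x. F x \<partial>IT.C 0 n (\<lambda>_. undefined))"
proof -
  let ?P = "markov_law M Q \<xi>"
  have r: "(\<lambda>\<omega>. restrict \<omega> {0..<n}) \<in> ?P \<rightarrow>\<^sub>M (\<Pi>\<^sub>M i\<in>{0..<n}. M)"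
    by (simp add: measurable_restrict_subset)
  \<comment> \<open>The constant \<open>undefined\<close> is the only element of the product over
    the empty index set, that is, the empty past from which the iterated kernel starts.\<close>
  have u: "(\<lambda>_. undefined) \<in> space (\<Pi>\<^sub>M i\<in>{0..<0::nat}. M)" by (simp add: space_PiM)
  have "distr ?P (\<Pi>\<^sub>M i\<in>{0..<n}. M) (\<lambda>\<omega>. restrict \<omega> {0..<n}) = IT.C 0 n (\<lambda>_. undefined)"
  proof (rule measure_eqI)
    show "sets (distr ?P (\<Pi>\<^sub>M i\<in>{0..<n}. M) (\<lambda>\<omega>. restrict \<omega> {0..<n})) = sets (IT.C 0 n (\<lambda>_. undefined))"
      using IT.sets_C[OF u, of n] by simp
    fix X assume "X \<in> sets (distr ?P (\<Pi>\<^sub>M i\<in>{0..<n}. M) (\<lambda>\<omega>. restrict \<omega> {0..<n}))"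
    then have X: "X \<in> sets (\<Pi>\<^sub>M i\<in>{0..<n}. M)" by simp
    have "emeasure (distr ?P (\<Pi>\<^sub>M i\<in>{0..<n}. M) (\<lambda>\<omega>. restrict \<omega> {0..<n})) X
        = emeasure ?P (prod_emb UNIV (\<lambda>_. M) {0..<n} X)"
      using r X by (subst emeasure_distr) (auto simp: prod_emb_def space_PiM)
    also have "\<dots> = emeasure (IT.CI {0..<n}) X"
      by (rule emeasure_markov_law_cylinder[OF Q \<xi> _ X]) simp
    also have "\<dots> = emeasure (IT.C 0 n (\<lambda>_. undefined)) (prod_emb {0..<n} (\<lambda>_. M) {0..<n} X)"
      by (rule IT.emeasure_CI[OF _ X]) simp
    also have "prod_emb {0..<n} (\<lambda>_. M) {0..<n} X = X"
      using sets.sets_into_space[OF X] by (intro prod_emb_id) (auto simp: space_PiM)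
    finally show "emeasure (distr ?P (\<Pi>\<^sub>M i\<in>{0..<n}. M) (\<lambda>\<omega>. restrict \<omega> {0..<n})) X = emeasure (IT.C 0 n (\<lambda>_. undefined)) X" .
  qed
  then show ?thesis
    using nn_integral_distr[OF r, of F] F IT.sets_C[OF u, of n] by (auto cong: measurable_cong_sets)
qed

lemma nn_integral_path_step:
  assumes H [measurable]: "H \<in> borel_measurable ((\<Pi>\<^sub>M i\<in>UNIV. M) \<Otimes>\<^sub>M M)"
  shows "(\<integral>\<^sup>+\<omega>. H (stop_path l \<omega>, \<omega> (Suc l)) \<partial>markov_law M Q \<xi>)
    = (\<integral>\<^sup>+\<omega>. \<integral>\<^sup>+y. H (stop_path l \<omega>, y) \<partial>Q (\<omega> l) \<partial>markov_law M Q \<xi>)"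
proof -
  let ?P = "markov_law M Q \<xi>" and ?u = "\<lambda>_::nat. undefined :: 'a"
  let ?F = "\<lambda>x. H (stop_path l x, x (Suc l))"
  let ?G = "\<lambda>x. \<integral>\<^sup>+y. H (stop_path l x, y) \<partial>Q (x l)"
  have u: "?u \<in> space (\<Pi>\<^sub>M i\<in>{0..<0::nat}. M)" by (simp add: space_PiM)
  have [measurable]: "(\<lambda>x. x l) \<in> (\<Pi>\<^sub>M i\<in>{0..<Suc l}. M) \<rightarrow>\<^sub>M M" "(\<lambda>x. x (Suc l)) \<in> (\<Pi>\<^sub>M i\<in>{0..<Suc (Suc l)}. M) \<rightarrow>\<^sub>M M"
    by (auto intro!: measurable_component_singleton)
  have F: "?F \<in> borel_measurable (\<Pi>\<^sub>M i\<in>{0..<Suc (Suc l)}. M)" by measurable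
  have Qm: "(\<lambda>x. Q (x l)) \<in> (\<Pi>\<^sub>M i\<in>{0..<Suc l}. M) \<rightarrow>\<^sub>M subprob_algebra M" by measurable
  have G: "?G \<in> borel_measurable (\<Pi>\<^sub>M i\<in>{0..<Suc l}. M)"
  proof (rule nn_integral_measurable_subprob_algebra2[OF _ Qm])
    have [measurable]: "stop_path l \<in> (\<Pi>\<^sub>M i\<in>{0..<Suc l}. M) \<rightarrow>\<^sub>M (\<Pi>\<^sub>M i\<in>UNIV. M)"
      by (rule stop_path_measurable_restrict) simp
    have "(\<lambda>p. H (stop_path l (fst p), snd p)) \<in> borel_measurable ((\<Pi>\<^sub>M i\<in>{0..<Suc l}. M) \<Otimes>\<^sub>M M)"
      by measurable
    then show "(\<lambda>(x, y). H (stop_path l x, y)) \<in> borel_measurable ((\<Pi>\<^sub>M i\<in>{0..<Suc l}. M) \<Otimes>\<^sub>M M)"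
      by (simp add: split_beta')
  qed
  have s1: "stop_path l (restrict \<omega> {0..<Suc k}) = stop_path l \<omega>" if "l \<le> k" for k and \<omega> :: "nat \<Rightarrow> 'a"
    using that by (auto simp: stop_path_def fun_eq_iff min_def)
  have "(\<integral>\<^sup>+\<omega>. ?F \<omega> \<partial>?P) = (\<integral>\<^sup>+\<omega>. ?F (restrict \<omega> {0..<Suc (Suc l)}) \<partial>?P)"
    by (simp add: s1 del: restrict_apply) (simp add: restrict_def)
  also have "\<dots> = (\<integral>\<^sup>+x. ?F x \<partial>IT.C 0 (Suc (Suc l)) ?u)"
    by (rule nn_integral_path_restrict[OF F])
  also have "\<dots> = (\<integral>\<^sup>+x. \<integral>\<^sup>+x'. ?F x' \<partial>IT.eP (Suc l) x \<partial>IT.C 0 (Suc l) ?u)"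
    using F IT.sets_C[OF u, of "Suc l"] IT.measurable_eP[of "Suc l"] unfolding IT.C.simps(2)[of 0 "Suc l"]
    by (subst nn_integral_bind[where B="\<Pi>\<^sub>M i\<in>{0..<Suc (Suc l)}. M"]) (auto cong: measurable_cong_sets simp del: IT.C.simps)
  also have "\<dots> = (\<integral>\<^sup>+x. ?G x \<partial>IT.C 0 (Suc l) ?u)"
  proof (rule nn_integral_cong)
    fix x assume "x \<in> space (IT.C 0 (Suc l) ?u)"
    then have x: "x \<in> space (\<Pi>\<^sub>M i\<in>{0..<Suc l}. M)" using IT.space_C[OF u, of "Suc l"] by simp
    have "stop_path l (x(Suc l := y)) = stop_path l x" for y by (auto simp: stop_path_def fun_eq_iff min_def)
    then show "(\<integral>\<^sup>+x'. ?F x' \<partial>IT.eP (Suc l) x) = ?G x"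
      unfolding IT.nn_integral_eP[OF x F] by (simp add: markov_step_def)
  qed
  also have "\<dots> = (\<integral>\<^sup>+\<omega>. ?G (restrict \<omega> {0..<Suc l}) \<partial>?P)"
    by (rule nn_integral_path_restrict[OF G, symmetric])
  also have "\<dots> = (\<integral>\<^sup>+\<omega>. ?G \<omega> \<partial>?P)"
    by (simp add: s1 del: restrict_apply) (simp add: restrict_def)
  finally show ?thesis .
qed

lemma nn_integral_path_0:
  assumes [measurable]: "h \<in> borel_measurable M"
  shows "(\<integral>\<^sup>+\<omega>. h (\<omega> 0) \<partial>markov_law M Q \<xi>) = (\<integral>\<^sup>+z. h z \<partial>\<xi>)"
proof -
  let ?u = "\<lambda>_::nat. undefined :: 'a"
  have u: "?u \<in> space (\<Pi>\<^sub>M i\<in>{0..<0::nat}. M)" by (simp add: space_PiM)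
  have F: "(\<lambda>x. h (x 0)) \<in> borel_measurable (\<Pi>\<^sub>M i\<in>{0..<Suc 0}. M)"
    by (intro measurable_compose[OF measurable_component_singleton]) auto
  have "(\<integral>\<^sup>+\<omega>. h (\<omega> 0) \<partial>markov_law M Q \<xi>) = (\<integral>\<^sup>+\<omega>. h (restrict \<omega> {0..<Suc 0} 0) \<partial>markov_law M Q \<xi>)"
    by simp
  also have "\<dots> = (\<integral>\<^sup>+x. h (x 0) \<partial>IT.C 0 (Suc 0) ?u)"
    by (rule nn_integral_path_restrict[OF F])
  also have "IT.C 0 (Suc 0) ?u = IT.eP 0 ?u"
    using u IT.measurable_eP[of 0] by (simp add: bind_return)
  also have "(\<integral>\<^sup>+x. h (x 0) \<partial>IT.eP 0 ?u) = (\<integral>\<^sup>+z. h z \<partial>\<xi>)"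
    by (subst IT.nn_integral_eP[OF u F]) (simp add: markov_step_def)
  finally show ?thesis .
qed

lemma nn_integral_path:
  "h \<in> borel_measurable M \<Longrightarrow> (\<integral>\<^sup>+\<omega>. h (\<omega> l) \<partial>markov_law M Q \<xi>) = (\<integral>\<^sup>+z. \<integral>\<^sup>+y. h y \<partial>kernel_power M Q l z \<partial>\<xi>)"
proof (induction l arbitrary: h)
  case 0
  have s: "space \<xi> = space M" using \<xi> sets_eq_imp_space_eq by (auto simp: space_prob_algebra)
  have "(\<integral>\<^sup>+z. \<integral>\<^sup>+y. h y \<partial>kernel_power M Q 0 z \<partial>\<xi>) = (\<integral>\<^sup>+z. h z \<partial>\<xi>)"
    using s 0 by (intro nn_integral_cong) (simp add: nn_integral_return)
  then show ?case using nn_integral_path_0[OF 0] by simp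
next
  case (Suc l)
  note [measurable] = Suc.prems
  have s: "space \<xi> = space M" using \<xi> sets_eq_imp_space_eq by (auto simp: space_prob_algebra)
  have "(\<integral>\<^sup>+\<omega>. h (\<omega> (Suc l)) \<partial>markov_law M Q \<xi>) = (\<integral>\<^sup>+\<omega>. \<integral>\<^sup>+y. h y \<partial>Q (\<omega> l) \<partial>markov_law M Q \<xi>)"
    using nn_integral_path_step[of "\<lambda>(\<omega>, y). h y" l] by simp
  also have "\<dots> = (\<integral>\<^sup>+z. \<integral>\<^sup>+x. \<integral>\<^sup>+y. h y \<partial>Q x \<partial>kernel_power M Q l z \<partial>\<xi>)"
    by (rule Suc.IH) (rule measurable_compose[OF Q_sub nn_integral_measurable_subprob_algebra[OF Suc.prems]])
  also have "\<dots> = (\<integral>\<^sup>+z. \<integral>\<^sup>+y. h y \<partial>kernel_power M Q (Suc l) z \<partial>\<xi>)"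
    using s by (intro nn_integral_cong nn_integral_Suc(1)[symmetric] Suc.prems) simp
  finally show ?case .
qed

lemma prob_space_path: "prob_space (markov_law M Q \<xi>)"
proof (rule prob_spaceI)
  interpret prob_space \<xi> using \<xi> by (simp add: space_prob_algebra)
  have "(\<integral>\<^sup>+\<omega>. 1 \<partial>markov_law M Q \<xi>) = (\<integral>\<^sup>+z. 1 \<partial>\<xi>)" by (rule nn_integral_path_0) simp
  then show "emeasure (markov_law M Q \<xi>) (space (markov_law M Q \<xi>)) = 1"
    by (simp add: emeasure_space_1)
qed

text \<open>The Markov property for signed integrands. Only the product is assumed integrable on the
  path space, since F by itself is a high power of a martingale and is known to be integrable only
  through such products.\<close>

lemma integral_path_step:
  fixes F :: "(nat \<Rightarrow> 'a) \<Rightarrow> real" and \<phi> :: "'a \<Rightarrow> real"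
  assumes F [measurable]: "F \<in> borel_measurable (\<Pi>\<^sub>M i\<in>UNIV. M)" and stop: "\<And>\<omega>. F (stop_path l \<omega>) = F \<omega>"
    and \<phi> [measurable]: "\<phi> \<in> borel_measurable M"
    and fin: "\<And>z. z \<in> space M \<Longrightarrow> (\<integral>\<^sup>+y. ennreal \<bar>\<phi> y\<bar> \<partial>Q z) < \<infinity>"
    and i: "integrable (markov_law M Q \<xi>) (\<lambda>\<omega>. F \<omega> * \<phi> (\<omega> (Suc l)))"
  shows "integrable (markov_law M Q \<xi>) (\<lambda>\<omega>. F \<omega> * (\<integral>y. \<phi> y \<partial>Q (\<omega> l)))"
    "(\<integral>\<omega>. F \<omega> * \<phi> (\<omega> (Suc l)) \<partial>markov_law M Q \<xi>) = (\<integral>\<omega>. F \<omega> * (\<integral>y. \<phi> y \<partial>Q (\<omega> l)) \<partial>markov_law M Q \<xi>)"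
proof -
  let ?P = "markov_law M Q \<xi>" and ?S = "\<Pi>\<^sub>M i\<in>(UNIV::nat set). M"
  let ?N = "?S \<Otimes>\<^sub>M M"
  \<comment> \<open>K sends a path to the joint law of its frozen part and one further step. Binding
    the path law with K gives the law of past and next state, so the claim becomes an instance of
    \<open>integral_bind_kernel\<close>.\<close>
  define K where "K \<omega> = distr (Q (\<omega> l)) ?N (\<lambda>y. (stop_path l \<omega>, y))" for \<omega>
  define \<Phi> where "\<Phi> = (\<lambda>(\<omega>, y). F \<omega> * \<phi> y)"
  have \<Phi> [measurable]: "\<Phi> \<in> borel_measurable ?N" unfolding \<Phi>_def by measurable
  have K: "K \<in> ?P \<rightarrow>\<^sub>M subprob_algebra ?N"
    unfolding K_def[abs_def] measurable_path by (rule measurable_distr2[where M=M]) measurable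
  have pair: "(\<lambda>y. (stop_path l \<omega>, y)) \<in> Q (\<omega> l) \<rightarrow>\<^sub>M ?N" if "\<omega> \<in> space ?S" for \<omega>
    using Q_space[OF space_path_component[OF that, of l]] measurable_space[OF stop_path_measurable that]
    by (auto cong: measurable_cong_sets)
  have nnK: "(\<integral>\<^sup>+x. h x \<partial>K \<omega>) = (\<integral>\<^sup>+y. h (stop_path l \<omega>, y) \<partial>Q (\<omega> l))" if "\<omega> \<in> space ?S" "h \<in> borel_measurable ?N" for \<omega> h
    unfolding K_def by (rule nn_integral_distr[OF pair[OF that(1)]]) (use that in simp)
  have IK: "(\<integral>x. \<Phi> x \<partial>K \<omega>) = F \<omega> * (\<integral>y. \<phi> y \<partial>Q (\<omega> l))" if "\<omega> \<in> space ?S" for \<omega>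
    unfolding K_def by (subst integral_distr[OF pair[OF that]]) (simp_all add: \<Phi>_def stop)
  have ne: "space ?P \<noteq> {}" using prob_space.not_empty[OF prob_space_path] .
  have bind: "?P \<bind> K = distr ?P ?N (\<lambda>\<omega>. (stop_path l \<omega>, \<omega> (Suc l)))" (is "_ = ?D")
  proof (rule measure_eqI)
    have m: "(\<lambda>\<omega>. (stop_path l \<omega>, \<omega> (Suc l))) \<in> ?P \<rightarrow>\<^sub>M ?N" by simp
    show s: "sets (?P \<bind> K) = sets ?D" using ne sets_kernel[OF K] by (subst sets_bind) auto
    fix A assume "A \<in> sets (?P \<bind> K)"
    then have A: "A \<in> sets ?N" unfolding s by simp
    then have H: "indicator A \<in> borel_measurable ?N" by simp
    have "emeasure ?D A = (\<integral>\<^sup>+x. indicator A x \<partial>?D)" using A by simp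
    also have "\<dots> = (\<integral>\<^sup>+\<omega>. indicator A (stop_path l \<omega>, \<omega> (Suc l)) \<partial>?P)" by (rule nn_integral_distr[OF m]) (use H in simp)
    also have "\<dots> = (\<integral>\<^sup>+\<omega>. \<integral>\<^sup>+y. indicator A (stop_path l \<omega>, y) \<partial>Q (\<omega> l) \<partial>?P)" by (rule nn_integral_path_step[OF H])
    also have "\<dots> = (\<integral>\<^sup>+\<omega>. \<integral>\<^sup>+x. indicator A x \<partial>K \<omega> \<partial>?P)" using H by (intro nn_integral_cong nnK[symmetric]) auto
    also have "\<dots> = (\<integral>\<^sup>+\<omega>. emeasure (K \<omega>) A \<partial>?P)"
      using A sets_kernel[OF K] by (intro nn_integral_cong) auto
    also have "\<dots> = emeasure (?P \<bind> K) A" by (rule emeasure_bind[OF ne K A, symmetric])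
    finally show "emeasure (?P \<bind> K) A = emeasure ?D A" by simp
  qed
  have fin1: "(\<integral>\<^sup>+\<omega>. \<integral>\<^sup>+x. ennreal \<bar>\<Phi> x\<bar> \<partial>K \<omega> \<partial>?P) < \<infinity>"
  proof -
    have "(\<integral>\<^sup>+\<omega>. \<integral>\<^sup>+x. ennreal \<bar>\<Phi> x\<bar> \<partial>K \<omega> \<partial>?P) = (\<integral>\<^sup>+\<omega>. \<integral>\<^sup>+y. ennreal \<bar>\<Phi> (stop_path l \<omega>, y)\<bar> \<partial>Q (\<omega> l) \<partial>?P)"
      by (intro nn_integral_cong nnK) auto
    also have "\<dots> = (\<integral>\<^sup>+\<omega>. ennreal \<bar>\<Phi> (stop_path l \<omega>, \<omega> (Suc l))\<bar> \<partial>?P)"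
      by (rule nn_integral_path_step[symmetric]) measurable
    also have "\<dots> < \<infinity>" using i by (simp add: integrable_iff_bounded \<Phi>_def stop)
    finally show ?thesis .
  qed
  have fin2: "(\<integral>\<^sup>+x. ennreal \<bar>\<Phi> x\<bar> \<partial>K \<omega>) < \<infinity>" if "\<omega> \<in> space ?P" for \<omega>
  proof -
    have \<omega>: "\<omega> \<in> space ?S" using that by simp
    have z: "\<omega> l \<in> space M" by (rule space_path_component[OF \<omega>])
    have "(\<integral>\<^sup>+x. ennreal \<bar>\<Phi> x\<bar> \<partial>K \<omega>) = (\<integral>\<^sup>+y. ennreal \<bar>F \<omega>\<bar> * ennreal \<bar>\<phi> y\<bar> \<partial>Q (\<omega> l))"
      using nnK[OF \<omega>, of "\<lambda>x. ennreal \<bar>\<Phi> x\<bar>"] by (simp add: \<Phi>_def stop abs_mult ennreal_mult)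
    also have "\<dots> = ennreal \<bar>F \<omega>\<bar> * (\<integral>\<^sup>+y. ennreal \<bar>\<phi> y\<bar> \<partial>Q (\<omega> l))"
      using Q_space[OF z] by (intro nn_integral_cmult) (auto cong: measurable_cong_sets)
    also have "\<dots> < \<infinity>" using fin[OF z] by (simp add: ennreal_mult_less_top)
    finally show ?thesis .
  qed
  note I = integral_bind_kernel[OF K ne \<Phi> fin1 fin2]
  show "integrable ?P (\<lambda>\<omega>. F \<omega> * (\<integral>y. \<phi> y \<partial>Q (\<omega> l)))"
  proof -
    have "integrable ?P (\<lambda>\<omega>. \<integral>x. \<Phi> x \<partial>K \<omega>) = integrable ?P (\<lambda>\<omega>. F \<omega> * (\<integral>y. \<phi> y \<partial>Q (\<omega> l)))"
      using IK by (intro Bochner_Integration.integrable_cong) auto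
    then show ?thesis using I(2) by simp
  qed
  have "(\<integral>\<omega>. F \<omega> * \<phi> (\<omega> (Suc l)) \<partial>?P) = (\<integral>x. \<Phi> x \<partial>?D)"
    by (subst integral_distr) (auto simp: \<Phi>_def stop)
  also have "\<dots> = (\<integral>\<omega>. \<integral>x. \<Phi> x \<partial>K \<omega> \<partial>?P)" using I(3) unfolding bind .
  also have "\<dots> = (\<integral>\<omega>. F \<omega> * (\<integral>y. \<phi> y \<partial>Q (\<omega> l)) \<partial>?P)"
    by (intro Bochner_Integration.integral_cong refl IK) simp
  finally show "(\<integral>\<omega>. F \<omega> * \<phi> (\<omega> (Suc l)) \<partial>?P) = (\<integral>\<omega>. F \<omega> * (\<integral>y. \<phi> y \<partial>Q (\<omega> l)) \<partial>?P)" .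
qed

end

end

section \<open>Moments of perturbed sums\<close>

text \<open>The tail of a binomial sum is again dominated by a binomial sum: n choose (j + k) is at
  most (n choose k) times ((n - k) choose j), and n choose k is at most n^k.\<close>

lemma binomial_remainder_le:
  fixes x d :: real
  assumes k: "k \<le> n"
  shows "\<bar>(x + d) ^ n - (\<Sum>i<k. of_nat (n choose i) * d ^ i * x ^ (n - i))\<bar> \<le> real n ^ k * \<bar>d\<bar> ^ k * (\<bar>x\<bar> + \<bar>d\<bar>) ^ (n - k)"
proof -
  let ?t = "\<lambda>i. of_nat (n choose i) * d ^ i * x ^ (n - i)"
  have "(x + d) ^ n = (\<Sum>i\<le>n. ?t i)"
    by (subst add.commute) (rule binomial_ring)
  also have "\<dots> = (\<Sum>i<k. ?t i) + (\<Sum>i=k..n. ?t i)"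
    using k by (subst sum.union_disjoint[symmetric]) (auto intro!: sum.cong)
  finally have "\<bar>(x + d) ^ n - (\<Sum>i<k. ?t i)\<bar> = \<bar>\<Sum>i=k..n. ?t i\<bar>" by simp
  also have "\<dots> \<le> (\<Sum>i=k..n. \<bar>?t i\<bar>)" by (rule sum_abs)
  also have "\<dots> = (\<Sum>j=0..n - k. \<bar>?t (j + k)\<bar>)"
    using sum.shift_bounds_cl_nat_ivl[of "\<lambda>i. \<bar>?t i\<bar>" 0 k "n - k"] k by simp
  also have "\<dots> \<le> (\<Sum>j=0..n - k. real n ^ k * \<bar>d\<bar> ^ k * (of_nat ((n - k) choose j) * \<bar>d\<bar> ^ j * \<bar>x\<bar> ^ (n - k - j)))"
  proof (rule sum_mono)
    fix j assume j: "j \<in> {0..n - k}"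
    have "n choose (j + k) \<le> (n choose (j + k)) * ((j + k) choose k)"
      by (simp add: Suc_le_eq)
    also have "\<dots> = (n choose k) * ((n - k) choose j)"
      using choose_mult[of k "j + k" n] j k by simp
    also have "\<dots> \<le> n ^ k * ((n - k) choose j)"
      using binomial_le_pow[OF k] by simp
    finally have c: "real (n choose (j + k)) \<le> real n ^ k * real ((n - k) choose j)"
      by (metis of_nat_le_iff of_nat_mult of_nat_power)
    have "\<bar>?t (j + k)\<bar> = real (n choose (j + k)) * (\<bar>d\<bar> ^ (j + k) * \<bar>x\<bar> ^ (n - (j + k)))"
      by (simp add: abs_mult power_abs)
    also have "\<dots> \<le> (real n ^ k * real ((n - k) choose j)) * (\<bar>d\<bar> ^ (j + k) * \<bar>x\<bar> ^ (n - (j + k)))"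
      using c by (intro mult_right_mono) auto
    finally show "\<bar>?t (j + k)\<bar> \<le> real n ^ k * \<bar>d\<bar> ^ k * (of_nat ((n - k) choose j) * \<bar>d\<bar> ^ j * \<bar>x\<bar> ^ (n - k - j))"
      by (simp add: power_add mult_ac add.commute)
  qed
  also have "\<dots> = real n ^ k * \<bar>d\<bar> ^ k * (\<bar>d\<bar> + \<bar>x\<bar>) ^ (n - k)"
    unfolding binomial_ring[of "\<bar>d\<bar>" "\<bar>x\<bar>"] by (simp add: sum_distrib_left atLeast0AtMost)
  finally show ?thesis by (simp add: add.commute)
qed

lemma real_choose_two: "real (n choose 2) = real n * (real n - 1) / 2"
  by (induction n) (auto simp: numeral_2_eq_2 field_simps)

text \<open>The constant 3 in front of the variance proxy leaves room to absorb the cubic term and the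
  cross term \<open>\<psi> d x^(P - 3)\<close> by the inequality \<open>2 a b \<le> a\<^sup>2 + b\<^sup>2\<close>.\<close>

lemma even_power_perturbation:
  fixes x d \<psi> G :: real
  assumes ev: "even m" and d: "\<bar>d\<bar> \<le> G" and \<psi>: "\<bar>\<psi>\<bar> \<le> G\<^sup>2"
  defines "p \<equiv> real (m + 4)"
  defines "c \<equiv> p * (p - 1) / 2"
  shows "(x + d) ^ (m + 4) + 3 * c * \<psi> * (x + d) ^ (m + 2)
    \<le> x ^ (m + 4) + p * (d * x ^ (m + 3)) + 3 * c * ((d\<^sup>2 + \<psi>) * x ^ (m + 2)) + 5 * p ^ 4 * (G ^ 4 * (\<bar>x\<bar> + G) ^ m)"
proof -
  define Y where "Y = \<bar>x\<bar> + G"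
  have G: "0 \<le> G" using d by linarith
  have p: "p \<ge> 4" by (simp add: p_def)
  \<comment> \<open>For p \<ge> 4 the term p / 2 in c = p^2 / 2 - p / 2 is at most p^2 / 8. The
    resulting 3/8 is exactly what the square in \<open>D\<close> requires.\<close>
  have c_lo: "3 / 8 * p\<^sup>2 \<le> c" and c_hi: "c \<le> p\<^sup>2 / 2"
  proof -
    have "p * 4 \<le> p * p" using p by (intro mult_left_mono) auto
    then show "3 / 8 * p\<^sup>2 \<le> c" by (simp add: c_def power2_eq_square field_simps)
    show "c \<le> p\<^sup>2 / 2" using p by (simp add: c_def power2_eq_square field_simps)
  qed
  have c0: "0 \<le> c" using c_lo zero_le_power2[of p] by linarith
  have xm: "0 \<le> x ^ m" using ev by (rule zero_le_even_power)
  have xY: "x ^ m \<le> Y ^ m"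
  proof -
    have "x ^ m = \<bar>x\<bar> ^ m" using ev by (simp add: power_even_abs)
    also have "\<dots> \<le> Y ^ m" using G by (intro power_mono) (auto simp: Y_def)
    finally show ?thesis .
  qed
  have dY: "(\<bar>x\<bar> + \<bar>d\<bar>) ^ m \<le> Y ^ m" using d by (intro power_mono) (auto simp: Y_def)
  have d2: "d\<^sup>2 \<le> G\<^sup>2" using d G by (metis abs_le_square_iff abs_of_nonneg)
  have d4: "d ^ 4 \<le> G ^ 4"
    using power_mono[OF d2, of 2] by simp
  have c2: "real ((m + 4) choose 2) = c"
    unfolding real_choose_two c_def p_def by simp
  have c3: "real ((m + 4) choose 3) \<le> p ^ 3 / 6"
  proof -
    have "real (((m + 4) choose 3) * fact 3) \<le> real ((m + 4) ^ 3)"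
      by (intro of_nat_mono binomial_fact_pow)
    moreover have "real (fact 3) = 6" by (simp add: fact_numeral)
    ultimately show ?thesis by (simp only: p_def of_nat_mult of_nat_power)
  qed
  have A: "(x + d) ^ (m + 4) \<le> x ^ (m + 4) + p * (d * x ^ (m + 3)) + c * (d\<^sup>2 * x ^ (m + 2)) + real ((m + 4) choose 3) * (d ^ 3 * x ^ (m + 1)) + p ^ 4 * (G ^ 4 * Y ^ m)"
  proof -
    have s4: "(\<Sum>i<4. t i) = t 0 + t 1 + t 2 + t 3" for t :: "nat \<Rightarrow> real"
      by (simp add: eval_nat_numeral)
    have e: "m + 4 - 0 = m + 4" "m + 4 - 1 = m + 3" "m + 4 - 2 = m + 2" "m + 4 - 3 = m + 1" "m + 4 - 4 = m" by auto
    have "\<bar>(x + d) ^ (m + 4) - (x ^ (m + 4) + p * (d * x ^ (m + 3)) + c * (d\<^sup>2 * x ^ (m + 2)) + real ((m + 4) choose 3) * (d ^ 3 * x ^ (m + 1)))\<bar>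
       \<le> p ^ 4 * (\<bar>d\<bar> ^ 4 * (\<bar>x\<bar> + \<bar>d\<bar>) ^ m)"
      using binomial_remainder_le[of 4 "m + 4" x d] unfolding s4 e c2
      by (simp only: p_def binomial_n_0 choose_one of_nat_1 power_0 power_one_right mult_1_left mult.assoc)
    then have "(x + d) ^ (m + 4) - (x ^ (m + 4) + p * (d * x ^ (m + 3)) + c * (d\<^sup>2 * x ^ (m + 2)) + real ((m + 4) choose 3) * (d ^ 3 * x ^ (m + 1)))
       \<le> p ^ 4 * (\<bar>d\<bar> ^ 4 * (\<bar>x\<bar> + \<bar>d\<bar>) ^ m)" by linarith
    also have "\<dots> \<le> p ^ 4 * (G ^ 4 * Y ^ m)"
      using d4 dY p by (intro mult_left_mono mult_mono) (auto simp: power_even_abs)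
    finally show ?thesis by linarith
  qed
  \<comment> \<open>The cubic term has no sign. It is traded for one more quadratic term and a
    fourth-order remainder.\<close>
  have B: "real ((m + 4) choose 3) * (d ^ 3 * x ^ (m + 1)) \<le> c * (d\<^sup>2 * x ^ (m + 2)) + p ^ 4 * (G ^ 4 * Y ^ m)"
  proof -
    have "d ^ 3 * x ^ (m + 1) \<le> \<bar>d\<bar> ^ 3 * \<bar>x\<bar> * x ^ m"
    proof -
      have "d ^ 3 * x \<le> \<bar>d\<bar> ^ 3 * \<bar>x\<bar>" by (metis abs_ge_self abs_mult power_abs)
      from mult_right_mono[OF this xm] show ?thesis by (simp add: mult_ac)
    qed
    then have "real ((m + 4) choose 3) * (d ^ 3 * x ^ (m + 1)) \<le> real ((m + 4) choose 3) * (\<bar>d\<bar> ^ 3 * \<bar>x\<bar> * x ^ m)"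
      by (intro mult_left_mono) auto
    also have "\<dots> \<le> p ^ 3 / 6 * (\<bar>d\<bar> ^ 3 * \<bar>x\<bar> * x ^ m)"
      using c3 xm by (intro mult_right_mono) auto
    also have "\<dots> = (2 * (p * \<bar>d\<bar> * \<bar>x\<bar>) * (p\<^sup>2 * \<bar>d\<bar>\<^sup>2)) / 12 * x ^ m"
      by (simp add: power2_eq_square power3_eq_cube)
    also have "\<dots> \<le> ((p * \<bar>d\<bar> * \<bar>x\<bar>)\<^sup>2 + (p\<^sup>2 * \<bar>d\<bar>\<^sup>2)\<^sup>2) / 12 * x ^ m"
      using xm sum_squares_bound[of "p * \<bar>d\<bar> * \<bar>x\<bar>" "p\<^sup>2 * \<bar>d\<bar>\<^sup>2"]
      by (intro mult_right_mono divide_right_mono) auto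
    also have "\<dots> = p\<^sup>2 / 12 * (d\<^sup>2 * x\<^sup>2 * x ^ m) + p ^ 4 / 12 * (d ^ 4 * x ^ m)"
      by (simp add: power_mult_distrib field_simps)
    also have "\<dots> \<le> c * (d\<^sup>2 * x\<^sup>2 * x ^ m) + p ^ 4 * (G ^ 4 * Y ^ m)"
    proof (intro add_mono mult_mono)
      show "p\<^sup>2 / 12 \<le> c" using c_lo zero_le_power2[of p] by linarith
    qed (use xm xY d4 c_lo zero_le_power2[of p] p in \<open>auto simp: order_trans[OF _ c_lo]\<close>)
    finally show ?thesis by (simp add: power_add mult_ac power2_eq_square)
  qed
  have C: "3 * c * \<psi> * (x + d) ^ (m + 2) \<le> 3 * c * (\<psi> * x ^ (m + 2)) + 3 * c * \<psi> * (real (m + 2) * (d * x ^ (m + 1))) + 3 / 2 * p ^ 4 * (G ^ 4 * Y ^ m)"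
  proof -
    have "\<bar>(x + d) ^ (m + 2) - x ^ (m + 2) - real (m + 2) * (d * x ^ (m + 1))\<bar> \<le> real (m + 2) ^ 2 * (d\<^sup>2 * (\<bar>x\<bar> + \<bar>d\<bar>) ^ m)"
    proof -
      have s2: "(\<Sum>i<2. t i) = t 0 + t 1" for t :: "nat \<Rightarrow> real"
        by (simp add: eval_nat_numeral)
      have e: "m + 2 - 0 = m + 2" "m + 2 - 1 = m + 1" "m + 2 - 2 = m" by auto
      show ?thesis using binomial_remainder_le[of 2 "m + 2" x d] unfolding s2 e
        by (simp add: algebra_simps)
    qed
    also have "\<dots> \<le> p ^ 2 * (G\<^sup>2 * Y ^ m)"
    proof -
      have "(real (m + 2))\<^sup>2 \<le> p\<^sup>2" by (intro power_mono) (auto simp: p_def)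
      then show ?thesis using dY d2 by (intro mult_mono) auto
    qed
    finally have 1: "\<bar>(x + d) ^ (m + 2) - x ^ (m + 2) - real (m + 2) * (d * x ^ (m + 1))\<bar> \<le> p ^ 2 * (G\<^sup>2 * Y ^ m)" (is "\<bar>?R\<bar> \<le> _") .
    have "3 * c * (\<psi> * ?R) \<le> 3 * c * (G\<^sup>2 * (p ^ 2 * (G\<^sup>2 * Y ^ m)))"
    proof (intro mult_left_mono)
      have "\<psi> * ?R \<le> \<bar>\<psi>\<bar> * \<bar>?R\<bar>" by (metis abs_ge_self abs_mult)
      also have "\<dots> \<le> G\<^sup>2 * (p ^ 2 * (G\<^sup>2 * Y ^ m))" using 1 \<psi> by (intro mult_mono) auto
      finally show "\<psi> * ?R \<le> G\<^sup>2 * (p ^ 2 * (G\<^sup>2 * Y ^ m))" .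
    qed (use c_lo zero_le_power2[of p] in linarith)
    also have "\<dots> \<le> 3 * (p\<^sup>2 / 2) * (G\<^sup>2 * (p ^ 2 * (G\<^sup>2 * Y ^ m)))"
      using c_hi G by (intro mult_right_mono) (auto simp: Y_def)
    also have "\<dots> = 3 / 2 * p ^ 4 * (G ^ 4 * Y ^ m)" by (simp add: eval_nat_numeral)
    finally show ?thesis by (simp add: algebra_simps)
  qed
  have D: "3 * c * \<psi> * (real (m + 2) * (d * x ^ (m + 1))) \<le> c * (d\<^sup>2 * x ^ (m + 2)) + 3 / 2 * p ^ 4 * (G ^ 4 * Y ^ m)"
  proof -
    have "3 * c * \<psi> * (real (m + 2) * (d * x ^ (m + 1))) = 3 * c * (real (m + 2) * (\<psi> * d * x * x ^ m))" by simp
    also have "\<dots> \<le> 3 * c * (real (m + 2) * (G\<^sup>2 * \<bar>d\<bar> * \<bar>x\<bar> * x ^ m))"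
    proof (intro mult_left_mono mult_right_mono)
      have "\<psi> * d * x \<le> \<bar>\<psi>\<bar> * \<bar>d\<bar> * \<bar>x\<bar>" by (metis abs_ge_self abs_mult)
      also have "\<dots> \<le> G\<^sup>2 * \<bar>d\<bar> * \<bar>x\<bar>" using \<psi> by (intro mult_right_mono) auto
      finally show "\<psi> * d * x \<le> G\<^sup>2 * \<bar>d\<bar> * \<bar>x\<bar>" .
    qed (use xm c0 in auto)
    also have "\<dots> \<le> 3 * (p\<^sup>2 / 2) * (p * (G\<^sup>2 * \<bar>d\<bar> * \<bar>x\<bar> * x ^ m))"
      using c_hi c0 xm by (intro mult_mono mult_nonneg_nonneg) (auto simp: p_def)
    \<comment> \<open>The extra factor 2 in the second product is chosen so that the first square
      receives the coefficient 3/8 p^2, which \<open>c_lo\<close> puts below c.\<close>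
    also have "\<dots> = 3 / 8 * (2 * (p * \<bar>d\<bar> * \<bar>x\<bar>) * (2 * p\<^sup>2 * G\<^sup>2)) * x ^ m"
      by (simp add: power2_eq_square)
    also have "\<dots> \<le> 3 / 8 * ((p * \<bar>d\<bar> * \<bar>x\<bar>)\<^sup>2 + (2 * p\<^sup>2 * G\<^sup>2)\<^sup>2) * x ^ m"
      using xm sum_squares_bound[of "p * \<bar>d\<bar> * \<bar>x\<bar>" "2 * p\<^sup>2 * G\<^sup>2"]
      by (intro mult_right_mono mult_left_mono) auto
    also have "\<dots> = 3 / 8 * p\<^sup>2 * (d\<^sup>2 * x\<^sup>2 * x ^ m) + 3 / 2 * p ^ 4 * (G ^ 4 * x ^ m)"
      by (simp add: power_mult_distrib field_simps)
    also have "\<dots> \<le> c * (d\<^sup>2 * x\<^sup>2 * x ^ m) + 3 / 2 * p ^ 4 * (G ^ 4 * Y ^ m)"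
      using c_lo xY xm G by (intro add_mono mult_mono mult_left_mono) (auto simp: order_trans[OF _ c_lo])
    finally show ?thesis by (simp add: power_add mult_ac power2_eq_square)
  qed
  \<comment> \<open>\<open>A\<close>, \<open>B\<close> and \<open>D\<close> each contribute c to d^2
    x^(m + 2), which makes 3 c; the four remainders add up to 1 + 1 + 3/2 + 3/2 = 5.\<close>
  show ?thesis using A B C D unfolding Y_def[symmetric] by (simp add: distrib_left distrib_right)
qed

text \<open>A crude substitute for Hoelder's inequality: if the moments of order i + j of a and b
  are at most \<alpha>^(i + j) and \<beta>^(i + j), integration gives at most twice \<alpha>^i
  \<beta>^j.\<close>

lemma mult_power_le_sum:
  fixes a b \<alpha> \<beta> :: real
  assumes "0 \<le> a" "0 \<le> b" "0 < \<alpha>" "0 < \<beta>"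
  shows "a ^ i * b ^ j \<le> \<alpha> ^ i * \<beta> ^ j * ((a / \<alpha>) ^ (i + j) + (b / \<beta>) ^ (i + j))"
proof -
  let ?a = "a / \<alpha>" and ?b = "b / \<beta>"
  have "?a ^ i * ?b ^ j \<le> max ?a ?b ^ i * max ?a ?b ^ j"
    using assms by (intro mult_mono power_mono zero_le_power) (auto simp: le_max_iff_disj)
  also have "\<dots> = max ?a ?b ^ (i + j)" by (simp add: power_add)
  also have "\<dots> \<le> ?a ^ (i + j) + ?b ^ (i + j)"
    using assms by (auto simp: max_def)
  finally have "?a ^ i * ?b ^ j \<le> ?a ^ (i + j) + ?b ^ (i + j)" .
  from mult_left_mono[OF this, of "\<alpha> ^ i * \<beta> ^ j"] assms show ?thesis
    by (simp add: power_divide)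
qed

text \<open>Convexity alone would put 2^(n - 1) in front of x^n. Splitting at x = n G keeps that
  coefficient below 3, because (1 + 1/n)^n \<le> e, and leaves the growth in n to the term with
  G.\<close>

lemma power_add_le_3:
  fixes x G :: real
  assumes "0 \<le> x" "0 \<le> G" "1 \<le> n"
  shows "(x + G) ^ n \<le> 3 * x ^ n + (2 * real n * G) ^ n"
proof (cases "real n * G \<le> x")
  case True
  then have "G \<le> x / real n" using assms by (simp add: field_simps)
  then have "(x + G) ^ n \<le> (x + x / real n) ^ n" using assms by (intro power_mono) auto
  also have "\<dots> = x ^ n * (1 + 1 / real n) ^ n" by (simp add: power_mult_distrib[symmetric] algebra_simps)
  also have "\<dots> \<le> x ^ n * 3"
  proof (intro mult_left_mono)
    have "(1 + 1 / real n) ^ n \<le> exp (1 / real n) ^ n" using assms by (intro power_mono exp_ge_add_one_self) auto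
    also have "\<dots> = exp 1" using assms by (simp add: exp_of_nat_mult[symmetric])
    also have "\<dots> \<le> 3" by (rule exp_le)
    finally show "(1 + 1 / real n) ^ n \<le> 3" .
  qed (use assms in auto)
  finally show ?thesis using assms by (simp add: add_increasing2 mult.commute)
next
  case False
  have "G * 1 \<le> G * real n" using assms by (intro mult_left_mono) auto
  with False have "x + G \<le> 2 * real n * G" by (simp add: mult.commute)
  then have "(x + G) ^ n \<le> (2 * real n * G) ^ n" using assms by (intro power_mono) auto
  then show ?thesis using assms by (simp add: add_increasing)
qed

section \<open>The Lyapunov recursion for even moments\<close>

context prob_space
begin

lemma integrable_mult_power:
  fixes X Y :: "'a \<Rightarrow> real"
  assumes [measurable]: "X \<in> borel_measurable M" "Y \<in> borel_measurable M"
    and "integrable M (\<lambda>\<omega>. \<bar>X \<omega>\<bar> ^ n)" "integrable M (\<lambda>\<omega>. \<bar>Y \<omega>\<bar> ^ n)" and n: "i + j = n"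
  shows "integrable M (\<lambda>\<omega>. X \<omega> ^ i * Y \<omega> ^ j)"
proof (rule Bochner_Integration.integrable_bound)
  show "integrable M (\<lambda>\<omega>. \<bar>X \<omega>\<bar> ^ n + \<bar>Y \<omega>\<bar> ^ n)" using assms by simp
  show "AE \<omega> in M. norm (X \<omega> ^ i * Y \<omega> ^ j) \<le> norm (\<bar>X \<omega>\<bar> ^ n + \<bar>Y \<omega>\<bar> ^ n)"
    using mult_power_le_sum[of "\<bar>X _\<bar>" "\<bar>Y _\<bar>" 1 1 i j] unfolding n by (intro AE_I2) (simp add: abs_mult power_abs)
qed measurable

lemma integrable_power_add:
  fixes X Y :: "'a \<Rightarrow> real"
  assumes [measurable]: "X \<in> borel_measurable M" "Y \<in> borel_measurable M"
    and "integrable M (\<lambda>\<omega>. \<bar>X \<omega>\<bar> ^ n)" "integrable M (\<lambda>\<omega>. \<bar>Y \<omega>\<bar> ^ n)" and n: "1 \<le> n"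
  shows "integrable M (\<lambda>\<omega>. (\<bar>X \<omega>\<bar> + \<bar>Y \<omega>\<bar>) ^ n)"
proof (rule Bochner_Integration.integrable_bound)
  show "integrable M (\<lambda>\<omega>. 3 * \<bar>X \<omega>\<bar> ^ n + (2 * real n) ^ n * \<bar>Y \<omega>\<bar> ^ n)" using assms by simp
  show "AE \<omega> in M. norm ((\<bar>X \<omega>\<bar> + \<bar>Y \<omega>\<bar>) ^ n) \<le> norm (3 * \<bar>X \<omega>\<bar> ^ n + (2 * real n) ^ n * \<bar>Y \<omega>\<bar> ^ n)"
    using power_add_le_3[of "\<bar>X _\<bar>" "\<bar>Y _\<bar>" n] n by (intro AE_I2) (simp add: power_mult_distrib)
qed measurable

text \<open>A Rosenthal-type bound by a Lyapunov argument for \<open>E[X^P + 3 c \<psi> X^(P - 2)]\<close>, with \<open>c = P (P - 1) / 2\<close>: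
  the corrector \<open>\<psi>\<close> replaces the conditional variance of the increments by the constant \<open>v\<close>.\<close>

lemma even_moment_bound:
  fixes X \<psi> G :: "nat \<Rightarrow> 'a \<Rightarrow> real" and D v :: real and k m :: nat
  assumes X [measurable]: "\<And>j. X j \<in> borel_measurable M" and \<psi>_meas [measurable]: "\<And>j. \<psi> j \<in> borel_measurable M"
    and G_meas [measurable]: "\<And>j. G j \<in> borel_measurable M"
    and k: "even k" and D: "0 < D" and v: "0 \<le> v" and m: "1 \<le> m"
    and d: "\<And>j \<omega>. \<omega> \<in> space M \<Longrightarrow> \<bar>X (Suc j) \<omega> - X j \<omega>\<bar> \<le> G j \<omega>"
    and \<psi>: "\<And>j \<omega>. \<omega> \<in> space M \<Longrightarrow> \<bar>\<psi> j \<omega>\<bar> \<le> (G j \<omega>)\<^sup>2"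
       "\<And>j \<omega>. \<omega> \<in> space M \<Longrightarrow> \<bar>\<psi> (Suc j) \<omega>\<bar> \<le> (G j \<omega>)\<^sup>2"
    and G: "\<And>j. integrable M (\<lambda>\<omega>. G j \<omega> ^ (k + 4))" "\<And>j. expectation (\<lambda>\<omega>. G j \<omega> ^ (k + 4)) \<le> D ^ (k + 4)"
    and X0: "integrable M (\<lambda>\<omega>. X 0 \<omega> ^ (k + 4))" "expectation (\<lambda>\<omega>. X 0 \<omega> ^ (k + 4)) \<le> D ^ (k + 4)"
    and mart: "\<And>j. integrable M (\<lambda>\<omega>. X j \<omega> ^ (k + 4)) \<Longrightarrow> expectation (\<lambda>\<omega>. (X (Suc j) \<omega> - X j \<omega>) * X j \<omega> ^ (k + 3)) = 0"
    and quad: "\<And>j. integrable M (\<lambda>\<omega>. X j \<omega> ^ (k + 4)) \<Longrightarrow>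
      expectation (\<lambda>\<omega>. ((X (Suc j) \<omega> - X j \<omega>)\<^sup>2 + \<psi> (Suc j) \<omega>) * X j \<omega> ^ (k + 2))
      = expectation (\<lambda>\<omega>. (\<psi> j \<omega> + v) * X j \<omega> ^ (k + 2))"
  defines "p \<equiv> real (k + 4)"
  shows "integrable M (\<lambda>\<omega>. X m \<omega> ^ (k + 4)) \<and>
    expectation (\<lambda>\<omega>. X m \<omega> ^ (k + 4)) \<le> 4 * sqrt (9 * p\<^sup>2 * D\<^sup>2 * sqrt (real m) + 15 * p * v * real m) ^ (k + 4)"
proof -
  define P where "P = k + 4"
  define c where "c = p * (p - 1) / 2"
  \<comment> \<open>The square of the target \<open>K j\<close> at time j. The constant part grows
    like sqrt m with the final horizon, so that K^4 absorbs m fourth-order remainders; the linear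
    part follows the drift v of each step.\<close>
  define A where "A j = 9 * p\<^sup>2 * D\<^sup>2 * sqrt (real m) + 15 * p * v * real j" for j :: nat
  define K where "K j = sqrt (A j)" for j
  define q where "q = P div 2"
  have P2: "P = 2 * q" "even P" "1 \<le> P" "2 \<le> q" using k by (auto simp: P_def q_def)
  have P22: "P = 2 + (k + 2)" by (simp add: P_def)
  have p4: "4 \<le> p" by (simp add: p_def)
  have c_hi: "c \<le> p\<^sup>2 / 2" and c0: "0 \<le> c" using p4 by (simp_all add: c_def power2_eq_square field_simps)
  have sm: "1 \<le> sqrt (real m)" using m by simp
  have A0: "9 * p\<^sup>2 * D\<^sup>2 \<le> A j" for j
  proof -
    have "9 * p\<^sup>2 * D\<^sup>2 * 1 \<le> 9 * p\<^sup>2 * D\<^sup>2 * sqrt (real m)" using sm by (intro mult_left_mono) auto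
    moreover have "0 \<le> 15 * p * v * real j" using p4 v by simp
    ultimately show ?thesis by (simp add: A_def)
  qed
  have pD: "0 < p * D" using p4 D by simp
  have Apos: "0 < A j" for j using A0[of j] pD by (smt (verit) mult_pos_pos zero_less_power2 D p4)
  have K3: "3 * p * D \<le> K j" for j
  proof -
    have "(3 * p * D)\<^sup>2 \<le> A j" using A0[of j] by (simp add: power_mult_distrib)
    then show ?thesis unfolding K_def by (rule real_le_rsqrt)
  qed
  have Kpos: "0 < K j" for j using Apos by (simp add: K_def)
  have KP: "K j ^ (2 * r) = A j ^ r" for j r using Apos[of j] by (simp add: K_def power_mult)
  \<comment> \<open>70 is 5 from \<open>even_power_perturbation\<close> times 14 from
    \<open>r\<close> below, and it fits under 81 = 9^2.\<close>
  have K4: "70 * p ^ 4 * D ^ 4 * real m \<le> K j ^ 4" for j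
  proof -
    have "9 * p\<^sup>2 * D\<^sup>2 * sqrt (real m) \<le> A j" using p4 v by (simp add: A_def)
    then have "(9 * p\<^sup>2 * D\<^sup>2 * sqrt (real m))\<^sup>2 \<le> (A j)\<^sup>2" using D by (intro power_mono) auto
    then have "81 * p ^ 4 * D ^ 4 * real m \<le> K j ^ 4" using KP[of j 2] by (simp add: power_mult_distrib)
    moreover have "70 * (p ^ 4 * D ^ 4 * real m) \<le> 81 * (p ^ 4 * D ^ 4 * real m)" using D p4 by (intro mult_right_mono) auto
    ultimately show ?thesis unfolding mult.assoc by linarith
  qed
  \<comment> \<open>Bernoulli's inequality for the power q = P / 2 of \<open>A\<close>: the
    increment 15 p v raises K^P by at least the variance term of one step. The constant 15 is the 3
    in front of c times the 5 from \<open>x2\<close> below.\<close>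
  have Kstep: "K j ^ P + 15 * c * v * K j ^ (k + 2) \<le> K (Suc j) ^ P" for j
  proof -
    have "A j ^ q + real q * (15 * p * v) * A j ^ (q - 1) \<le> (A j + 15 * p * v) ^ q"
    proof -
      have a: "0 \<le> 15 * p * v" using p4 v by simp
      have "A j ^ q * (1 + real q * (15 * p * v / A j)) \<le> A j ^ q * (1 + 15 * p * v / A j) ^ q"
        using Apos[of j] a by (intro mult_left_mono Bernoulli_inequality) (auto intro: order_trans[of _ 0])
      also have "\<dots> = (A j + 15 * p * v) ^ q"
        using Apos[of j] by (simp add: power_mult_distrib[symmetric] algebra_simps)
      also have "A j ^ q * (1 + real q * (15 * p * v / A j)) = A j ^ q + real q * (15 * p * v) * A j ^ (q - 1)"
        using Apos[of j] P2(4) by (cases q) (auto simp: field_simps)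
      finally show ?thesis .
    qed
    moreover have "15 * c * v * A j ^ (q - 1) \<le> real q * (15 * p * v) * A j ^ (q - 1)"
    proof (intro mult_right_mono)
      have q: "real q = p / 2" using P2(1) by (simp add: P_def p_def)
      have "15 * c * v = 15 * (c * v)" by simp
      also have "\<dots> \<le> 15 * (p\<^sup>2 / 2 * v)" by (intro mult_left_mono mult_right_mono c_hi v) simp
      also have "\<dots> = real q * (15 * p * v)" by (simp add: q power2_eq_square)
      finally show "15 * c * v \<le> real q * (15 * p * v)" .
    qed (use Apos[of j] in auto)
    moreover have "k + 2 = 2 * (q - 1)" using P2 by (simp add: P_def)
    moreover have "A (Suc j) = A j + 15 * p * v" by (simp add: A_def algebra_simps)
    ultimately show ?thesis unfolding P2(1) by (simp add: KP)
  qed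
  have Gn: "0 \<le> G j \<omega>" if "\<omega> \<in> space M" for j \<omega> using d[OF that, of j] by linarith
  have Gabs: "integrable M (\<lambda>\<omega>. \<bar>G j \<omega>\<bar> ^ P)" for j
    using G(1)[of j] P2(2) by (simp add: power_even_abs P_def)
  have iX: "integrable M (\<lambda>\<omega>. X j \<omega> ^ P)" for j
  proof (induction j)
    case 0 then show ?case using X0 by (simp add: P_def)
  next
    case (Suc j)
    have "integrable M (\<lambda>\<omega>. (\<bar>X j \<omega>\<bar> + \<bar>G j \<omega>\<bar>) ^ P)"
      using Suc Gabs[of j] P2 by (intro integrable_power_add) (auto simp: power_even_abs)
    then show ?case
    proof (rule Bochner_Integration.integrable_bound)
      show "AE \<omega> in M. norm (X (Suc j) \<omega> ^ P) \<le> norm ((\<bar>X j \<omega>\<bar> + \<bar>G j \<omega>\<bar>) ^ P)"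
      proof (rule AE_I2)
        fix \<omega> assume "\<omega> \<in> space M"
        from d[OF this, of j] have "\<bar>X (Suc j) \<omega>\<bar> \<le> \<bar>X j \<omega>\<bar> + \<bar>G j \<omega>\<bar>" by linarith
        then show "norm (X (Suc j) \<omega> ^ P) \<le> norm ((\<bar>X j \<omega>\<bar> + \<bar>G j \<omega>\<bar>) ^ P)"
          by (simp add: power_abs power_mono)
      qed
    qed measurable
  qed
  have iXabs: "integrable M (\<lambda>\<omega>. \<bar>X j \<omega>\<bar> ^ P)" for j
    using iX[of j] P2(2) by (simp add: power_even_abs)
  have iY: "integrable M (\<lambda>\<omega>. (\<bar>X j \<omega>\<bar> + G j \<omega>) ^ P)" for j
  proof -
    have "integrable M (\<lambda>\<omega>. (\<bar>X j \<omega>\<bar> + \<bar>G j \<omega>\<bar>) ^ P)"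
      using iXabs Gabs P2 by (intro integrable_power_add) auto
    moreover have "integrable M (\<lambda>\<omega>. (\<bar>X j \<omega>\<bar> + \<bar>G j \<omega>\<bar>) ^ P) = integrable M (\<lambda>\<omega>. (\<bar>X j \<omega>\<bar> + G j \<omega>) ^ P)"
      using Gn by (intro Bochner_Integration.integrable_cong) auto
    ultimately show ?thesis by simp
  qed
  have ib: "integrable M h" if "h \<in> borel_measurable M" "\<And>\<omega>. \<omega> \<in> space M \<Longrightarrow> \<bar>h \<omega>\<bar> \<le> w * (\<bar>X i \<omega>\<bar> + G i \<omega>) ^ P" for h i w
  proof (rule Bochner_Integration.integrable_bound)
    show "integrable M (\<lambda>\<omega>. w * (\<bar>X i \<omega>\<bar> + G i \<omega>) ^ P)" using iY by simp
    show "AE \<omega> in M. norm (h \<omega>) \<le> norm (w * (\<bar>X i \<omega>\<bar> + G i \<omega>) ^ P)"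
      using that(2) by (intro AE_I2) (auto intro: order_trans[OF _ abs_ge_self])
  qed fact
  have iXG: "integrable M (\<lambda>\<omega>. h \<omega> * X j \<omega> ^ i)"
    if [measurable]: "h \<in> borel_measurable M" and h: "\<And>\<omega>. \<omega> \<in> space M \<Longrightarrow> \<bar>h \<omega>\<bar> \<le> G j \<omega> ^ l" and il: "l + i = P" for h j i l
  proof (rule ib[of _ 1 j])
    fix \<omega> assume w: "\<omega> \<in> space M"
    have "\<bar>h \<omega>\<bar> * \<bar>X j \<omega>\<bar> ^ i \<le> (\<bar>X j \<omega>\<bar> + G j \<omega>) ^ l * (\<bar>X j \<omega>\<bar> + G j \<omega>) ^ i"
      using Gn[OF w, of j] h[OF w]
      by (intro mult_mono power_mono order_trans[OF h[OF w]] zero_le_power) auto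
    then show "\<bar>h \<omega> * X j \<omega> ^ i\<bar> \<le> 1 * (\<bar>X j \<omega>\<bar> + G j \<omega>) ^ P"
      by (simp add: abs_mult power_abs il flip: power_add)
  qed measurable
  have d2: "(X (Suc j) \<omega> - X j \<omega>)\<^sup>2 \<le> (G j \<omega>)\<^sup>2" if "\<omega> \<in> space M" for j \<omega>
    using d[OF that, of j] Gn[OF that, of j] by (metis abs_le_square_iff abs_of_nonneg)
  have i1: "integrable M (\<lambda>\<omega>. (X (Suc j) \<omega> - X j \<omega>) * X j \<omega> ^ (k + 3))" for j
    by (rule iXG[of _ _ 1]) (use d in \<open>auto simp: P_def\<close>)
  have i2: "integrable M (\<lambda>\<omega>. (X (Suc j) \<omega> - X j \<omega>)\<^sup>2 * X j \<omega> ^ (k + 2))" for j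
    by (rule iXG[of _ _ 2]) (use d2 in \<open>auto simp: P_def\<close>)
  have i3: "integrable M (\<lambda>\<omega>. \<psi> (Suc j) \<omega> * X j \<omega> ^ (k + 2))" for j
    by (rule iXG[of _ _ 2]) (use \<psi>(2) in \<open>auto simp: P_def\<close>)
  have i4: "integrable M (\<lambda>\<omega>. \<psi> j \<omega> * X j \<omega> ^ (k + 2))" for j
    by (rule iXG[of _ _ 2]) (use \<psi>(1) in \<open>auto simp: P_def\<close>)
  have i5: "integrable M (\<lambda>\<omega>. X j \<omega> ^ (k + 2))" for j
    using integrable_mult_power[of "X j" "\<lambda>_. 1" P "k + 2" 2] iXabs[of j] by (simp add: P_def)
  have i6: "integrable M (\<lambda>\<omega>. G j \<omega> ^ 4 * (\<bar>X j \<omega>\<bar> + G j \<omega>) ^ k)" for j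
    using integrable_mult_power[of "G j" "\<lambda>\<omega>. \<bar>X j \<omega>\<bar> + G j \<omega>" P 4 k] iY[of j] Gabs[of j] P2(2)
    by (simp add: P_def power_even_abs)
  define \<Phi> where "\<Phi> j = expectation (\<lambda>\<omega>. X j \<omega> ^ P) + 3 * c * expectation (\<lambda>\<omega>. \<psi> j \<omega> * X j \<omega> ^ (k + 2))" for j
  have step: "\<Phi> (Suc j) \<le> \<Phi> j + 3 * c * v * expectation (\<lambda>\<omega>. X j \<omega> ^ (k + 2)) + 5 * p ^ 4 * expectation (\<lambda>\<omega>. G j \<omega> ^ 4 * (\<bar>X j \<omega>\<bar> + G j \<omega>) ^ k)" for j
  proof -
    let ?d = "\<lambda>\<omega>. X (Suc j) \<omega> - X j \<omega>"
    have i23: "integrable M (\<lambda>\<omega>. ((?d \<omega>)\<^sup>2 + \<psi> (Suc j) \<omega>) * X j \<omega> ^ (k + 2))"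
      using i2[of j] i3[of j] by (simp add: distrib_right)
    have "\<Phi> (Suc j) = expectation (\<lambda>\<omega>. X (Suc j) \<omega> ^ P + 3 * c * (\<psi> (Suc j) \<omega> * X (Suc j) \<omega> ^ (k + 2)))"
      using iX i4[of "Suc j"] by (simp add: \<Phi>_def)
    also have "\<dots> \<le> expectation (\<lambda>\<omega>. X j \<omega> ^ P + p * (?d \<omega> * X j \<omega> ^ (k + 3)) + 3 * c * (((?d \<omega>)\<^sup>2 + \<psi> (Suc j) \<omega>) * X j \<omega> ^ (k + 2))
        + 5 * p ^ 4 * (G j \<omega> ^ 4 * (\<bar>X j \<omega>\<bar> + G j \<omega>) ^ k))"
    proof (rule integral_mono)
      fix \<omega> assume "\<omega> \<in> space M"
      from even_power_perturbation[OF k d[OF this, of j] \<psi>(2)[OF this, of j], of "X j \<omega>"]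
      show "X (Suc j) \<omega> ^ P + 3 * c * (\<psi> (Suc j) \<omega> * X (Suc j) \<omega> ^ (k + 2)) \<le> X j \<omega> ^ P + p * (?d \<omega> * X j \<omega> ^ (k + 3)) + 3 * c * (((?d \<omega>)\<^sup>2 + \<psi> (Suc j) \<omega>) * X j \<omega> ^ (k + 2))
        + 5 * p ^ 4 * (G j \<omega> ^ 4 * (\<bar>X j \<omega>\<bar> + G j \<omega>) ^ k)"
        by (simp add: P_def c_def p_def mult.assoc)
    qed (use iX i4[of "Suc j"] i1 i23 i6 in simp_all)
    also have "\<dots> = expectation (\<lambda>\<omega>. X j \<omega> ^ P) + p * expectation (\<lambda>\<omega>. ?d \<omega> * X j \<omega> ^ (k + 3))
        + 3 * c * expectation (\<lambda>\<omega>. ((?d \<omega>)\<^sup>2 + \<psi> (Suc j) \<omega>) * X j \<omega> ^ (k + 2))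
        + 5 * p ^ 4 * expectation (\<lambda>\<omega>. G j \<omega> ^ 4 * (\<bar>X j \<omega>\<bar> + G j \<omega>) ^ k)"
      using iX i1 i23 i6 by simp
    also have "expectation (\<lambda>\<omega>. ((?d \<omega>)\<^sup>2 + \<psi> (Suc j) \<omega>) * X j \<omega> ^ (k + 2)) =
        expectation (\<lambda>\<omega>. \<psi> j \<omega> * X j \<omega> ^ (k + 2)) + v * expectation (\<lambda>\<omega>. X j \<omega> ^ (k + 2))"
      using quad[of j] iX[of j] i4[of j] i5[of j] by (simp add: distrib_right P_def)
    also have "expectation (\<lambda>\<omega>. ?d \<omega> * X j \<omega> ^ (k + 3)) = 0" using mart[of j] iX[of j] by (simp add: P_def)
    finally show ?thesis by (simp add: \<Phi>_def algebra_simps)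
  qed
  have KDP: "(3 * p * D) ^ P \<le> K j ^ P" for j using K3 p4 D by (intro power_mono) auto
  have EG: "expectation (\<lambda>\<omega>. G j \<omega> ^ P) \<le> D ^ P" for j using G(2) by (simp add: P_def)
  \<comment> \<open>The cross term in \<Phi> has no sign. It is at most x^P / 4 where x^2 dominates
    12 c G^2, and at most (3 p G)^P elsewhere; hence three quarters of the moment is at most 2 K^P +
    K^P.\<close>
  have u_le: "expectation (\<lambda>\<omega>. X j \<omega> ^ P) \<le> 4 * K j ^ P" if "\<Phi> j \<le> 2 * K j ^ P" for j
  proof -
    have pt: "- (3 * c * (\<psi> j \<omega> * X j \<omega> ^ (k + 2))) \<le> X j \<omega> ^ P / 4 + (3 * p) ^ P * G j \<omega> ^ P" if w: "\<omega> \<in> space M" for \<omega>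
    proof -
      let ?x = "\<bar>X j \<omega>\<bar>" and ?g = "G j \<omega>"
      have g: "0 \<le> ?g" by (rule Gn[OF w])
      have xP: "X j \<omega> ^ P = ?x ^ P" using P2 by (simp add: power_even_abs)
      have "- (3 * c * (\<psi> j \<omega> * X j \<omega> ^ (k + 2))) \<le> 3 * c * (\<bar>\<psi> j \<omega>\<bar> * ?x ^ (k + 2))"
      proof -
        have "- (\<psi> j \<omega> * X j \<omega> ^ (k + 2)) \<le> \<bar>\<psi> j \<omega>\<bar> * ?x ^ (k + 2)"
          by (metis abs_ge_minus_self abs_mult power_abs)
        from mult_left_mono[OF this, of "3 * c"] c0 show ?thesis by simp
      qed
      also have "\<dots> \<le> 3 * c * (?g\<^sup>2 * ?x ^ (k + 2))" using \<psi>(1)[OF w] c0 by (intro mult_left_mono mult_right_mono) auto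
      also have "\<dots> \<le> ?x ^ P / 4 + (3 * p * ?g) ^ P"
      proof (cases "12 * c * ?g\<^sup>2 \<le> ?x\<^sup>2")
        case True
        have "3 * c * (?g\<^sup>2 * ?x ^ (k + 2)) = (12 * c * ?g\<^sup>2) * ?x ^ (k + 2) / 4" by simp
        also have "\<dots> \<le> ?x\<^sup>2 * ?x ^ (k + 2) / 4" using True by (intro divide_right_mono mult_right_mono) auto
        also have "\<dots> = ?x ^ P / 4" unfolding P22 power_add by simp
        also have "\<dots> \<le> ?x ^ P / 4 + (3 * p * ?g) ^ P" using p4 g by simp
        finally show ?thesis .
      next
        case False
        have "12 * c * ?g\<^sup>2 \<le> (3 * p * ?g)\<^sup>2"
        proof -
          have "12 * (c * ?g\<^sup>2) \<le> 12 * (p\<^sup>2 / 2 * ?g\<^sup>2)" using c_hi by (intro mult_left_mono mult_right_mono) auto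
          also have "\<dots> = 6 * (p\<^sup>2 * ?g\<^sup>2)" by simp
          also have "\<dots> \<le> 9 * (p\<^sup>2 * ?g\<^sup>2)" by (intro mult_right_mono) auto
          finally show ?thesis by (simp add: power_mult_distrib)
        qed
        with False have "?x\<^sup>2 \<le> (3 * p * ?g)\<^sup>2" by linarith
        then have x: "?x \<le> 3 * p * ?g" by (rule power2_le_imp_le) (use p4 g in simp)
        have "3 * c * (?g\<^sup>2 * ?x ^ (k + 2)) = (3 * c * ?g\<^sup>2) * ?x ^ (k + 2)" by simp
        also have "\<dots> \<le> (3 * p * ?g)\<^sup>2 * (3 * p * ?g) ^ (k + 2)"
        proof (rule mult_mono)
          have "0 \<le> c * ?g\<^sup>2" using c0 by simp
          then show "3 * c * ?g\<^sup>2 \<le> (3 * p * ?g)\<^sup>2" using \<open>12 * c * ?g\<^sup>2 \<le> (3 * p * ?g)\<^sup>2\<close> by linarith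
          show "?x ^ (k + 2) \<le> (3 * p * ?g) ^ (k + 2)" using x by (intro power_mono) auto
        qed simp_all
        also have "\<dots> = (3 * p * ?g) ^ P" unfolding P22 power_add by simp
        finally show ?thesis by (rule order_trans) simp
      qed
      finally show ?thesis unfolding xP by (simp add: power_mult_distrib)
    qed
    have "expectation (\<lambda>\<omega>. - (3 * c * (\<psi> j \<omega> * X j \<omega> ^ (k + 2)))) \<le> expectation (\<lambda>\<omega>. X j \<omega> ^ P / 4 + (3 * p) ^ P * G j \<omega> ^ P)"
      using i4 iX G(1)[of j] by (intro integral_mono pt) (auto simp: P_def)
    also have "\<dots> = expectation (\<lambda>\<omega>. X j \<omega> ^ P) / 4 + (3 * p) ^ P * expectation (\<lambda>\<omega>. G j \<omega> ^ P)"
      using iX[of j] G(1)[of j] by (simp add: P_def)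
    also have "\<dots> \<le> expectation (\<lambda>\<omega>. X j \<omega> ^ P) / 4 + (3 * p) ^ P * D ^ P"
      using EG p4 by (intro add_left_mono mult_left_mono) auto
    also have "(3 * p) ^ P * D ^ P \<le> K j ^ P" using KDP by (simp add: power_mult_distrib)
    finally have "- (3 * c * expectation (\<lambda>\<omega>. \<psi> j \<omega> * X j \<omega> ^ (k + 2))) \<le> expectation (\<lambda>\<omega>. X j \<omega> ^ P) / 4 + K j ^ P"
      by simp
    then show ?thesis using that unfolding \<Phi>_def by linarith
  qed
  \<comment> \<open>Every step spends K^P / m on the fourth-order remainder. Over m steps the
    prefactor grows from 1 to 2, which is what \<open>u_le\<close> tolerates.\<close>
  have main: "\<Phi> j \<le> (1 + real j / real m) * K j ^ P" if "j \<le> m" for j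
    using that
  proof (induction j)
    case 0
    have "expectation (\<lambda>\<omega>. \<psi> 0 \<omega> * X 0 \<omega> ^ (k + 2)) \<le> expectation (\<lambda>\<omega>. D ^ 2 * D ^ (k + 2) / D ^ P * (G 0 \<omega> ^ P + X 0 \<omega> ^ P))"
    proof (rule integral_mono)
      fix \<omega> assume w: "\<omega> \<in> space M"
      have "\<psi> 0 \<omega> * X 0 \<omega> ^ (k + 2) \<le> \<bar>\<psi> 0 \<omega>\<bar> * \<bar>X 0 \<omega>\<bar> ^ (k + 2)" by (metis abs_ge_self abs_mult power_abs)
      also have "\<dots> \<le> G 0 \<omega> ^ 2 * \<bar>X 0 \<omega>\<bar> ^ (k + 2)" using \<psi>(1)[OF w] by (intro mult_right_mono) auto
      also have "\<dots> \<le> D ^ 2 * D ^ (k + 2) * ((G 0 \<omega> / D) ^ (2 + (k + 2)) + (\<bar>X 0 \<omega>\<bar> / D) ^ (2 + (k + 2)))"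
        using Gn[OF w] D by (intro mult_power_le_sum) auto
      also have "2 + (k + 2) = P" by (simp add: P_def)
      also have "D ^ 2 * D ^ (k + 2) * ((G 0 \<omega> / D) ^ P + (\<bar>X 0 \<omega>\<bar> / D) ^ P) = D ^ 2 * D ^ (k + 2) / D ^ P * (G 0 \<omega> ^ P + X 0 \<omega> ^ P)"
        using P2(2) by (simp add: power_divide power_even_abs add_divide_distrib distrib_left)
      finally show "\<psi> 0 \<omega> * X 0 \<omega> ^ (k + 2) \<le> D ^ 2 * D ^ (k + 2) / D ^ P * (G 0 \<omega> ^ P + X 0 \<omega> ^ P)" .
    qed (use i4 G(1) X0(1) in \<open>auto simp: P_def\<close>)
    also have "D ^ 2 * D ^ (k + 2) / D ^ P = 1" unfolding P22 power_add using D by simp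
    also have "expectation (\<lambda>\<omega>. 1 * (G 0 \<omega> ^ P + X 0 \<omega> ^ P)) \<le> 2 * D ^ P"
      using G[of 0] X0 by (simp add: P_def)
    finally have "3 * c * expectation (\<lambda>\<omega>. \<psi> 0 \<omega> * X 0 \<omega> ^ (k + 2)) \<le> 3 * c * (2 * D ^ P)"
      using c0 by (intro mult_left_mono) auto
    then have "\<Phi> 0 \<le> (1 + 6 * c) * D ^ P" using X0(2) by (simp add: \<Phi>_def P_def algebra_simps)
    also have "\<dots> \<le> (3 * p) ^ P * D ^ P"
    proof (intro mult_right_mono)
      have "1 + 6 * c \<le> 9 * p\<^sup>2" using c_hi power_mono[OF p4, of 2] by simp
      also have "\<dots> = (3 * p) ^ 2" by (simp add: power_mult_distrib)
      also have "\<dots> \<le> (3 * p) ^ P" using p4 by (intro power_increasing) (auto simp: P_def)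
      finally show "1 + 6 * c \<le> (3 * p) ^ P" .
    qed (use D in auto)
    also have "\<dots> \<le> K 0 ^ P" using KDP by (simp add: power_mult_distrib)
    finally show ?case by simp
  next
    case (Suc j)
    then have IH: "\<Phi> j \<le> (1 + real j / real m) * K j ^ P" by simp
    also have "\<dots> \<le> 2 * K j ^ P" using Suc.prems Kpos[of j] by (intro mult_right_mono) (auto simp: field_simps)
    finally have u: "expectation (\<lambda>\<omega>. X j \<omega> ^ P) \<le> 4 * K j ^ P" by (rule u_le)
    have Kp: "0 < K j ^ r" for r using Kpos by simp
    have Kp0: "0 \<le> K j ^ r" for r using Kp[of r] by (rule less_imp_le)
    have u': "expectation (\<lambda>\<omega>. X j \<omega> ^ P) / K j ^ P \<le> 4" using u Kp[of P] by (simp add: divide_le_eq)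
    have x2: "expectation (\<lambda>\<omega>. X j \<omega> ^ (k + 2)) \<le> 5 * K j ^ (k + 2)"
    proof -
      have "expectation (\<lambda>\<omega>. X j \<omega> ^ (k + 2)) \<le> expectation (\<lambda>\<omega>. K j ^ (k + 2) * (X j \<omega> ^ P / K j ^ P + 1))"
      proof (rule integral_mono)
        fix \<omega>
        have "X j \<omega> ^ (k + 2) = \<bar>X j \<omega>\<bar> ^ (k + 2) * 1 ^ 2" using k by (simp add: power_even_abs)
        also have "\<dots> \<le> K j ^ (k + 2) * 1 ^ 2 * ((\<bar>X j \<omega>\<bar> / K j) ^ (k + 2 + 2) + (1 / 1) ^ (k + 2 + 2))"
          using Kpos by (intro mult_power_le_sum) auto
        also have "k + 2 + 2 = P" by (simp add: P_def)
        finally show "X j \<omega> ^ (k + 2) \<le> K j ^ (k + 2) * (X j \<omega> ^ P / K j ^ P + 1)"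
          using P2(2) by (simp add: power_divide power_even_abs)
      qed (use i5 iX in auto)
      also have "\<dots> = K j ^ (k + 2) * (expectation (\<lambda>\<omega>. X j \<omega> ^ P) / K j ^ P + 1)"
        using iX[of j] by (simp add: prob_space)
      also have "\<dots> \<le> K j ^ (k + 2) * (4 + 1)"
        by (intro mult_left_mono add_right_mono u' Kp0)
      finally show ?thesis by simp
    qed
    \<comment> \<open>13 = 3 * 4 + 1: three times the bound \<open>u\<close>, plus the term with G,
      which K^P dominates. Together with the moment of G itself this gives the 14 in
      \<open>r\<close>.\<close>
    have Y: "expectation (\<lambda>\<omega>. (\<bar>X j \<omega>\<bar> + G j \<omega>) ^ P) \<le> 13 * K j ^ P"
    proof -
      have "expectation (\<lambda>\<omega>. (\<bar>X j \<omega>\<bar> + G j \<omega>) ^ P) \<le> expectation (\<lambda>\<omega>. 3 * X j \<omega> ^ P + (2 * p) ^ P * G j \<omega> ^ P)"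
      proof (rule integral_mono)
        fix \<omega> assume w: "\<omega> \<in> space M"
        show "(\<bar>X j \<omega>\<bar> + G j \<omega>) ^ P \<le> 3 * X j \<omega> ^ P + (2 * p) ^ P * G j \<omega> ^ P"
        proof -
          have "real P = p" by (simp add: P_def p_def)
          moreover have "\<bar>X j \<omega>\<bar> ^ P = X j \<omega> ^ P" using P2(2) by (rule power_even_abs)
          ultimately show ?thesis
            using power_add_le_3[OF abs_ge_zero[of "X j \<omega>"] Gn[OF w, of j] P2(3)] by (simp only: power_mult_distrib)
        qed
      qed (use iY iX G(1) in \<open>auto simp: P_def\<close>)
      also have "\<dots> = 3 * expectation (\<lambda>\<omega>. X j \<omega> ^ P) + (2 * p) ^ P * expectation (\<lambda>\<omega>. G j \<omega> ^ P)"
        using iX[of j] G(1)[of j] by (simp add: P_def)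
      also have "\<dots> \<le> 3 * (4 * K j ^ P) + (2 * p) ^ P * D ^ P"
        using u EG p4 by (intro add_mono mult_left_mono) auto
      also have "(2 * p) ^ P * D ^ P \<le> (3 * p * D) ^ P"
        unfolding power_mult_distrib[symmetric] using p4 D by (intro power_mono) auto
      finally show ?thesis using KDP[of j] by simp
    qed
    have r: "expectation (\<lambda>\<omega>. G j \<omega> ^ 4 * (\<bar>X j \<omega>\<bar> + G j \<omega>) ^ k) \<le> 14 * (D ^ 4 * K j ^ k)"
    proof -
      have "expectation (\<lambda>\<omega>. G j \<omega> ^ 4 * (\<bar>X j \<omega>\<bar> + G j \<omega>) ^ k) \<le>
          expectation (\<lambda>\<omega>. D ^ 4 * K j ^ k * (G j \<omega> ^ P / D ^ P + (\<bar>X j \<omega>\<bar> + G j \<omega>) ^ P / K j ^ P))"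
      proof (rule integral_mono)
        fix \<omega> assume w: "\<omega> \<in> space M"
        have "G j \<omega> ^ 4 * (\<bar>X j \<omega>\<bar> + G j \<omega>) ^ k \<le> D ^ 4 * K j ^ k * ((G j \<omega> / D) ^ (4 + k) + ((\<bar>X j \<omega>\<bar> + G j \<omega>) / K j) ^ (4 + k))"
          using Gn[OF w, of j] D Kpos by (intro mult_power_le_sum) auto
        then show "G j \<omega> ^ 4 * (\<bar>X j \<omega>\<bar> + G j \<omega>) ^ k \<le> D ^ 4 * K j ^ k * (G j \<omega> ^ P / D ^ P + (\<bar>X j \<omega>\<bar> + G j \<omega>) ^ P / K j ^ P)"
          by (simp add: power_divide P_def add.commute)
      qed (use i6 iY G(1) in \<open>auto simp: P_def\<close>)
      also have "\<dots> = D ^ 4 * K j ^ k * (expectation (\<lambda>\<omega>. G j \<omega> ^ P) / D ^ P + expectation (\<lambda>\<omega>. (\<bar>X j \<omega>\<bar> + G j \<omega>) ^ P) / K j ^ P)"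
        using iY[of j] G(1)[of j] by (simp add: P_def)
      also have "\<dots> \<le> D ^ 4 * K j ^ k * (1 + 13)"
      proof (intro mult_left_mono add_mono mult_nonneg_nonneg Kp0)
        show "expectation (\<lambda>\<omega>. G j \<omega> ^ P) / D ^ P \<le> 1" using EG[of j] D by simp
        show "expectation (\<lambda>\<omega>. (\<bar>X j \<omega>\<bar> + G j \<omega>) ^ P) / K j ^ P \<le> 13" using Y Kp[of P] by (simp add: divide_le_eq)
      qed (use D in simp)
      finally show ?thesis by simp
    qed
    have r': "5 * p ^ 4 * (14 * (D ^ 4 * K j ^ k)) \<le> K j ^ P / real m"
    proof -
      have "(70 * p ^ 4 * D ^ 4 * real m) * K j ^ k \<le> K j ^ 4 * K j ^ k"
        using K4 Kp[of k] by (intro mult_right_mono) (auto intro: less_imp_le)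
      then show ?thesis using m by (simp add: P_def power_add field_simps)
    qed
    have "3 * c * v * expectation (\<lambda>\<omega>. X j \<omega> ^ (k + 2)) \<le> 3 * c * v * (5 * K j ^ (k + 2))"
      using c0 v x2 by (intro mult_left_mono) auto
    moreover have "5 * p ^ 4 * expectation (\<lambda>\<omega>. G j \<omega> ^ 4 * (\<bar>X j \<omega>\<bar> + G j \<omega>) ^ k) \<le> 5 * p ^ 4 * (14 * (D ^ 4 * K j ^ k))"
      using r p4 by (intro mult_left_mono) auto
    ultimately have "\<Phi> (Suc j) \<le> (1 + real j / real m) * K j ^ P + 15 * c * v * K j ^ (k + 2) + K j ^ P / real m"
      using step[of j] IH r' by linarith
    also have "\<dots> \<le> (1 + real j / real m) * K j ^ P + (K (Suc j) ^ P - K j ^ P) + K j ^ P / real m"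
      using Kstep[of j] by linarith
    also have "\<dots> = real (Suc j) / real m * K j ^ P + K (Suc j) ^ P" by (simp add: field_simps add_divide_distrib)
    also have "\<dots> \<le> real (Suc j) / real m * K (Suc j) ^ P + K (Suc j) ^ P"
    proof (intro add_right_mono mult_left_mono)
      show "K j ^ P \<le> K (Suc j) ^ P" using Kstep[of j] c0 v Kp[of "k + 2"] by (smt (verit) mult_nonneg_nonneg)
    qed auto
    finally show ?case by (simp add: algebra_simps)
  qed
  have "\<Phi> m \<le> 2 * K m ^ P" using main[of m] m by simp
  from u_le[OF this] iX[of m] show ?thesis by (simp add: P_def K_def A_def)
qed

end

section \<open>Moment norms\<close>

text \<open>The L^p norm of X is at most a, expressed without roots; the inequality itself excludes
  an infinite moment. The measure is arbitrary because the coupling argument takes norms on a space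
  of pairs of a time and a path.\<close>

definition lp_le :: "'b measure \<Rightarrow> real \<Rightarrow> ('b \<Rightarrow> real) \<Rightarrow> real \<Rightarrow> bool" where
  "lp_le \<mu> p X a \<longleftrightarrow> 0 \<le> a \<and> X \<in> borel_measurable \<mu> \<and> (\<integral>\<^sup>+\<omega>. ennreal (\<bar>X \<omega>\<bar> powr p) \<partial>\<mu>) \<le> ennreal (a powr p)"

text \<open>Minkowski's inequality in pointwise form, by convexity with weights a / (a + b) and b /
  (a + b). Integrated against p-th moments at most a^p and b^p, the right-hand side becomes (a +
  b)^p.\<close>

lemma powr_Minkowski_bound:
  fixes x y a b p :: real
  assumes xy: "0 \<le> x" "0 \<le> y" and ab: "0 < a" "0 < b" and p: "1 \<le> p"
  shows "(x + y) powr p \<le> (a + b) powr (p - 1) * (a powr (1 - p) * x powr p + b powr (1 - p) * y powr p)"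
proof -
  have mono: "1 \<le> (a + b) powr (p - 1) * c powr (1 - p)" if "0 < c" "c \<le> a + b" for c
  proof -
    have "c powr (p - 1) \<le> (a + b) powr (p - 1)" using that p by (intro powr_mono2) auto
    then have "c powr (p - 1) * c powr (1 - p) \<le> (a + b) powr (p - 1) * c powr (1 - p)" by (rule mult_right_mono) simp
    then show ?thesis using that by (simp add: powr_add[symmetric])
  qed
  consider "x = 0" | "y = 0" | "0 < x" "0 < y" using xy by linarith
  then show ?thesis
  proof cases
    case 1
    then show ?thesis using mult_right_mono[OF mono[of b], of "y powr p"] ab by (simp add: mult.assoc)
  next
    case 2
    then show ?thesis using mult_right_mono[OF mono[of a], of "x powr p"] ab by (simp add: mult.assoc)
  next
    case 3
    define t where "t = a / (a + b)"
    have t: "0 \<le> t" "t \<le> 1" "1 - t = b / (a + b)" using ab by (auto simp: t_def field_simps)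
    have "(t *\<^sub>R (x / a) + (1 - t) *\<^sub>R (y / b)) powr p \<le> t * (x / a) powr p + (1 - t) * (y / b) powr p"
      using convex_onD[OF powr_convex[OF p], of "1 - t" "x / a" "y / b"] 3 ab t(1,2) by simp
    moreover have "t *\<^sub>R (x / a) + (1 - t) *\<^sub>R (y / b) = (x + y) / (a + b)"
      unfolding t(3) using ab by (simp add: t_def add_divide_distrib)
    ultimately have "(x + y) powr p / (a + b) powr p \<le> t * (x powr p / a powr p) + (1 - t) * (y powr p / b powr p)"
      using 3 ab by (simp add: powr_divide)
    then have "(x + y) powr p \<le> (a + b) powr p * (t * (x powr p / a powr p) + (1 - t) * (y powr p / b powr p))"
      using ab by (simp add: field_simps)
    also have "\<dots> = (a + b) powr (p - 1) * (a powr (1 - p) * x powr p + b powr (1 - p) * y powr p)"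
      unfolding t(3) using ab by (simp add: t_def powr_diff distrib_left)
    finally show ?thesis .
  qed
qed

lemma lp_le_mono:
  assumes "lp_le \<mu> p X a" "Y \<in> borel_measurable \<mu>" "\<And>\<omega>. \<omega> \<in> space \<mu> \<Longrightarrow> \<bar>Y \<omega>\<bar> \<le> \<bar>X \<omega>\<bar>" "a \<le> b" and p: "0 \<le> p"
  shows "lp_le \<mu> p Y b"
proof -
  have "(\<integral>\<^sup>+\<omega>. ennreal (\<bar>Y \<omega>\<bar> powr p) \<partial>\<mu>) \<le> (\<integral>\<^sup>+\<omega>. ennreal (\<bar>X \<omega>\<bar> powr p) \<partial>\<mu>)"
    using assms by (intro nn_integral_mono ennreal_leI powr_mono2) auto
  also have "\<dots> \<le> ennreal (a powr p)" using assms by (simp add: lp_le_def)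
  also have "\<dots> \<le> ennreal (b powr p)" using assms by (intro ennreal_leI powr_mono2) (auto simp: lp_le_def)
  finally show ?thesis using assms by (auto simp: lp_le_def)
qed

lemma lp_le_0_AE:
  assumes "lp_le \<mu> p X 0" "0 < p"
  shows "AE \<omega> in \<mu>. X \<omega> = 0"
proof -
  have [measurable]: "X \<in> borel_measurable \<mu>" using assms by (simp add: lp_le_def)
  have "(\<integral>\<^sup>+\<omega>. ennreal (\<bar>X \<omega>\<bar> powr p) \<partial>\<mu>) = 0" using assms by (simp add: lp_le_def)
  then have "AE \<omega> in \<mu>. ennreal (\<bar>X \<omega>\<bar> powr p) = 0" by (subst (asm) nn_integral_0_iff_AE) auto
  then show ?thesis by eventually_elim (auto simp: ennreal_eq_0_iff)
qed

lemma lp_le_add: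
  assumes X: "lp_le \<mu> p X a" and Y: "lp_le \<mu> p Y b" and p: "1 \<le> p"
  shows "lp_le \<mu> p (\<lambda>\<omega>. X \<omega> + Y \<omega>) (a + b)"
proof -
  have [measurable]: "X \<in> borel_measurable \<mu>" "Y \<in> borel_measurable \<mu>" using X Y by (simp_all add: lp_le_def)
  have nn: "0 \<le> a" "0 \<le> b" using X Y by (simp_all add: lp_le_def)
  have Xi: "(\<integral>\<^sup>+\<omega>. ennreal (\<bar>X \<omega>\<bar> powr p) \<partial>\<mu>) \<le> ennreal (a powr p)"
   and Yi: "(\<integral>\<^sup>+\<omega>. ennreal (\<bar>Y \<omega>\<bar> powr p) \<partial>\<mu>) \<le> ennreal (b powr p)" using X Y by (simp_all add: lp_le_def)
  have "(\<integral>\<^sup>+\<omega>. ennreal (\<bar>X \<omega> + Y \<omega>\<bar> powr p) \<partial>\<mu>) \<le> ennreal ((a + b) powr p)"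
  proof -
    \<comment> \<open>The weights need positive a and b; a bound 0 means that the variable vanishes
      almost everywhere.\<close>
    consider "a = 0" | "b = 0" | "0 < a" "0 < b" using nn by linarith
    then show ?thesis
    proof cases
      case 1
      have "AE \<omega> in \<mu>. X \<omega> = 0" by (rule lp_le_0_AE) (use X 1 p in auto)
      then have "(\<integral>\<^sup>+\<omega>. ennreal (\<bar>X \<omega> + Y \<omega>\<bar> powr p) \<partial>\<mu>) = (\<integral>\<^sup>+\<omega>. ennreal (\<bar>Y \<omega>\<bar> powr p) \<partial>\<mu>)"
        by (intro nn_integral_cong_AE) (erule eventually_mono, simp)
      then show ?thesis using Yi 1 by simp
    next
      case 2
      have "AE \<omega> in \<mu>. Y \<omega> = 0" by (rule lp_le_0_AE) (use Y 2 p in auto)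
      then have "(\<integral>\<^sup>+\<omega>. ennreal (\<bar>X \<omega> + Y \<omega>\<bar> powr p) \<partial>\<mu>) = (\<integral>\<^sup>+\<omega>. ennreal (\<bar>X \<omega>\<bar> powr p) \<partial>\<mu>)"
        by (intro nn_integral_cong_AE) (erule eventually_mono, simp)
      then show ?thesis using Xi 2 by simp
    next
      case 3
      let ?c = "(a + b) powr (p - 1)"
      have "(\<integral>\<^sup>+\<omega>. ennreal (\<bar>X \<omega> + Y \<omega>\<bar> powr p) \<partial>\<mu>) \<le>
          (\<integral>\<^sup>+\<omega>. ennreal ?c * (ennreal (a powr (1 - p)) * ennreal (\<bar>X \<omega>\<bar> powr p) + ennreal (b powr (1 - p)) * ennreal (\<bar>Y \<omega>\<bar> powr p)) \<partial>\<mu>)"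
      proof (rule nn_integral_mono)
        fix \<omega>
        have "\<bar>X \<omega> + Y \<omega>\<bar> powr p \<le> (\<bar>X \<omega>\<bar> + \<bar>Y \<omega>\<bar>) powr p" using p by (intro powr_mono2) auto
        also have "\<dots> \<le> ?c * (a powr (1 - p) * \<bar>X \<omega>\<bar> powr p + b powr (1 - p) * \<bar>Y \<omega>\<bar> powr p)"
          using 3 p by (intro powr_Minkowski_bound) auto
        finally have "ennreal (\<bar>X \<omega> + Y \<omega>\<bar> powr p) \<le> ennreal (?c * (a powr (1 - p) * \<bar>X \<omega>\<bar> powr p + b powr (1 - p) * \<bar>Y \<omega>\<bar> powr p))"
          by (rule ennreal_leI)
        then show "ennreal (\<bar>X \<omega> + Y \<omega>\<bar> powr p) \<le> ennreal ?c * (ennreal (a powr (1 - p)) * ennreal (\<bar>X \<omega>\<bar> powr p) + ennreal (b powr (1 - p)) * ennreal (\<bar>Y \<omega>\<bar> powr p))"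
          by (simp add: ennreal_mult)
      qed
      also have "\<dots> = ennreal ?c * (ennreal (a powr (1 - p)) * (\<integral>\<^sup>+\<omega>. ennreal (\<bar>X \<omega>\<bar> powr p) \<partial>\<mu>) + ennreal (b powr (1 - p)) * (\<integral>\<^sup>+\<omega>. ennreal (\<bar>Y \<omega>\<bar> powr p) \<partial>\<mu>))"
        by (simp add: nn_integral_cmult nn_integral_add)
      also have "\<dots> \<le> ennreal ?c * (ennreal (a powr (1 - p)) * ennreal (a powr p) + ennreal (b powr (1 - p)) * ennreal (b powr p))"
        by (intro mult_left_mono add_mono Xi Yi) auto
      also have "\<dots> = ennreal (?c * (a powr (1 - p) * a powr p + b powr (1 - p) * b powr p))"
        by (simp add: ennreal_mult)
      also have "?c * (a powr (1 - p) * a powr p + b powr (1 - p) * b powr p) = (a + b) powr p"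
        using 3 by (simp add: powr_add[symmetric] powr_diff)
      finally show ?thesis .
    qed
  qed
  then show ?thesis using nn by (simp add: lp_le_def)
qed

lemma lp_le_sum:
  assumes "finite A" "\<And>i. i \<in> A \<Longrightarrow> lp_le \<mu> p (X i) (a i)" and p: "1 \<le> p"
  shows "lp_le \<mu> p (\<lambda>\<omega>. \<Sum>i\<in>A. X i \<omega>) (\<Sum>i\<in>A. a i)"
  using assms(1,2)
proof (induction A rule: finite_induct)
  case empty then show ?case using p by (simp add: lp_le_def)
next
  case (insert i A)
  then show ?case using lp_le_add[OF _ _ p, of \<mu> "X i" "a i" "\<lambda>\<omega>. \<Sum>i\<in>A. X i \<omega>" "\<Sum>i\<in>A. a i"] by simp
qed

lemma lp_le_cmult:
  assumes X: "lp_le \<mu> p X a"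
  shows "lp_le \<mu> p (\<lambda>\<omega>. c * X \<omega>) (\<bar>c\<bar> * a)"
proof -
  have [measurable]: "X \<in> borel_measurable \<mu>" using X by (simp add: lp_le_def)
  have "(\<integral>\<^sup>+\<omega>. ennreal (\<bar>c * X \<omega>\<bar> powr p) \<partial>\<mu>) = ennreal (\<bar>c\<bar> powr p) * (\<integral>\<^sup>+\<omega>. ennreal (\<bar>X \<omega>\<bar> powr p) \<partial>\<mu>)"
    by (simp add: abs_mult powr_mult ennreal_mult nn_integral_cmult)
  also have "\<dots> \<le> ennreal (\<bar>c\<bar> powr p) * ennreal (a powr p)" using X by (intro mult_left_mono) (auto simp: lp_le_def)
  also have "\<dots> = ennreal ((\<bar>c\<bar> * a) powr p)" using X by (simp add: ennreal_mult powr_mult lp_le_def)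
  finally show ?thesis using X by (simp add: lp_le_def)
qed

text \<open>Jensen's inequality, again through the tangent of a concave power. It carries a bound
  for the even exponent back to p.\<close>

lemma (in prob_space) lp_le_exponent_mono:
  assumes X: "lp_le M r X a" and p: "0 < p" "p \<le> r"
  shows "lp_le M p X a"
proof -
  have [measurable]: "X \<in> borel_measurable M" using X by (simp add: lp_le_def)
  have a: "0 \<le> a" using X by (simp add: lp_le_def)
  have "(\<integral>\<^sup>+\<omega>. ennreal (\<bar>X \<omega>\<bar> powr p) \<partial>M) \<le> ennreal (a powr p)"
  proof (cases "a = 0")
    case True
    have "AE \<omega> in M. X \<omega> = 0" by (rule lp_le_0_AE[of M r]) (use X True p in auto)
    then have "(\<integral>\<^sup>+\<omega>. ennreal (\<bar>X \<omega>\<bar> powr p) \<partial>M) = (\<integral>\<^sup>+\<omega>. 0 \<partial>M)"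
      by (intro nn_integral_cong_AE) (erule eventually_mono, simp)
    then show ?thesis by simp
  next
    case False
    then have a: "0 < a" using a by simp
    let ?t = "p / r"
    have t: "0 \<le> ?t" "?t \<le> 1" "r * ?t = p" using p by auto
    have pt: "\<bar>X \<omega>\<bar> powr p \<le> a powr p * (?t * a powr (- r) * \<bar>X \<omega>\<bar> powr r + (1 - ?t))" for \<omega>
    proof (cases "X \<omega> = 0")
      case True
      then show ?thesis using t by simp
    next
      case False
      have "((\<bar>X \<omega>\<bar> / a) powr r) powr ?t * 1 powr (1 - ?t) \<le> ?t * (\<bar>X \<omega>\<bar> / a) powr r + (1 - ?t) * 1"
        using t False a by (intro Youngs_inequality_0) auto
      then have "\<bar>X \<omega>\<bar> powr p / a powr p \<le> ?t * (\<bar>X \<omega>\<bar> powr r / a powr r) + (1 - ?t)"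
        using a t by (simp add: powr_powr powr_divide)
      then show ?thesis using a by (simp add: powr_minus field_simps)
    qed
    have "(\<integral>\<^sup>+\<omega>. ennreal (\<bar>X \<omega>\<bar> powr p) \<partial>M) \<le> (\<integral>\<^sup>+\<omega>. ennreal (a powr p) * (ennreal (?t * a powr (- r)) * ennreal (\<bar>X \<omega>\<bar> powr r) + ennreal (1 - ?t)) \<partial>M)"
      using t p by (intro nn_integral_mono order_trans[OF ennreal_leI[OF pt]]) (auto simp flip: ennreal_mult ennreal_plus)
    also have "\<dots> = ennreal (a powr p) * (ennreal (?t * a powr (- r)) * (\<integral>\<^sup>+\<omega>. ennreal (\<bar>X \<omega>\<bar> powr r) \<partial>M) + ennreal (1 - ?t))"
      by (simp add: nn_integral_cmult nn_integral_add emeasure_space_1)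
    also have "\<dots> \<le> ennreal (a powr p) * (ennreal (?t * a powr (- r)) * ennreal (a powr r) + ennreal (1 - ?t))"
      using X by (intro mult_left_mono add_right_mono) (auto simp: lp_le_def)
    also have "ennreal (?t * a powr (- r)) * ennreal (a powr r) = ennreal (?t * a powr (- r) * a powr r)"
      using t p by (intro ennreal_mult[symmetric]) auto
    also have "?t * a powr (- r) * a powr r = ?t" using a by (simp add: powr_add[symmetric])
    also have "ennreal ?t + ennreal (1 - ?t) = 1" using t by (simp flip: ennreal_plus)
    finally show ?thesis by simp
  qed
  then show ?thesis using a by (simp add: lp_le_def)
qed

lemma ennpowr_root_le:
  assumes x: "x \<le> ennreal (a powr p)" and a: "0 \<le> a" and p: "0 < p"
  shows "ennpowr x (1 / p) \<le> ennreal a"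
proof -
  have fin: "x < \<infinity>" using x by (rule le_less_trans) simp
  have "enn2real x \<le> a powr p" using enn2real_mono[OF x] a by simp
  then have "enn2real x powr (1 / p) \<le> (a powr p) powr (1 / p)" using p by (intro powr_mono2) auto
  also have "\<dots> = a" using a p by (simp add: powr_powr)
  finally show ?thesis using fin by (auto simp: ennpowr_def intro: ennreal_leI)
qed

lemma lp_le_moment_norm:
  assumes "lp_le (markov_law M Q \<xi>) p X a" "0 < p"
  shows "moment_norm M Q \<xi> p X \<le> ennreal a"
  unfolding moment_norm_def using assms by (intro ennpowr_root_le) (auto simp: lp_le_def)

lemma moment_norm_lp_le:
  assumes X: "X \<in> borel_measurable (markov_law M Q \<xi>)" and fin: "moment_norm M Q \<xi> p X < \<infinity>" and p: "0 < p"
  shows "lp_le (markov_law M Q \<xi>) p X (enn2real (moment_norm M Q \<xi> p X))"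
proof -
  let ?x = "\<integral>\<^sup>+\<omega>. ennreal (\<bar>X \<omega>\<bar> powr p) \<partial>markov_law M Q \<xi>"
  have x: "?x < \<infinity>" using fin by (auto simp: moment_norm_def ennpowr_def less_top split: if_splits)
  then have "enn2real (moment_norm M Q \<xi> p X) = enn2real ?x powr (1 / p)"
    by (simp add: moment_norm_def ennpowr_def less_top)
  then have "enn2real (moment_norm M Q \<xi> p X) powr p = enn2real ?x"
    using p by (simp add: powr_powr)
  then show ?thesis using x X by (simp add: lp_le_def less_top)
qed

lemma lp_le_even_iff:
  assumes "even k" "0 < k" "X \<in> borel_measurable \<mu>" "0 \<le> a"
  shows "lp_le \<mu> (real k) X a \<longleftrightarrow> integrable \<mu> (\<lambda>\<omega>. X \<omega> ^ k) \<and> (\<integral>\<omega>. X \<omega> ^ k \<partial>\<mu>) \<le> a ^ k"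
proof -
  note [measurable] = assms(3)
  have e: "\<bar>x\<bar> powr real k = x ^ k" "0 \<le> x ^ k" for x :: real
    using assms(1,2) by (auto simp: powr_realpow' power_even_abs zero_le_even_power)
  have ea: "a powr real k = a ^ k" using assms by (simp add: powr_realpow')
  show ?thesis
  proof
    assume L: "lp_le \<mu> (real k) X a"
    then have le: "(\<integral>\<^sup>+\<omega>. ennreal (X \<omega> ^ k) \<partial>\<mu>) \<le> ennreal (a ^ k)" by (simp add: lp_le_def e ea)
    have i: "integrable \<mu> (\<lambda>\<omega>. X \<omega> ^ k)"
      using le_less_trans[OF le] e(2) by (intro integrableI_nonneg) auto
    moreover have "(\<integral>\<omega>. X \<omega> ^ k \<partial>\<mu>) \<le> a ^ k"
      using le nn_integral_eq_integral[OF i] e(2) assms(4) by simp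
    ultimately show "integrable \<mu> (\<lambda>\<omega>. X \<omega> ^ k) \<and> (\<integral>\<omega>. X \<omega> ^ k \<partial>\<mu>) \<le> a ^ k" by simp
  next
    assume "integrable \<mu> (\<lambda>\<omega>. X \<omega> ^ k) \<and> (\<integral>\<omega>. X \<omega> ^ k \<partial>\<mu>) \<le> a ^ k"
    then show "lp_le \<mu> (real k) X a"
      using nn_integral_eq_integral[of \<mu> "\<lambda>\<omega>. X \<omega> ^ k"] e(2) assms(4) by (simp add: lp_le_def e ea ennreal_leI)
  qed
qed

section \<open>The Poisson martingale\<close>

text \<open>The logarithmic weight has been replaced by a power of V at the cost of the constant N.
  In this locale \<open>p\<close> is the even exponent k + 4, the P of the overview. It is at least
  4, so that \<open>kf\<close>, of order V^(2/p), still falls under the Poisson bounds, with s = p /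
  2 \<ge> 2.\<close>

locale additive_functional = vge_chain +
  fixes f :: "'a \<Rightarrow> real" and N :: real and k :: nat
  assumes f_meas [measurable]: "f \<in> borel_measurable M"
    and f_le: "\<And>z. z \<in> space M \<Longrightarrow> \<bar>f z\<bar> \<le> N * V z powr (1 / real (k + 4))"
    and N_pos: "0 < N" and k_even: "even k"
begin

text \<open>With \<open>M\<^sub>l = \<Sum>i<l. fb (Z\<^sub>i) + g (Z\<^sub>l)\<close>, the Poisson equation for \<open>kf\<close> is what makes
  \<open>(M\<^sub>l - M\<^sub>0)\<^sup>2 + \<psi> (Z\<^sub>l) - l \<sigma>\<^sup>2\<close> a martingale.\<close>

definition "p = real (k + 4)"
definition "C = piV powr (1 / p)"
abbreviation "fb \<equiv> centered \<pi> f"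
definition "W z = V z powr (1 / p) + C"
text \<open>A common scale: \<open>g\<close> and \<open>fb\<close> are bounded by multiples of E W,
  and \<psi> by a multiple of (E W)^2. The factors \<kappa>^(2/p) and C are dictated by \<psi>,
  which solves two Poisson equations in succession.\<close>

definition "E = p * real \<tau> * N * \<kappa> powr (2 / p) * C"
definition "g = poisson f"
definition "kf z = 2 * g z * fb z - (fb z)\<^sup>2"
definition "\<psi> z = poisson kf z - (g z)\<^sup>2"

lemma p4: "4 \<le> p"
  by (simp add: p_def)

lemma C_ge1: "1 \<le> C"
  using piV_ge1 p4 by (simp add: C_def ge_one_powr_ge_zero)

lemma kappa_powr: "0 \<le> x \<Longrightarrow> 1 \<le> \<kappa> powr x"
  using kappa by (simp add: ge_one_powr_ge_zero)

lemma kappa_powr_le: "x \<le> y \<Longrightarrow> \<kappa> powr x \<le> \<kappa> powr y"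
  using kappa by (simp add: powr_mono)

lemma W_ge1: "z \<in> space M \<Longrightarrow> 1 \<le> W z"
  using C_ge1 by (simp add: W_def add_increasing)

lemma W_nonneg: "0 \<le> W z"
  using C_ge1 by (simp add: W_def)

lemma tau1: "1 \<le> real \<tau>"
  using tau by simp

lemma N_le_E: "p * real \<tau> * N * \<kappa> powr (1 / p) \<le> E" "p * real \<tau> * N \<le> E" "N \<le> E" "0 < E"
proof -
  have 1: "1 \<le> p * real \<tau>" using p4 tau1 mult_mono[of 1 p 1 "real \<tau>"] by simp
  have 2: "\<kappa> powr (1 / p) * 1 \<le> \<kappa> powr (2 / p) * C"
    using p4 C_ge1 by (intro mult_mono kappa_powr_le) (auto simp: field_simps)
  have a: "0 \<le> p * real \<tau> * N" using p4 N_pos by simp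
  show e1: "p * real \<tau> * N * \<kappa> powr (1 / p) \<le> E"
    using mult_left_mono[OF 2 a] by (simp add: E_def mult.assoc)
  have "p * real \<tau> * N * 1 \<le> p * real \<tau> * N * \<kappa> powr (1 / p)"
    using a p4 by (intro mult_left_mono kappa_powr) auto
  then show e2: "p * real \<tau> * N \<le> E" using e1 by simp
  have "1 * N \<le> p * real \<tau> * N" using 1 N_pos by (intro mult_right_mono) auto
  then show "N \<le> E" using e2 by simp
  then show "0 < E" using N_pos by linarith
qed

lemma W_measurable [measurable]: "W \<in> borel_measurable M" "fb \<in> borel_measurable M" "g \<in> borel_measurable M"
  "kf \<in> borel_measurable M" "\<psi> \<in> borel_measurable M"
proof -
  show "W \<in> borel_measurable M" unfolding W_def[abs_def] by measurable
  show [measurable]: "fb \<in> borel_measurable M" unfolding centered_def[abs_def] by measurable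
  show [measurable]: "g \<in> borel_measurable M" unfolding g_def by (rule poisson_measurable) simp
  show [measurable]: "kf \<in> borel_measurable M" unfolding kf_def[abs_def] by measurable
  have "poisson kf \<in> borel_measurable M" by (rule poisson_measurable) simp
  then show "\<psi> \<in> borel_measurable M" unfolding \<psi>_def[abs_def] by measurable
qed

lemma f_le': "z \<in> space M \<Longrightarrow> \<bar>f z\<bar> \<le> N * (V z powr (1 / p) + 0)"
  using f_le by (simp add: p_def)

lemma f_V_bound: "z \<in> space M \<Longrightarrow> \<bar>f z\<bar> \<le> N * (1 + 0) * V z"
  using V_bound_of_powr_bound[OF f_le'] p4 N_pos by simp

lemma pi_f_le: "\<bar>\<integral>z. f z \<partial>\<pi>\<bar> \<le> N * C"
proof -
  have "\<bar>\<integral>z. f z \<partial>\<pi>\<bar> \<le> (\<integral>z. \<bar>f z\<bar> \<partial>\<pi>)" by (rule integral_abs_bound)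
  also have "\<dots> \<le> (\<integral>z. N * V z powr (1 / p) \<partial>\<pi>)"
    using V_bounded_integrable(2)[OF f_meas f_V_bound] pi_powr_integrable[of p] f_le' p4 pi_space
    by (intro integral_mono) auto
  also have "\<dots> = N * (\<integral>z. V z powr (1 / p) \<partial>\<pi>)" by simp
  also have "\<dots> \<le> N * C" unfolding C_def using pi_powr_le[of p] p4 N_pos by (intro mult_left_mono) auto
  finally show ?thesis .
qed

lemma fb_le: "z \<in> space M \<Longrightarrow> \<bar>fb z\<bar> \<le> N * W z"
  using f_le'[of z] pi_f_le by (simp add: centered_def W_def distrib_left)

lemma g_le: "z \<in> space M \<Longrightarrow> \<bar>g z\<bar> \<le> 2 * (p * real \<tau> * N * \<kappa> powr (1 / p)) * W z"
  using poisson_le[OF f_meas f_le' _ _ _ , of z] p4 N_pos unfolding g_def W_def C_def by (simp add: mult_ac)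

lemma g_le_E: "z \<in> space M \<Longrightarrow> \<bar>g z\<bar> \<le> 2 * E * W z"
  using g_le[of z] mult_right_mono[OF N_le_E(1) W_nonneg[of z]] by linarith

lemma fb_le_E: "z \<in> space M \<Longrightarrow> \<bar>fb z\<bar> \<le> E * W z"
  using fb_le[of z] mult_right_mono[OF N_le_E(3) W_nonneg[of z]] by linarith

definition "A2 = 10 * p * real \<tau> * \<kappa> powr (1 / p) * N\<^sup>2"

lemma powr_half: "x powr (1 / (p / 2)) = (x powr (1 / p))\<^sup>2" for x :: real
proof -
  have "1 / (p / 2) = 1 / p + 1 / p" using p4 by simp
  then show ?thesis by (simp only: powr_add power2_eq_square)
qed

text \<open>Squares of V^(1/p) appear because \<open>kf\<close> is quadratic; written as V^(1 / (p /
  2)) they fit the Poisson bounds. The 10 in \<open>A2\<close> is 4 + 1, from 2 g fb and fb^2, times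
  2 from (a + b)^2 \<le> 2 (a^2 + b^2).\<close>

lemma kf_le: "z \<in> space M \<Longrightarrow> \<bar>kf z\<bar> \<le> A2 * (V z powr (1 / (p / 2)) + C\<^sup>2)"
proof -
  assume z: "z \<in> space M"
  let ?c = "p * real \<tau> * \<kappa> powr (1 / p)" and ?v = "V z powr (1 / p)"
  have c: "1 \<le> ?c"
    using p4 tau1 kappa_powr[of "1 / p"] mult_mono[of 1 p 1 "real \<tau>"] mult_mono[of 1 "p * real \<tau>" 1 "\<kappa> powr (1/p)"] by simp
  have "\<bar>kf z\<bar> \<le> 2 * (\<bar>g z\<bar> * \<bar>fb z\<bar>) + \<bar>fb z\<bar> * \<bar>fb z\<bar>"
    unfolding kf_def by (rule order_trans[OF abs_triangle_ineq4]) (simp add: abs_mult power2_eq_square)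
  also have "\<dots> \<le> 2 * ((2 * (p * real \<tau> * N * \<kappa> powr (1 / p)) * W z) * (N * W z)) + (N * W z) * (N * W z)"
    using g_le[OF z] fb_le[OF z] N_pos p4 W_nonneg[of z] by (intro add_mono mult_left_mono mult_mono) auto
  also have "\<dots> = (4 * ?c + 1) * (N\<^sup>2 * (W z)\<^sup>2)" by (simp add: power2_eq_square algebra_simps)
  also have "\<dots> \<le> (5 * ?c) * (N\<^sup>2 * (2 * (?v\<^sup>2 + C\<^sup>2)))"
  proof (intro mult_mono mult_left_mono)
    show "(W z)\<^sup>2 \<le> 2 * (?v\<^sup>2 + C\<^sup>2)" unfolding W_def using sum_squares_bound[of ?v C] by (simp add: power2_sum)
    show "4 * ?c + 1 \<le> 5 * ?c" using c by linarith
  qed (use c in auto)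
  also have "\<dots> = A2 * (?v\<^sup>2 + C\<^sup>2)" by (simp add: A2_def)
  finally show ?thesis unfolding powr_half .
qed

lemma A2_nonneg: "0 \<le> A2"
  using p4 by (simp add: A2_def)

lemmas kf_assms = W_measurable(4) kf_le

lemma psi_le: "z \<in> space M \<Longrightarrow> \<bar>\<psi> z\<bar> \<le> (6 * E * W z)\<^sup>2"
proof -
  assume z: "z \<in> space M"
  let ?v = "V z powr (1 / p)"
  have CC: "piV powr (1 / (p / 2)) = C\<^sup>2" by (simp only: powr_half C_def)
  have vW: "?v\<^sup>2 + C\<^sup>2 \<le> (W z)\<^sup>2" unfolding W_def using C_ge1 by (simp add: power2_sum)
  have "\<bar>poisson kf z\<bar> \<le> 2 * A2 * (1 + C\<^sup>2) * \<kappa> powr (1 / (p / 2)) * real \<tau> * (p / 2) * (V z powr (1 / (p / 2)) + piV powr (1 / (p / 2)))"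
    by (rule poisson_le[OF kf_assms _ _ A2_nonneg z]) (use p4 in auto)
  also have "\<dots> = 2 * A2 * (1 + C\<^sup>2) * \<kappa> powr (2 / p) * real \<tau> * (p / 2) * (?v\<^sup>2 + C\<^sup>2)"
    unfolding CC powr_half[of "V z"] by simp
  also have "\<dots> \<le> 2 * A2 * (C\<^sup>2 + C\<^sup>2) * \<kappa> powr (2 / p) * real \<tau> * (p / 2) * (W z)\<^sup>2"
    using C_ge1 A2_nonneg p4 vW by (intro mult_mono mult_left_mono mult_right_mono mult_nonneg_nonneg) (auto simp: one_le_power)
  also have "\<dots> = 20 * (p * real \<tau> * N * C * W z)\<^sup>2 * (\<kappa> powr (1 / p) * \<kappa> powr (2 / p))"
    by (simp add: A2_def power2_eq_square)
  also have "\<dots> \<le> 20 * (p * real \<tau> * N * C * W z)\<^sup>2 * (\<kappa> powr (2 / p) * \<kappa> powr (2 / p))"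
    using p4 by (intro mult_left_mono mult_right_mono kappa_powr_le) (auto simp: field_simps)
  also have "\<dots> = 20 * (E * W z)\<^sup>2" by (simp add: E_def power2_eq_square)
  finally have 1: "\<bar>poisson kf z\<bar> \<le> 20 * (E * W z)\<^sup>2" .
  \<comment> \<open>In units of (E W)^2 the Poisson solution contributes 20 and g^2 contributes 4;
    the sum is rounded up to the square 36.\<close>
  have "(g z)\<^sup>2 \<le> (2 * E * W z)\<^sup>2"
    using g_le_E[OF z] by (metis abs_le_square_iff abs_ge_self order_trans)
  moreover have "(2 * E * W z)\<^sup>2 = 4 * (E * W z)\<^sup>2" "(6 * E * W z)\<^sup>2 = 36 * (E * W z)\<^sup>2"
    by (simp_all add: power_mult_distrib)
  ultimately show ?thesis using 1 zero_le_power2[of "g z"] zero_le_power2[of "E * W z"]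
    unfolding \<psi>_def by (simp only: abs_le_iff) linarith
qed

lemma poisson_kf_le: "z \<in> space M \<Longrightarrow> \<bar>poisson kf z\<bar> \<le> 2 * (6 * E * W z)\<^sup>2"
proof -
  assume z: "z \<in> space M"
  have "(g z)\<^sup>2 \<le> (6 * E * W z)\<^sup>2"
  proof -
    have "2 * E * W z \<le> 6 * E * W z" using N_le_E(4) W_nonneg[of z] by (intro mult_right_mono) auto
    then show ?thesis using g_le_E[OF z] by (metis abs_le_square_iff abs_ge_self order_trans)
  qed
  then show ?thesis using psi_le[OF z] zero_le_power2[of "g z"] unfolding \<psi>_def by (simp only: abs_le_iff) linarith
qed

lemma Q_g: "z \<in> space M \<Longrightarrow> (\<integral>y. g y \<partial>Q z) = g z - fb z"
  unfolding g_def centered_def using poisson_eq[OF f_meas f_le' _ _ _] p4 N_pos by simp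

lemma Q_kf: "z \<in> space M \<Longrightarrow> (\<integral>y. poisson kf y \<partial>Q z) = poisson kf z - (kf z - (\<integral>z. kf z \<partial>\<pi>))"
  using poisson_eq[OF kf_assms _ _ A2_nonneg] p4 by simp

lemma Q_g_finite: "z \<in> space M \<Longrightarrow> (\<integral>\<^sup>+y. ennreal \<bar>g y\<bar> \<partial>Q z) < \<infinity>"
  unfolding g_def Q_eq_kernel using p4 N_pos
  by (intro V_bounded_abs_finite[OF poisson_measurable[OF f_meas] poisson_V_bound[OF f_meas f_le']]) auto

lemma Q_kf_finite: "z \<in> space M \<Longrightarrow> (\<integral>\<^sup>+y. ennreal \<bar>poisson kf y\<bar> \<partial>Q z) < \<infinity>"
  unfolding Q_eq_kernel using p4 A2_nonneg
  by (intro V_bounded_abs_finite[OF poisson_measurable[OF kf_assms(1)] poisson_V_bound[OF kf_assms]]) auto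

lemma V_bound_product:
  assumes "\<And>z. z \<in> space M \<Longrightarrow> \<bar>h z\<bar> \<le> a * W z" "\<And>z. z \<in> space M \<Longrightarrow> \<bar>h' z\<bar> \<le> a' * W z" and z: "z \<in> space M"
  shows "\<bar>h z * h' z\<bar> \<le> (a * a' * (1 + C)\<^sup>2) * V z"
proof -
  have "\<bar>h z * h' z\<bar> \<le> (a * W z) * (a' * W z)"
    unfolding abs_mult using assms(1)[OF z] assms(2)[OF z] by (intro mult_mono) auto
  also have "\<dots> = a * a' * (W z)\<^sup>2" by (simp add: power2_eq_square)
  also have "\<dots> \<le> a * a' * ((1 + C)\<^sup>2 * V z)"
  proof (rule mult_left_mono)
    have v: "1 \<le> V z powr (1 / p)" using V_powr_ge1[OF z] p4 by simp
    have "W z \<le> (1 + C) * V z powr (1 / p)" unfolding W_def using mult_left_mono[OF v, of C] C_ge1 by (simp add: algebra_simps)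
    then have "(W z)\<^sup>2 \<le> ((1 + C) * V z powr (1 / p))\<^sup>2" using W_nonneg by (intro power_mono) auto
    also have "\<dots> = (1 + C)\<^sup>2 * V z powr (1 / (p / 2))" by (simp only: powr_half power_mult_distrib)
    also have "\<dots> \<le> (1 + C)\<^sup>2 * V z" using V_powr_le[OF z, of "p / 2"] p4 by (intro mult_left_mono) auto
    finally show "(W z)\<^sup>2 \<le> (1 + C)\<^sup>2 * V z" .
    have "0 \<le> a * W z" "0 \<le> a' * W z" using assms(1)[OF z] assms(2)[OF z] by linarith+
    then have "0 \<le> a" "0 \<le> a'" using W_ge1[OF z] by (simp_all add: zero_le_mult_iff)
    then show "0 \<le> a * a'" by simp
  qed
  finally show ?thesis by (simp add: mult.assoc)
qed

text \<open>The drift of the corrected square is \<sigma>^2. The series for \<pi>(fb g) starts at n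
  = 0, so doubling it counts \<pi>(fb^2) twice, and the term -fb^2 of \<open>kf\<close> removes one
  copy.\<close>

lemma pi_kf: "(\<integral>z. kf z \<partial>\<pi>) = asymp_var M Q \<pi> f"
proof -
  have gW: "\<And>z. z \<in> space M \<Longrightarrow> \<bar>g z\<bar> \<le> (2 * E) * W z" and fW: "\<And>z. z \<in> space M \<Longrightarrow> \<bar>fb z\<bar> \<le> E * W z"
    using g_le_E fb_le_E by auto
  have ig: "integrable \<pi> (\<lambda>z. fb z * g z)"
    by (rule V_bounded_integrable(2)[OF _ V_bound_product[OF fW gW]]) auto
  have iff: "integrable \<pi> (\<lambda>z. fb z * fb z)"
    by (rule V_bounded_integrable(2)[OF _ V_bound_product[OF fW fW]]) auto
  have fW': "\<And>z. z \<in> space M \<Longrightarrow> \<bar>fb z\<bar> \<le> E * (V z powr (1 / p) + C)" using fb_le_E by (simp add: W_def)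
  let ?t = "\<lambda>n. \<integral>z. fb z * (T n f z - (\<integral>z. f z \<partial>\<pi>)) \<partial>\<pi>"
  have I: "(\<integral>z. fb z * g z \<partial>\<pi>) = (\<Sum>n. ?t n)" "summable ?t"
    unfolding g_def using p4 N_pos N_le_E(4) C_ge1
    by (intro integral_mult_poisson[OF f_meas f_le' _ _ _ W_measurable(2) fW']; simp)+
  have t0: "?t 0 = (\<integral>z. fb z * fb z \<partial>\<pi>)"
    using pi_space f_meas by (intro Bochner_Integration.integral_cong) (auto simp: integral_return centered_def)
  have tS: "?t n = (\<integral>z. fb z * T n fb z \<partial>\<pi>)" for n
  proof (intro Bochner_Integration.integral_cong refl arg_cong[of _ _ "\<lambda>x. _ * x"])
    fix z assume "z \<in> space \<pi>"
    then have z: "z \<in> space M" using pi_space by simp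
    interpret prob_space "kernel_power M Q n z" by (rule kernel_space[OF z])
    show "T n f z - (\<integral>z. f z \<partial>\<pi>) = T n fb z"
      unfolding centered_def using V_bounded_integrable(1)[OF f_meas f_V_bound z] by (simp add: prob_space)
  qed
  have "(\<Sum>n. ?t n) = (\<integral>z. fb z * fb z \<partial>\<pi>) + (\<Sum>n. ?t (Suc n))"
    using suminf_split_head[OF I(2)] t0 by simp
  moreover have "(\<integral>z. kf z \<partial>\<pi>) = 2 * (\<integral>z. fb z * g z \<partial>\<pi>) - (\<integral>z. fb z * fb z \<partial>\<pi>)"
  proof -
    have "(\<integral>z. kf z \<partial>\<pi>) = (\<integral>z. 2 * (fb z * g z) - fb z * fb z \<partial>\<pi>)"
      unfolding kf_def by (intro Bochner_Integration.integral_cong) (auto simp: power2_eq_square)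
    then show ?thesis using ig iff by simp
  qed
  ultimately show ?thesis using I(1) unfolding asymp_var_def tS by (simp add: power2_eq_square del: kernel_power.simps)
qed

end

context vge_chain
begin

lemma pi_prob_algebra: "\<pi> \<in> space (prob_algebra M)"
  using pi_space by (simp add: space_prob_algebra)

lemma nn_integral_stationary_path:
  "h \<in> borel_measurable M \<Longrightarrow> (\<integral>\<^sup>+\<omega>. h (\<omega> l) \<partial>markov_law M Q \<pi>) = (\<integral>\<^sup>+z. h z \<partial>\<pi>)"
  by (simp add: nn_integral_path[OF pi_prob_algebra] nn_integral_pi)

lemma lp_le_stationary:
  assumes h: "h \<in> borel_measurable M" and L: "lp_le \<pi> q h a"
  shows "lp_le (markov_law M Q \<pi>) q (\<lambda>\<omega>. h (\<omega> l)) a"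
proof -
  note [measurable] = h
  have "(\<integral>\<^sup>+\<omega>. ennreal (\<bar>h (\<omega> l)\<bar> powr q) \<partial>markov_law M Q \<pi>) = (\<integral>\<^sup>+z. ennreal (\<bar>h z\<bar> powr q) \<partial>\<pi>)"
    by (rule nn_integral_stationary_path[where h="\<lambda>z. ennreal (\<bar>h z\<bar> powr q)"]) measurable
  then show ?thesis using L by (simp add: lp_le_def measurable_path[OF pi_prob_algebra])
qed

end

section \<open>Moments of the Poisson martingale in stationarity\<close>

context additive_functional
begin

abbreviation "P \<equiv> markov_law M Q \<pi>"
abbreviation "\<Omega> \<equiv> \<Pi>\<^sub>M i\<in>(UNIV::nat set). M"

lemmas path_simps [simp] = space_path[OF pi_prob_algebra] measurable_path[OF pi_prob_algebra]

interpretation path: prob_space P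
  by (rule prob_space_path[OF pi_prob_algebra])

lemma lp_W: "lp_le P p (\<lambda>\<omega>. W (\<omega> l)) (2 * C)"
proof (rule lp_le_stationary)
  interpret prob_space \<pi> by (rule pi_space)
  have Cp: "C powr p = piV" using p4 piV_ge1 by (simp add: C_def powr_powr)
  have "(\<integral>\<^sup>+z. ennreal (\<bar>V z powr (1 / p)\<bar> powr p) \<partial>\<pi>) = (\<integral>\<^sup>+z. ennreal (V z) \<partial>\<pi>)"
    using p4 V_pos pi_space by (intro nn_integral_cong) (auto simp: powr_powr less_imp_le)
  then have Vp: "(\<integral>\<^sup>+z. ennreal (\<bar>V z powr (1 / p)\<bar> powr p) \<partial>\<pi>) = ennreal piV" by (simp add: piV_nn)
  have "lp_le \<pi> p (\<lambda>z. V z powr (1 / p)) C"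
  proof -
    have "(\<lambda>z. V z powr (1 / p)) \<in> borel_measurable \<pi>" by measurable
    then show ?thesis using C_ge1 Vp unfolding lp_le_def Cp by simp
  qed
  moreover have "lp_le \<pi> p (\<lambda>z. C) C"
    using C_ge1 by (simp add: lp_le_def emeasure_space_1)
  ultimately show "lp_le \<pi> p W (2 * C)"
    using lp_le_add[of \<pi> p "\<lambda>z. V z powr (1 / p)" C "\<lambda>_. C" C] p4 by (simp add: W_def[abs_def])
qed simp

lemma lp_bounded_by_W:
  assumes h: "h \<in> borel_measurable M" and le: "\<And>z. z \<in> space M \<Longrightarrow> \<bar>h z\<bar> \<le> a * W z" and a: "0 \<le> a"
  shows "lp_le P p (\<lambda>\<omega>. h (\<omega> l)) (a * (2 * C))"
proof (rule lp_le_mono)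
  show "lp_le P p (\<lambda>\<omega>. a * W (\<omega> l)) (a * (2 * C))"
    using lp_le_cmult[OF lp_W, of a] a by simp
  show "\<bar>h (\<omega> l)\<bar> \<le> \<bar>a * W (\<omega> l)\<bar>" if "\<omega> \<in> space P" for \<omega>
    using le[of "\<omega> l"] space_path_component[of \<omega> M l] that by (auto intro: order_trans)
qed (use h p4 in simp_all)

definition poisson_mart :: "nat \<Rightarrow> (nat \<Rightarrow> 'a) \<Rightarrow> real" where
  "poisson_mart l \<omega> = (\<Sum>i<l. fb (\<omega> i)) + g (\<omega> l)"

lemma poisson_mart_measurable [measurable]: "poisson_mart l \<in> borel_measurable \<Omega>"
  unfolding poisson_mart_def[abs_def] by measurable

lemma poisson_mart_Suc: "poisson_mart (Suc l) \<omega> = poisson_mart l \<omega> + (fb (\<omega> l) + g (\<omega> (Suc l)) - g (\<omega> l))"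
  by (simp add: poisson_mart_def)

lemma poisson_mart_stop: "i \<le> l \<Longrightarrow> poisson_mart i (stop_path l \<omega>) = poisson_mart i \<omega>"
  by (simp add: poisson_mart_def stop_path_apply min_absorb1)

text \<open>Multiplication by an F known at time l is harmless, so the Poisson equation Q g = g - fb
  holds under the integral.\<close>

lemma integral_g_step:
  assumes F: "F \<in> borel_measurable \<Omega>" "\<And>\<omega>. F (stop_path l \<omega>) = F \<omega>"
    and i: "integrable P (\<lambda>\<omega>. F \<omega> * g (\<omega> (Suc l)))"
  shows "(\<integral>\<omega>. F \<omega> * g (\<omega> (Suc l)) \<partial>P) = (\<integral>\<omega>. F \<omega> * (g (\<omega> l) - fb (\<omega> l)) \<partial>P)"
proof -
  have "(\<integral>\<omega>. F \<omega> * g (\<omega> (Suc l)) \<partial>P) = (\<integral>\<omega>. F \<omega> * (\<integral>y. g y \<partial>Q (\<omega> l)) \<partial>P)"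
    by (rule integral_path_step(2)[OF pi_prob_algebra F W_measurable(3) Q_g_finite i])
  also have "\<dots> = (\<integral>\<omega>. F \<omega> * (g (\<omega> l) - fb (\<omega> l)) \<partial>P)"
    using space_path_component[of _ M l] by (intro Bochner_Integration.integral_cong) (auto simp: Q_g)
  finally show ?thesis .
qed

lemma integral_kf_step:
  assumes F: "F \<in> borel_measurable \<Omega>" "\<And>\<omega>. F (stop_path l \<omega>) = F \<omega>"
    and i: "integrable P (\<lambda>\<omega>. F \<omega> * poisson kf (\<omega> (Suc l)))"
  shows "(\<integral>\<omega>. F \<omega> * poisson kf (\<omega> (Suc l)) \<partial>P) = (\<integral>\<omega>. F \<omega> * (poisson kf (\<omega> l) - (kf (\<omega> l) - asymp_var M Q \<pi> f)) \<partial>P)"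
proof -
  have "(\<integral>\<omega>. F \<omega> * poisson kf (\<omega> (Suc l)) \<partial>P) = (\<integral>\<omega>. F \<omega> * (\<integral>y. poisson kf y \<partial>Q (\<omega> l)) \<partial>P)"
    by (rule integral_path_step(2)[OF pi_prob_algebra F poisson_measurable[OF W_measurable(4)] Q_kf_finite i])
  also have "\<dots> = (\<integral>\<omega>. F \<omega> * (poisson kf (\<omega> l) - (kf (\<omega> l) - asymp_var M Q \<pi> f)) \<partial>P)"
    using space_path_component[of _ M l] by (intro Bochner_Integration.integral_cong) (auto simp: Q_kf pi_kf)
  finally show ?thesis .
qed

lemma poisson_kf_measurable [measurable]: "poisson kf \<in> borel_measurable M"
  by (rule poisson_measurable[OF W_measurable(4)])

lemma p_nat: "p = real (k + 4)" "even (k + 4)" "0 < k + 4"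
  using k_even by (simp_all add: p_def)

context
  fixes a b :: nat
  assumes iX: "integrable P (\<lambda>\<omega>. poisson_mart a \<omega> ^ (k + 4))"
begin

text \<open>An integrable majorant for everything that occurs in the block from a to a + b. It only
  certifies integrability, so summing over all times up to a + b is affordable; the quantitative
  bounds use the variable \<open>G\<close> of \<open>lp_poisson_mart_blocks\<close>.\<close>

definition envelope :: "(nat \<Rightarrow> 'a) \<Rightarrow> real" where
  "envelope \<omega> = \<bar>poisson_mart a \<omega>\<bar> + (\<Sum>l\<le>a + b. 6 * E * W (\<omega> l))"

lemma envelope_measurable [measurable]: "envelope \<in> borel_measurable \<Omega>"
  unfolding envelope_def[abs_def] by measurable

lemma envelope_integrable: "integrable P (\<lambda>\<omega>. envelope \<omega> ^ (k + 4))"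
proof -
  define a0 where "a0 = root (k + 4) (\<integral>\<omega>. poisson_mart a \<omega> ^ (k + 4) \<partial>P)"
  have "0 \<le> (\<integral>\<omega>. poisson_mart a \<omega> ^ (k + 4) \<partial>P)" using k_even by (intro Bochner_Integration.integral_nonneg) (simp add: zero_le_even_power)
  then have a0: "0 \<le> a0" "a0 ^ (k + 4) = (\<integral>\<omega>. poisson_mart a \<omega> ^ (k + 4) \<partial>P)"
    unfolding a0_def by (auto simp: real_root_ge_zero intro!: real_root_pow_pos2)
  have "lp_le P p (poisson_mart a) a0"
    unfolding p_nat(1) using iX a0 p_nat by (subst lp_le_even_iff) auto
  then have "lp_le P p (\<lambda>\<omega>. \<bar>poisson_mart a \<omega>\<bar>) a0"
    by (rule lp_le_mono) (use p4 in auto)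
  moreover have "lp_le P p (\<lambda>\<omega>. \<Sum>l\<le>a + b. 6 * E * W (\<omega> l)) (\<Sum>l\<le>a + b. \<bar>6 * E\<bar> * (2 * C))"
    using p4 by (intro lp_le_sum lp_le_cmult lp_W) auto
  ultimately have "lp_le P p envelope (a0 + (\<Sum>l\<le>a + b. \<bar>6 * E\<bar> * (2 * C)))"
    unfolding envelope_def[abs_def] using p4 by (intro lp_le_add) auto
  then have "lp_le P (real (k + 4)) envelope (a0 + (\<Sum>l\<le>a + b. \<bar>6 * E\<bar> * (2 * C)))" unfolding p_nat(1) .
  then show ?thesis
    using lp_le_even_iff[OF p_nat(2,3), of envelope P "a0 + (\<Sum>l\<le>a + b. \<bar>6 * E\<bar> * (2 * C))"] by (auto simp: lp_le_def)
qed

lemma envelope_bounds: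
  assumes "\<omega> \<in> space \<Omega>"
  shows "\<bar>poisson_mart a \<omega>\<bar> \<le> envelope \<omega>" "0 \<le> envelope \<omega>" "l \<le> a + b \<Longrightarrow> 6 * E * W (\<omega> l) \<le> envelope \<omega>"
    "l \<le> a + b \<Longrightarrow> \<bar>g (\<omega> l)\<bar> \<le> envelope \<omega>" "l \<le> a + b \<Longrightarrow> \<bar>fb (\<omega> l)\<bar> \<le> envelope \<omega>" "l \<le> a + b \<Longrightarrow> \<bar>\<psi> (\<omega> l)\<bar> \<le> (envelope \<omega>)\<^sup>2"
    "l \<le> a + b \<Longrightarrow> \<bar>poisson kf (\<omega> l)\<bar> \<le> 2 * (envelope \<omega>)\<^sup>2"
    "i \<le> b \<Longrightarrow> \<bar>poisson_mart (a + i) \<omega> - poisson_mart a \<omega>\<bar> \<le> 3 * envelope \<omega>"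
proof -
  have z: "\<omega> l \<in> space M" for l by (rule space_path_component[OF assms])
  have E: "0 < E" by (rule N_le_E)
  have nn: "0 \<le> 6 * E * W (\<omega> l)" for l using E W_nonneg by simp
  show 1: "\<bar>poisson_mart a \<omega>\<bar> \<le> envelope \<omega>" "0 \<le> envelope \<omega>" unfolding envelope_def by (auto intro!: add_nonneg_nonneg sum_nonneg nn)
  have 2: "6 * E * W (\<omega> l) \<le> envelope \<omega>" if "l \<le> a + b" for l
    using member_le_sum[of l "{..a + b}" "\<lambda>l. 6 * E * W (\<omega> l)"] nn that unfolding envelope_def by auto
  then show "l \<le> a + b \<Longrightarrow> 6 * E * W (\<omega> l) \<le> envelope \<omega>" .
  have EW: "0 \<le> E * W (\<omega> l)" for l using E W_nonneg by simp
  have 3: "\<bar>g (\<omega> l)\<bar> \<le> envelope \<omega>" if "l \<le> a + b" for l using g_le_E[OF z[of l]] 2[OF that] EW[of l] by linarith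
  then show "l \<le> a + b \<Longrightarrow> \<bar>g (\<omega> l)\<bar> \<le> envelope \<omega>" .
  show "l \<le> a + b \<Longrightarrow> \<bar>fb (\<omega> l)\<bar> \<le> envelope \<omega>" using fb_le_E[OF z[of l]] 2[of l] EW[of l] by linarith
  have sq: "(6 * E * W (\<omega> l))\<^sup>2 \<le> (envelope \<omega>)\<^sup>2" if "l \<le> a + b" for l using 2[OF that] nn by (intro power_mono) auto
  show "l \<le> a + b \<Longrightarrow> \<bar>\<psi> (\<omega> l)\<bar> \<le> (envelope \<omega>)\<^sup>2" using psi_le[OF z[of l]] sq[of l] by linarith
  show "l \<le> a + b \<Longrightarrow> \<bar>poisson kf (\<omega> l)\<bar> \<le> 2 * (envelope \<omega>)\<^sup>2" using poisson_kf_le[OF z[of l]] sq[of l] by linarith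
  show "i \<le> b \<Longrightarrow> \<bar>poisson_mart (a + i) \<omega> - poisson_mart a \<omega>\<bar> \<le> 3 * envelope \<omega>"
  proof -
    assume i: "i \<le> b"
    have "poisson_mart (a + i) \<omega> - poisson_mart a \<omega> = (\<Sum>l\<in>{a..<a + i}. fb (\<omega> l)) + g (\<omega> (a + i)) - g (\<omega> a)"
    proof -
      have "(\<Sum>l<a + i. fb (\<omega> l)) = (\<Sum>l<a. fb (\<omega> l)) + (\<Sum>l\<in>{a..<a + i}. fb (\<omega> l))"
        by (subst sum.union_disjoint[symmetric]) (auto intro!: sum.cong)
      then show ?thesis by (simp add: poisson_mart_def)
    qed
    moreover have "\<bar>\<Sum>l\<in>{a..<a + i}. fb (\<omega> l)\<bar> \<le> envelope \<omega>"
    proof -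
      have "\<bar>\<Sum>l\<in>{a..<a + i}. fb (\<omega> l)\<bar> \<le> (\<Sum>l\<in>{a..<a + i}. \<bar>fb (\<omega> l)\<bar>)" by (rule sum_abs)
      also have "\<dots> \<le> (\<Sum>l\<in>{a..<a + i}. 6 * E * W (\<omega> l))"
      proof (rule sum_mono)
        show "\<bar>fb (\<omega> l)\<bar> \<le> 6 * E * W (\<omega> l)" for l using fb_le_E[OF z[of l]] EW[of l] by linarith
      qed
      also have "\<dots> \<le> (\<Sum>l\<le>a + b. 6 * E * W (\<omega> l))" using i nn by (intro sum_mono2) auto
      also have "\<dots> \<le> envelope \<omega>" by (simp add: envelope_def)
      finally show ?thesis .
    qed
    ultimately show ?thesis using 3[of a] 3[of "a + i"] i by linarith
  qed
qed

text \<open>The integrands of the next two lemmas are homogeneous: a power of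
  \<open>poisson_mart a\<close> times a factor bounded by a power of the envelope, of total degree
  at most k + 4. The case of total degree k + 4 is isolated here.\<close>

lemma R_integrable_bound:
  assumes "h \<in> borel_measurable \<Omega>" "\<And>\<omega>. \<omega> \<in> space \<Omega> \<Longrightarrow> \<bar>h \<omega>\<bar> \<le> w * envelope \<omega> ^ l" and l: "l + r = k + 4"
  shows "integrable P (\<lambda>\<omega>. poisson_mart a \<omega> ^ r * h \<omega>)"
proof (rule Bochner_Integration.integrable_bound)
  show "integrable P (\<lambda>\<omega>. w * envelope \<omega> ^ (k + 4))" using envelope_integrable by simp
  show "AE \<omega> in P. norm (poisson_mart a \<omega> ^ r * h \<omega>) \<le> norm (w * envelope \<omega> ^ (k + 4))"
  proof (rule AE_I2)
    fix \<omega> assume "\<omega> \<in> space P"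
    then have w: "\<omega> \<in> space \<Omega>" by simp
    have "\<bar>poisson_mart a \<omega>\<bar> ^ r * \<bar>h \<omega>\<bar> \<le> envelope \<omega> ^ r * (w * envelope \<omega> ^ l)"
      using envelope_bounds(1,2)[OF w] assms(2)[OF w] by (intro mult_mono power_mono) auto
    also have "\<dots> = w * envelope \<omega> ^ (k + 4)" unfolding l[symmetric] by (simp add: power_add)
    finally have "norm (poisson_mart a \<omega> ^ r * h \<omega>) \<le> w * envelope \<omega> ^ (k + 4)" by (simp add: abs_mult power_abs)
    then show "norm (poisson_mart a \<omega> ^ r * h \<omega>) \<le> norm (w * envelope \<omega> ^ (k + 4))"
      by (rule order_trans) (simp only: real_norm_def abs_ge_self)
  qed
qed (use assms in simp)

text \<open>Each one-step increment has conditional mean 0 by Q g = g - fb, and the power of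
  \<open>poisson_mart a\<close> is known at time a. Summing over the block needs only induction on
  its length.\<close>

lemma martingale_block:
  assumes "i \<le> b"
  shows "(\<integral>\<omega>. poisson_mart a \<omega> ^ (k + 3) * (poisson_mart (a + i) \<omega> - poisson_mart a \<omega>) \<partial>P) = 0"
  using assms
proof (induction i)
  case 0 then show ?case by simp
next
  case (Suc i)
  let ?F = "\<lambda>\<omega>. poisson_mart a \<omega> ^ (k + 3)" and ?l = "a + i"
  have i1: "integrable P (\<lambda>\<omega>. ?F \<omega> * (poisson_mart ?l \<omega> - poisson_mart a \<omega>))"
    by (rule R_integrable_bound[of _ 3 1]) (use envelope_bounds(8)[of _ i] Suc.prems in simp_all)
  have i2: "integrable P (\<lambda>\<omega>. ?F \<omega> * g (\<omega> (Suc ?l)))"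
    by (rule R_integrable_bound[of _ 1 1]) (use envelope_bounds(4) Suc.prems in simp_all)
  have i3: "integrable P (\<lambda>\<omega>. ?F \<omega> * (g (\<omega> ?l) - fb (\<omega> ?l)))"
  proof (rule R_integrable_bound[of _ 2 1])
    fix \<omega> assume w: "\<omega> \<in> space \<Omega>"
    show "\<bar>g (\<omega> ?l) - fb (\<omega> ?l)\<bar> \<le> 2 * envelope \<omega> ^ 1"
      using envelope_bounds(4)[OF w, of ?l] envelope_bounds(5)[OF w, of ?l] Suc.prems by simp
  qed simp_all
  have s: "(\<integral>\<omega>. ?F \<omega> * g (\<omega> (Suc ?l)) \<partial>P) = (\<integral>\<omega>. ?F \<omega> * (g (\<omega> ?l) - fb (\<omega> ?l)) \<partial>P)"
    by (rule integral_g_step[OF _ _ i2]) (simp_all add: poisson_mart_stop)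
  have "(\<integral>\<omega>. ?F \<omega> * (poisson_mart (a + Suc i) \<omega> - poisson_mart a \<omega>) \<partial>P) =
      (\<integral>\<omega>. ?F \<omega> * (poisson_mart ?l \<omega> - poisson_mart a \<omega>) + ?F \<omega> * g (\<omega> (Suc ?l)) - ?F \<omega> * (g (\<omega> ?l) - fb (\<omega> ?l)) \<partial>P)"
    by (intro Bochner_Integration.integral_cong) (simp_all add: poisson_mart_Suc algebra_simps)
  also have "\<dots> = 0" using i1 i2 i3 s Suc by simp
  finally show ?case .
qed

lemma quadratic_block:
  assumes "i \<le> b"
  shows "(\<integral>\<omega>. poisson_mart a \<omega> ^ (k + 2) * ((poisson_mart (a + i) \<omega> - poisson_mart a \<omega>)\<^sup>2 + \<psi> (\<omega> (a + i))) \<partial>P) =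
    (\<integral>\<omega>. poisson_mart a \<omega> ^ (k + 2) * \<psi> (\<omega> a) \<partial>P) + real i * asymp_var M Q \<pi> f * (\<integral>\<omega>. poisson_mart a \<omega> ^ (k + 2) \<partial>P)"
  using assms
proof (induction i)
  case 0 then show ?case by simp
next
  case (Suc i)
  let ?F = "\<lambda>\<omega>. poisson_mart a \<omega> ^ (k + 2)" and ?l = "a + i" and ?\<sigma> = "asymp_var M Q \<pi> f"
  let ?D = "\<lambda>\<omega>. poisson_mart ?l \<omega> - poisson_mart a \<omega>" and ?e = "\<lambda>\<omega>. g (\<omega> ?l) - fb (\<omega> ?l)"
  have sq: "x\<^sup>2 \<le> c\<^sup>2 * r\<^sup>2" if "\<bar>x\<bar> \<le> c * r" for x c r :: real
    using power_mono[OF that, of 2] by (simp add: power_mult_distrib)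
  have b5: "\<bar>?D \<omega> - ?e \<omega>\<bar> \<le> 5 * envelope \<omega>" if w: "\<omega> \<in> space \<Omega>" for \<omega>
    using envelope_bounds(8)[OF w, of i] envelope_bounds(4)[OF w, of ?l] envelope_bounds(5)[OF w, of ?l] Suc.prems by simp
  have b2: "\<bar>?e \<omega>\<bar> \<le> 2 * envelope \<omega>" if w: "\<omega> \<in> space \<Omega>" for \<omega>
    using envelope_bounds(4)[OF w, of ?l] envelope_bounds(5)[OF w, of ?l] Suc.prems by simp
  have iF: "integrable P ?F"
  proof -
    have "integrable P (\<lambda>\<omega>. \<bar>poisson_mart a \<omega>\<bar> ^ (k + 4))" using iX k_even by (simp add: power_even_abs)
    from path.integrable_mult_power[OF _ _ this, of "\<lambda>_. 1" "k + 2" 2] show ?thesis by simp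
  qed
  have i1: "integrable P (\<lambda>\<omega>. ?F \<omega> * (?D \<omega> - ?e \<omega>)\<^sup>2)"
  proof (rule R_integrable_bound[of _ 25 2])
    show "\<bar>(?D \<omega> - ?e \<omega>)\<^sup>2\<bar> \<le> 25 * envelope \<omega> ^ 2" if "\<omega> \<in> space \<Omega>" for \<omega>
      using sq[OF b5[OF that]] by simp
  qed simp_all
  have i2: "integrable P (\<lambda>\<omega>. ?F \<omega> * ((2 * (?D \<omega> - ?e \<omega>)) * h \<omega>))"
    if "h \<in> borel_measurable \<Omega>" "\<And>\<omega>. \<omega> \<in> space \<Omega> \<Longrightarrow> \<bar>h \<omega>\<bar> \<le> 2 * envelope \<omega>" for h
  proof (rule R_integrable_bound[of _ 20 2])
    fix \<omega> assume w: "\<omega> \<in> space \<Omega>"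
    have "\<bar>?D \<omega> - ?e \<omega>\<bar> * \<bar>h \<omega>\<bar> \<le> (5 * envelope \<omega>) * (2 * envelope \<omega>)"
      using b5[OF w] that(2)[OF w] envelope_bounds(2)[OF w] by (intro mult_mono) auto
    moreover have e: "\<bar>(2 * x) * y\<bar> = 2 * (\<bar>x\<bar> * \<bar>y\<bar>)" for x y :: real by (simp add: abs_mult)
    ultimately show "\<bar>(2 * (?D \<omega> - ?e \<omega>)) * h \<omega>\<bar> \<le> 20 * (envelope \<omega>)\<^sup>2"
      unfolding power2_eq_square e by linarith
  qed (use that in simp_all)
  have i2g: "integrable P (\<lambda>\<omega>. ?F \<omega> * ((2 * (?D \<omega> - ?e \<omega>)) * g (\<omega> (Suc ?l))))"
  proof (rule i2)
    fix \<omega> assume w: "\<omega> \<in> space \<Omega>"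
    show "\<bar>g (\<omega> (Suc ?l))\<bar> \<le> 2 * envelope \<omega>" using envelope_bounds(4)[OF w, of "Suc ?l"] envelope_bounds(2)[OF w] Suc.prems by simp
  qed simp
  have i2e: "integrable P (\<lambda>\<omega>. ?F \<omega> * ((2 * (?D \<omega> - ?e \<omega>)) * ?e \<omega>))"
    by (rule i2) (use b2 in simp_all)
  have i3: "integrable P (\<lambda>\<omega>. ?F \<omega> * poisson kf (\<omega> (Suc ?l)))" "integrable P (\<lambda>\<omega>. ?F \<omega> * poisson kf (\<omega> ?l))"
    by (rule R_integrable_bound[of _ 2 2]; use envelope_bounds(7) Suc.prems in simp)+
  have i4: "integrable P (\<lambda>\<omega>. ?F \<omega> * kf (\<omega> ?l))"
  proof (rule R_integrable_bound[of _ 3 2])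
    fix \<omega> assume w: "\<omega> \<in> space \<Omega>"
    have r: "\<bar>g (\<omega> ?l)\<bar> \<le> envelope \<omega>" "\<bar>fb (\<omega> ?l)\<bar> \<le> envelope \<omega>" using envelope_bounds(4,5)[OF w, of ?l] Suc.prems by auto
    have "\<bar>g (\<omega> ?l) * fb (\<omega> ?l)\<bar> \<le> envelope \<omega> * envelope \<omega>" unfolding abs_mult using r by (intro mult_mono) auto
    moreover have "(fb (\<omega> ?l))\<^sup>2 \<le> envelope \<omega> * envelope \<omega>" using sq[of "fb (\<omega> ?l)" 1 "envelope \<omega>"] r by (simp add: power2_eq_square)
    ultimately show "\<bar>kf (\<omega> ?l)\<bar> \<le> 3 * (envelope \<omega>)\<^sup>2" unfolding kf_def power2_eq_square[of "envelope \<omega>"] using zero_le_power2[of "fb (\<omega> ?l)"]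
      by (simp only: abs_le_iff) linarith
  qed simp_all
  have s1: "(\<integral>\<omega>. (?F \<omega> * (2 * (?D \<omega> - ?e \<omega>))) * g (\<omega> (Suc ?l)) \<partial>P) = (\<integral>\<omega>. (?F \<omega> * (2 * (?D \<omega> - ?e \<omega>))) * ?e \<omega> \<partial>P)"
    by (rule integral_g_step) (use i2g in \<open>simp_all add: poisson_mart_stop stop_path_apply mult.assoc\<close>)
  have s2: "(\<integral>\<omega>. ?F \<omega> * poisson kf (\<omega> (Suc ?l)) \<partial>P) = (\<integral>\<omega>. ?F \<omega> * (poisson kf (\<omega> ?l) - (kf (\<omega> ?l) - ?\<sigma>)) \<partial>P)"
    by (rule integral_kf_step[OF _ _ i3(1)]) (simp_all add: poisson_mart_stop)
  \<comment> \<open>The increment up to the next time is (D - e) + g', with e = Q g at the current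
    state and g' the value of \<open>g\<close> at the next one. In its square plus \<psi> the term
    g'^2 cancels against the one inside \<psi>, so the next state enters only through g' and the
    Poisson solution of \<open>kf\<close>, both of which Q evaluates.\<close>
  have "(\<integral>\<omega>. ?F \<omega> * ((poisson_mart (a + Suc i) \<omega> - poisson_mart a \<omega>)\<^sup>2 + \<psi> (\<omega> (a + Suc i))) \<partial>P) =
      (\<integral>\<omega>. ?F \<omega> * (?D \<omega> - ?e \<omega>)\<^sup>2 + ?F \<omega> * ((2 * (?D \<omega> - ?e \<omega>)) * g (\<omega> (Suc ?l))) + ?F \<omega> * poisson kf (\<omega> (Suc ?l)) \<partial>P)"
  proof (intro Bochner_Integration.integral_cong refl)
    fix \<omega>
    have "poisson_mart (a + Suc i) \<omega> - poisson_mart a \<omega> = (?D \<omega> - ?e \<omega>) + g (\<omega> (Suc ?l))" by (simp add: poisson_mart_Suc)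
    then have "(poisson_mart (a + Suc i) \<omega> - poisson_mart a \<omega>)\<^sup>2 + \<psi> (\<omega> (a + Suc i)) = (?D \<omega> - ?e \<omega>)\<^sup>2 + (2 * (?D \<omega> - ?e \<omega>)) * g (\<omega> (Suc ?l)) + poisson kf (\<omega> (Suc ?l))"
      by (simp only: power2_sum \<psi>_def add_Suc_right)
    then show "?F \<omega> * ((poisson_mart (a + Suc i) \<omega> - poisson_mart a \<omega>)\<^sup>2 + \<psi> (\<omega> (a + Suc i))) =
       ?F \<omega> * (?D \<omega> - ?e \<omega>)\<^sup>2 + ?F \<omega> * ((2 * (?D \<omega> - ?e \<omega>)) * g (\<omega> (Suc ?l))) + ?F \<omega> * poisson kf (\<omega> (Suc ?l))"
      by (simp only: distrib_left)
  qed
  also have "\<dots> = (\<integral>\<omega>. ?F \<omega> * (?D \<omega> - ?e \<omega>)\<^sup>2 \<partial>P) + (\<integral>\<omega>. ?F \<omega> * ((2 * (?D \<omega> - ?e \<omega>)) * g (\<omega> (Suc ?l))) \<partial>P) + (\<integral>\<omega>. ?F \<omega> * poisson kf (\<omega> (Suc ?l)) \<partial>P)"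
    using i1 i2g i3 by (subst Bochner_Integration.integral_add Bochner_Integration.integrable_add; simp)+
  also have "\<dots> = (\<integral>\<omega>. ?F \<omega> * (?D \<omega> - ?e \<omega>)\<^sup>2 \<partial>P) + (\<integral>\<omega>. ?F \<omega> * ((2 * (?D \<omega> - ?e \<omega>)) * ?e \<omega>) \<partial>P) + (\<integral>\<omega>. ?F \<omega> * (poisson kf (\<omega> ?l) - (kf (\<omega> ?l) - ?\<sigma>)) \<partial>P)"
    using s1 s2 by (simp only: mult.assoc)
  also have "(\<integral>\<omega>. ?F \<omega> * (poisson kf (\<omega> ?l) - (kf (\<omega> ?l) - ?\<sigma>)) \<partial>P) = (\<integral>\<omega>. ?F \<omega> * poisson kf (\<omega> ?l) - ?F \<omega> * kf (\<omega> ?l) \<partial>P) + ?\<sigma> * (\<integral>\<omega>. ?F \<omega> \<partial>P)"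
  proof -
    have "(\<integral>\<omega>. ?F \<omega> * (poisson kf (\<omega> ?l) - (kf (\<omega> ?l) - ?\<sigma>)) \<partial>P) = (\<integral>\<omega>. (?F \<omega> * poisson kf (\<omega> ?l) - ?F \<omega> * kf (\<omega> ?l)) + ?F \<omega> * ?\<sigma> \<partial>P)"
      by (intro Bochner_Integration.integral_cong refl) (simp add: algebra_simps)
    also have "\<dots> = (\<integral>\<omega>. ?F \<omega> * poisson kf (\<omega> ?l) - ?F \<omega> * kf (\<omega> ?l) \<partial>P) + (\<integral>\<omega>. ?F \<omega> * ?\<sigma> \<partial>P)"
      using i3(2) i4 iF by (intro Bochner_Integration.integral_add) simp_all
    finally show ?thesis by simp
  qed
  also have "(\<integral>\<omega>. ?F \<omega> * (?D \<omega> - ?e \<omega>)\<^sup>2 \<partial>P) + (\<integral>\<omega>. ?F \<omega> * ((2 * (?D \<omega> - ?e \<omega>)) * ?e \<omega>) \<partial>P) + ((\<integral>\<omega>. ?F \<omega> * poisson kf (\<omega> ?l) - ?F \<omega> * kf (\<omega> ?l) \<partial>P) + ?\<sigma> * (\<integral>\<omega>. ?F \<omega> \<partial>P))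
    = (\<integral>\<omega>. ?F \<omega> * ((?D \<omega>)\<^sup>2 + \<psi> (\<omega> ?l)) \<partial>P) + ?\<sigma> * (\<integral>\<omega>. ?F \<omega> \<partial>P)"
  proof -
    \<comment> \<open>Reassembly at the current state: (D - e)^2 + 2 (D - e) e = D^2 - e^2, and e^2
      + kf = g^2 restores the term inside \<psi>.\<close>
    have "(\<integral>\<omega>. ?F \<omega> * ((?D \<omega>)\<^sup>2 + \<psi> (\<omega> ?l)) \<partial>P) = (\<integral>\<omega>. (?F \<omega> * (?D \<omega> - ?e \<omega>)\<^sup>2 + ?F \<omega> * ((2 * (?D \<omega> - ?e \<omega>)) * ?e \<omega>)) + (?F \<omega> * poisson kf (\<omega> ?l) - ?F \<omega> * kf (\<omega> ?l)) \<partial>P)"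
    proof (intro Bochner_Integration.integral_cong refl)
      fix \<omega>
      have "(x :: real)\<^sup>2 + (q - G\<^sup>2) = (x - (G - h))\<^sup>2 + (2 * (x - (G - h))) * (G - h) + (q - (2 * G * h - h\<^sup>2))" for x q G h
        by (simp add: power2_eq_square algebra_simps)
      from this[of "?D \<omega>" "poisson kf (\<omega> ?l)" "g (\<omega> ?l)" "fb (\<omega> ?l)"]
      show "?F \<omega> * ((?D \<omega>)\<^sup>2 + \<psi> (\<omega> ?l)) = (?F \<omega> * (?D \<omega> - ?e \<omega>)\<^sup>2 + ?F \<omega> * ((2 * (?D \<omega> - ?e \<omega>)) * ?e \<omega>)) + (?F \<omega> * poisson kf (\<omega> ?l) - ?F \<omega> * kf (\<omega> ?l))"
        unfolding \<psi>_def kf_def by (simp only: distrib_left right_diff_distrib)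
    qed
    also have "\<dots> = (\<integral>\<omega>. ?F \<omega> * (?D \<omega> - ?e \<omega>)\<^sup>2 + ?F \<omega> * ((2 * (?D \<omega> - ?e \<omega>)) * ?e \<omega>) \<partial>P) + (\<integral>\<omega>. ?F \<omega> * poisson kf (\<omega> ?l) - ?F \<omega> * kf (\<omega> ?l) \<partial>P)"
      using i1 i2e i3(2) i4 by (intro Bochner_Integration.integral_add Bochner_Integration.integrable_add Bochner_Integration.integrable_diff)
    also have "(\<integral>\<omega>. ?F \<omega> * (?D \<omega> - ?e \<omega>)\<^sup>2 + ?F \<omega> * ((2 * (?D \<omega> - ?e \<omega>)) * ?e \<omega>) \<partial>P) = (\<integral>\<omega>. ?F \<omega> * (?D \<omega> - ?e \<omega>)\<^sup>2 \<partial>P) + (\<integral>\<omega>. ?F \<omega> * ((2 * (?D \<omega> - ?e \<omega>)) * ?e \<omega>) \<partial>P)"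
      by (rule Bochner_Integration.integral_add[OF i1 i2e])
    finally show ?thesis by simp
  qed
  finally show ?case using Suc by (simp add: algebra_simps)
qed

end


text \<open>From Q g = g - fb one gets kf = g^2 - (Q g)^2. By invariance its \<pi>-mean is the
  average over z of the variance of \<open>g\<close> under Q z.\<close>

lemma asymp_var_nonneg: "0 \<le> asymp_var M Q \<pi> f"
proof -
  have gW: "\<And>z. z \<in> space M \<Longrightarrow> \<bar>g z\<bar> \<le> (2 * E) * W z" using g_le_E by auto
  have eW: "\<And>z. z \<in> space M \<Longrightarrow> \<bar>g z - fb z\<bar> \<le> (3 * E) * W z"
    using g_le_E fb_le_E by (smt (verit) distrib_right)
  have g1: "\<And>z. z \<in> space M \<Longrightarrow> \<bar>g z\<bar> \<le> (2 * E * (1 + C)) * V z"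
    using V_bound_of_powr_bound[of g "2 * E" p C] g_le_E C_ge1 N_le_E(4) p4 by (simp add: W_def)
  note g2 = V_bound_product[OF gW gW] and e2 = V_bound_product[OF eW eW]
  have ig2: "integrable \<pi> (\<lambda>z. g z * g z)" by (rule V_bounded_integrable(2)[OF _ g2]) auto
  have ie2: "integrable \<pi> (\<lambda>z. (g z - fb z) * (g z - fb z))" by (rule V_bounded_integrable(2)[OF _ e2]) auto
  have "(\<integral>z. (g z - fb z) * (g z - fb z) \<partial>\<pi>) \<le> (\<integral>z. T 1 (\<lambda>z. g z * g z) z \<partial>\<pi>)"
  proof (rule integral_mono)
    show "integrable \<pi> (\<lambda>z. T 1 (\<lambda>z. g z * g z) z)" by (rule T_pi(2)[OF _ g2]) auto
    fix z assume "z \<in> space \<pi>"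
    then have z: "z \<in> space M" using pi_space by simp
    interpret prob_space "Q z" by (rule Q_space[OF z])
    have i1: "integrable (Q z) g" unfolding Q_eq_kernel[OF z] by (rule V_bounded_integrable(1)[OF _ g1 z]) auto
    have "integrable (Q z) (\<lambda>y. g y * g y)" unfolding Q_eq_kernel[OF z] by (rule V_bounded_integrable(1)[OF _ g2 z]) auto
    then have i2: "integrable (Q z) (\<lambda>y. (g y)\<^sup>2)" by (simp add: power2_eq_square)
    have "0 \<le> variance g" by (rule variance_positive)
    then have "(expectation g)\<^sup>2 \<le> expectation (\<lambda>y. (g y)\<^sup>2)" using variance_eq[OF i1 i2] by simp
    then show "(g z - fb z) * (g z - fb z) \<le> T 1 (\<lambda>z. g z * g z) z"
      unfolding Q_eq_kernel[OF z, symmetric] Q_g[OF z] by (simp add: power2_eq_square)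
  qed fact
  also have "\<dots> = (\<integral>z. g z * g z \<partial>\<pi>)" by (rule T_pi(1)[OF _ g2]) auto
  finally have "0 \<le> (\<integral>z. g z * g z \<partial>\<pi>) - (\<integral>z. (g z - fb z) * (g z - fb z) \<partial>\<pi>)" by simp
  also have "\<dots> = (\<integral>z. g z * g z - (g z - fb z) * (g z - fb z) \<partial>\<pi>)" using ig2 ie2 by simp
  also have "\<dots> = (\<integral>z. kf z \<partial>\<pi>)"
    by (intro Bochner_Integration.integral_cong) (simp_all add: kf_def power2_eq_square algebra_simps)
  finally show ?thesis unfolding pi_kf .
qed

definition "block_len = \<tau> * (k + 4)"

lemma block_len_real: "real block_len = p * real \<tau>"
  by (simp add: block_len_def p_def)

lemma block_len_pos: "0 < block_len"
  using tau by (simp add: block_len_def)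

lemma lp_fb: "lp_le P p (\<lambda>\<omega>. fb (\<omega> l)) (N * (2 * C))"
  by (rule lp_bounded_by_W[OF _ fb_le]) (use N_pos in auto)

lemma lp_g: "lp_le P p (\<lambda>\<omega>. g (\<omega> l)) (2 * (p * real \<tau> * N * \<kappa> powr (1 / p)) * (2 * C))"
  by (rule lp_bounded_by_W[OF _ g_le]) (use N_pos p4 in auto)

lemma lp_poisson_mart_blocks:
  assumes m: "1 \<le> m"
  shows "lp_le P p (poisson_mart (m * block_len)) (4 * sqrt (9 * p\<^sup>2 * (26 * E * C)\<^sup>2 * sqrt (real m) + 15 * p * (real block_len * asymp_var M Q \<pi> f) * real m))"
proof -
  define \<sigma> where "\<sigma> = asymp_var M Q \<pi> f"
  \<comment> \<open>In units of E C: 2 from the sum of |fb| over a block, where block length times N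
    is at most E, and 6 * 2 = 12 from each end point of the block.\<close>
  define D where "D = 26 * E * C"
  define X where "X j = poisson_mart (j * block_len)" for j
  define Y where "Y j \<omega> = \<psi> (\<omega> (j * block_len))" for j and \<omega> :: "nat \<Rightarrow> 'a"
  \<comment> \<open>One variable has to bound the block increment and also the square root of
    |\<psi>| at both ends; the end terms cover \<open>g\<close> as well, since |g| \<le> 2 E
    W.\<close>
  define G where "G j \<omega> = (\<Sum>l\<in>{j * block_len..<j * block_len + block_len}. \<bar>fb (\<omega> l)\<bar>) + (6 * E * W (\<omega> (j * block_len)) + 6 * E * W (\<omega> (j * block_len + block_len)))" for j and \<omega> :: "nat \<Rightarrow> 'a"
  have E: "0 < E" by (rule N_le_E)
  have D: "0 < D" using E C_ge1 by (simp add: D_def)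
  have [measurable]: "X j \<in> borel_measurable \<Omega>" "Y j \<in> borel_measurable \<Omega>" "G j \<in> borel_measurable \<Omega>" for j
    unfolding X_def Y_def[abs_def] G_def[abs_def] by measurable
  have z: "\<omega> l \<in> space M" if "\<omega> \<in> space P" for \<omega> l using space_path_component[of \<omega> M l] that by simp
  have nn: "0 \<le> E * W (\<omega> l)" for \<omega> :: "nat \<Rightarrow> 'a" and l using E W_nonneg by simp
  have lpG: "lp_le P p (G j) D" for j
  proof -
    have f: "lp_le P p (\<lambda>\<omega>. \<bar>fb (\<omega> l)\<bar>) (N * (2 * C))" for l
      by (rule lp_le_mono[OF lp_fb[of l]]) (use p4 in simp_all)
    have w: "lp_le P p (\<lambda>\<omega>. 6 * E * W (\<omega> l)) (6 * E * (2 * C))" for l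
      using lp_le_cmult[OF lp_W, of "6 * E"] E by simp
    have "lp_le P p (G j) ((\<Sum>l\<in>{j * block_len..<j * block_len + block_len}. N * (2 * C)) + (6 * E * (2 * C) + 6 * E * (2 * C)))"
      unfolding G_def[abs_def] using p4 by (intro lp_le_add lp_le_sum f w) auto
    then show ?thesis
    proof (rule lp_le_mono)
      have "real block_len * N * (2 * C) \<le> E * (2 * C)" using N_le_E(2) C_ge1 unfolding block_len_real by (intro mult_right_mono) auto
      moreover have "(\<Sum>l\<in>{j * block_len..<j * block_len + block_len}. N * (2 * C)) = real block_len * N * (2 * C)" by simp
      ultimately show "(\<Sum>l\<in>{j * block_len..<j * block_len + block_len}. N * (2 * C)) + (6 * E * (2 * C) + 6 * E * (2 * C)) \<le> D"
        unfolding D_def by linarith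
    qed (use p4 in simp_all)
  qed
  have G: "integrable P (\<lambda>\<omega>. G j \<omega> ^ (k + 4)) \<and> path.expectation (\<lambda>\<omega>. G j \<omega> ^ (k + 4)) \<le> D ^ (k + 4)" for j
    using lpG[of j] D p_nat(2,3) unfolding p_nat(1) by (subst (asm) lp_le_even_iff) auto
  have "lp_le P p (X 0) D"
    unfolding X_def
  proof (rule lp_le_mono[OF lp_g[of 0]])
    show "2 * (p * real \<tau> * N * \<kappa> powr (1 / p)) * (2 * C) \<le> D"
    proof -
      have "(p * real \<tau> * N * \<kappa> powr (1 / p)) * (4 * C) \<le> E * (4 * C)" using N_le_E(1) C_ge1 by (intro mult_right_mono) auto
      also have "\<dots> \<le> E * (26 * C)" using E C_ge1 by (intro mult_left_mono) auto
      finally show ?thesis by (simp add: D_def mult_ac)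
    qed
  qed (use p4 in \<open>simp_all add: poisson_mart_def\<close>)
  then have X0: "integrable P (\<lambda>\<omega>. X 0 \<omega> ^ (k + 4)) \<and> path.expectation (\<lambda>\<omega>. X 0 \<omega> ^ (k + 4)) \<le> D ^ (k + 4)"
    using D p_nat(2,3) unfolding p_nat(1) by (subst (asm) lp_le_even_iff) auto
  have XS: "X (Suc j) = poisson_mart (j * block_len + block_len)" for j by (simp add: X_def add.commute)
  have res: "integrable P (\<lambda>\<omega>. X m \<omega> ^ (k + 4)) \<and>
    path.expectation (\<lambda>\<omega>. X m \<omega> ^ (k + 4)) \<le> 4 * sqrt (9 * (real (k + 4))\<^sup>2 * D\<^sup>2 * sqrt (real m) + 15 * real (k + 4) * (real block_len * \<sigma>) * real m) ^ (k + 4)"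
  proof (rule path.even_moment_bound[where G=G and \<psi>=Y])
    show "even k" by (rule k_even)
    show "0 < D" by (rule D)
    show "1 \<le> m" by (rule m)
    show "0 \<le> real block_len * \<sigma>" using asymp_var_nonneg by (simp add: \<sigma>_def)
    show "integrable P (\<lambda>\<omega>. X 0 \<omega> ^ (k + 4))" "path.expectation (\<lambda>\<omega>. X 0 \<omega> ^ (k + 4)) \<le> D ^ (k + 4)" using X0 by auto
    fix j
    show "integrable P (\<lambda>\<omega>. G j \<omega> ^ (k + 4))" "path.expectation (\<lambda>\<omega>. G j \<omega> ^ (k + 4)) \<le> D ^ (k + 4)" using G by auto
    show "X j \<in> borel_measurable P" "Y j \<in> borel_measurable P" "G j \<in> borel_measurable P" by simp_all
    show "path.expectation (\<lambda>\<omega>. (X (Suc j) \<omega> - X j \<omega>) * X j \<omega> ^ (k + 3)) = 0" if "integrable P (\<lambda>\<omega>. X j \<omega> ^ (k + 4))"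
      using martingale_block[of "j * block_len" block_len block_len] that by (simp add: X_def mult.commute add.commute)
    show "path.expectation (\<lambda>\<omega>. ((X (Suc j) \<omega> - X j \<omega>)\<^sup>2 + Y (Suc j) \<omega>) * X j \<omega> ^ (k + 2)) = path.expectation (\<lambda>\<omega>. (Y j \<omega> + real block_len * \<sigma>) * X j \<omega> ^ (k + 2))"
      if i: "integrable P (\<lambda>\<omega>. X j \<omega> ^ (k + 4))"
    proof -
      have i': "integrable P (\<lambda>\<omega>. poisson_mart (j * block_len) \<omega> ^ (k + 4))" using i by (simp add: X_def)
      have i1: "integrable P (\<lambda>\<omega>. X j \<omega> ^ (k + 2) * Y j \<omega>)"
        unfolding X_def Y_def by (rule R_integrable_bound[OF i', of _ 1 block_len 2]) (use envelope_bounds(6)[OF i'] in simp_all)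
      have "integrable P (\<lambda>\<omega>. \<bar>poisson_mart (j * block_len) \<omega>\<bar> ^ (k + 4))" using i' k_even by (simp add: power_even_abs)
      from path.integrable_mult_power[OF _ _ this, of "\<lambda>_. 1" "k + 2" 2] have i2: "integrable P (\<lambda>\<omega>. X j \<omega> ^ (k + 2))" by (simp add: X_def)
      have "path.expectation (\<lambda>\<omega>. ((X (Suc j) \<omega> - X j \<omega>)\<^sup>2 + Y (Suc j) \<omega>) * X j \<omega> ^ (k + 2)) =
          path.expectation (\<lambda>\<omega>. X j \<omega> ^ (k + 2) * Y j \<omega>) + real block_len * \<sigma> * path.expectation (\<lambda>\<omega>. X j \<omega> ^ (k + 2))"
        using quadratic_block[OF i', of block_len block_len] by (simp add: X_def Y_def \<sigma>_def mult.commute add.commute)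
      also have "\<dots> = path.expectation (\<lambda>\<omega>. X j \<omega> ^ (k + 2) * Y j \<omega> + real block_len * \<sigma> * X j \<omega> ^ (k + 2))"
        using i1 i2 by simp
      also have "\<dots> = path.expectation (\<lambda>\<omega>. (Y j \<omega> + real block_len * \<sigma>) * X j \<omega> ^ (k + 2))"
        by (intro Bochner_Integration.integral_cong) (simp_all add: algebra_simps)
      finally show ?thesis .
    qed
    fix \<omega> assume w: "\<omega> \<in> space P"
    have s0: "0 \<le> (\<Sum>l\<in>{j * block_len..<j * block_len + block_len}. \<bar>fb (\<omega> l)\<bar>)" by (simp add: sum_nonneg)
    have G0: "6 * E * W (\<omega> (j * block_len)) \<le> G j \<omega>" "6 * E * W (\<omega> (j * block_len + block_len)) \<le> G j \<omega>"
      using s0 nn[of \<omega> "j * block_len"] nn[of \<omega> "j * block_len + block_len"] unfolding G_def by linarith+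
    have sq: "\<bar>\<psi> (\<omega> l)\<bar> \<le> (G j \<omega>)\<^sup>2" if "6 * E * W (\<omega> l) \<le> G j \<omega>" for l
    proof -
      have "(6 * E * W (\<omega> l))\<^sup>2 \<le> (G j \<omega>)\<^sup>2" using that nn[of \<omega> l] by (intro power_mono) (simp_all add: mult.assoc)
      then show ?thesis using psi_le[OF z[OF w, of l]] by linarith
    qed
    show "\<bar>Y j \<omega>\<bar> \<le> (G j \<omega>)\<^sup>2" "\<bar>Y (Suc j) \<omega>\<bar> \<le> (G j \<omega>)\<^sup>2"
      using sq G0 by (simp_all add: Y_def add.commute)
    show "\<bar>X (Suc j) \<omega> - X j \<omega>\<bar> \<le> G j \<omega>"
    proof -
      have "(\<Sum>l<j * block_len + block_len. fb (\<omega> l)) = (\<Sum>l<j * block_len. fb (\<omega> l)) + (\<Sum>l\<in>{j * block_len..<j * block_len + block_len}. fb (\<omega> l))"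
        by (subst sum.union_disjoint[symmetric]) (auto intro!: sum.cong)
      then have "X (Suc j) \<omega> - X j \<omega> = (\<Sum>l\<in>{j * block_len..<j * block_len + block_len}. fb (\<omega> l)) + g (\<omega> (j * block_len + block_len)) - g (\<omega> (j * block_len))"
        unfolding XS by (simp add: X_def poisson_mart_def)
      moreover have "\<bar>\<Sum>l\<in>{j * block_len..<j * block_len + block_len}. fb (\<omega> l)\<bar> \<le> (\<Sum>l\<in>{j * block_len..<j * block_len + block_len}. \<bar>fb (\<omega> l)\<bar>)" by (rule sum_abs)
      ultimately show ?thesis
        using g_le_E[OF z[OF w, of "j * block_len"]] g_le_E[OF z[OF w, of "j * block_len + block_len"]] nn[of \<omega> "j * block_len"] nn[of \<omega> "j * block_len + block_len"]
        unfolding G_def by linarith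
    qed
  qed
  define K where "K = sqrt (9 * p\<^sup>2 * D\<^sup>2 * sqrt (real m) + 15 * p * (real block_len * \<sigma>) * real m)"
  have K: "0 \<le> K" using asymp_var_nonneg p4 by (simp add: K_def \<sigma>_def)
  have "4 * K ^ (k + 4) \<le> 4 ^ (k + 4) * K ^ (k + 4)" using K by (intro mult_right_mono self_le_power) auto
  then have "path.expectation (\<lambda>\<omega>. X m \<omega> ^ (k + 4)) \<le> (4 * K) ^ (k + 4)"
    using res unfolding K_def p_def power_mult_distrib by linarith
  then have "lp_le P p (X m) (4 * K)"
    unfolding p_nat(1) using res K p_nat(2,3) by (subst lp_le_even_iff) auto
  then show ?thesis by (simp add: X_def K_def D_def \<sigma>_def)
qed

theorem lp_centered_sum:
  "lp_le P p (centered_sum \<pi> f n) (16 * sqrt (p * real n * asymp_var M Q \<pi> f)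
     + 312 * p\<^sup>2 * N * (\<kappa> * piV) powr (2 / p) * real n powr (1 / 4) * real \<tau> powr (3 / 4)
     + 6 * p * real \<tau> * N * (\<kappa> * piV) powr (1 / p))"
proof -
  define m where "m = n div block_len"
  let ?\<sigma> = "asymp_var M Q \<pi> f"
  have Sm [measurable]: "centered_sum \<pi> f n \<in> borel_measurable \<Omega>"
    unfolding centered_sum_def[abs_def] by measurable
  have kC: "(\<kappa> * piV) powr (1 / p) = \<kappa> powr (1 / p) * C"
    using kappa piV_ge1 by (simp add: powr_mult C_def)
  have kC2: "(\<kappa> * piV) powr (2 / p) = \<kappa> powr (2 / p) * C\<^sup>2"
  proof -
    have "C\<^sup>2 = piV powr (1 / (p / 2))" by (simp only: powr_half C_def)
    then show ?thesis using kappa piV_ge1 by (simp add: powr_mult)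
  qed
  have r: "real (n - m * block_len) \<le> real block_len"
    using mod_less_divisor[OF block_len_pos, of n] unfolding m_def by (simp add: minus_div_mult_eq_mod)
  have mb: "m * block_len \<le> n" unfolding m_def by simp
  have rest: "lp_le P p (\<lambda>\<omega>. \<Sum>l\<in>{m * block_len..<n}. fb (\<omega> l)) (p * real \<tau> * (N * (2 * C)))"
  proof (rule lp_le_mono)
    show "lp_le P p (\<lambda>\<omega>. \<Sum>l\<in>{m * block_len..<n}. fb (\<omega> l)) (\<Sum>l\<in>{m * block_len..<n}. N * (2 * C))"
      using p4 by (intro lp_le_sum lp_fb) auto
    have "real (n - m * block_len) * (N * (2 * C)) \<le> p * real \<tau> * (N * (2 * C))"
      using r N_pos C_ge1 unfolding block_len_real by (intro mult_right_mono) auto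
    then show "(\<Sum>l\<in>{m * block_len..<n}. N * (2 * C)) \<le> p * real \<tau> * (N * (2 * C))" by simp
  qed (use p4 in simp_all)
  have split: "centered_sum \<pi> f n \<omega> = (\<Sum>l<m * block_len. fb (\<omega> l)) + (\<Sum>l\<in>{m * block_len..<n}. fb (\<omega> l))" for \<omega>
    unfolding centered_sum_def using mb by (subst sum.union_disjoint[symmetric]) (auto intro!: sum.cong)
  have c1: "p * real \<tau> * (N * (2 * C)) \<le> 2 * p * real \<tau> * N * (\<kappa> powr (1 / p) * C)"
  proof -
    have "(2 * p * real \<tau> * N * C) * 1 \<le> (2 * p * real \<tau> * N * C) * \<kappa> powr (1 / p)"
      using p4 N_pos C_ge1 kappa_powr[of "1 / p"] by (intro mult_left_mono) auto
    then show ?thesis by (simp add: mult_ac)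
  qed
  have nn: "0 \<le> sqrt (p * real n * ?\<sigma>)" "0 \<le> p\<^sup>2 * N * (\<kappa> powr (2 / p) * C\<^sup>2) * real n powr (1 / 4) * real \<tau> powr (3 / 4)"
    "0 \<le> p * real \<tau> * N * (\<kappa> powr (1 / p) * C)"
    using p4 asymp_var_nonneg N_pos C_ge1 by auto
  show ?thesis unfolding kC kC2
  proof (cases "m = 0")
    \<comment> \<open>With no complete block the whole sum is the remainder.\<close>
    case True
    show "lp_le P p (centered_sum \<pi> f n) (16 * sqrt (p * real n * ?\<sigma>)
     + 312 * p\<^sup>2 * N * (\<kappa> powr (2 / p) * C\<^sup>2) * real n powr (1 / 4) * real \<tau> powr (3 / 4)
     + 6 * p * real \<tau> * N * (\<kappa> powr (1 / p) * C))"
    proof (rule lp_le_mono[OF rest])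
      show "p * real \<tau> * (N * (2 * C)) \<le> 16 * sqrt (p * real n * ?\<sigma>)
         + 312 * p\<^sup>2 * N * (\<kappa> powr (2 / p) * C\<^sup>2) * real n powr (1 / 4) * real \<tau> powr (3 / 4)
         + 6 * p * real \<tau> * N * (\<kappa> powr (1 / p) * C)"
        using c1 nn by linarith
    qed (use p4 True split in simp_all)
  next
    case False
    then have m: "1 \<le> m" by simp
    let ?D = "26 * E * C" and ?K = "sqrt (9 * p\<^sup>2 * (26 * E * C)\<^sup>2 * sqrt (real m) + 15 * p * (real block_len * ?\<sigma>) * real m)"
    have K: "?K \<le> 3 * p * ?D * real m powr (1 / 4) + 4 * sqrt (p * real n * ?\<sigma>)"
    proof -
      have a: "sqrt (9 * p\<^sup>2 * ?D\<^sup>2 * sqrt (real m)) = 3 * p * ?D * real m powr (1 / 4)"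
      proof -
        have "sqrt (sqrt (real m)) = real m powr (1 / 4)"
          using m by (simp add: powr_half_sqrt[symmetric] powr_powr)
        moreover have "sqrt (9 * p\<^sup>2 * ?D\<^sup>2) = 3 * p * ?D"
        proof -
          have "(3 * p * ?D)\<^sup>2 = 9 * p\<^sup>2 * ?D\<^sup>2" by (simp add: power_mult_distrib)
          moreover have "0 \<le> 3 * p * ?D" using p4 N_le_E(4) C_ge1 by simp
          ultimately show ?thesis by (rule real_sqrt_unique)
        qed
        ultimately show ?thesis by (simp only: real_sqrt_mult)
      qed
      have "15 * p * (real block_len * ?\<sigma>) * real m \<le> 16 * (p * real n * ?\<sigma>)"
      proof -
        have "real block_len * real m \<le> real n" using mb by (metis mult.commute of_nat_le_iff of_nat_mult)
        then have "(p * ?\<sigma>) * (real block_len * real m) \<le> (p * ?\<sigma>) * real n" using p4 asymp_var_nonneg by (intro mult_left_mono) auto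
        moreover have "0 \<le> (p * ?\<sigma>) * real n" using p4 asymp_var_nonneg by simp
        moreover have "15 * p * (real block_len * ?\<sigma>) * real m = 15 * ((p * ?\<sigma>) * (real block_len * real m))" "16 * (p * real n * ?\<sigma>) = 16 * ((p * ?\<sigma>) * real n)" by simp_all
        ultimately show ?thesis by linarith
      qed
      then have b: "sqrt (15 * p * (real block_len * ?\<sigma>) * real m) \<le> 4 * sqrt (p * real n * ?\<sigma>)"
        using real_sqrt_le_mono[of "15 * p * (real block_len * ?\<sigma>) * real m" "16 * (p * real n * ?\<sigma>)"] by (simp add: real_sqrt_mult)
      have "?K \<le> sqrt (9 * p\<^sup>2 * ?D\<^sup>2 * sqrt (real m)) + sqrt (15 * p * (real block_len * ?\<sigma>) * real m)"
        using p4 asymp_var_nonneg by (intro sqrt_add_le_add_sqrt) auto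
      then show ?thesis using a b by linarith
    qed
    \<comment> \<open>E carries a full factor \<tau>. Since m \<tau> \<le> n, its quarter power
      turns m^(1/4) into n^(1/4), and \<tau>^(3/4) remains.\<close>
    have m4: "E * real m powr (1 / 4) \<le> p * N * \<kappa> powr (2 / p) * C * (real n powr (1 / 4) * real \<tau> powr (3 / 4))"
    proof -
      have "real m * real \<tau> \<le> real n"
      proof -
        have "m * \<tau> * 1 \<le> m * \<tau> * (k + 4)" by (intro mult_left_mono) auto
        also have "\<dots> = m * block_len" by (simp add: block_len_def)
        finally show ?thesis using mb by (metis le_trans mult.right_neutral of_nat_le_iff of_nat_mult)
      qed
      then have "(real m * real \<tau>) powr (1 / 4) \<le> real n powr (1 / 4)" by (intro powr_mono2) auto
      then have "real m powr (1 / 4) * (real \<tau> powr (1 / 4) * real \<tau> powr (3 / 4)) \<le> real n powr (1 / 4) * real \<tau> powr (3 / 4)"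
        by (simp add: powr_mult mult_right_mono flip: mult.assoc)
      also have "real \<tau> powr (1 / 4) * real \<tau> powr (3 / 4) = real \<tau>" using tau by (simp add: powr_add[symmetric])
      finally have "(p * N * \<kappa> powr (2 / p) * C) * (real m powr (1 / 4) * real \<tau>) \<le> (p * N * \<kappa> powr (2 / p) * C) * (real n powr (1 / 4) * real \<tau> powr (3 / 4))"
        using p4 N_pos C_ge1 by (intro mult_left_mono) auto
      then show ?thesis by (simp add: E_def mult_ac)
    qed
    \<comment> \<open>16 = 4 * 4, where sqrt 15 has been rounded up to 4, and 312 = 4 * 3 *
      26.\<close>
    have KK: "4 * ?K \<le> 16 * sqrt (p * real n * ?\<sigma>) + 312 * p\<^sup>2 * N * (\<kappa> powr (2 / p) * C\<^sup>2) * real n powr (1 / 4) * real \<tau> powr (3 / 4)"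
    proof -
      have "(312 * p * C) * (E * real m powr (1 / 4)) \<le> (312 * p * C) * (p * N * \<kappa> powr (2 / p) * C * (real n powr (1 / 4) * real \<tau> powr (3 / 4)))"
        using m4 p4 C_ge1 by (intro mult_left_mono) auto
      moreover have "4 * (3 * p * ?D * real m powr (1 / 4)) = (312 * p * C) * (E * real m powr (1 / 4))" by simp
      moreover have "(312 * p * C) * (p * N * \<kappa> powr (2 / p) * C * (real n powr (1 / 4) * real \<tau> powr (3 / 4))) = 312 * p\<^sup>2 * N * (\<kappa> powr (2 / p) * C\<^sup>2) * real n powr (1 / 4) * real \<tau> powr (3 / 4)"
        by (simp add: power2_eq_square)
      ultimately show ?thesis using K by linarith
    qed
    \<comment> \<open>The sum is the martingale at the last complete block, minus \<open>g\<close>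
      there, plus the incomplete block. The last two contribute 4 and 2, hence the constant
      6.\<close>
    have "lp_le P p (\<lambda>\<omega>. poisson_mart (m * block_len) \<omega> + ((- 1) * g (\<omega> (m * block_len)) + (\<Sum>l\<in>{m * block_len..<n}. fb (\<omega> l))))
      (4 * ?K + (\<bar>- 1\<bar> * (2 * (p * real \<tau> * N * \<kappa> powr (1 / p)) * (2 * C)) + p * real \<tau> * (N * (2 * C))))"
      using p4 by (intro lp_le_add lp_le_cmult lp_g rest lp_poisson_mart_blocks m) auto
    then show "lp_le P p (centered_sum \<pi> f n) (16 * sqrt (p * real n * ?\<sigma>)
     + 312 * p\<^sup>2 * N * (\<kappa> powr (2 / p) * C\<^sup>2) * real n powr (1 / 4) * real \<tau> powr (3 / 4)
     + 6 * p * real \<tau> * N * (\<kappa> powr (1 / p) * C))"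
    proof (rule lp_le_mono)
      have "2 * (p * real \<tau> * N * \<kappa> powr (1 / p)) * (2 * C) = 4 * (p * real \<tau> * N * (\<kappa> powr (1 / p) * C))" by simp
      then show "4 * ?K + (\<bar>- 1\<bar> * (2 * (p * real \<tau> * N * \<kappa> powr (1 / p)) * (2 * C)) + p * real \<tau> * (N * (2 * C))) \<le> 16 * sqrt (p * real n * ?\<sigma>)
     + 312 * p\<^sup>2 * N * (\<kappa> powr (2 / p) * C\<^sup>2) * real n powr (1 / 4) * real \<tau> powr (3 / 4)
     + 6 * p * real \<tau> * N * (\<kappa> powr (1 / p) * C)"
        using KK c1 unfolding abs_minus_cancel abs_one by linarith
    qed (use p4 split in \<open>simp_all add: poisson_mart_def\<close>)
  qed
qed

end

section \<open>Splitting a chain at a random time\<close>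

text \<open>The density will serve as a stopping probability and must lie in [0, 1] at every point.
  Domination forces a Radon-Nikodym density to be at most 1 almost everywhere, and truncation does
  the rest.\<close>

lemma dominated_density:
  assumes fin: "finite_measure \<alpha>" and sets: "sets \<nu> = sets \<alpha>"
    and le: "\<And>A. A \<in> sets \<alpha> \<Longrightarrow> emeasure \<nu> A \<le> emeasure \<alpha> A"
  obtains g :: "'a \<Rightarrow> real" where "g \<in> borel_measurable \<alpha>" "\<And>z. 0 \<le> g z \<and> g z \<le> 1" "density \<alpha> (\<lambda>z. ennreal (g z)) = \<nu>"
proof -
  interpret finite_measure \<alpha> by fact
  have "absolutely_continuous \<alpha> \<nu>"
    unfolding absolutely_continuous_def
  proof
    fix A assume A: "A \<in> null_sets \<alpha>"
    then have "emeasure \<nu> A \<le> 0" using le[OF null_setsD2[OF A]] null_setsD1[OF A] by simp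
    then show "A \<in> null_sets \<nu>" using A sets by (auto simp: null_sets_def)
  qed
  from Radon_Nikodym[OF this sets] obtain f where f [measurable]: "f \<in> borel_measurable \<alpha>" and d: "density \<alpha> f = \<nu>" by auto
  have f1: "AE z in \<alpha>. f z \<le> 1"
  proof -
    \<comment> \<open>On B the excess f - 1 is positive, yet its integral is 0: the finite mass
      \<alpha> B cancels from \<nu> B \<le> \<alpha> B.\<close>
    define B where "B = {z \<in> space \<alpha>. 1 < f z}"
    have B [measurable]: "B \<in> sets \<alpha>" unfolding B_def by measurable
    have "emeasure \<nu> B = (\<integral>\<^sup>+z. f z * indicator B z \<partial>\<alpha>)" unfolding d[symmetric] by (rule emeasure_density) simp_all
    also have "\<dots> = (\<integral>\<^sup>+z. indicator B z + (f z - 1) * indicator B z \<partial>\<alpha>)"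
      by (intro nn_integral_cong) (auto simp: B_def add_diff_inverse_ennreal less_imp_le split: split_indicator)
    also have "\<dots> = emeasure \<alpha> B + (\<integral>\<^sup>+z. (f z - 1) * indicator B z \<partial>\<alpha>)" by (subst nn_integral_add) auto
    finally have "emeasure \<alpha> B + (\<integral>\<^sup>+z. (f z - 1) * indicator B z \<partial>\<alpha>) \<le> emeasure \<alpha> B + 0" using le[OF B] by simp
    then have "(\<integral>\<^sup>+z. (f z - 1) * indicator B z \<partial>\<alpha>) = 0"
      using emeasure_finite[of B] by (auto simp: ennreal_add_left_cancel_le)
    then have "AE z in \<alpha>. (f z - 1) * indicator B z = 0" by (subst (asm) nn_integral_0_iff_AE) auto
    then show ?thesis
      using AE_space
    proof eventually_elim
      case (elim z)
      show "f z \<le> 1"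
      proof (rule ccontr)
        assume n: "\<not> f z \<le> 1"
        then have "indicator B z = (1 :: ennreal)" using elim(2) by (auto simp: B_def)
        with elim(1) have "f z - 1 = 0" by simp
        with n show False by (simp add: diff_eq_0_iff_ennreal)
      qed
    qed
  qed
  define g where "g z = min 1 (enn2real (f z))" for z
  have "density \<alpha> (\<lambda>z. ennreal (g z)) = density \<alpha> f"
  proof (rule density_cong)
    show "AE z in \<alpha>. ennreal (g z) = f z"
      using f1
    proof eventually_elim
      case (elim z)
      then have fin: "f z < \<top>" using le_less_trans[of "f z" 1 \<top>] by simp
      then have "enn2real (f z) \<le> 1" using enn2real_mono[OF elim] by simp
      then show ?case using fin by (simp add: g_def min_absorb2)
    qed
  qed (simp_all add: g_def[abs_def])
  then show thesis
    by (intro that[of g]) (auto simp: g_def[abs_def] d)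
qed

text \<open>Both densities represent the minimum of \<alpha> and \<beta>: it is \<beta> on the Hahn
  set Y, where \<beta> is the smaller one, and \<alpha> outside. The rest of \<alpha> lives on Y and
  the rest of \<beta> outside, so the two remainders are mutually singular.\<close>

lemma measure_overlap:
  assumes fin: "finite_measure \<alpha>" "finite_measure \<beta>" and sets: "sets \<alpha> = sets M" "sets \<beta> = sets M"
  shows "\<exists>g h Y. g \<in> borel_measurable M \<and> h \<in> borel_measurable M \<and> (\<forall>z. 0 \<le> g z \<and> g z \<le> (1::real)) \<and> (\<forall>z. 0 \<le> h z \<and> h z \<le> (1::real))
    \<and> Y \<in> sets M \<and> density \<alpha> (\<lambda>z. ennreal (g z)) = density \<beta> (\<lambda>z. ennreal (h z))
    \<and> (\<forall>z. z \<notin> Y \<longrightarrow> g z = 1) \<and> (\<forall>z\<in>Y. h z = 1)"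
proof -
  have s: "sets \<beta> = sets \<alpha>" using sets by simp
  obtain Y where Y: "Y \<in> sets \<alpha>"
    and YY: "(\<forall>X\<in>sets \<alpha>. X \<subseteq> Y \<longrightarrow> emeasure \<beta> X \<le> emeasure \<alpha> X) \<and> (\<forall>X\<in>sets \<alpha>. X \<inter> Y = {} \<longrightarrow> emeasure \<alpha> X \<le> emeasure \<beta> X)"
    using finite_unsigned_Hahn_decomposition[OF fin s] by (elim bexE)
  have Y1: "emeasure \<beta> X \<le> emeasure \<alpha> X" if "X \<in> sets \<alpha>" "X \<subseteq> Y" for X using YY that by simp
  have Y2: "emeasure \<alpha> X \<le> emeasure \<beta> X" if "X \<in> sets \<alpha>" "X \<inter> Y = {}" for X using YY that by simp
  have YM: "Y \<in> sets M" "Y \<in> sets \<beta>" using Y s sets by auto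
  have e: "emeasure (density \<mu> (indicator B)) A = emeasure \<mu> (B \<inter> A)" if "B \<in> sets \<mu>" "A \<in> sets \<mu>" for \<mu> :: "'a measure" and A B
    by (rule emeasure_restricted[OF that])
  have co: "space M - Y \<in> sets M" using YM by auto
  obtain g where g: "g \<in> borel_measurable \<alpha>" "\<And>z. 0 \<le> g z \<and> g z \<le> (1::real)" "density \<alpha> (\<lambda>z. ennreal (g z)) = density \<beta> (indicator Y)"
  proof (rule dominated_density[OF fin(1)])
    fix A assume A: "A \<in> sets \<alpha>"
    have "emeasure (density \<beta> (indicator Y)) A = emeasure \<beta> (Y \<inter> A)" using A s YM by (intro e) auto
    also have "\<dots> \<le> emeasure \<alpha> (Y \<inter> A)" using A Y by (intro Y1) auto
    also have "\<dots> \<le> emeasure \<alpha> A" using A by (intro emeasure_mono) auto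
    finally show "emeasure (density \<beta> (indicator Y)) A \<le> emeasure \<alpha> A" .
  qed (use s in auto)
  obtain h where h: "h \<in> borel_measurable \<beta>" "\<And>z. 0 \<le> h z \<and> h z \<le> (1::real)" "density \<beta> (\<lambda>z. ennreal (h z)) = density \<alpha> (indicator (space M - Y))"
  proof (rule dominated_density[OF fin(2)])
    fix A assume A: "A \<in> sets \<beta>"
    have "emeasure (density \<alpha> (indicator (space M - Y))) A = emeasure \<alpha> ((space M - Y) \<inter> A)" using A co sets by (intro e) auto
    also have "\<dots> \<le> emeasure \<beta> ((space M - Y) \<inter> A)" using A co sets by (intro Y2) auto
    also have "\<dots> \<le> emeasure \<beta> A" using A by (intro emeasure_mono) auto
    finally show "emeasure (density \<alpha> (indicator (space M - Y))) A \<le> emeasure \<beta> A" .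
  qed (use s in auto)
  define g' where "g' z = (if z \<in> Y then g z else 1)" for z
  define h' where "h' z = (if z \<in> Y then 1 else h z)" for z
  have gM: "g \<in> borel_measurable M" "h \<in> borel_measurable M" using g h sets by (auto cong: measurable_cong_sets)
  have m: "g' \<in> borel_measurable M" "h' \<in> borel_measurable M"
    unfolding g'_def[abs_def] h'_def[abs_def] using gM YM(1) by measurable
  have m': "g' \<in> borel_measurable \<alpha>" "h' \<in> borel_measurable \<beta>" using m sets by (auto cong: measurable_cong_sets)
  have "density \<alpha> (\<lambda>z. ennreal (g' z)) = density \<beta> (\<lambda>z. ennreal (h' z))"
  proof (rule measure_eqI)
    show "sets (density \<alpha> (\<lambda>z. ennreal (g' z))) = sets (density \<beta> (\<lambda>z. ennreal (h' z)))" using s by simp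
    fix A assume "A \<in> sets (density \<alpha> (\<lambda>z. ennreal (g' z)))"
    then have A: "A \<in> sets \<alpha>" "A \<in> sets \<beta>" "A \<in> sets M" using s sets by auto
    have "emeasure (density \<alpha> (\<lambda>z. ennreal (g' z))) A = (\<integral>\<^sup>+z. ennreal (g' z) * indicator A z \<partial>\<alpha>)"
      using m' A by (intro emeasure_density) auto
    also have "\<dots> = (\<integral>\<^sup>+z. ennreal (g z) * indicator (Y \<inter> A) z + indicator (A - Y) z \<partial>\<alpha>)"
      by (intro nn_integral_cong) (auto simp: g'_def split: split_indicator)
    also have "\<dots> = (\<integral>\<^sup>+z. ennreal (g z) * indicator (Y \<inter> A) z \<partial>\<alpha>) + emeasure \<alpha> (A - Y)"
      using g A Y by (subst nn_integral_add) auto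
    also have "(\<integral>\<^sup>+z. ennreal (g z) * indicator (Y \<inter> A) z \<partial>\<alpha>) = emeasure (density \<beta> (indicator Y)) (Y \<inter> A)"
      unfolding g(3)[symmetric] using g(1) A Y by (intro emeasure_density[symmetric]) auto
    also have "\<dots> = emeasure \<beta> (Y \<inter> A)" using e[of Y \<beta> "Y \<inter> A"] YM A by (simp add: Int_assoc[symmetric])
    finally have 1: "emeasure (density \<alpha> (\<lambda>z. ennreal (g' z))) A = emeasure \<beta> (Y \<inter> A) + emeasure \<alpha> (A - Y)" .
    have "emeasure (density \<beta> (\<lambda>z. ennreal (h' z))) A = (\<integral>\<^sup>+z. ennreal (h' z) * indicator A z \<partial>\<beta>)"
      using m' A by (intro emeasure_density) auto
    also have "\<dots> = (\<integral>\<^sup>+z. indicator (Y \<inter> A) z + ennreal (h z) * indicator (A - Y) z \<partial>\<beta>)"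
      by (intro nn_integral_cong) (auto simp: h'_def split: split_indicator)
    also have "\<dots> = emeasure \<beta> (Y \<inter> A) + (\<integral>\<^sup>+z. ennreal (h z) * indicator (A - Y) z \<partial>\<beta>)"
      using h A YM by (subst nn_integral_add) auto
    also have "(\<integral>\<^sup>+z. ennreal (h z) * indicator (A - Y) z \<partial>\<beta>) = emeasure (density \<alpha> (indicator (space M - Y))) (A - Y)"
      unfolding h(3)[symmetric] using h(1) A YM by (intro emeasure_density[symmetric]) auto
    also have "\<dots> = emeasure \<alpha> ((space M - Y) \<inter> (A - Y))" using YM A Y co sets by (intro e) auto
    also have "(space M - Y) \<inter> (A - Y) = A - Y" using sets.sets_into_space[OF A(3)] by auto
    finally show "emeasure (density \<alpha> (\<lambda>z. ennreal (g' z))) A = emeasure (density \<beta> (\<lambda>z. ennreal (h' z))) A"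
      using 1 by simp
  qed
  then show ?thesis
    using m YM(1) g(2) h(2) by (intro exI[of _ g'] exI[of _ h'] exI[of _ Y]) (auto simp: g'_def h'_def)
qed

context markov_kernel
begin

text \<open>\<open>killed w \<xi> k\<close> is the law of the state at time \<open>k\<close> on the event that a chain started from \<open>\<xi>\<close>
  which is stopped at time \<open>j\<close> with probability \<open>w j (Z\<^sub>j)\<close> is still running before time \<open>k\<close>.\<close>

primrec killed :: "(nat \<Rightarrow> 'a \<Rightarrow> real) \<Rightarrow> 'a measure \<Rightarrow> nat \<Rightarrow> 'a measure" where
  "killed w \<xi> 0 = \<xi>"
| "killed w \<xi> (Suc k) = density (killed w \<xi> k) (\<lambda>z. ennreal (1 - w k z)) \<bind> Q"

definition survival :: "(nat \<Rightarrow> 'a \<Rightarrow> real) \<Rightarrow> nat \<Rightarrow> (nat \<Rightarrow> 'a) \<Rightarrow> real" where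
  "survival w k \<omega> = (\<Prod>j<k. 1 - w j (\<omega> j))"

lemma nn_integral_Q_measurable [measurable]:
  "h \<in> borel_measurable M \<Longrightarrow> (\<lambda>z. \<integral>\<^sup>+y. h y \<partial>Q z) \<in> borel_measurable M" for h :: "'a \<Rightarrow> ennreal"
  by (rule measurable_compose[OF Q_sub nn_integral_measurable_subprob_algebra])

context
  fixes \<xi> :: "'a measure" and w :: "nat \<Rightarrow> 'a \<Rightarrow> real"
  assumes \<xi>: "\<xi> \<in> space (prob_algebra M)"
    and w [measurable]: "\<And>k. w k \<in> borel_measurable M" and w01: "\<And>k z. 0 \<le> w k z \<and> w k z \<le> 1"
begin

lemma sets_killed: "sets (killed w \<xi> k) = sets M" and space_killed: "space (killed w \<xi> k) = space M"
proof -
  have "sets \<xi> = sets M" "prob_space \<xi>" using \<xi> by (simp_all add: space_prob_algebra)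
  then have ne: "space M \<noteq> {}" using prob_space.not_empty[of \<xi>] sets_eq_imp_space_eq[of \<xi> M] by simp
  have "sets (killed w \<xi> k) = sets M"
  proof (induction k)
    case 0 then show ?case using \<xi> by (simp add: space_prob_algebra)
  next
    case (Suc k)
    have "space (killed w \<xi> k) = space M" by (rule sets_eq_imp_space_eq[OF Suc])
    then show ?case using ne Q_space by (auto intro!: sets_bind)
  qed
  then show "sets (killed w \<xi> k) = sets M" "space (killed w \<xi> k) = space M" by (auto dest: sets_eq_imp_space_eq)
qed

lemma measurable_killed: "measurable (killed w \<xi> k) N = measurable M N"
  by (rule measurable_cong_sets) (simp_all add: sets_killed)

lemma nn_integral_killed_Suc:
  assumes h: "h \<in> borel_measurable M"
  shows "(\<integral>\<^sup>+z. h z \<partial>killed w \<xi> (Suc k)) = (\<integral>\<^sup>+z. ennreal (1 - w k z) * (\<integral>\<^sup>+y. h y \<partial>Q z) \<partial>killed w \<xi> k)"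
proof -
  have "(\<integral>\<^sup>+z. h z \<partial>killed w \<xi> (Suc k)) = (\<integral>\<^sup>+z. \<integral>\<^sup>+y. h y \<partial>Q z \<partial>density (killed w \<xi> k) (\<lambda>z. ennreal (1 - w k z)))"
    using h by (simp, subst nn_integral_bind[where B=M]) (auto simp: measurable_killed cong: measurable_cong_sets)
  also have "\<dots> = (\<integral>\<^sup>+z. ennreal (1 - w k z) * (\<integral>\<^sup>+y. h y \<partial>Q z) \<partial>killed w \<xi> k)"
    using h by (intro nn_integral_density) (auto simp: measurable_killed)
  finally show ?thesis .
qed

lemma survival_measurable [measurable]: "survival w k \<in> borel_measurable (\<Pi>\<^sub>M i\<in>UNIV. M)"
  unfolding survival_def[abs_def] by measurable

lemma survival_bounds: "0 \<le> survival w k \<omega>" "survival w k \<omega> \<le> 1"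
  unfolding survival_def using w01 by (auto intro!: prod_nonneg prod_le_1)

lemma survival_stop: "k \<le> Suc l \<Longrightarrow> survival w k (stop_path l \<omega>) = survival w k \<omega>"
  unfolding survival_def by (intro prod.cong) (auto simp: stop_path_apply min_absorb1)

text \<open>A Feynman-Kac formula: weighting paths by the conditional probability of not having
  stopped reproduces the killed iterates. It lets integrals over paths be computed on the state
  space.\<close>

lemma nn_integral_survival:
  "h \<in> borel_measurable M \<Longrightarrow> (\<integral>\<^sup>+\<omega>. ennreal (survival w k \<omega>) * h (\<omega> k) \<partial>markov_law M Q \<xi>) = (\<integral>\<^sup>+z. h z \<partial>killed w \<xi> k)"
proof (induction k arbitrary: h)
  case 0
  then show ?case using nn_integral_path_0[OF \<xi> 0] by (simp add: survival_def)
next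
  case (Suc k)
  note [measurable] = Suc.prems
  have e: "ennreal (survival w (Suc k) \<omega>) = ennreal (survival w k \<omega>) * ennreal (1 - w k (\<omega> k))" for \<omega>
    using survival_bounds w01 by (simp add: survival_def ennreal_mult[symmetric] prod_nonneg)
  have "(\<integral>\<^sup>+\<omega>. ennreal (survival w (Suc k) \<omega>) * h (\<omega> (Suc k)) \<partial>markov_law M Q \<xi>) =
      (\<integral>\<^sup>+\<omega>. (case (stop_path k \<omega>, \<omega> (Suc k)) of (\<omega>, y) \<Rightarrow> ennreal (survival w (Suc k) \<omega>) * h y) \<partial>markov_law M Q \<xi>)"
    by (simp add: survival_stop)
  also have "\<dots> = (\<integral>\<^sup>+\<omega>. \<integral>\<^sup>+y. (case (stop_path k \<omega>, y) of (\<omega>, y) \<Rightarrow> ennreal (survival w (Suc k) \<omega>) * h y) \<partial>Q (\<omega> k) \<partial>markov_law M Q \<xi>)"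
    by (rule nn_integral_path_step[OF \<xi>]) measurable
  also have "\<dots> = (\<integral>\<^sup>+\<omega>. ennreal (survival w (Suc k) \<omega>) * (\<integral>\<^sup>+y. h y \<partial>Q (\<omega> k)) \<partial>markov_law M Q \<xi>)"
  proof (rule nn_integral_cong)
    fix \<omega> assume "\<omega> \<in> space (markov_law M Q \<xi>)"
    then have z: "\<omega> k \<in> space M" using space_path_component[of \<omega> M k] space_path[OF \<xi>] by simp
    show "(\<integral>\<^sup>+y. (case (stop_path k \<omega>, y) of (\<omega>, y) \<Rightarrow> ennreal (survival w (Suc k) \<omega>) * h y) \<partial>Q (\<omega> k)) = ennreal (survival w (Suc k) \<omega>) * (\<integral>\<^sup>+y. h y \<partial>Q (\<omega> k))"
      using Q_space[OF z] by (simp add: survival_stop, subst nn_integral_cmult) (auto cong: measurable_cong_sets)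
  qed
  also have "\<dots> = (\<integral>\<^sup>+\<omega>. ennreal (survival w k \<omega>) * (ennreal (1 - w k (\<omega> k)) * (\<integral>\<^sup>+y. h y \<partial>Q (\<omega> k))) \<partial>markov_law M Q \<xi>)"
    by (simp add: e mult.assoc)
  also have "\<dots> = (\<integral>\<^sup>+z. ennreal (1 - w k z) * (\<integral>\<^sup>+y. h y \<partial>Q z) \<partial>killed w \<xi> k)"
    by (rule Suc.IH) measurable
  also have "\<dots> = (\<integral>\<^sup>+z. h z \<partial>killed w \<xi> (Suc k))" by (rule nn_integral_killed_Suc[symmetric]) simp
  finally show ?case .
qed

end

text \<open>The p-th absolute moment of a value already accumulated plus the next r values of u
  along the chain, the one at the current state included. It is a function of state and accumulated
  value only, which is why equal laws at stopping give equal moments.\<close>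

primrec tail_moment :: "('a \<Rightarrow> real) \<Rightarrow> real \<Rightarrow> nat \<Rightarrow> 'a \<times> real \<Rightarrow> ennreal" where
  "tail_moment u p 0 x = ennreal (\<bar>snd x\<bar> powr p)"
| "tail_moment u p (Suc r) x = (\<integral>\<^sup>+y. tail_moment u p r (y, snd x + u (fst x)) \<partial>Q (fst x))"

lemma tail_moment_measurable [measurable]:
  assumes [measurable]: "u \<in> borel_measurable M"
  shows "tail_moment u p r \<in> borel_measurable (M \<Otimes>\<^sub>M borel)"
proof (induction r)
  case 0 then show ?case by (simp cong: measurable_cong)
next
  case (Suc r)
  note [measurable] = Suc
  have "(\<lambda>x. \<integral>\<^sup>+y. tail_moment u p r (y, snd x + u (fst x)) \<partial>Q (fst x)) \<in> borel_measurable (M \<Otimes>\<^sub>M borel)"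
  proof (rule nn_integral_measurable_subprob_algebra2[where N=M])
    have "(\<lambda>q. tail_moment u p r (snd q, snd (fst q) + u (fst (fst q)))) \<in> borel_measurable ((M \<Otimes>\<^sub>M borel) \<Otimes>\<^sub>M M)"
      by measurable
    then show "(\<lambda>(x, y). tail_moment u p r (y, snd x + u (fst x))) \<in> borel_measurable ((M \<Otimes>\<^sub>M borel) \<Otimes>\<^sub>M M)"
      by (simp add: split_beta')
  qed measurable
  then show ?case by (simp cong: measurable_cong)
qed

text \<open>The accumulated value B must be an adapted variable and not a number, because each
  induction step adds u at the current state to it.\<close>

lemma nn_integral_tail_moment:
  assumes \<xi>: "\<xi> \<in> space (prob_algebra M)" and u [measurable]: "u \<in> borel_measurable M"
  shows "F \<in> borel_measurable (\<Pi>\<^sub>M i\<in>UNIV. M) \<Longrightarrow> B \<in> borel_measurable (\<Pi>\<^sub>M i\<in>UNIV. M) \<Longrightarrow> (\<And>\<omega>. F (stop_path k \<omega>) = F \<omega>) \<Longrightarrow> (\<And>\<omega>. B (stop_path k \<omega>) = B \<omega>) \<Longrightarrow>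
    (\<integral>\<^sup>+\<omega>. F \<omega> * ennreal (\<bar>B \<omega> + (\<Sum>l\<in>{k..<k + r}. u (\<omega> l))\<bar> powr p) \<partial>markov_law M Q \<xi>) = (\<integral>\<^sup>+\<omega>. F \<omega> * tail_moment u p r (\<omega> k, B \<omega>) \<partial>markov_law M Q \<xi>)"
proof (induction r arbitrary: k F B)
  case 0 then show ?case by simp
next
  case (Suc r)
  note [measurable] = Suc.prems(1,2)
  note stop = Suc.prems(3,4)
  have F': "F (stop_path (Suc k) \<omega>) = F \<omega>" "B (stop_path (Suc k) \<omega>) = B \<omega>" for \<omega>
    using stop(1)[of "stop_path (Suc k) \<omega>"] stop(1)[of \<omega>] stop(2)[of "stop_path (Suc k) \<omega>"] stop(2)[of \<omega>] by simp_all
  have "(\<integral>\<^sup>+\<omega>. F \<omega> * ennreal (\<bar>B \<omega> + (\<Sum>l\<in>{k..<k + Suc r}. u (\<omega> l))\<bar> powr p) \<partial>markov_law M Q \<xi>) =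
      (\<integral>\<^sup>+\<omega>. F \<omega> * ennreal (\<bar>(B \<omega> + u (\<omega> k)) + (\<Sum>l\<in>{Suc k..<Suc k + r}. u (\<omega> l))\<bar> powr p) \<partial>markov_law M Q \<xi>)"
  proof -
    have "{k..<k + Suc r} = insert k {Suc k..<Suc k + r}" by auto
    then show ?thesis by (simp add: add.assoc del: sum.op_ivl_Suc)
  qed
  also have "\<dots> = (\<integral>\<^sup>+\<omega>. F \<omega> * tail_moment u p r (\<omega> (Suc k), B \<omega> + u (\<omega> k)) \<partial>markov_law M Q \<xi>)"
  proof (rule Suc.IH)
    show "B (stop_path (Suc k) \<omega>) + u (stop_path (Suc k) \<omega> k) = B \<omega> + u (\<omega> k)" for \<omega>
      unfolding F' by (simp add: stop_path_apply)
  qed (use F' in simp_all)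
  also have "\<dots> = (\<integral>\<^sup>+\<omega>. (\<lambda>x. F (fst x) * tail_moment u p r (snd x, B (fst x) + u (fst x k))) (stop_path k \<omega>, \<omega> (Suc k)) \<partial>markov_law M Q \<xi>)"
    by (simp add: stop stop_path_apply)
  also have "\<dots> = (\<integral>\<^sup>+\<omega>. \<integral>\<^sup>+y. (\<lambda>x. F (fst x) * tail_moment u p r (snd x, B (fst x) + u (fst x k))) (stop_path k \<omega>, y) \<partial>Q (\<omega> k) \<partial>markov_law M Q \<xi>)"
    by (rule nn_integral_path_step[OF \<xi>]) measurable
  also have "\<dots> = (\<integral>\<^sup>+\<omega>. F \<omega> * tail_moment u p (Suc r) (\<omega> k, B \<omega>) \<partial>markov_law M Q \<xi>)"
  proof (rule nn_integral_cong)
    fix \<omega> assume "\<omega> \<in> space (markov_law M Q \<xi>)"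
    then have z: "\<omega> k \<in> space M" using space_path_component[of \<omega> M k] space_path[OF \<xi>] by simp
    have m: "(\<lambda>y. tail_moment u p r (y, B \<omega> + u (\<omega> k))) \<in> borel_measurable (Q (\<omega> k))"
      using Q_space[OF z] by (auto cong: measurable_cong_sets)
    show "(\<integral>\<^sup>+y. (\<lambda>x. F (fst x) * tail_moment u p r (snd x, B (fst x) + u (fst x k))) (stop_path k \<omega>, y) \<partial>Q (\<omega> k)) = F \<omega> * tail_moment u p (Suc r) (\<omega> k, B \<omega>)"
      using nn_integral_cmult[OF m, of "F \<omega>"] by (simp add: stop stop_path_apply)
  qed
  finally show ?case .
qed

end

section \<open>The joint law of a randomised stopping time and the path\<close>

context markov_kernel
begin

context
  fixes \<xi> :: "'a measure" and w :: "nat \<Rightarrow> 'a \<Rightarrow> real" and n :: nat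
  assumes \<xi>: "\<xi> \<in> space (prob_algebra M)"
    and w [measurable]: "\<And>k. w k \<in> borel_measurable M" and w01: "\<And>k z. 0 \<le> w k z \<and> w k z \<le> 1"
begin

text \<open>The conditional probability, given the path, of stopping at time k. Whatever survives is
  stopped at n, so the weights over k \<le> n sum to 1.\<close>

definition stop_weight :: "nat \<Rightarrow> (nat \<Rightarrow> 'a) \<Rightarrow> real" where
  "stop_weight k \<omega> = (if k < n then survival w k \<omega> * w k (\<omega> k) else survival w n \<omega>)"

text \<open>The randomisation is encoded by weights on pairs of a time and a path, instead of
  auxiliary uniform variables; the path marginal remains the law of the chain.\<close>

definition stopped_law :: "(nat \<times> (nat \<Rightarrow> 'a)) measure" where
  "stopped_law = density (count_space {..n} \<Otimes>\<^sub>M markov_law M Q \<xi>) (\<lambda>(k, \<omega>). ennreal (stop_weight k \<omega>))"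

lemmas path_rules [simp] = space_path[OF \<xi>] measurable_path[OF \<xi>]

lemma survival_meas [measurable]: "survival w k \<in> borel_measurable (\<Pi>\<^sub>M i\<in>UNIV. M)"
  by (rule survival_measurable[of \<xi> w, OF \<xi> w w01])

lemma surv01: "0 \<le> survival w k \<omega>" "survival w k \<omega> \<le> 1"
  by (rule survival_bounds[of \<xi> w, OF \<xi> w w01])+

lemma stop_weight_measurable [measurable]: "stop_weight k \<in> borel_measurable (\<Pi>\<^sub>M i\<in>UNIV. M)"
  unfolding stop_weight_def[abs_def] by measurable

lemma stop_weight_nonneg: "0 \<le> stop_weight k \<omega>"
  using surv01 w01 by (simp add: stop_weight_def)

lemma sum_stop_weight: "l \<le> n \<Longrightarrow> (\<Sum>k\<in>{l..n}. stop_weight k \<omega>) = survival w l \<omega>"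
proof (induction rule: inc_induct)
  case base then show ?case by (simp add: stop_weight_def)
next
  case (step l)
  have "{l..n} = insert l {Suc l..n}" using step by auto
  then have "(\<Sum>k\<in>{l..n}. stop_weight k \<omega>) = stop_weight l \<omega> + survival w (Suc l) \<omega>" using step by simp
  also have "\<dots> = survival w l \<omega>" using step by (simp add: stop_weight_def survival_def algebra_simps)
  finally show ?case .
qed

lemma count_measurable:
  assumes "\<And>k. k \<le> n \<Longrightarrow> (\<lambda>\<omega>. F (k, \<omega>)) \<in> (\<Pi>\<^sub>M i\<in>UNIV. M) \<rightarrow>\<^sub>M K"
  shows "F \<in> count_space {..n} \<Otimes>\<^sub>M markov_law M Q \<xi> \<rightarrow>\<^sub>M K"
  by (rule measurable_pair_measure_countable1) (use assms in auto)

lemma space_stopped_law: "x \<in> space stopped_law \<Longrightarrow> fst x \<le> n"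
  by (auto simp: stopped_law_def space_pair_measure)

lemma stopped_law_measurable:
  assumes "\<And>k. k \<le> n \<Longrightarrow> (\<lambda>\<omega>. F (k, \<omega>)) \<in> (\<Pi>\<^sub>M i\<in>UNIV. M) \<rightarrow>\<^sub>M K"
  shows "F \<in> stopped_law \<rightarrow>\<^sub>M K"
  using count_measurable[OF assms] unfolding stopped_law_def by simp

lemma nn_integral_stopped_law:
  assumes F: "\<And>k. k \<le> n \<Longrightarrow> (\<lambda>\<omega>. F (k, \<omega>)) \<in> borel_measurable (\<Pi>\<^sub>M i\<in>UNIV. M)"
  shows "(\<integral>\<^sup>+x. F x \<partial>stopped_law) = (\<Sum>k\<le>n. \<integral>\<^sup>+\<omega>. ennreal (stop_weight k \<omega>) * F (k, \<omega>) \<partial>markov_law M Q \<xi>)"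
proof -
  interpret prob_space "markov_law M Q \<xi>" by (rule prob_space_path[OF \<xi>])
  let ?W = "\<lambda>x :: nat \<times> (nat \<Rightarrow> 'a). case x of (k, \<omega>) \<Rightarrow> ennreal (stop_weight k \<omega>)"
  have Wm: "?W \<in> borel_measurable (count_space {..n} \<Otimes>\<^sub>M markov_law M Q \<xi>)" by (rule count_measurable) simp
  have Fm: "F \<in> borel_measurable (count_space {..n} \<Otimes>\<^sub>M markov_law M Q \<xi>)" by (rule count_measurable) (rule F)
  have "(\<integral>\<^sup>+x. F x \<partial>stopped_law) = (\<integral>\<^sup>+x. ?W x * F x \<partial>(count_space {..n} \<Otimes>\<^sub>M markov_law M Q \<xi>))"
    unfolding stopped_law_def by (rule nn_integral_density[OF Wm Fm])
  also have "\<dots> = (\<integral>\<^sup>+k. \<integral>\<^sup>+\<omega>. ?W (k, \<omega>) * F (k, \<omega>) \<partial>markov_law M Q \<xi> \<partial>count_space {..n})"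
    using Wm Fm by (intro nn_integral_fst[symmetric]) simp
  also have "\<dots> = (\<Sum>k\<le>n. \<integral>\<^sup>+\<omega>. ennreal (stop_weight k \<omega>) * F (k, \<omega>) \<partial>markov_law M Q \<xi>)"
    by (simp add: nn_integral_count_space_finite)
  finally show ?thesis .
qed

text \<open>The weights of all k \<ge> l telescope to the survival probability, which depends only
  on the path before l.\<close>

lemma nn_integral_stopped_law_running:
  assumes \<Phi> [measurable]: "\<Phi> \<in> borel_measurable (\<Pi>\<^sub>M i\<in>UNIV. M)" and l: "l \<le> n"
  shows "(\<integral>\<^sup>+x. (if l \<le> fst x then \<Phi> (snd x) else 0) \<partial>stopped_law) = (\<integral>\<^sup>+\<omega>. ennreal (survival w l \<omega>) * \<Phi> \<omega> \<partial>markov_law M Q \<xi>)"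
proof -
  have "(\<integral>\<^sup>+x. (if l \<le> fst x then \<Phi> (snd x) else 0) \<partial>stopped_law) =
      (\<Sum>k\<le>n. \<integral>\<^sup>+\<omega>. ennreal (stop_weight k \<omega>) * (if l \<le> k then \<Phi> \<omega> else 0) \<partial>markov_law M Q \<xi>)"
  proof -
    have "(\<lambda>\<omega>. if l \<le> fst (k, \<omega>) then \<Phi> (snd (k, \<omega>)) else 0) \<in> borel_measurable (\<Pi>\<^sub>M i\<in>UNIV. M)" for k :: nat
      by (cases "l \<le> k") auto
    from nn_integral_stopped_law[of "\<lambda>x. if l \<le> fst x then \<Phi> (snd x) else 0", OF this] show ?thesis by (simp only: fst_conv snd_conv)
  qed
  also have "\<dots> = (\<integral>\<^sup>+\<omega>. (\<Sum>k\<le>n. ennreal (stop_weight k \<omega>) * (if l \<le> k then \<Phi> \<omega> else 0)) \<partial>markov_law M Q \<xi>)"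
    by (rule nn_integral_sum[symmetric]) simp
  also have "\<dots> = (\<integral>\<^sup>+\<omega>. ennreal (survival w l \<omega>) * \<Phi> \<omega> \<partial>markov_law M Q \<xi>)"
  proof (rule nn_integral_cong)
    fix \<omega>
    have "(\<Sum>k\<le>n. ennreal (stop_weight k \<omega>) * (if l \<le> k then \<Phi> \<omega> else 0)) = (\<Sum>k\<in>{l..n}. ennreal (stop_weight k \<omega>) * \<Phi> \<omega>)"
      by (rule sum.mono_neutral_cong_right) auto
    also have "\<dots> = ennreal (\<Sum>k\<in>{l..n}. stop_weight k \<omega>) * \<Phi> \<omega>"
      by (simp add: sum_distrib_right[symmetric] stop_weight_nonneg)
    finally show "(\<Sum>k\<le>n. ennreal (stop_weight k \<omega>) * (if l \<le> k then \<Phi> \<omega> else 0)) = ennreal (survival w l \<omega>) * \<Phi> \<omega>"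
      by (simp add: sum_stop_weight[OF l])
  qed
  finally show ?thesis .
qed

lemma lp_le_stopped_law_iff:
  assumes X: "X \<in> borel_measurable (\<Pi>\<^sub>M i\<in>UNIV. M)"
  shows "lp_le stopped_law p (\<lambda>x. X (snd x)) a \<longleftrightarrow> lp_le (markov_law M Q \<xi>) p X a"
proof -
  have m: "(\<lambda>x. X (snd x)) \<in> borel_measurable stopped_law" by (rule stopped_law_measurable) (use X in simp)
  have "(\<integral>\<^sup>+x. ennreal (\<bar>X (snd x)\<bar> powr p) \<partial>stopped_law) = (\<integral>\<^sup>+\<omega>. ennreal (\<bar>X \<omega>\<bar> powr p) \<partial>markov_law M Q \<xi>)"
    using nn_integral_stopped_law_running[of "\<lambda>\<omega>. ennreal (\<bar>X \<omega>\<bar> powr p)" 0] X by (simp add: survival_def)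
  then show ?thesis using m X by (simp add: lp_le_def)
qed

text \<open>On the right the stopping rule and the initial law enter only through the laws of the
  stopped states and the mass that survives to n, exactly the data that the coupling equalises. At
  time n the sum is empty, so the mass alone suffices there.\<close>

lemma nn_integral_stopped_law_future:
  assumes u [measurable]: "u \<in> borel_measurable M"
  shows "(\<integral>\<^sup>+x. ennreal (\<bar>b (fst x) + (\<Sum>l\<in>{fst x..<n}. u (snd x l))\<bar> powr p) \<partial>stopped_law) =
    (\<Sum>k<n. \<integral>\<^sup>+z. tail_moment u p (n - k) (z, b k) \<partial>density (killed w \<xi> k) (\<lambda>z. ennreal (w k z)))
    + ennreal (\<bar>b n\<bar> powr p) * emeasure (killed w \<xi> n) (space M)"
proof -
  let ?P = "markov_law M Q \<xi>"
  note mk = measurable_killed[of \<xi> w, OF \<xi> w w01]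
  have "(\<integral>\<^sup>+x. ennreal (\<bar>b (fst x) + (\<Sum>l\<in>{fst x..<n}. u (snd x l))\<bar> powr p) \<partial>stopped_law) =
      (\<Sum>k\<le>n. \<integral>\<^sup>+\<omega>. ennreal (stop_weight k \<omega>) * ennreal (\<bar>b k + (\<Sum>l\<in>{k..<n}. u (\<omega> l))\<bar> powr p) \<partial>?P)"
  proof -
    have "(\<lambda>\<omega>. ennreal (\<bar>b k + (\<Sum>l\<in>{k..<n}. u (\<omega> l))\<bar> powr p)) \<in> borel_measurable (\<Pi>\<^sub>M i\<in>UNIV. M)" for k
      by measurable
    then show ?thesis by (subst nn_integral_stopped_law) simp_all
  qed
  also have "\<dots> = (\<Sum>k<n. \<integral>\<^sup>+\<omega>. ennreal (stop_weight k \<omega>) * ennreal (\<bar>b k + (\<Sum>l\<in>{k..<n}. u (\<omega> l))\<bar> powr p) \<partial>?P)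
      + (\<integral>\<^sup>+\<omega>. ennreal (survival w n \<omega>) * ennreal (\<bar>b n\<bar> powr p) \<partial>?P)"
    by (simp add: lessThan_Suc_atMost[symmetric] stop_weight_def)
  also have "(\<integral>\<^sup>+\<omega>. ennreal (survival w n \<omega>) * ennreal (\<bar>b n\<bar> powr p) \<partial>?P) = ennreal (\<bar>b n\<bar> powr p) * emeasure (killed w \<xi> n) (space M)"
  proof -
    have "(\<integral>\<^sup>+\<omega>. ennreal (survival w n \<omega>) * ennreal (\<bar>b n\<bar> powr p) \<partial>?P) = (\<integral>\<^sup>+z. ennreal (\<bar>b n\<bar> powr p) \<partial>killed w \<xi> n)"
      using nn_integral_survival[of \<xi> w, OF \<xi> w w01, of "\<lambda>_. ennreal (\<bar>b n\<bar> powr p)" n] by simp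
    then show ?thesis by (simp add: space_killed[of \<xi> w, OF \<xi> w w01])
  qed
  also have "(\<Sum>k<n. \<integral>\<^sup>+\<omega>. ennreal (stop_weight k \<omega>) * ennreal (\<bar>b k + (\<Sum>l\<in>{k..<n}. u (\<omega> l))\<bar> powr p) \<partial>?P)
      = (\<Sum>k<n. \<integral>\<^sup>+z. tail_moment u p (n - k) (z, b k) \<partial>density (killed w \<xi> k) (\<lambda>z. ennreal (w k z)))"
  proof (rule sum.cong[OF refl])
    fix k assume "k \<in> {..<n}"
    then have k: "k < n" "k + (n - k) = n" by auto
    have m: "(\<lambda>z. tail_moment u p (n - k) (z, b k)) \<in> borel_measurable M" by measurable
    have "(\<integral>\<^sup>+\<omega>. ennreal (stop_weight k \<omega>) * ennreal (\<bar>b k + (\<Sum>l\<in>{k..<n}. u (\<omega> l))\<bar> powr p) \<partial>?P) =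
        (\<integral>\<^sup>+\<omega>. ennreal (stop_weight k \<omega>) * tail_moment u p (n - k) (\<omega> k, b k) \<partial>?P)"
    proof -
      have "stop_weight k (stop_path k \<omega>) = stop_weight k \<omega>" for \<omega>
        using k survival_stop[of \<xi> w, OF \<xi> w w01, of k k \<omega>] by (simp add: stop_weight_def stop_path_apply)
      then show ?thesis
        using nn_integral_tail_moment[OF \<xi> u, of "\<lambda>\<omega>. ennreal (stop_weight k \<omega>)" "\<lambda>_. b k" k "n - k" p] k(2) by simp
    qed
    also have "\<dots> = (\<integral>\<^sup>+\<omega>. ennreal (survival w k \<omega>) * (ennreal (w k (\<omega> k)) * tail_moment u p (n - k) (\<omega> k, b k)) \<partial>?P)"
      using k surv01 w01 by (simp add: stop_weight_def ennreal_mult mult.assoc)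
    also have "\<dots> = (\<integral>\<^sup>+z. ennreal (w k z) * tail_moment u p (n - k) (z, b k) \<partial>killed w \<xi> k)"
      by (rule nn_integral_survival[of \<xi> w, OF \<xi> w w01]) (use m in measurable)
    also have "\<dots> = (\<integral>\<^sup>+z. tail_moment u p (n - k) (z, b k) \<partial>density (killed w \<xi> k) (\<lambda>z. ennreal (w k z)))"
      using m by (intro nn_integral_density[symmetric]) (simp_all add: mk)
    finally show "(\<integral>\<^sup>+\<omega>. ennreal (stop_weight k \<omega>) * ennreal (\<bar>b k + (\<Sum>l\<in>{k..<n}. u (\<omega> l))\<bar> powr p) \<partial>?P) =
      (\<integral>\<^sup>+z. tail_moment u p (n - k) (z, b k) \<partial>density (killed w \<xi> k) (\<lambda>z. ennreal (w k z)))" .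
  qed
  finally show ?thesis .
qed

text \<open>The term at time l counts only if the chain is not stopped at l either. Hence the factor
  1 - w l: what controls the norm is the V-mass left after the common part has been removed.\<close>

lemma lp_le_running:
  assumes f [measurable]: "f \<in> borel_measurable M" and le: "\<And>z. z \<in> space M \<Longrightarrow> \<bar>f z\<bar> \<le> N * V z powr (1 / p)"
    and V [measurable]: "V \<in> borel_measurable M" and Vpos: "\<And>z. z \<in> space M \<Longrightarrow> 0 < V z"
    and N: "0 \<le> N" and p: "1 \<le> p" and l: "l < n"
    and r: "(\<integral>\<^sup>+z. ennreal (1 - w l z) * ennreal (V z) \<partial>killed w \<xi> l) \<le> ennreal r" "0 \<le> r"
  shows "lp_le stopped_law p (\<lambda>x. if l < fst x then f (snd x l) else 0) (N * r powr (1 / p))"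
proof -
  note mk = measurable_killed[of \<xi> w, OF \<xi> w w01]
  have fp: "\<bar>f z\<bar> powr p \<le> N powr p * V z" if "z \<in> space M" for z
  proof -
    have "\<bar>f z\<bar> powr p \<le> (N * V z powr (1 / p)) powr p" using le[OF that] p by (intro powr_mono2) auto
    also have "\<dots> = N powr p * V z" using N p Vpos[OF that] by (simp add: powr_mult powr_powr)
    finally show ?thesis .
  qed
  have m: "(\<lambda>x. if l < fst x then f (snd x l) else 0) \<in> borel_measurable stopped_law"
  proof (rule stopped_law_measurable)
    show "(\<lambda>\<omega>. if l < fst (k, \<omega>) then f (snd (k, \<omega>) l) else 0) \<in> borel_measurable (\<Pi>\<^sub>M i\<in>UNIV. M)" for k
      by (cases "l < k") auto
  qed
  have "(\<integral>\<^sup>+x. ennreal (\<bar>if l < fst x then f (snd x l) else 0\<bar> powr p) \<partial>stopped_law) =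
      (\<integral>\<^sup>+x. (if Suc l \<le> fst x then ennreal (\<bar>f (snd x l)\<bar> powr p) else 0) \<partial>stopped_law)"
    by (intro nn_integral_cong) auto
  also have "\<dots> = (\<integral>\<^sup>+\<omega>. ennreal (survival w (Suc l) \<omega>) * ennreal (\<bar>f (\<omega> l)\<bar> powr p) \<partial>markov_law M Q \<xi>)"
    using l by (intro nn_integral_stopped_law_running) auto
  also have "\<dots> = (\<integral>\<^sup>+\<omega>. ennreal (survival w l \<omega>) * (ennreal (1 - w l (\<omega> l)) * ennreal (\<bar>f (\<omega> l)\<bar> powr p)) \<partial>markov_law M Q \<xi>)"
  proof (rule nn_integral_cong)
    fix \<omega>
    have "survival w (Suc l) \<omega> = survival w l \<omega> * (1 - w l (\<omega> l))" by (simp add: survival_def)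
    then show "ennreal (survival w (Suc l) \<omega>) * ennreal (\<bar>f (\<omega> l)\<bar> powr p) = ennreal (survival w l \<omega>) * (ennreal (1 - w l (\<omega> l)) * ennreal (\<bar>f (\<omega> l)\<bar> powr p))"
      using surv01 w01 by (simp add: ennreal_mult mult.assoc)
  qed
  also have "\<dots> = (\<integral>\<^sup>+z. ennreal (1 - w l z) * ennreal (\<bar>f z\<bar> powr p) \<partial>killed w \<xi> l)"
    by (rule nn_integral_survival[of \<xi> w, OF \<xi> w w01]) measurable
  also have "\<dots> \<le> (\<integral>\<^sup>+z. ennreal (N powr p) * (ennreal (1 - w l z) * ennreal (V z)) \<partial>killed w \<xi> l)"
  proof (rule nn_integral_mono)
    fix z assume "z \<in> space (killed w \<xi> l)"
    then have z: "z \<in> space M" by (simp add: space_killed[of \<xi> w, OF \<xi> w w01])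
    have "ennreal (\<bar>f z\<bar> powr p) \<le> ennreal (N powr p) * ennreal (V z)"
      using ennreal_leI[OF fp[OF z]] Vpos[OF z] by (simp add: ennreal_mult)
    from mult_left_mono[OF this, of "ennreal (1 - w l z)"]
    show "ennreal (1 - w l z) * ennreal (\<bar>f z\<bar> powr p) \<le> ennreal (N powr p) * (ennreal (1 - w l z) * ennreal (V z))"
      by (simp add: mult_ac)
  qed
  also have "\<dots> = ennreal (N powr p) * (\<integral>\<^sup>+z. ennreal (1 - w l z) * ennreal (V z) \<partial>killed w \<xi> l)"
    by (rule nn_integral_cmult) (simp add: mk)
  also have "\<dots> \<le> ennreal (N powr p) * ennreal r" by (intro mult_left_mono r) simp
  also have "\<dots> = ennreal ((N * r powr (1 / p)) powr p)"
    using N p r by (simp add: powr_mult powr_powr ennreal_mult)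
  finally show ?thesis using m N by (simp add: lp_le_def)
qed

end

end

section \<open>Maximal coupling\<close>

lemma ennreal_add_cancel_le:
  fixes x y c :: ennreal
  assumes "c + x \<le> c + y" "c < \<infinity>"
  shows "x \<le> y"
  using assms by (auto simp: ennreal_add_left_cancel_le)

lemma ennreal_add_cancel_eq:
  fixes x y c :: ennreal
  assumes "c + x = c + y" "c < \<infinity>"
  shows "x = y"
  using assms by (auto simp: ennreal_add_left_cancel)

context vge_chain
begin

context
  fixes \<xi> :: "'a measure"
  assumes \<xi>: "\<xi> \<in> space (prob_algebra M)"
begin

lemma xi_space: "prob_space \<xi>" "sets \<xi> = sets M" "space \<xi> = space M"
  using \<xi> sets_eq_imp_space_eq[of \<xi> M] by (auto simp: space_prob_algebra)

text \<open>The splitting functions of the maximal coupling of the chains started from \<open>\<xi>\<close> and from \<open>\<pi>\<close>: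
  in each step the common part of the two laws of the not yet coupled states is removed.\<close>

lemma coupling_exists:
  "\<exists>g h Y. (\<forall>k. g k \<in> borel_measurable M \<and> h k \<in> borel_measurable M \<and> (\<forall>z. 0 \<le> g k z \<and> g k z \<le> (1::real)) \<and> (\<forall>z. 0 \<le> h k z \<and> h k z \<le> (1::real))
    \<and> Y k \<in> sets M \<and> density (killed g \<xi> k) (\<lambda>z. ennreal (g k z)) = density (killed h \<pi> k) (\<lambda>z. ennreal (h k z))
    \<and> (\<forall>z. z \<notin> Y k \<longrightarrow> g k z = 1) \<and> (\<forall>z\<in>Y k. h k z = 1))"
proof -
  define R where "R \<alpha> \<beta> g h Y \<longleftrightarrow> g \<in> borel_measurable M \<and> h \<in> borel_measurable M \<and> (\<forall>z. 0 \<le> g z \<and> g z \<le> (1::real)) \<and> (\<forall>z. 0 \<le> h z \<and> h z \<le> (1::real))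
    \<and> Y \<in> sets M \<and> density \<alpha> (\<lambda>z. ennreal (g z)) = density \<beta> (\<lambda>z. ennreal (h z))
    \<and> (\<forall>z. z \<notin> Y \<longrightarrow> g z = 1) \<and> (\<forall>z\<in>Y. h z = 1)" for \<alpha> \<beta> g h Y
  define P where "P n x \<longleftrightarrow> (case x of (\<alpha>, \<beta>, g, h, Y) \<Rightarrow> finite_measure \<alpha> \<and> finite_measure \<beta> \<and> sets \<alpha> = sets M \<and> sets \<beta> = sets M
     \<and> R \<alpha> \<beta> g h Y \<and> (n = 0 \<longrightarrow> \<alpha> = \<xi> \<and> \<beta> = \<pi>))" for n :: nat and x :: "'a measure \<times> 'a measure \<times> ('a \<Rightarrow> real) \<times> ('a \<Rightarrow> real) \<times> 'a set"
  define S where "S (n::nat) x y \<longleftrightarrow> (case x of (\<alpha>, \<beta>, g, h, Y) \<Rightarrow> case y of (\<alpha>', \<beta>', _) \<Rightarrow>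
     \<alpha>' = density \<alpha> (\<lambda>z. ennreal (1 - g z)) \<bind> Q \<and> \<beta>' = density \<beta> (\<lambda>z. ennreal (1 - h z)) \<bind> Q)"
    for n and x y :: "'a measure \<times> 'a measure \<times> ('a \<Rightarrow> real) \<times> ('a \<Rightarrow> real) \<times> 'a set"
  have Rex: "\<exists>g h Y. R \<alpha> \<beta> g h Y" if "finite_measure \<alpha>" "finite_measure \<beta>" "sets \<alpha> = sets M" "sets \<beta> = sets M" for \<alpha> \<beta>
    using measure_overlap[OF that] unfolding R_def .
  have ne: "space M \<noteq> {}" using prob_space.not_empty[OF pi_space(1)] pi_space(3) by simp
  have bnd: "sets (density \<alpha> (\<lambda>z. ennreal (1 - g z)) \<bind> Q) = sets M \<and> finite_measure (density \<alpha> (\<lambda>z. ennreal (1 - g z)) \<bind> Q)"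
    if \<alpha>: "finite_measure \<alpha>" "sets \<alpha> = sets M" and g: "g \<in> borel_measurable M" "\<forall>z. 0 \<le> g z \<and> g z \<le> (1::real)" for \<alpha> g
  proof -
    let ?d = "density \<alpha> (\<lambda>z. ennreal (1 - g z))"
    have sp: "space \<alpha> = space M" by (rule sets_eq_imp_space_eq[OF \<alpha>(2)])
    have m: "(\<lambda>z. ennreal (1 - g z)) \<in> borel_measurable \<alpha>" using g(1) \<alpha>(2) by (auto cong: measurable_cong_sets)
    have s: "sets (?d \<bind> Q) = sets M" using ne sp Q_space by (intro sets_bind) auto
    have spb: "space (?d \<bind> Q) = space M" by (rule sets_eq_imp_space_eq[OF s])
    have Qd: "Q \<in> ?d \<rightarrow>\<^sub>M subprob_algebra M" using \<alpha>(2) by (auto cong: measurable_cong_sets)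
    have "emeasure (?d \<bind> Q) (space M) = (\<integral>\<^sup>+z. emeasure (Q z) (space M) \<partial>?d)"
      using ne sp by (intro emeasure_bind[OF _ Qd]) auto
    also have "\<dots> = (\<integral>\<^sup>+z. 1 \<partial>?d)"
    proof (rule nn_integral_cong)
      fix z assume "z \<in> space ?d"
      then have z: "z \<in> space M" using sp by simp
      show "emeasure (Q z) (space M) = 1"
        using prob_space.emeasure_space_1[OF Q_space(1)[OF z]] Q_space(3)[OF z] by simp
    qed
    also have "\<dots> = (\<integral>\<^sup>+z. ennreal (1 - g z) \<partial>\<alpha>)" using m by (subst nn_integral_density) auto
    also have "\<dots> \<le> (\<integral>\<^sup>+z. 1 \<partial>\<alpha>)" using g(2) by (intro nn_integral_mono) (auto simp: ennreal_le_1)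
    also have "\<dots> < \<infinity>" using finite_measure.emeasure_finite[OF \<alpha>(1), of "space \<alpha>"] by (simp add: less_top)
    finally have "finite_measure (?d \<bind> Q)" by (intro finite_measureI) (simp add: spb less_top)
    with s show ?thesis by simp
  qed
  \<comment> \<open>Dependent choice: the killed laws at time k + 1 depend on the splitting
    functions chosen at time k, so the laws are carried along with the functions and only afterwards
    identified with \<open>killed\<close>.\<close>
  have "\<exists>x. \<forall>n. P n (x n) \<and> S n (x n) (x (Suc n))"
  proof (rule dependent_nat_choice)
    obtain g h Y where "R \<xi> \<pi> g h Y"
      using Rex[of \<xi> \<pi>] xi_space pi_space prob_space.finite_measure by blast
    then show "\<exists>x. P 0 x"
      using xi_space pi_space prob_space.finite_measure by (intro exI[of _ "(\<xi>, \<pi>, g, h, Y)"]) (auto simp: P_def)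
  next
    fix x n assume "P n x"
    obtain \<alpha> \<beta> g h Y where x: "x = (\<alpha>, \<beta>, g, h, Y)" by (cases x) auto
    have R: "finite_measure \<alpha>" "finite_measure \<beta>" "sets \<alpha> = sets M" "sets \<beta> = sets M" "R \<alpha> \<beta> g h Y"
      using \<open>P n x\<close> by (auto simp: P_def x)
    let ?a = "density \<alpha> (\<lambda>z. ennreal (1 - g z)) \<bind> Q" and ?b = "density \<beta> (\<lambda>z. ennreal (1 - h z)) \<bind> Q"
    have a: "sets ?a = sets M \<and> finite_measure ?a" by (rule bnd) (use R in \<open>auto simp: R_def\<close>)
    have b: "sets ?b = sets M \<and> finite_measure ?b" by (rule bnd) (use R in \<open>auto simp: R_def\<close>)
    obtain g' h' Y' where "R ?a ?b g' h' Y'" using Rex[of ?a ?b] a b by blast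
    then show "\<exists>y. P (Suc n) y \<and> S n x y"
      using a b by (intro exI[of _ "(?a, ?b, g', h', Y')"]) (auto simp: P_def S_def x)
  qed
  then obtain x where x: "\<And>n. P n (x n)" "\<And>n. S n (x n) (x (Suc n))" by blast
  define \<alpha> \<beta> g h Y where "\<alpha> n = fst (x n)" and "\<beta> n = fst (snd (x n))" and "g n = fst (snd (snd (x n)))"
    and "h n = fst (snd (snd (snd (x n))))" and "Y n = snd (snd (snd (snd (x n))))" for n
  have xe: "x n = (\<alpha> n, \<beta> n, g n, h n, Y n)" for n by (simp add: \<alpha>_def \<beta>_def g_def h_def Y_def)
  have r: "R (\<alpha> n) (\<beta> n) (g n) (h n) (Y n)" "\<alpha> 0 = \<xi>" "\<beta> 0 = \<pi>" for n
    using x(1)[of n] x(1)[of 0] by (auto simp: P_def xe)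
  have s: "\<alpha> (Suc n) = density (\<alpha> n) (\<lambda>z. ennreal (1 - g n z)) \<bind> Q" "\<beta> (Suc n) = density (\<beta> n) (\<lambda>z. ennreal (1 - h n z)) \<bind> Q" for n
    using x(2)[of n] by (auto simp: S_def xe)
  have k: "killed g \<xi> n = \<alpha> n" "killed h \<pi> n = \<beta> n" for n
    by (induction n) (simp_all add: r s)
  show ?thesis
    by (intro exI[of _ g] exI[of _ h] exI[of _ Y] allI) (use r(1) in \<open>simp add: k R_def\<close>)
qed

context
  fixes g h :: "nat \<Rightarrow> 'a \<Rightarrow> real" and Y :: "nat \<Rightarrow> 'a set"
  assumes g [measurable]: "\<And>k. g k \<in> borel_measurable M" and g01: "\<And>k z. 0 \<le> g k z \<and> g k z \<le> 1"
    and h [measurable]: "\<And>k. h k \<in> borel_measurable M" and h01: "\<And>k z. 0 \<le> h k z \<and> h k z \<le> 1"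
    and Y [measurable]: "\<And>k. Y k \<in> sets M"
    and dens: "\<And>k. density (killed g \<xi> k) (\<lambda>z. ennreal (g k z)) = density (killed h \<pi> k) (\<lambda>z. ennreal (h k z))"
    and gY: "\<And>k z. z \<notin> Y k \<Longrightarrow> g k z = 1" and hY: "\<And>k z. z \<in> Y k \<Longrightarrow> h k z = 1"
begin

abbreviation "A k \<equiv> killed g \<xi> k"
abbreviation "B k \<equiv> killed h \<pi> k"

lemmas mA = measurable_killed[of \<xi> g, OF \<xi> g g01]
  and spA = space_killed[of \<xi> g, OF \<xi> g g01]
  and mB = measurable_killed[of \<pi> h, OF pi_prob_algebra h h01]
  and spB = space_killed[of \<pi> h, OF pi_prob_algebra h h01]
  and A_Suc = nn_integral_killed_Suc[of \<xi> g, OF \<xi> g g01]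
  and B_Suc = nn_integral_killed_Suc[of \<pi> h, OF pi_prob_algebra h h01]

lemma common_part:
  assumes \<phi>: "\<phi> \<in> borel_measurable M"
  shows "(\<integral>\<^sup>+z. ennreal (g k z) * \<phi> z \<partial>A k) = (\<integral>\<^sup>+z. ennreal (h k z) * \<phi> z \<partial>B k)"
proof -
  have "(\<integral>\<^sup>+z. ennreal (g k z) * \<phi> z \<partial>A k) = (\<integral>\<^sup>+z. \<phi> z \<partial>density (A k) (\<lambda>z. ennreal (g k z)))"
    using \<phi> by (intro nn_integral_density[symmetric]) (simp_all add: mA)
  also have "\<dots> = (\<integral>\<^sup>+z. ennreal (h k z) * \<phi> z \<partial>B k)"
    unfolding dens using \<phi> by (intro nn_integral_density) (simp_all add: mB)
  finally show ?thesis .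
qed

lemma split_weight:
  fixes w :: "'a \<Rightarrow> real"
  assumes "\<phi> \<in> borel_measurable \<mu>" "w \<in> borel_measurable \<mu>" "\<And>z. 0 \<le> w z \<and> w z \<le> 1"
  shows "(\<integral>\<^sup>+z. \<phi> z \<partial>\<mu>) = (\<integral>\<^sup>+z. ennreal (w z) * \<phi> z \<partial>\<mu>) + (\<integral>\<^sup>+z. ennreal (1 - w z) * \<phi> z \<partial>\<mu>)"
proof -
  have "(\<integral>\<^sup>+z. \<phi> z \<partial>\<mu>) = (\<integral>\<^sup>+z. ennreal (w z) * \<phi> z + ennreal (1 - w z) * \<phi> z \<partial>\<mu>)"
    using assms(3) by (intro nn_integral_cong) (simp flip: distrib_right ennreal_plus)
  then show ?thesis using assms by (simp add: nn_integral_add)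
qed

lemma pi_Q: "\<phi> \<in> borel_measurable M \<Longrightarrow> (\<integral>\<^sup>+z. \<integral>\<^sup>+y. \<phi> y \<partial>Q z \<partial>\<pi>) = (\<integral>\<^sup>+z. \<phi> z \<partial>\<pi>)" for \<phi> :: "'a \<Rightarrow> ennreal"
proof -
  assume \<phi>: "\<phi> \<in> borel_measurable M"
  have "(\<integral>\<^sup>+z. \<integral>\<^sup>+y. \<phi> y \<partial>Q z \<partial>\<pi>) = (\<integral>\<^sup>+z. \<integral>\<^sup>+y. \<phi> y \<partial>kernel_power M Q 1 z \<partial>\<pi>)"
  proof (rule nn_integral_cong)
    fix z assume "z \<in> space \<pi>"
    then have "z \<in> space M" using pi_space by simp
    then show "(\<integral>\<^sup>+y. \<phi> y \<partial>Q z) = (\<integral>\<^sup>+y. \<phi> y \<partial>kernel_power M Q 1 z)" by (subst Q_eq_kernel) auto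
  qed
  then show ?thesis using nn_integral_pi[OF \<phi>, of 1] by simp
qed

text \<open>Killing only removes mass and \<pi> is invariant. Through \<open>common_finite\<close>
  this makes the removed common parts finite, so that they can be cancelled.\<close>

lemma B_le_pi: "\<phi> \<in> borel_measurable M \<Longrightarrow> (\<integral>\<^sup>+z. \<phi> z \<partial>B k) \<le> (\<integral>\<^sup>+z. \<phi> z \<partial>\<pi>)" for \<phi> :: "'a \<Rightarrow> ennreal"
proof (induction k arbitrary: \<phi>)
  case 0 then show ?case by simp
next
  case (Suc k)
  have "(\<integral>\<^sup>+z. \<phi> z \<partial>B (Suc k)) = (\<integral>\<^sup>+z. ennreal (1 - h k z) * (\<integral>\<^sup>+y. \<phi> y \<partial>Q z) \<partial>B k)" by (rule B_Suc[OF Suc.prems])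
  also have "\<dots> \<le> (\<integral>\<^sup>+z. 1 * (\<integral>\<^sup>+y. \<phi> y \<partial>Q z) \<partial>B k)"
    using h01 by (intro nn_integral_mono mult_right_mono) (auto simp: ennreal_le_1)
  also have "\<dots> \<le> (\<integral>\<^sup>+z. (\<integral>\<^sup>+y. \<phi> y \<partial>Q z) \<partial>\<pi>)" using Suc.IH[of "\<lambda>z. \<integral>\<^sup>+y. \<phi> y \<partial>Q z"] Suc.prems by simp
  also have "\<dots> = (\<integral>\<^sup>+z. \<phi> z \<partial>\<pi>)" by (rule pi_Q[OF Suc.prems])
  finally show ?case .
qed

abbreviation "K k \<phi> \<equiv> (\<integral>\<^sup>+z. \<integral>\<^sup>+y. \<phi> y \<partial>kernel_power M Q k z \<partial>\<xi>)"

lemma common_finite: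
  assumes \<phi>: "\<phi> \<in> borel_measurable M" and fin: "(\<integral>\<^sup>+z. \<phi> z \<partial>\<pi>) < \<infinity>"
  shows "(\<integral>\<^sup>+z. ennreal (g k z) * \<phi> z \<partial>A k) < \<infinity>"
proof -
  have "(\<integral>\<^sup>+z. ennreal (g k z) * \<phi> z \<partial>A k) \<le> (\<integral>\<^sup>+z. 1 * \<phi> z \<partial>B k)"
    unfolding common_part[OF \<phi>] using h01 by (intro nn_integral_mono mult_right_mono) (auto simp: ennreal_le_1)
  also have "\<dots> \<le> (\<integral>\<^sup>+z. \<phi> z \<partial>\<pi>)" using B_le_pi[OF \<phi>] by simp
  finally show ?thesis using fin by (rule le_less_trans)
qed

text \<open>Removing the same measure from both chains preserves their difference, so A k - B k
  equals \<xi> Q^k - \<pi>. It is written as an equality of sums, and the finite common part cancels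
  in each step.\<close>

lemma signed_balance:
  "\<phi> \<in> borel_measurable M \<Longrightarrow> (\<integral>\<^sup>+z. \<phi> z \<partial>\<pi>) < \<infinity> \<Longrightarrow> (\<integral>\<^sup>+z. \<phi> z \<partial>A k) + (\<integral>\<^sup>+z. \<phi> z \<partial>\<pi>) = (\<integral>\<^sup>+z. \<phi> z \<partial>B k) + K k \<phi>"
  for \<phi> :: "'a \<Rightarrow> ennreal"
proof (induction k arbitrary: \<phi>)
  case 0
  have "K 0 \<phi> = (\<integral>\<^sup>+z. \<phi> z \<partial>\<xi>)" using 0 xi_space by (intro nn_integral_cong) (simp add: nn_integral_return)
  then show ?case by (simp add: add.commute)
next
  case (Suc k)
  note [measurable] = Suc.prems(1)
  let ?q = "\<lambda>z. \<integral>\<^sup>+y. \<phi> y \<partial>Q z"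
  have qm: "?q \<in> borel_measurable M" by measurable
  have piq: "(\<integral>\<^sup>+z. ?q z \<partial>\<pi>) = (\<integral>\<^sup>+z. \<phi> z \<partial>\<pi>)" by (rule pi_Q[OF Suc.prems(1)])
  have Kq: "K k ?q = K (Suc k) \<phi>"
    using xi_space by (intro nn_integral_cong nn_integral_Suc(1)[symmetric]) auto
  let ?c = "\<integral>\<^sup>+z. ennreal (g k z) * ?q z \<partial>A k"
  have Aq: "(\<integral>\<^sup>+z. ?q z \<partial>A k) = ?c + (\<integral>\<^sup>+z. \<phi> z \<partial>A (Suc k))"
    unfolding A_Suc[OF Suc.prems(1)] by (rule split_weight) (use g01 in \<open>simp_all add: mA\<close>)
  have Bq: "(\<integral>\<^sup>+z. ?q z \<partial>B k) = ?c + (\<integral>\<^sup>+z. \<phi> z \<partial>B (Suc k))"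
    unfolding B_Suc[OF Suc.prems(1)] common_part[OF qm] by (rule split_weight) (use h01 in \<open>simp_all add: mB\<close>)
  have "?c + ((\<integral>\<^sup>+z. \<phi> z \<partial>A (Suc k)) + (\<integral>\<^sup>+z. \<phi> z \<partial>\<pi>)) = ?c + ((\<integral>\<^sup>+z. \<phi> z \<partial>B (Suc k)) + K (Suc k) \<phi>)"
    using Suc.IH[OF qm] Suc.prems(2) unfolding Aq Bq piq Kq by (simp add: add.assoc)
  moreover have "?c < \<infinity>" by (rule common_finite[OF qm]) (use Suc.prems(2) piq in simp)
  ultimately show ?case by (rule ennreal_add_cancel_eq)
qed

lemma emeasure_killed_eq: "emeasure (A k) (space M) = emeasure (B k) (space M)"
proof -
  interpret pi: prob_space \<pi> by (rule pi_space)
  interpret xi: prob_space \<xi> by (rule xi_space)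
  have "(\<integral>\<^sup>+z. 1 \<partial>A k) + (\<integral>\<^sup>+z. 1 \<partial>\<pi>) = (\<integral>\<^sup>+z. 1 \<partial>B k) + K k (\<lambda>_. 1)"
    by (rule signed_balance) (simp_all add: pi.emeasure_space_1)
  moreover have "K k (\<lambda>_. 1) = (\<integral>\<^sup>+z. 1 \<partial>\<xi>)"
  proof (rule nn_integral_cong)
    fix z assume "z \<in> space \<xi>"
    then have z: "z \<in> space M" using xi_space by simp
    show "(\<integral>\<^sup>+y. 1 \<partial>kernel_power M Q k z) = 1"
      using prob_space.emeasure_space_1[OF kernel_space(1)[OF z]] by simp
  qed
  ultimately have "1 + emeasure (A k) (space M) = 1 + emeasure (B k) (space M)"
    using spA spB by (simp add: pi.emeasure_space_1 xi.emeasure_space_1 add.commute)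
  then show ?thesis by (rule ennreal_add_cancel_eq) simp
qed

text \<open>The remainder of the first chain lives on Y k and that of the second outside. They are
  thus the positive and the negative part of \<xi> Q^k - \<pi>, and their joint V-mass is its
  V-norm.\<close>

lemma uncoupled_mass_le:
  "(\<integral>\<^sup>+z. ennreal (1 - g k z) * ennreal (V z) \<partial>A k) + (\<integral>\<^sup>+z. ennreal (1 - h k z) * ennreal (V z) \<partial>B k)
    \<le> ennreal (\<kappa> * (1/4)^(k div \<tau>)) * ((\<integral>\<^sup>+z. ennreal (V z) \<partial>\<xi>) + (\<integral>\<^sup>+z. ennreal (V z) \<partial>\<pi>))"
proof -
  interpret pi: prob_space \<pi> by (rule pi_space)
  interpret xi: prob_space \<xi> by (rule xi_space)
  let ?a = "\<integral>\<^sup>+z. ennreal (1 - g k z) * ennreal (V z) \<partial>A k" and ?b = "\<integral>\<^sup>+z. ennreal (1 - h k z) * ennreal (V z) \<partial>B k"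
  let ?\<phi> = "\<lambda>z. ennreal (V z) * indicator (Y k) z" and ?\<psi> = "\<lambda>z. ennreal (V z) * indicator (space M - Y k) z"
  let ?r = "\<kappa> * (1/4)^(k div \<tau>)"
  have m: "?\<phi> \<in> borel_measurable M" "?\<psi> \<in> borel_measurable M" by measurable
  have fin: "(\<integral>\<^sup>+z. ?\<phi> z \<partial>\<pi>) < \<infinity>" "(\<integral>\<^sup>+z. ?\<psi> z \<partial>\<pi>) < \<infinity>"
  proof -
    have "(\<integral>\<^sup>+z. ennreal (V z) \<partial>\<pi>) < \<infinity>" unfolding piV_nn by simp
    then show "(\<integral>\<^sup>+z. ?\<phi> z \<partial>\<pi>) < \<infinity>" "(\<integral>\<^sup>+z. ?\<psi> z \<partial>\<pi>) < \<infinity>"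
      by (rule le_less_trans[rotated]; intro nn_integral_mono; simp split: split_indicator)+
  qed
  have e1: "?a + (\<integral>\<^sup>+z. ?\<phi> z \<partial>\<pi>) = K k ?\<phi>"
  proof -
    let ?c = "\<integral>\<^sup>+z. ennreal (g k z) * ?\<phi> z \<partial>A k"
    have "(\<integral>\<^sup>+z. ?\<phi> z \<partial>A k) = ?c + (\<integral>\<^sup>+z. ennreal (1 - g k z) * ?\<phi> z \<partial>A k)"
      by (rule split_weight) (use g01 m in \<open>simp_all add: mA\<close>)
    also have "(\<integral>\<^sup>+z. ennreal (1 - g k z) * ?\<phi> z \<partial>A k) = ?a"
      using gY by (intro nn_integral_cong) (auto split: split_indicator)
    finally have a: "(\<integral>\<^sup>+z. ?\<phi> z \<partial>A k) = ?c + ?a" .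
    have "(\<integral>\<^sup>+z. ?\<phi> z \<partial>B k) = ?c + (\<integral>\<^sup>+z. ennreal (1 - h k z) * ?\<phi> z \<partial>B k)"
      unfolding common_part[OF m(1)] by (rule split_weight) (use h01 m in \<open>simp_all add: mB\<close>)
    also have "(\<integral>\<^sup>+z. ennreal (1 - h k z) * ?\<phi> z \<partial>B k) = (\<integral>\<^sup>+z. 0 \<partial>B k)"
      using hY by (intro nn_integral_cong) (auto split: split_indicator)
    finally have b: "(\<integral>\<^sup>+z. ?\<phi> z \<partial>B k) = ?c" by simp
    have "?c + (?a + (\<integral>\<^sup>+z. ?\<phi> z \<partial>\<pi>)) = ?c + K k ?\<phi>"
      using signed_balance[OF m(1) fin(1), of k] unfolding a b by (simp add: add.assoc)
    then show ?thesis by (rule ennreal_add_cancel_eq[OF _ common_finite[OF m(1) fin(1)]])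
  qed
  have e2: "(\<integral>\<^sup>+z. ?\<psi> z \<partial>\<pi>) = ?b + K k ?\<psi>"
  proof -
    let ?c = "\<integral>\<^sup>+z. ennreal (g k z) * ?\<psi> z \<partial>A k"
    have "(\<integral>\<^sup>+z. ?\<psi> z \<partial>A k) = ?c + (\<integral>\<^sup>+z. ennreal (1 - g k z) * ?\<psi> z \<partial>A k)"
      by (rule split_weight) (use g01 m in \<open>simp_all add: mA\<close>)
    also have "(\<integral>\<^sup>+z. ennreal (1 - g k z) * ?\<psi> z \<partial>A k) = (\<integral>\<^sup>+z. 0 \<partial>A k)"
      using gY by (intro nn_integral_cong) (auto split: split_indicator)
    finally have a: "(\<integral>\<^sup>+z. ?\<psi> z \<partial>A k) = ?c" by simp
    have "(\<integral>\<^sup>+z. ?\<psi> z \<partial>B k) = ?c + (\<integral>\<^sup>+z. ennreal (1 - h k z) * ?\<psi> z \<partial>B k)"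
      unfolding common_part[OF m(2)] by (rule split_weight) (use h01 m in \<open>simp_all add: mB\<close>)
    also have "(\<integral>\<^sup>+z. ennreal (1 - h k z) * ?\<psi> z \<partial>B k) = ?b"
      using hY spB by (intro nn_integral_cong) (auto split: split_indicator)
    finally have b: "(\<integral>\<^sup>+z. ?\<psi> z \<partial>B k) = ?c + ?b" .
    have "?c + (\<integral>\<^sup>+z. ?\<psi> z \<partial>\<pi>) = ?c + (?b + K k ?\<psi>)"
      using signed_balance[OF m(2) fin(2), of k] unfolding a b by (simp add: add.assoc)
    then show ?thesis by (rule ennreal_add_cancel_eq[OF _ common_finite[OF m(2) fin(2)]])
  qed
  \<comment> \<open>VGE speaks about pairs of points. The weights \<phi> and \<psi> are V on Y k and
    V outside, so the two total variation integrals recombine to the one of V; afterwards z is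
    averaged over \<xi> and z' over \<pi>.\<close>
  have pt: "(\<integral>\<^sup>+y. ?\<phi> y \<partial>kernel_power M Q k z) + (\<integral>\<^sup>+y. ?\<psi> y \<partial>kernel_power M Q k z') \<le>
      (\<integral>\<^sup>+y. ?\<phi> y \<partial>kernel_power M Q k z') + (\<integral>\<^sup>+y. ?\<psi> y \<partial>kernel_power M Q k z) + ennreal ?r * (ennreal (V z) + ennreal (V z'))"
    if z: "z \<in> space M" "z' \<in> space M" for z z'
  proof -
    let ?\<mu> = "kernel_power M Q k z" and ?\<nu> = "kernel_power M Q k z'"
    let ?T = "tv_measure ?\<mu> ?\<nu>"
    have ks: "sets ?\<mu> = sets M" "sets ?\<nu> = sets M" using kernel_space z by auto
    have le: "(\<integral>\<^sup>+y. ?\<phi> y \<partial>?\<mu>) \<le> (\<integral>\<^sup>+y. ?\<phi> y \<partial>?\<nu>) + (\<integral>\<^sup>+y. ?\<phi> y \<partial>?T)" "(\<integral>\<^sup>+y. ?\<psi> y \<partial>?\<nu>) \<le> (\<integral>\<^sup>+y. ?\<psi> y \<partial>?\<mu>) + (\<integral>\<^sup>+y. ?\<psi> y \<partial>?T)"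
      using m ks kernel_space[OF z(1)] kernel_space[OF z(2)] tv_measure_le_add[of ?\<mu> ?\<nu>]
      by (auto intro!: nn_integral_mono_add_measure cong: measurable_cong_sets)
    have "(\<integral>\<^sup>+y. ?\<phi> y \<partial>?T) + (\<integral>\<^sup>+y. ?\<psi> y \<partial>?T) = (\<integral>\<^sup>+y. ?\<phi> y + ?\<psi> y \<partial>?T)"
      using m ks by (intro nn_integral_add[symmetric]) (auto cong: measurable_cong_sets)
    also have "\<dots> = (\<integral>\<^sup>+y. ennreal (V y) \<partial>?T)"
      using kernel_space[OF z(1)] by (intro nn_integral_cong) (auto split: split_indicator)
    also have "\<dots> \<le> ennreal (?r * (V z + V z'))" by (rule tv_V_le[OF z])
    also have "\<dots> = ennreal ?r * (ennreal (V z) + ennreal (V z'))"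
      using V_pos[OF z(1)] V_pos[OF z(2)] kappa by (simp add: ennreal_mult)
    finally have t: "(\<integral>\<^sup>+y. ?\<phi> y \<partial>?T) + (\<integral>\<^sup>+y. ?\<psi> y \<partial>?T) \<le> ennreal ?r * (ennreal (V z) + ennreal (V z'))" .
    have "(\<integral>\<^sup>+y. ?\<phi> y \<partial>?\<mu>) + (\<integral>\<^sup>+y. ?\<psi> y \<partial>?\<nu>) \<le> ((\<integral>\<^sup>+y. ?\<phi> y \<partial>?\<nu>) + (\<integral>\<^sup>+y. ?\<phi> y \<partial>?T)) + ((\<integral>\<^sup>+y. ?\<psi> y \<partial>?\<mu>) + (\<integral>\<^sup>+y. ?\<psi> y \<partial>?T))"
      by (intro add_mono le)
    also have "\<dots> = (\<integral>\<^sup>+y. ?\<phi> y \<partial>?\<nu>) + (\<integral>\<^sup>+y. ?\<psi> y \<partial>?\<mu>) + ((\<integral>\<^sup>+y. ?\<phi> y \<partial>?T) + (\<integral>\<^sup>+y. ?\<psi> y \<partial>?T))" by (simp add: ac_simps)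
    also have "\<dots> \<le> (\<integral>\<^sup>+y. ?\<phi> y \<partial>?\<nu>) + (\<integral>\<^sup>+y. ?\<psi> y \<partial>?\<mu>) + ennreal ?r * (ennreal (V z) + ennreal (V z'))"
      by (intro add_left_mono t)
    finally show ?thesis .
  qed
  have km: "(\<lambda>z. \<integral>\<^sup>+y. q y \<partial>kernel_power M Q k z) \<in> borel_measurable M" if "q \<in> borel_measurable M" for q :: "'a \<Rightarrow> ennreal"
    by (rule measurable_compose[OF kernel_sub nn_integral_measurable_subprob_algebra[OF that]])
  note [measurable] = km[OF m(1)] km[OF m(2)]
  have xm: "q \<in> borel_measurable \<xi>" "q \<in> borel_measurable \<pi>" if "q \<in> borel_measurable M" for q :: "'a \<Rightarrow> ennreal"
    using that xi_space pi_space by (auto cong: measurable_cong_sets)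
  have Vm: "(\<lambda>z. ennreal (V z)) \<in> borel_measurable M" by measurable
  note km' = xm[OF km[OF m(1)]] xm[OF km[OF m(2)]] xm[OF Vm]
  have in1: "(\<integral>\<^sup>+y. ?\<phi> y \<partial>kernel_power M Q k z) + (\<integral>\<^sup>+z'. ?\<psi> z' \<partial>\<pi>) \<le>
      (\<integral>\<^sup>+z'. ?\<phi> z' \<partial>\<pi>) + (\<integral>\<^sup>+y. ?\<psi> y \<partial>kernel_power M Q k z) + ennreal ?r * (ennreal (V z) + (\<integral>\<^sup>+z'. ennreal (V z') \<partial>\<pi>))"
    if z: "z \<in> space M" for z
  proof -
    have "(\<integral>\<^sup>+y. ?\<phi> y \<partial>kernel_power M Q k z) + (\<integral>\<^sup>+z'. ?\<psi> z' \<partial>\<pi>) = (\<integral>\<^sup>+z'. (\<integral>\<^sup>+y. ?\<phi> y \<partial>kernel_power M Q k z) + (\<integral>\<^sup>+y. ?\<psi> y \<partial>kernel_power M Q k z') \<partial>\<pi>)"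
      using km' by (subst nn_integral_add) (auto simp: nn_integral_pi[OF m(2)] pi.emeasure_space_1)
    also have "\<dots> \<le> (\<integral>\<^sup>+z'. (\<integral>\<^sup>+y. ?\<phi> y \<partial>kernel_power M Q k z') + (\<integral>\<^sup>+y. ?\<psi> y \<partial>kernel_power M Q k z) + ennreal ?r * (ennreal (V z) + ennreal (V z')) \<partial>\<pi>)"
      using pi_space by (intro nn_integral_mono pt z) auto
    also have "\<dots> = (\<integral>\<^sup>+z'. ?\<phi> z' \<partial>\<pi>) + (\<integral>\<^sup>+y. ?\<psi> y \<partial>kernel_power M Q k z) + ennreal ?r * (ennreal (V z) + (\<integral>\<^sup>+z'. ennreal (V z') \<partial>\<pi>))"
      using km' by (simp add: nn_integral_add nn_integral_cmult nn_integral_pi[OF m(1)] pi.emeasure_space_1)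
    finally show ?thesis .
  qed
  have "K k ?\<phi> + (\<integral>\<^sup>+z'. ?\<psi> z' \<partial>\<pi>) = (\<integral>\<^sup>+z. (\<integral>\<^sup>+y. ?\<phi> y \<partial>kernel_power M Q k z) + (\<integral>\<^sup>+z'. ?\<psi> z' \<partial>\<pi>) \<partial>\<xi>)"
    using km' by (subst nn_integral_add) (auto simp: xi.emeasure_space_1)
  also have "\<dots> \<le> (\<integral>\<^sup>+z. (\<integral>\<^sup>+z'. ?\<phi> z' \<partial>\<pi>) + (\<integral>\<^sup>+y. ?\<psi> y \<partial>kernel_power M Q k z) + ennreal ?r * (ennreal (V z) + (\<integral>\<^sup>+z'. ennreal (V z') \<partial>\<pi>)) \<partial>\<xi>)"
    using xi_space by (intro nn_integral_mono in1) auto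
  also have "\<dots> = (\<integral>\<^sup>+z'. ?\<phi> z' \<partial>\<pi>) + K k ?\<psi> + ennreal ?r * ((\<integral>\<^sup>+z. ennreal (V z) \<partial>\<xi>) + (\<integral>\<^sup>+z'. ennreal (V z') \<partial>\<pi>))"
    using km' by (simp add: nn_integral_add nn_integral_cmult xi.emeasure_space_1)
  finally have "((\<integral>\<^sup>+z'. ?\<phi> z' \<partial>\<pi>) + K k ?\<psi>) + (?a + ?b) \<le> ((\<integral>\<^sup>+z'. ?\<phi> z' \<partial>\<pi>) + K k ?\<psi>) + ennreal ?r * ((\<integral>\<^sup>+z. ennreal (V z) \<partial>\<xi>) + (\<integral>\<^sup>+z'. ennreal (V z') \<partial>\<pi>))"
    unfolding e1[symmetric] e2 by (simp add: ac_simps)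
  moreover have "(\<integral>\<^sup>+z'. ?\<phi> z' \<partial>\<pi>) + K k ?\<psi> < \<infinity>"
    using fin e2 by (auto simp: less_top)
  ultimately show ?thesis by (rule ennreal_add_cancel_le)
qed

end

end

end

section \<open>Moment bounds\<close>

context vge_chain
begin

lemma lp_le_change_initial:
  fixes f :: "'a \<Rightarrow> real" and N p s v :: real and n :: nat
  assumes \<xi>: "\<xi> \<in> space (prob_algebra M)" and f [measurable]: "f \<in> borel_measurable M"
    and f_le: "\<And>z. z \<in> space M \<Longrightarrow> \<bar>f z\<bar> \<le> N * V z powr (1 / p)" and N: "0 \<le> N" and p: "2 \<le> p"
    and v: "(\<integral>\<^sup>+z. ennreal (V z) \<partial>\<xi>) = ennreal v" "0 \<le> v"
    and S: "lp_le (markov_law M Q \<pi>) p (centered_sum \<pi> f n) s"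
  shows "lp_le (markov_law M Q \<xi>) p (centered_sum \<pi> f n) (s + 2 * N * \<kappa> powr (1 / p) * (v + piV) powr (1 / p) * (real \<tau> * p))"
proof -
  from coupling_exists[OF \<xi>] obtain g h Y where gh: "\<forall>k. g k \<in> borel_measurable M \<and> h k \<in> borel_measurable M \<and> (\<forall>z. 0 \<le> g k z \<and> g k z \<le> (1::real)) \<and> (\<forall>z. 0 \<le> h k z \<and> h k z \<le> (1::real))
    \<and> Y k \<in> sets M \<and> density (killed g \<xi> k) (\<lambda>z. ennreal (g k z)) = density (killed h \<pi> k) (\<lambda>z. ennreal (h k z))
    \<and> (\<forall>z. z \<notin> Y k \<longrightarrow> g k z = 1) \<and> (\<forall>z\<in>Y k. h k z = 1)" by (elim exE)
  have g: "\<And>k. g k \<in> borel_measurable M" "\<And>k z. 0 \<le> g k z \<and> g k z \<le> 1"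
    and h: "\<And>k. h k \<in> borel_measurable M" "\<And>k z. 0 \<le> h k z \<and> h k z \<le> 1" and Y: "\<And>k. Y k \<in> sets M"
    and dens: "\<And>k. density (killed g \<xi> k) (\<lambda>z. ennreal (g k z)) = density (killed h \<pi> k) (\<lambda>z. ennreal (h k z))"
    and gY: "\<And>k z. z \<notin> Y k \<Longrightarrow> g k z = 1" and hY: "\<And>k z. z \<in> Y k \<Longrightarrow> h k z = 1"
    using gh by auto
  define c where "c l = \<kappa> * (1/4)^(l div \<tau>) * (v + piV)" for l
  have vp: "0 \<le> v + piV" using v(2) piV_ge1 by simp
  have c0: "0 \<le> c l" for l using vp kappa by (simp add: c_def)
  let ?a = "\<lambda>l. \<integral>\<^sup>+z. ennreal (1 - g l z) * ennreal (V z) \<partial>killed g \<xi> l"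
  let ?b = "\<lambda>l. \<integral>\<^sup>+z. ennreal (1 - h l z) * ennreal (V z) \<partial>killed h \<pi> l"
  have ab: "?a l + ?b l \<le> ennreal (c l)" for l
  proof -
    have "?a l + ?b l \<le> ennreal (\<kappa> * (1/4)^(l div \<tau>)) * ((\<integral>\<^sup>+z. ennreal (V z) \<partial>\<xi>) + (\<integral>\<^sup>+z. ennreal (V z) \<partial>\<pi>))"
      by (rule uncoupled_mass_le[of \<xi> g h Y, OF \<xi> g h Y dens gY hY])
    also have "\<dots> = ennreal (c l)" unfolding v(1) piV_nn c_def using v(2) piV_ge1 kappa by (simp add: ennreal_mult flip: ennreal_plus)
    finally show ?thesis .
  qed
  have a: "?a l \<le> ennreal (c l)" and b: "?b l \<le> ennreal (c l)" for l
    using ab[of l] order_trans[OF add_increasing2[OF zero_le order_refl] ab[of l]] order_trans[OF add_increasing[OF zero_le order_refl] ab[of l]] by auto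
  let ?LA = "stopped_law \<xi> g n" and ?LB = "stopped_law \<pi> h n"
  let ?m = "\<integral>z. f z \<partial>\<pi>"
  \<comment> \<open>f is collected before stopping without centring, so that the bound N V^(1/p)
    applies directly. The missing \<pi>(f) of each step becomes an offset of \<open>U\<close> that
    depends on the stopping time only, the form required by
    \<open>nn_integral_stopped_law_future\<close>.\<close>
  define X where "X x = (\<Sum>l<n. if l < fst x then f (snd x l) else 0)" for x :: "nat \<times> (nat \<Rightarrow> 'a)"
  define U where "U x = - real (fst x) * ?m + (\<Sum>l\<in>{fst x..<n}. centered \<pi> f (snd x l))" for x :: "nat \<times> (nat \<Rightarrow> 'a)"
  define s1 where "s1 = (\<Sum>l<n. N * c l powr (1 / p))"
  have fb [measurable]: "centered \<pi> f \<in> borel_measurable M" unfolding centered_def[abs_def] by measurable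
  have Sm: "centered_sum \<pi> f n \<in> borel_measurable (\<Pi>\<^sub>M i\<in>UNIV. M)" unfolding centered_sum_def[abs_def] by measurable
  have XA: "lp_le ?LA p X s1"
    unfolding X_def[abs_def] s1_def using p N a c0
    by (intro lp_le_sum lp_le_running[of \<xi> g, OF \<xi> g f f_le V_meas V_pos]) auto
  have XB: "lp_le ?LB p X s1"
    unfolding X_def[abs_def] s1_def using p N b c0
    by (intro lp_le_sum lp_le_running[of \<pi> h, OF pi_prob_algebra h f f_le V_meas V_pos]) auto
  have SB: "lp_le ?LB p (\<lambda>x. centered_sum \<pi> f n (snd x)) s"
    using S lp_le_stopped_law_iff[of \<pi> h, OF pi_prob_algebra h Sm] by simp
  have Um: "(\<lambda>\<omega>. U (k, \<omega>)) \<in> borel_measurable (\<Pi>\<^sub>M i\<in>UNIV. M)" for k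
    unfolding U_def by simp
  have UA: "U \<in> borel_measurable ?LA" and UB: "U \<in> borel_measurable ?LB"
    by (rule stopped_law_measurable[of \<xi> g, OF \<xi> g Um], rule stopped_law_measurable[of \<pi> h, OF pi_prob_algebra h Um])
  have split: "centered_sum \<pi> f n (snd x) = X x + U x" if "fst x \<le> n" for x
  proof -
    have "(\<Sum>l<n. if l < fst x then f (snd x l) else 0) = (\<Sum>l<fst x. f (snd x l))"
      using that by (intro sum.mono_neutral_cong_right) auto
    moreover have "centered_sum \<pi> f n (snd x) = (\<Sum>l<fst x. centered \<pi> f (snd x l)) + (\<Sum>l\<in>{fst x..<n}. centered \<pi> f (snd x l))"
      unfolding centered_sum_def using that by (subst sum.union_disjoint[symmetric]) (auto intro!: sum.cong)
    moreover have "(\<Sum>l<fst x. centered \<pi> f (snd x l)) = (\<Sum>l<fst x. f (snd x l)) - real (fst x) * ?m"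
      by (simp add: centered_def sum_subtractf)
    ultimately show ?thesis by (simp add: X_def U_def)
  qed
  note fst_le_A = space_stopped_law[of \<xi> g, OF \<xi> g] and fst_le_B = space_stopped_law[of \<pi> h, OF pi_prob_algebra h]
  \<comment> \<open>The factor 2 of the result: under \<pi> the part \<open>U\<close> is the full
    sum minus \<open>X\<close>, which costs one \<open>s1\<close>; under \<xi> adding
    \<open>X\<close> back costs another.\<close>
  have "lp_le ?LB p (\<lambda>x. centered_sum \<pi> f n (snd x) + (- 1) * X x) (s + \<bar>- 1\<bar> * s1)"
    using p by (intro lp_le_add SB lp_le_cmult XB) simp
  then have "lp_le ?LB p U (s + s1)"
  proof (rule lp_le_mono)
    show "\<bar>U x\<bar> \<le> \<bar>centered_sum \<pi> f n (snd x) + - 1 * X x\<bar>" if "x \<in> space ?LB" for x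
      using split[OF fst_le_B[OF that]] by simp
  qed (use UB p in simp_all)
  moreover have "(\<integral>\<^sup>+x. ennreal (\<bar>U x\<bar> powr p) \<partial>?LA) = (\<integral>\<^sup>+x. ennreal (\<bar>U x\<bar> powr p) \<partial>?LB)"
  proof -
    let ?b = "\<lambda>k. - real k * ?m"
    have mass: "emeasure (killed g \<xi> n) (space M) = emeasure (killed h \<pi> n) (space M)"
      by (rule emeasure_killed_eq[of \<xi> g h Y n, OF \<xi> g h Y dens gY hY])
    have "(\<integral>\<^sup>+x. ennreal (\<bar>U x\<bar> powr p) \<partial>?LA) = (\<Sum>k<n. \<integral>\<^sup>+z. tail_moment (centered \<pi> f) p (n - k) (z, ?b k) \<partial>density (killed g \<xi> k) (\<lambda>z. ennreal (g k z)))
      + ennreal (\<bar>?b n\<bar> powr p) * emeasure (killed g \<xi> n) (space M)"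
      unfolding U_def by (rule nn_integral_stopped_law_future[of \<xi> g, OF \<xi> g fb, where b="?b"])
    also have "\<dots> = (\<Sum>k<n. \<integral>\<^sup>+z. tail_moment (centered \<pi> f) p (n - k) (z, ?b k) \<partial>density (killed h \<pi> k) (\<lambda>z. ennreal (h k z)))
      + ennreal (\<bar>?b n\<bar> powr p) * emeasure (killed h \<pi> n) (space M)"
      unfolding dens mass ..
    also have "\<dots> = (\<integral>\<^sup>+x. ennreal (\<bar>U x\<bar> powr p) \<partial>?LB)"
      unfolding U_def by (rule nn_integral_stopped_law_future[of \<pi> h, OF pi_prob_algebra h fb, where b="?b", symmetric])
    finally show ?thesis .
  qed
  ultimately have "lp_le ?LA p U (s + s1)" using UA by (simp add: lp_le_def)
  then have "lp_le ?LA p (\<lambda>x. X x + U x) (s1 + (s + s1))" using p by (intro lp_le_add XA) simp_all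
  then have "lp_le ?LA p (\<lambda>x. centered_sum \<pi> f n (snd x)) (s1 + (s + s1))"
  proof (rule lp_le_mono)
    show "(\<lambda>x. centered_sum \<pi> f n (snd x)) \<in> borel_measurable ?LA"
      by (rule stopped_law_measurable[of \<xi> g, OF \<xi> g]) (use Sm in simp)
    show "\<bar>centered_sum \<pi> f n (snd x)\<bar> \<le> \<bar>X x + U x\<bar>" if "x \<in> space ?LA" for x
      using split[OF fst_le_A[OF that]] by simp
  qed (use p in simp_all)
  then have L: "lp_le (markov_law M Q \<xi>) p (centered_sum \<pi> f n) (s1 + (s + s1))"
    using lp_le_stopped_law_iff[of \<xi> g, OF \<xi> g Sm] by simp
  have "s1 \<le> N * \<kappa> powr (1 / p) * (v + piV) powr (1 / p) * (real \<tau> * p)"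
  proof -
    let ?r = "(1/4) powr (1/p) :: real"
    have pw: "((1/4) ^ k) powr (1/p) = ?r ^ k" for k
    proof -
      have "((1/4::real) ^ k) powr (1/p) = ((1/4) powr real k) powr (1/p)" by (subst powr_realpow) auto
      also have "\<dots> = ?r powr real k" by (simp only: powr_powr mult.commute)
      also have "\<dots> = ?r ^ k" by (rule powr_realpow) simp
      finally show ?thesis .
    qed
    have "s1 = N * \<kappa> powr (1 / p) * (v + piV) powr (1 / p) * (\<Sum>l<n. ?r ^ (l div \<tau>))"
      unfolding s1_def c_def sum_distrib_left using kappa vp by (intro sum.cong) (simp_all add: powr_mult pw)
    also have "(\<Sum>l<n. ?r ^ (l div \<tau>)) \<le> (\<Sum>l. ?r ^ (l div \<tau>))"
      by (intro sum_le_suminf poisson_rate[OF p]) simp_all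
    also have "\<dots> \<le> real \<tau> * p" by (rule poisson_rate[OF p])
    finally show ?thesis using N by (simp add: mult_left_mono)
  qed
  then show ?thesis by (intro lp_le_mono[OF L]) (use Sm p in \<open>simp_all add: measurable_path[OF \<xi>]\<close>)
qed

end

text \<open>The inequality ln y \<le> y / e with y = x^(1 / (\<beta> q)), raised to the power
  \<beta>; this is the origin of (\<beta> / e)^\<beta>. The case \<beta> = 0 is separate because
  that exponent is undefined there.\<close>

lemma ln_powr_le:
  fixes x \<beta> q :: real
  assumes x: "exp 1 \<le> x" and \<beta>: "0 \<le> \<beta>" and q: "0 < q"
  shows "ln x powr \<beta> \<le> powr0 (\<beta> / exp 1) \<beta> * q powr \<beta> * x powr (1 / q)"
proof -
  have x1: "1 < x" by (rule less_le_trans[OF _ x]) simp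
  have lnx: "1 \<le> ln x" using x x1 by (subst ln_ge_iff) auto
  show ?thesis
  proof (cases "\<beta> = 0")
    case True
    have "1 \<le> x powr (1 / q)" using x1 q by (intro ge_one_powr_ge_zero) auto
    then show ?thesis using True lnx q by (simp add: powr0_def)
  next
    case False
    let ?t = "1 / (\<beta> * q)"
    have pos: "0 < \<beta> * q" using False \<beta> q by simp
    have "ln (x powr ?t) \<le> x powr ?t / exp 1"
    proof -
      have "ln (x powr ?t / exp 1) \<le> x powr ?t / exp 1 - 1" using x1 by (intro ln_le_minus_one) simp
      then show ?thesis using x1 by (simp add: ln_div)
    qed
    then have "ln x \<le> (\<beta> * q) * (x powr ?t / exp 1)" using x1 pos by (simp add: ln_powr field_simps)
    then have "ln x powr \<beta> \<le> ((\<beta> * q) * (x powr ?t / exp 1)) powr \<beta>" using lnx \<beta> by (intro powr_mono2) auto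
    also have "\<dots> = ((\<beta> / exp 1) * q * x powr ?t) powr \<beta>" by simp
    also have "\<dots> = (\<beta> / exp 1) powr \<beta> * q powr \<beta> * x powr (1 / q)"
    proof -
      have "(x powr ?t) powr \<beta> = x powr (1 / q)" unfolding powr_powr using False by simp
      then show ?thesis using \<beta> q by (simp only: powr_mult divide_nonneg_nonneg exp_ge_zero)
    qed
    finally show ?thesis using False by (simp add: powr0_def)
  qed
qed

lemma wnorm_bound:
  assumes fin: "wnorm M W f < \<infinity>" and z: "z \<in> space M" and W: "0 < W z"
  shows "\<bar>f z\<bar> \<le> enn2real (wnorm M W f) * W z"
proof -
  have "ennreal (\<bar>f z\<bar> / W z) \<le> wnorm M W f" unfolding wnorm_def using z by (rule SUP_upper)
  then have "\<bar>f z\<bar> / W z \<le> enn2real (wnorm M W f)" using enn2real_mono[of "ennreal (\<bar>f z\<bar> / W z)" "wnorm M W f"] fin W by (simp add: less_top)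
  then show ?thesis using W by (simp add: divide_le_eq)
qed

lemma powr0_pos: "0 < c \<Longrightarrow> 0 \<le> \<beta> \<Longrightarrow> 0 < powr0 (\<beta> / c) \<beta>"
  by (auto simp: powr0_def)

lemma powr0_double: "0 \<le> \<beta> \<Longrightarrow> powr0 (2 * \<beta> / exp 1) \<beta> = powr0 (\<beta> / exp 1) \<beta> * 2 powr \<beta>"
  using powr_mult[of 2 "\<beta> / exp 1" \<beta>] by (auto simp: powr0_def)

text \<open>Twice the ceiling of p / 2 is below p + 2 \<le> 2 p. For p \<le> 4 the exponent 4 is
  taken, and 4 \<le> 2 p is exactly p \<ge> 2.\<close>

lemma even_exponent_exists:
  fixes p :: real
  assumes "2 \<le> p"
  obtains k :: nat where "even k" "p \<le> real (k + 4)" "real (k + 4) \<le> 2 * p"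
proof -
  define j where "j = nat \<lceil>p / 2\<rceil>"
  have j: "p / 2 \<le> real j" "real j < p / 2 + 1" using assms unfolding j_def by linarith+
  show thesis
  proof (cases "j \<le> 2")
    case True
    then have "real j \<le> 2" by simp
    then have "p \<le> 4" using j by linarith
    then show thesis using assms by (intro that[of 0]) auto
  next
    case False
    then have e: "real (2 * (j - 2) + 4) = 2 * real j" by simp
    from False have "3 \<le> real j" by simp
    have "even (2 * (j - 2))" by simp
    then show thesis by (rule that) (use e j in linarith)+
  qed
qed

text \<open>312 is the constant of the n^(1/4) term in \<open>lp_centered_sum\<close>; 12 is twice
  the 6 there, since the even exponent is at most 2 p.\<close>

lemma D_bounds: "312 \<le> D1" "12 \<le> D2"
proof -
  have e: "1 \<le> exp (1::real)" by simp
  have C1: "60 \<le> C1" using e by (simp add: C1_def)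
  have C12: "3600 \<le> C1\<^sup>2" using power_mono[OF C1, of 2] by simp
  have s1: "1 \<le> sqrt (16 / 3)" by (simp add: real_le_rsqrt)
  have s2: "0 \<le> sqrt C2" by (simp add: C2_def)
  have "8 / 3 * 1 * 3600 * 1 \<le> 8 / 3 * sqrt (16 / 3) * C1\<^sup>2 * (sqrt C2 + 1)"
    using s1 s2 C12 by (intro mult_mono mult_nonneg_nonneg) auto
  then show "312 \<le> D1" by (simp add: D1_def)
  have "8 / 3 * 1 * 60 \<le> 8 / 3 * exp 1 * (sqrt 2 * C1\<^sup>2 * sqrt C2 + C2)"
    using e s2 by (intro mult_mono) (auto simp: C2_def)
  then show "12 \<le> D2" by (simp add: D2_def)
qed

section \<open>The two inequalities of the theorem\<close>

context vge_chain
begin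

text \<open>A function of norm 0 is treated apart because \<open>additive_functional\<close> asks
  for N > 0.\<close>

lemma moment_norm_null:
  assumes \<xi>: "\<xi> \<in> space (prob_algebra M)" and f: "\<And>z. z \<in> space M \<Longrightarrow> f z = 0" and p: "0 < p"
  shows "moment_norm M Q \<xi> p (centered_sum \<pi> f n) = 0"
proof -
  have "(\<integral>z. f z \<partial>\<pi>) = (\<integral>z. 0 \<partial>\<pi>)" using f pi_space by (intro Bochner_Integration.integral_cong) auto
  then have c: "centered \<pi> f z = 0" if "z \<in> space M" for z using f[OF that] by (simp add: centered_def)
  have "(\<integral>\<^sup>+\<omega>. ennreal (\<bar>centered_sum \<pi> f n \<omega>\<bar> powr p) \<partial>markov_law M Q \<xi>) = (\<integral>\<^sup>+\<omega>. 0 \<partial>markov_law M Q \<xi>)"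
  proof (rule nn_integral_cong)
    fix \<omega> assume "\<omega> \<in> space (markov_law M Q \<xi>)"
    then have "\<omega> l \<in> space M" for l using space_path_component[of \<omega> M l] space_path[OF \<xi>] by simp
    then show "ennreal (\<bar>centered_sum \<pi> f n \<omega>\<bar> powr p) = 0" using c by (simp add: centered_sum_def)
  qed
  then show ?thesis by (simp add: moment_norm_def ennpowr_def)
qed

context
  fixes \<beta> p :: real and f :: "'a \<Rightarrow> real" and n :: nat
  assumes \<beta>: "0 \<le> \<beta>" and f_meas [measurable]: "f \<in> borel_measurable M"
    and f_norm: "wnorm M (\<lambda>z. ln (V z) powr \<beta>) f < \<infinity>" and p: "2 \<le> p" and n: "3 \<le> n"
begin

private abbreviation "L \<equiv> enn2real (wnorm M (\<lambda>z. ln (V z) powr \<beta>) f)"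

text \<open>The exponent q is left free: the stationary bound takes the even exponent, the change of
  initial law takes p itself.\<close>

lemma f_le_L:
  assumes z: "z \<in> space M" and q: "0 < q"
  shows "\<bar>f z\<bar> \<le> (powr0 (\<beta> / exp 1) \<beta> * q powr \<beta> * L) * V z powr (1 / q)"
proof -
  have "1 < V z" by (rule less_le_trans[OF _ V_ge[OF z]]) simp
  then have lnV: "0 < ln (V z) powr \<beta>" by simp
  have "\<bar>f z\<bar> \<le> L * ln (V z) powr \<beta>" using wnorm_bound[OF f_norm z] lnV by simp
  also have "\<dots> \<le> L * (powr0 (\<beta> / exp 1) \<beta> * q powr \<beta> * V z powr (1 / q))"
    by (intro mult_left_mono ln_powr_le V_ge z \<beta> q) simp
  finally show ?thesis by (simp add: mult_ac)
qed

lemma stationary_bound: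
  "moment_norm M Q \<pi> p (centered_sum \<pi> f n)
       \<le> ennreal
          (C1 * sqrt 2 * p powr (1/2) * real n powr (1/2) * sqrt (asymp_var M Q \<pi> f)
           + D1_beta \<beta> * (\<kappa> * piV) powr (2 / p) * p powr (2 + \<beta>) * log 2 (2 * p)
             * real n powr (1/4) * real \<tau> powr (3/4) * L
           + D2_beta \<beta> * (\<kappa> * piV) powr (1 / p) * p powr (2 + \<beta>) * log 2 (2 * p)
             * ln (real n) powr (\<beta> + 1) * real \<tau> * L)"
proof (cases "L = 0")
  case True
  then have "f z = 0" if "z \<in> space M" for z using f_le_L[OF that, of 1] by simp
  then have "moment_norm M Q \<pi> p (centered_sum \<pi> f n) = 0" using p by (intro moment_norm_null pi_prob_algebra) auto
  then show ?thesis by simp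
next
  case False
  then have L: "0 < L" by (simp add: less_le)
  obtain k where k: "even k" "p \<le> real (k + 4)" "real (k + 4) \<le> 2 * p" using even_exponent_exists[OF p] .
  define P where "P = real (k + 4)"
  define b where "b = powr0 (\<beta> / exp 1) \<beta>"
  define N where "N = b * P powr \<beta> * L"
  have b: "0 < b" unfolding b_def by (rule powr0_pos) (use \<beta> in auto)
  have P: "p \<le> P" "P \<le> 2 * p" "2 \<le> P" using k p by (auto simp: P_def)
  have N: "0 < N" using b L P by (simp add: N_def)
  interpret af: additive_functional M Q V \<pi> \<tau> \<kappa> f N k
  proof
    show "\<bar>f z\<bar> \<le> N * V z powr (1 / real (k + 4))" if "z \<in> space M" for z
      using f_le_L[OF that, of P] P unfolding N_def b_def P_def by simp
  qed (use N k in auto)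
  define b2 where "b2 = powr0 (2 * \<beta> / exp 1) \<beta>"
  let ?\<sigma> = "asymp_var M Q \<pi> f" and ?K = "\<kappa> * piV" and ?lg = "log 2 (2 * p)" and ?ln = "ln (real n)"
  have \<sigma>: "0 \<le> ?\<sigma>" by (rule af.asymp_var_nonneg)
  have K: "1 \<le> ?K" using kappa piV_ge1 mult_mono[of 1 \<kappa> 1 piV] by simp
  have b2: "0 < b2" unfolding b2_def powr0_double[OF \<beta>] using b unfolding b_def by simp
  \<comment> \<open>P \<le> 2 p turns P^\<beta> into 2^\<beta> p^\<beta>, and the 2^\<beta> is what
    doubles \<beta> inside \<open>D1_beta\<close> and \<open>D2_beta\<close>.\<close>
  have NN: "N \<le> b2 * p powr \<beta> * L"
  proof -
    have "P powr \<beta> \<le> (2 * p) powr \<beta>" using P \<beta> by (intro powr_mono2) auto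
    also have "\<dots> = 2 powr \<beta> * p powr \<beta>" using p by (simp add: powr_mult)
    finally have "b * P powr \<beta> * L \<le> b * (2 powr \<beta> * p powr \<beta>) * L" using b L by (intro mult_right_mono mult_left_mono) auto
    then show ?thesis unfolding N_def b2_def powr0_double[OF \<beta>] b_def by (simp add: mult_ac)
  qed
  have lg: "1 \<le> ?lg" using p by (subst le_log_iff) auto
  \<comment> \<open>n \<ge> 3 exceeds e, so powers of ln n only enlarge the bound.\<close>
  have ln1: "1 \<le> ?ln"
  proof -
    have "exp 1 \<le> real n" using exp_le n by linarith
    then show ?thesis using n by (subst ln_ge_iff) auto
  qed
  have Kp: "?K powr (2 / P) \<le> ?K powr (2 / p)" "?K powr (1 / P) \<le> ?K powr (1 / p)"
    using K P p by (auto intro!: powr_mono divide_left_mono)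
  have T1: "16 * sqrt (P * real n * ?\<sigma>) \<le> C1 * sqrt 2 * p powr (1/2) * real n powr (1/2) * sqrt ?\<sigma>"
  proof -
    have "sqrt (P * real n * ?\<sigma>) \<le> sqrt (2 * p * real n * ?\<sigma>)" using P \<sigma> by (intro real_sqrt_le_mono mult_right_mono) auto
    also have "\<dots> = sqrt 2 * p powr (1/2) * real n powr (1/2) * sqrt ?\<sigma>" using p by (simp add: real_sqrt_mult powr_half_sqrt)
    finally have "16 * sqrt (P * real n * ?\<sigma>) \<le> 16 * (sqrt 2 * p powr (1/2) * real n powr (1/2) * sqrt ?\<sigma>)" by simp
    also have "\<dots> \<le> C1 * (sqrt 2 * p powr (1/2) * real n powr (1/2) * sqrt ?\<sigma>)"
    proof (rule mult_right_mono)
      have "1 \<le> exp (1::real)" by simp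
      then show "16 \<le> C1" unfolding C1_def by linarith
    qed (use \<sigma> in simp)
    finally show ?thesis by (simp add: mult.assoc)
  qed
  \<comment> \<open>Squaring P \<le> 2 p yields the factor 4 in \<open>D1_beta\<close>.\<close>
  have P2: "P\<^sup>2 \<le> 4 * p\<^sup>2" using power_mono[OF P(2), of 2] P by (simp add: power_mult_distrib)
  have pp: "p\<^sup>2 * p powr \<beta> = p powr (2 + \<beta>)" using p by (simp add: powr_add)
  have T2: "312 * P\<^sup>2 * N * ?K powr (2 / P) * real n powr (1 / 4) * real \<tau> powr (3 / 4) \<le>
      D1_beta \<beta> * ?K powr (2 / p) * p powr (2 + \<beta>) * ?lg * real n powr (1/4) * real \<tau> powr (3/4) * L"
  proof -
    let ?w = "real n powr (1 / 4) * real \<tau> powr (3 / 4)"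
    have "312 * P\<^sup>2 * N * ?K powr (2 / P) \<le> D1 * (4 * p\<^sup>2) * (b2 * p powr \<beta> * L) * ?K powr (2 / p)"
      using P2 NN Kp(1) D_bounds N b2 L by (intro mult_mono mult_nonneg_nonneg) auto
    also have "\<dots> = (4 * D1 * b2) * ?K powr (2 / p) * p powr (2 + \<beta>) * L * 1" unfolding pp[symmetric] by simp
    also have "\<dots> \<le> (4 * D1 * b2) * ?K powr (2 / p) * p powr (2 + \<beta>) * L * ?lg"
      using lg D_bounds b2 L by (intro mult_left_mono mult_nonneg_nonneg) auto
    finally have "312 * P\<^sup>2 * N * ?K powr (2 / P) * ?w \<le> (4 * D1 * b2) * ?K powr (2 / p) * p powr (2 + \<beta>) * L * ?lg * ?w"
      by (rule mult_right_mono) simp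
    then show ?thesis unfolding D1_beta_def b2_def by (simp add: mult_ac)
  qed
  have T3: "6 * P * real \<tau> * N * ?K powr (1 / P) \<le> D2_beta \<beta> * ?K powr (1 / p) * p powr (2 + \<beta>) * ?lg * ?ln powr (\<beta> + 1) * real \<tau> * L"
  proof -
    have "p * 1 \<le> p * p" using p by (intro mult_left_mono) auto
    then have "6 * P \<le> 12 * p\<^sup>2" using P(2) unfolding power2_eq_square by linarith
    also have "\<dots> \<le> (4 * D2) * p\<^sup>2" using D_bounds by (intro mult_right_mono) auto
    finally have "6 * P \<le> (4 * D2) * p\<^sup>2" .
    then have "6 * P * N \<le> (4 * D2) * p\<^sup>2 * (b2 * p powr \<beta> * L)"
      by (rule mult_mono[OF _ NN]) (use D_bounds N in auto)
    then have "6 * P * N * ?K powr (1 / P) \<le> (4 * D2) * p\<^sup>2 * (b2 * p powr \<beta> * L) * ?K powr (1 / p)"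
      by (rule mult_mono[OF _ Kp(2)]) (use D_bounds b2 L in auto)
    also have "\<dots> = (4 * D2 * b2) * ?K powr (1 / p) * p powr (2 + \<beta>) * L * (1 * 1)" unfolding pp[symmetric] by simp
    also have "\<dots> \<le> (4 * D2 * b2) * ?K powr (1 / p) * p powr (2 + \<beta>) * L * (?lg * ?ln powr (\<beta> + 1))"
    proof (intro mult_left_mono mult_mono lg)
      show "1 \<le> ?ln powr (\<beta> + 1)" using ln1 \<beta> by (intro ge_one_powr_ge_zero) auto
    qed (use lg D_bounds b2 L in auto)
    finally have "6 * P * N * ?K powr (1 / P) * real \<tau> \<le> (4 * D2 * b2) * ?K powr (1 / p) * p powr (2 + \<beta>) * L * (?lg * ?ln powr (\<beta> + 1)) * real \<tau>"
      by (rule mult_right_mono) simp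
    then show ?thesis unfolding D2_beta_def b2_def by (simp add: mult_ac)
  qed
  have ap: "af.p = P" by (simp add: af.p_def P_def)
  interpret path: prob_space "markov_law M Q \<pi>" by (rule prob_space_path[OF pi_prob_algebra])
  have "lp_le (markov_law M Q \<pi>) p (centered_sum \<pi> f n) (16 * sqrt (P * real n * ?\<sigma>)
     + 312 * P\<^sup>2 * N * ?K powr (2 / P) * real n powr (1 / 4) * real \<tau> powr (3 / 4)
     + 6 * P * real \<tau> * N * ?K powr (1 / P))"
    using path.lp_le_exponent_mono[OF af.lp_centered_sum[unfolded ap], of p] P p by simp
  then have "moment_norm M Q \<pi> p (centered_sum \<pi> f n) \<le> ennreal (16 * sqrt (P * real n * ?\<sigma>)
     + 312 * P\<^sup>2 * N * ?K powr (2 / P) * real n powr (1 / 4) * real \<tau> powr (3 / 4)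
     + 6 * P * real \<tau> * N * ?K powr (1 / P))"
    using p by (intro lp_le_moment_norm) auto
  also have "\<dots> \<le> ennreal
          (C1 * sqrt 2 * p powr (1/2) * real n powr (1/2) * sqrt ?\<sigma>
           + D1_beta \<beta> * ?K powr (2 / p) * p powr (2 + \<beta>) * ?lg * real n powr (1/4) * real \<tau> powr (3/4) * L
           + D2_beta \<beta> * ?K powr (1 / p) * p powr (2 + \<beta>) * ?lg * ?ln powr (\<beta> + 1) * real \<tau> * L)"
    by (intro ennreal_leI add_mono T1 T2 T3)
  finally show ?thesis .
qed

lemma initial_bound:
  assumes \<xi>: "\<xi> \<in> space (prob_algebra M)"
  shows "moment_norm M Q \<xi> p (centered_sum \<pi> f n)
            \<le> moment_norm M Q \<pi> p (centered_sum \<pi> f n)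
              + ennreal (32 / 15 * powr0 (\<beta> / exp 1) \<beta> * \<kappa> powr (1 / p))
                * ennpowr ((\<integral>\<^sup>+z. ennreal (V z) \<partial>\<xi>) + (\<integral>\<^sup>+z. ennreal (V z) \<partial>\<pi>)) (1 / p)
                * ennreal (p powr (\<beta> + 1) * real \<tau> * L)"
\<comment> \<open>In the extended reals 0 times infinity is 0, so L = 0 has to be split off before
  the case of infinite \<xi>(V), where the right-hand side is infinite.\<close>
proof (cases "L = 0")
  case True
  then have "f z = 0" if "z \<in> space M" for z using f_le_L[OF that, of 1] by simp
  then have "moment_norm M Q \<xi> p (centered_sum \<pi> f n) = 0" using p by (intro moment_norm_null \<xi>) auto
  then show ?thesis by simp
next
  case False
  then have L: "0 < L" by (simp add: less_le)
  define b where "b = powr0 (\<beta> / exp 1) \<beta>"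
  have b: "0 < b" unfolding b_def by (rule powr0_pos) (use \<beta> in auto)
  have kp: "0 < \<kappa> powr (1 / p)" using kappa by simp
  let ?c = "32 / 15 * b * \<kappa> powr (1 / p)" and ?d = "p powr (\<beta> + 1) * real \<tau> * L"
  have c: "0 < ?c" and d: "0 < ?d" using b kp L p tau by auto
  show ?thesis
  proof (cases "(\<integral>\<^sup>+z. ennreal (V z) \<partial>\<xi>) = \<infinity>")
    case True
    have top: "ennreal x * \<infinity> * ennreal y = \<infinity>" if "0 < x" "0 < y" for x y
      using that by (simp add: ennreal_mult_top ennreal_top_mult)
    have "ennreal ?c * ennpowr ((\<integral>\<^sup>+z. ennreal (V z) \<partial>\<xi>) + (\<integral>\<^sup>+z. ennreal (V z) \<partial>\<pi>)) (1 / p) * ennreal ?d = \<infinity>"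
      unfolding True using top[OF c d] by (simp add: ennpowr_def)
    then show ?thesis unfolding b_def by simp
  next
    case fin: False
    then obtain v where v: "(\<integral>\<^sup>+z. ennreal (V z) \<partial>\<xi>) = ennreal v" "0 \<le> v"
      by (cases "\<integral>\<^sup>+z. ennreal (V z) \<partial>\<xi>") auto
    let ?m = "moment_norm M Q \<pi> p (centered_sum \<pi> f n)"
    have Sm: "centered_sum \<pi> f n \<in> borel_measurable (\<Pi>\<^sub>M i\<in>UNIV. M)" unfolding centered_sum_def[abs_def] centered_def by measurable
    \<comment> \<open>The stationary bound is used here as finiteness of the moment, which permits
      the passage to a real norm.\<close>
    have mfin: "?m < \<infinity>" using le_less_trans[OF stationary_bound] by simp
    have S: "lp_le (markov_law M Q \<pi>) p (centered_sum \<pi> f n) (enn2real ?m)"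
      using mfin p Sm measurable_path[OF pi_prob_algebra] by (intro moment_norm_lp_le) auto
    let ?N = "b * p powr \<beta> * L"
    let ?e = "2 * ?N * \<kappa> powr (1 / p) * (v + piV) powr (1 / p) * (real \<tau> * p)"
    have N0: "0 \<le> ?N" using b L by simp
    have "lp_le (markov_law M Q \<xi>) p (centered_sum \<pi> f n) (enn2real ?m + ?e)"
    proof (rule lp_le_change_initial[OF \<xi> f_meas _ N0 p v S])
      show "\<bar>f z\<bar> \<le> ?N * V z powr (1 / p)" if "z \<in> space M" for z
        using f_le_L[OF that, of p] p by (simp add: b_def)
    qed
    then have "moment_norm M Q \<xi> p (centered_sum \<pi> f n) \<le> ennreal (enn2real ?m + ?e)"
      using p by (intro lp_le_moment_norm) auto
    also have "\<dots> = ?m + ennreal ?e" using mfin N0 p by (simp add: less_top)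
    also have "\<dots> \<le> ?m + ennreal (?c * (v + piV) powr (1 / p) * ?d)"
    proof (intro add_left_mono ennreal_leI)
      have "?e = 2 * (b * \<kappa> powr (1 / p) * (v + piV) powr (1 / p) * ?d)" using p by (simp add: powr_add)
      \<comment> \<open>The coupling gives the constant 2, which is below 32/15.\<close>
      also have "\<dots> \<le> 32 / 15 * (b * \<kappa> powr (1 / p) * (v + piV) powr (1 / p) * ?d)"
        using b L by (intro mult_right_mono) auto
      finally show "?e \<le> ?c * (v + piV) powr (1 / p) * ?d" by (simp add: mult_ac)
    qed
    also have "ennreal (?c * (v + piV) powr (1 / p) * ?d) = ennreal ?c * ennreal ((v + piV) powr (1 / p)) * ennreal ?d"
      using c d by (simp only: ennreal_mult less_imp_le mult_nonneg_nonneg powr_ge_zero)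
    also have "ennreal ((v + piV) powr (1 / p)) = ennpowr ((\<integral>\<^sup>+z. ennreal (V z) \<partial>\<xi>) + (\<integral>\<^sup>+z. ennreal (V z) \<partial>\<pi>)) (1 / p)"
      unfolding v(1) piV_nn using v(2) piV_ge1 by (simp add: ennpowr_def flip: ennreal_plus)
    finally show ?thesis unfolding b_def .
  qed
qed

end

end

theorem theorem3:
  fixes M :: "'a measure" and Q :: "'a \<Rightarrow> 'a measure" and V :: "'a \<Rightarrow> real"
    and \<pi> :: "'a measure" and \<tau> n :: nat and \<kappa> \<beta> p :: real and f :: "'a \<Rightarrow> real"
  assumes V_meas: "V \<in> borel_measurable M"
    and V_ge: "\<And>z. z \<in> space M \<Longrightarrow> exp 1 \<le> V z"
    and Q: "Q \<in> M \<rightarrow>\<^sub>M prob_algebra M"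
    and VGE: "VGE M Q V \<pi> \<tau> \<kappa>"
    and \<beta>: "0 \<le> \<beta>"
    and f_meas: "f \<in> borel_measurable M"
    and f_norm: "wnorm M (\<lambda>z. ln (V z) powr \<beta>) f < \<infinity>"
    and p: "2 \<le> p"
    and n: "3 \<le> n"
  shows
    "moment_norm M Q \<pi> p (centered_sum \<pi> f n)
       \<le> ennreal
          (C1 * sqrt 2 * p powr (1/2) * real n powr (1/2) * sqrt (asymp_var M Q \<pi> f)
           + D1_beta \<beta> * (\<kappa> * (\<integral>z. V z \<partial>\<pi>)) powr (2 / p) * p powr (2 + \<beta>) * log 2 (2 * p)
             * real n powr (1/4) * real \<tau> powr (3/4)
             * enn2real (wnorm M (\<lambda>z. ln (V z) powr \<beta>) f)
           + D2_beta \<beta> * (\<kappa> * (\<integral>z. V z \<partial>\<pi>)) powr (1 / p) * p powr (2 + \<beta>) * log 2 (2 * p)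
             * ln (real n) powr (\<beta> + 1) * real \<tau>
             * enn2real (wnorm M (\<lambda>z. ln (V z) powr \<beta>) f))
     \<and> (\<forall>\<xi> \<in> space (prob_algebra M).
          moment_norm M Q \<xi> p (centered_sum \<pi> f n)
            \<le> moment_norm M Q \<pi> p (centered_sum \<pi> f n)
              + ennreal (32 / 15 * powr0 (\<beta> / exp 1) \<beta> * \<kappa> powr (1 / p))
                * ennpowr ((\<integral>\<^sup>+z. ennreal (V z) \<partial>\<xi>) + (\<integral>\<^sup>+z. ennreal (V z) \<partial>\<pi>)) (1 / p)
                * ennreal (p powr (\<beta> + 1) * real \<tau>
                    * enn2real (wnorm M (\<lambda>z. ln (V z) powr \<beta>) f)))"
proof -
  interpret vge_chain M Q V \<pi> \<tau> \<kappa>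
    by unfold_locales (use V_meas V_ge Q VGE in auto)
  show ?thesis
    using stationary_bound[OF \<beta> f_meas f_norm p n] initial_bound[OF \<beta> f_meas f_norm p n]
    unfolding piV_def by blast
qed

end
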